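(* Let $\boldsymbol f=(f_1,\dots,f_n)$ be a square 2-bilinear system of type $(n_x,n_y,n_z;r,s)$ that has $\binom{r}{n_y}\cdot\binom{s}{n_z}$ different solutions over $\mathcal P$. Let $\theta\in\mathcal A(1,1,1)$ be such that $\mathrm{Res}^{(2)}_{\mathcal P}(\boldsymbol w^\theta,f_1,\dots,f_n)\neq0$, and let $f_0\in S(1,1,1)$ be such that $\frac{f_0}{\boldsymbol w^\theta}$ separates the elements of $V_{\mathcal P}(\boldsymbol f)$. Put $\boldsymbol{f_0}=(f_0,f_1,\dots,f_n)$. Let $\boldsymbol m=(n_y-1,-1,n_x+n_y-r+1)$ and let $M=\begin{bmatrix} M_{1,1} & M_{1,2} \\ M_{2,1} & M_{2,2} \end{bmatrix}$ be the matrix over $\mathbb K[\boldsymbol u]$ of $\delta_1(\boldsymbol{F^{(2)}},\boldsymbol m)$ for the universal overdetermined 2-bilinear system, rearranged with respect to $\boldsymbol w^\theta$. Then the Schur complement $(M_{2,2}-M_{2,1}M_{1,1}^{-1}M_{1,2})(\boldsymbol{f_0})$ of $M_{2,2}(\boldsymbol{f_0})$ is diagonalizable, and each of its eigenvalues is $\frac{f_0}{\boldsymbol w^\theta}(\alpha)$ for some $\alpha\in V_{\mathcal P}(f_1,\dots,f_n)$. Moreover, for each $\alpha\in V_{\mathcal P}(f_1,\dots,f_n)$ (with $\alpha_{t,0}\ne0$ for $t\in\{x,y,z\}$), the eigenvector $\bar v_\alpha$ related to $\alpha$ (i.e. to the eigenvalue $\frac{f_0}{\boldsymbol w^\theta}(\alpha)$)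 can be extended to $$v_\alpha:=\begin{bmatrix} -M_{1,1}^{-1}\cdot M_{1,2} \\ I \end{bmatrix}(\boldsymbol{f_0})\cdot\bar v_\alpha$$ such that $v_\alpha$ is (the coordinate vector of) the element $\rho_\alpha(\widehat{\boldsymbol\lambda}_\alpha)\in K_1$ for some $\widehat{\boldsymbol\lambda}_\alpha\in\mathbb K^{\binom{s+1}{s-n_z+1}}$.
   Context: $\mathbb K$ is an algebraically closed field of characteristic $0$, $n_x,n_y,n_z\ge1$ are integers, $n=n_x+n_y+n_z$, $\mathcal P=\mathbb P^{n_x}\times\mathbb P^{n_y}\times\mathbb P^{n_z}$ over $\mathbb K$, with blocks of homogeneous coordinates $\boldsymbol x=(x_0,\dots,x_{n_x})$, $\boldsymbol y=(y_0,\dots,y_{n_y})$, $\boldsymbol z=(z_0,\dots,z_{n_z})$. For $t\in\{x,y,z\}$, $S_t(d)=\mathbb K[\boldsymbol t]_d$ (zero if $d<0$), $S(d_x,d_y,d_z)=S_x(d_x)\otimes S_y(d_y)\otimes S_z(d_z)$; $\mathcal A(\boldsymbol d)$ is the set of exponents $\sigma=(\sigma_x,\sigma_y,\sigma_z)$ of monomials of multidegree $\boldsymbol d$ and $\boldsymbol w^\sigma=\boldsymbol x^{\sigma_x}\boldsymbol y^{\sigma_y}\boldsymbol z^{\sigma_z}$. $V_{\mathcal P}(\cdot)$ is the set of common zeros in $\mathcal P$. A square 2-bilinear system of type $(n_x,n_y,n_z;r,s)$ is $(f_1,\dots,f_n)$ with $f_1,\dots,f_r\in S(1,1,0)$, $f_{r+1},\dots,f_n\in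 S(1,0,1)$, $n=r+s$, $n_y\le r$, $n_z\le s$. Adding $f_0\in S(1,1,1)$ gives an overdetermined 2-bilinear system. The universal such system $\boldsymbol{F^{(2)}}$ has as coefficients variables $\boldsymbol u=\{u_{i,\sigma}\}$, $u_{i,\sigma}$ being the coefficient of $\boldsymbol w^\sigma$ in the $i$-th polynomial; evaluating an object over $\mathbb K[\boldsymbol u]$ at $\boldsymbol{f_0}$ means replacing each $u_{i,\sigma}$ by the coefficient of $\boldsymbol w^\sigma$ in $f_i$. $\mathrm{Res}^{(2)}_{\mathcal P}\in\mathbb Z[\boldsymbol u]$ is the irreducible polynomial (unique up to sign) whose value at an overdetermined 2-bilinear system is zero if and only if the system has a common zero in $\mathcal P$. $\frac{f_0}{\boldsymbol w^\theta}$ separates the elements of $V_{\mathcal P}(\boldsymbol f)$ if $\boldsymbol w^\theta(\alpha)\ne0$ for all $\alpha\in V_{\mathcal P}(\boldsymbol f)$ and, for $\alpha,\alpha'\in V_{\mathcal P}(\boldsymbol f)$, $\frac{f_0}{\boldsymbol w^\theta}(\alpha)=\frac{f_0}{\boldsymbol w^\theta}(\alpha')$ if and only if $\alpha=\alpha'$. The map $\delta_1$. $E$ has basis $e_0,\dots,e_n$; $\boldsymbol e_I=e_{I_1}\wedge\dots\wedge e_{I_k}$ for $I=\{I_1<\dots<I_k\}$; $\bigwedge_{a,b,c}E$ is the span of the $\boldsymbol e_I$ with $\#(I\cap\{1,\dots,r\})=a$, $\#(I\cap\{r+1,\dots,n\})=b$, $\#(I\cap\{0\})=c$. Set $K_1=\big(S_x(1)^*\otimes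 S_y(r-n_y)^*\otimes S_z(0)\otimes\bigwedge_{r,s-n_z+1,0}E\big)\oplus\big(S_x(1)^*\otimes S_y(r-n_y+1)^*\otimes S_z(0)\otimes\bigwedge_{r,s-n_z,1}E\big)$ and $K_0=\big(S_x(0)^*\otimes S_y(r-n_y-1)^*\otimes S_z(0)\otimes\bigwedge_{r-1,s-n_z+1,0}E\big)\oplus\big(S_x(0)^*\otimes S_y(r-n_y)^*\otimes S_z(1)\otimes\bigwedge_{r,s-n_z,0}E\big)\oplus\big(S_x(0)^*\otimes S_y(r-n_y)^*\otimes S_z(0)\otimes\bigwedge_{r-1,s-n_z,1}E\big)\oplus\big(S_x(0)^*\otimes S_y(r-n_y+1)^*\otimes S_z(1)\otimes\bigwedge_{r,s-n_z-1,1}E\big)$. Let $\{\boldsymbol{\partial t}^{\sigma}\}$ be the basis of $S_t(d)^*$ dual to the monomials $\boldsymbol t^\sigma$; put $\boldsymbol t^\theta\star\boldsymbol{\partial t}^\sigma=\boldsymbol{\partial t}^{\sigma-\theta}$ if $\sigma\ge\theta$ componentwise and $0$ otherwise, extended bilinearly. Let $\psi$ be the bilinear map with $\psi(\boldsymbol{\partial x}^{\sigma_x}\otimes\boldsymbol{\partial y}^{\sigma_y}\otimes\boldsymbol z^{\sigma_z},\ \boldsymbol x^{\theta_x}\boldsymbol y^{\theta_y}\boldsymbol z^{\theta_z})=(\boldsymbol x^{\theta_x}\star\boldsymbol{\partial x}^{\sigma_x})\otimes(\boldsymbol y^{\theta_y}\star\boldsymbol{\partial y}^{\sigma_y})\otimes\boldsymbol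 z^{\theta_z+\sigma_z}$. Then $\delta_1(\boldsymbol{f_0},\boldsymbol m):K_1\to K_0$ is the linear map with $$\delta_1(\boldsymbol{f_0},\boldsymbol m)(\ell\otimes\boldsymbol e_I)=\sum_{i=1}^{n_x+n_y+1}(-1)^{i-1}\psi(\ell,f_{I_i})\otimes\boldsymbol e_{I\setminus\{I_i\}}.$$ For $\boldsymbol{F^{(2)}}$ the same formula is used over $\mathbb K[\boldsymbol u]$, and its matrix is taken with respect to the bases made of the $\boldsymbol{\partial x}^{\sigma_x}\otimes\boldsymbol{\partial y}^{\sigma_y}\otimes\boldsymbol z^{\sigma_z}\otimes\boldsymbol e_I$ (columns indexed by the basis of $K_1$, rows by that of $K_0$). "Rearranged with respect to $\boldsymbol w^\theta$" means: rows and columns are permuted and partitioned into blocks so that $M_{2,2}$ is square, all diagonal entries of $M_{2,2}$ equal $u_{0,\theta}$, and $u_{0,\theta}$ appears nowhere else in $M$ (this is possible for every $\theta\in\mathcal A(1,1,1)$). The map $\rho_\alpha$. For $\alpha=(\alpha_x,\alpha_y,\alpha_z)\in\mathcal P$ with $\alpha_{t,0}\ne0$ for $t\in\{x,y,z\}$, and $d\ge0$, let $\mathbb 1^t_\alpha(d)=\sum_{\sigma}\frac{\boldsymbol t^{\sigma}}{t_0^{d}}(\alpha_t)\,\boldsymbol{\partial t}^{\sigma}\in S_t(d)^*$, the sum being over all exponents $\sigma$ of degree-$d$ monomials in $\boldsymbol t$. Let $\omega^{(1)}=\{I:\boldsymbol e_I\in\bigwedge_{r,s-n_z+1,0}E\}$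 and $\omega^{(2)}=\{J:\boldsymbol e_J\in\bigwedge_{r,s-n_z,1}E\}$, so $\#\omega^{(1)}+\#\omega^{(2)}=\binom{s+1}{s-n_z+1}$. Then $\rho_\alpha:\mathbb K^{\binom{s+1}{s-n_z+1}}=\mathbb K^{\#\omega^{(1)}}\times\mathbb K^{\#\omega^{(2)}}\to K_1$ is $$\rho_\alpha(\lambda^{(1)},\lambda^{(2)})=\sum_{I\in\omega^{(1)}}\lambda^{(1)}_I\,\mathbb 1^x_\alpha(1)\otimes\mathbb 1^y_\alpha(r-n_y)\otimes1\otimes\boldsymbol e_I+\sum_{J\in\omega^{(2)}}\lambda^{(2)}_J\,\mathbb 1^x_\alpha(1)\otimes\mathbb 1^y_\alpha(r-n_y+1)\otimes1\otimes\boldsymbol e_J .$$ *)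

theory Defs
  imports
    "HOL-Library.Poly_Mapping"
    "HOL-Computational_Algebra.Polynomial"
    "Jordan_Normal_Form.Char_Poly"
    "Jordan_Normal_Form.Gauss_Jordan_Elimination"
begin

alias lookup = Poly_Mapping.lookup
alias keys = Poly_Mapping.keys

section \<open>Multihomogeneous polynomials in three blocks of variables\<close>

text \<open>An exponent of one block maps the index \<open>i\<close> to the exponent of \<open>t\<^sub>i\<close>.  A polynomial in
  \<open>x, y, z\<close> is the finitely supported map from exponents \<open>(\<sigma>\<^sub>x, \<sigma>\<^sub>y, \<sigma>\<^sub>z)\<close> to coefficients, and a
  polynomial in a family \<open>'v\<close> of variables has the usual type \<open>('v \<Rightarrow>\<^sub>0 nat) \<Rightarrow>\<^sub>0 'a\<close>.\<close>

type_synonym mono = "nat \<Rightarrow>\<^sub>0 nat"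
type_synonym expo = "mono \<times> mono \<times> mono"
type_synonym 'a xyz_poly = "expo \<Rightarrow>\<^sub>0 'a"
type_synonym ('v, 'a) mvpoly = "('v \<Rightarrow>\<^sub>0 nat) \<Rightarrow>\<^sub>0 'a"

text \<open>Degrees are integers, so that the pieces of negative degree are zero.\<close>

definition monos_of :: "nat \<Rightarrow> int \<Rightarrow> mono set" where
  "monos_of m d = {\<sigma>. keys \<sigma> \<subseteq> {0..m} \<and> int (\<Sum>i\<in>{0..m}. lookup \<sigma> i) = d}"

fun expos :: "nat \<Rightarrow> nat \<Rightarrow> nat \<Rightarrow> int \<times> int \<times> int \<Rightarrow> expo set" where
  "expos nx ny nz (dx, dy, dz) = monos_of nx dx \<times> monos_of ny dy \<times> monos_of nz dz"

definition S :: "nat \<Rightarrow> nat \<Rightarrow> nat \<Rightarrow> int \<times> int \<times> int \<Rightarrow> 'a::zero xyz_poly set" where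
  "S nx ny nz d = {f. keys f \<subseteq> expos nx ny nz d}"

definition monomial :: "expo \<Rightarrow> 'a::zero_neq_one xyz_poly" where
  "monomial \<theta> = Poly_Mapping.single \<theta> 1"

section \<open>Points of the product of projective spaces\<close>

definition proj_rel :: "nat \<Rightarrow> ('a::field vec \<times> 'a vec) set" where
  "proj_rel m = {(v, w). v \<in> carrier_vec (m + 1) - {0\<^sub>v (m + 1)} \<and>
     w \<in> carrier_vec (m + 1) - {0\<^sub>v (m + 1)} \<and> (\<exists>c. c \<noteq> 0 \<and> w = c \<cdot>\<^sub>v v)}"

lemma equiv_proj_rel:
  "equiv (carrier_vec (m + 1) - {0\<^sub>v (m + 1)}) (proj_rel m :: ('a::field vec \<times> 'a vec) set)"
    (is "equiv ?A ?r")
proof (rule equivI)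
  show "?r \<subseteq> ?A \<times> ?A"
    by (auto simp: proj_rel_def)
  show "refl_on ?A ?r"
    by (auto simp: refl_on_def proj_rel_def intro!: exI[of _ 1])
  show "sym ?r"
  proof (rule symI)
    fix v w
    assume "(v, w) \<in> ?r"
    then obtain c where c: "c \<noteq> 0" "w = c \<cdot>\<^sub>v v" and vw: "v \<in> ?A" "w \<in> ?A"
      by (auto simp: proj_rel_def)
    have "v = inverse c \<cdot>\<^sub>v w" using c by (simp add: smult_smult_assoc)
    moreover have "inverse c \<noteq> 0" using c(1) by simp
    ultimately show "(w, v) \<in> ?r"
      unfolding proj_rel_def using vw by blast
  qed
  show "trans ?r"
  proof (rule transI)
    fix u v w
    assume "(u, v) \<in> ?r" "(v, w) \<in> ?r"
    then obtain c d where cd: "c \<noteq> 0" "v = c \<cdot>\<^sub>v u" "d \<noteq> 0" "w = d \<cdot>\<^sub>v v"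
      and uw: "u \<in> ?A" "w \<in> ?A"
      by (auto simp: proj_rel_def)
    have "w = (d * c) \<cdot>\<^sub>v u" "d * c \<noteq> 0" using cd by (simp_all add: smult_smult_assoc)
    then show "(u, w) \<in> ?r"
      unfolding proj_rel_def using uw by blast
  qed
qed

type_synonym 'a point = "'a vec set \<times> 'a vec set \<times> 'a vec set"

definition proj_space :: "nat \<Rightarrow> 'a::field vec set set" where
  "proj_space m = (carrier_vec (m + 1) - {0\<^sub>v (m + 1)}) // proj_rel m"

definition PP :: "nat \<Rightarrow> nat \<Rightarrow> nat \<Rightarrow> 'a::field point set" where
  "PP nx ny nz = proj_space nx \<times> proj_space ny \<times> proj_space nz"

definition mono_val :: "mono \<Rightarrow> 'a::comm_semiring_1 vec \<Rightarrow> 'a" where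
  "mono_val \<sigma> v = (\<Prod>i\<in>keys \<sigma>. (v $ i) ^ lookup \<sigma> i)"

definition poly_val :: "'a::comm_semiring_1 xyz_poly \<Rightarrow> 'a vec \<Rightarrow> 'a vec \<Rightarrow> 'a vec \<Rightarrow> 'a" where
  "poly_val f a b c = (\<Sum>(\<sigma>x, \<sigma>y, \<sigma>z)\<in>keys f.
     lookup f (\<sigma>x, \<sigma>y, \<sigma>z) * mono_val \<sigma>x a * mono_val \<sigma>y b * mono_val \<sigma>z c)"

definition zeros :: "nat \<Rightarrow> nat \<Rightarrow> nat \<Rightarrow> 'a::field xyz_poly set \<Rightarrow> 'a point set" where
  "zeros nx ny nz F = {(X, Y, Z) \<in> PP nx ny nz.
     \<forall>f\<in>F. \<forall>a\<in>X. \<forall>b\<in>Y. \<forall>c\<in>Z. poly_val f a b c = 0}"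

text \<open>Homogeneous coordinates of a point of projective space.  They are only used below in
  expressions that do not depend on their choice.\<close>

definition coords :: "'a vec set \<Rightarrow> 'a vec" where
  "coords X = (SOME v. v \<in> X)"

fun at_point :: "'a::comm_semiring_1 xyz_poly \<Rightarrow> 'a point \<Rightarrow> 'a" where
  "at_point f (X, Y, Z) = poly_val f (coords X) (coords Y) (coords Z)"

text \<open>\<open>(f\<^sub>0 / w\<^sup>\<theta>)(\<alpha>)\<close>\<close>

definition ratio :: "'a::field xyz_poly \<Rightarrow> expo \<Rightarrow> 'a point \<Rightarrow> 'a" where
  "ratio f0 \<theta> \<alpha> = at_point f0 \<alpha> / at_point (monomial \<theta>) \<alpha>"

definition separates :: "'a::field xyz_poly \<Rightarrow> expo \<Rightarrow> 'a point set \<Rightarrow> bool" where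
  "separates f0 \<theta> V \<longleftrightarrow> (\<forall>\<alpha>\<in>V. at_point (monomial \<theta>) \<alpha> \<noteq> 0) \<and>
     (\<forall>\<alpha>\<in>V. \<forall>\<alpha>'\<in>V. ratio f0 \<theta> \<alpha> = ratio f0 \<theta> \<alpha>' \<longleftrightarrow> \<alpha> = \<alpha>')"

fun zeroth_coords_nonzero :: "'a::zero point \<Rightarrow> bool" where
  "zeroth_coords_nonzero (X, Y, Z) \<longleftrightarrow> coords X $ 0 \<noteq> 0 \<and> coords Y $ 0 \<noteq> 0 \<and> coords Z $ 0 \<noteq> 0"

section \<open>2-bilinear systems and their resultant\<close>

definition mdeg :: "nat \<Rightarrow> nat \<Rightarrow> int \<times> int \<times> int" where
  "mdeg r i = (if i = 0 then (1, 1, 1) else if i \<le> r then (1, 1, 0) else (1, 0, 1))"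

definition square_2bilinear ::
    "nat \<Rightarrow> nat \<Rightarrow> nat \<Rightarrow> nat \<Rightarrow> nat \<Rightarrow> (nat \<Rightarrow> 'a::zero xyz_poly) \<Rightarrow> bool" where
  "square_2bilinear nx ny nz r s f \<longleftrightarrow> 1 \<le> nx \<and> 1 \<le> ny \<and> 1 \<le> nz \<and>
     nx + ny + nz = r + s \<and> ny \<le> r \<and> nz \<le> s \<and>
     (\<forall>i\<in>{1..r + s}. f i \<in> S nx ny nz (mdeg r i))"

definition overdet_2bilinear ::
    "nat \<Rightarrow> nat \<Rightarrow> nat \<Rightarrow> nat \<Rightarrow> nat \<Rightarrow> (nat \<Rightarrow> 'a::zero xyz_poly) \<Rightarrow> bool" where
  "overdet_2bilinear nx ny nz r s f \<longleftrightarrow>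
     square_2bilinear nx ny nz r s f \<and> f 0 \<in> S nx ny nz (mdeg r 0)"

text \<open>The variable \<open>u\<^bsub>i,\<sigma>\<^esub>\<close> is named by the pair \<open>(i, \<sigma>)\<close>.\<close>

type_synonym uvar = "nat \<times> expo"

definition u_vars :: "nat \<Rightarrow> nat \<Rightarrow> nat \<Rightarrow> nat \<Rightarrow> nat \<Rightarrow> uvar set" where
  "u_vars nx ny nz r s = (SIGMA i:{0..r + s}. expos nx ny nz (mdeg r i))"

definition Var :: "'v \<Rightarrow> ('v, 'a::zero_neq_one) mvpoly" where
  "Var v = Poly_Mapping.single (Poly_Mapping.single v 1) 1"

definition vars_of :: "('v, 'a::zero) mvpoly \<Rightarrow> 'v set" where
  "vars_of p = (\<Union>m\<in>keys p. keys m)"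

text \<open>Evaluation of \<open>p\<close> at the point \<open>\<rho>\<close>, its coefficients being mapped along \<open>h\<close>.\<close>

definition eval_poly_via ::
    "('c::zero \<Rightarrow> 'a::comm_semiring_1) \<Rightarrow> ('v \<Rightarrow> 'a) \<Rightarrow> ('v, 'c) mvpoly \<Rightarrow> 'a" where
  "eval_poly_via h \<rho> p = (\<Sum>m\<in>keys p. h (lookup p m) * (\<Prod>v\<in>keys m. \<rho> v ^ lookup m v))"

definition coeff_of :: "(nat \<Rightarrow> 'a::zero xyz_poly) \<Rightarrow> uvar \<Rightarrow> 'a" where
  "coeff_of F = (\<lambda>(i, \<sigma>). lookup (F i) \<sigma>)"

definition eval_int :: "(nat \<Rightarrow> 'a::comm_ring_1 xyz_poly) \<Rightarrow> (uvar, int) mvpoly \<Rightarrow> 'a" where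
  "eval_int F = eval_poly_via of_int (coeff_of F)"

definition eval_at :: "(nat \<Rightarrow> 'a::comm_ring_1 xyz_poly) \<Rightarrow> (uvar, 'a) mvpoly \<Rightarrow> 'a" where
  "eval_at F = eval_poly_via id (coeff_of F)"

text \<open>This property determines the resultant up to sign.\<close>

definition is_resultant ::
    "'a::field itself \<Rightarrow> nat \<Rightarrow> nat \<Rightarrow> nat \<Rightarrow> nat \<Rightarrow> nat \<Rightarrow> (uvar, int) mvpoly \<Rightarrow> bool" where
  "is_resultant _ nx ny nz r s R \<longleftrightarrow>
     vars_of R \<subseteq> u_vars nx ny nz r s \<and> Factorial_Ring.irreducible R \<and>
     (\<forall>F :: nat \<Rightarrow> 'a xyz_poly. overdet_2bilinear nx ny nz r s F \<longrightarrow>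
        (eval_int F R = 0 \<longleftrightarrow> zeros nx ny nz (F ` {0..r + s}) \<noteq> {}))"

definition universal_system ::
    "nat \<Rightarrow> nat \<Rightarrow> nat \<Rightarrow> nat \<Rightarrow> nat \<Rightarrow> (uvar, 'a::comm_ring_1) mvpoly xyz_poly" where
  "universal_system nx ny nz r i =
     (\<Sum>\<sigma>\<in>expos nx ny nz (mdeg r i). Poly_Mapping.single \<sigma> (Var (i, \<sigma>)))"

section \<open>The map \<open>\<delta>\<^sub>1\<close>\<close>

text \<open>The label \<open>((\<sigma>\<^sub>x, \<sigma>\<^sub>y, \<sigma>\<^sub>z), I)\<close> stands for the basis element
  \<open>\<partial>x\<^bsup>\<sigma>\<^sub>x\<^esup> \<otimes> \<partial>y\<^bsup>\<sigma>\<^sub>y\<^esup> \<otimes> z\<^bsup>\<sigma>\<^sub>z\<^esup> \<otimes> e\<^sub>I\<close>: the blocks \<open>x\<close> and \<open>y\<close> are dual, the block \<open>z\<close> is not.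
  Elements of the spaces \<open>K\<^sub>1\<close> and \<open>K\<^sub>0\<close> (and of their extensions to \<open>K[u]\<close>) are the finitely
  supported coefficient families on these labels.  The summands of \<open>K\<^sub>1\<close> and of \<open>K\<^sub>0\<close> have
  disjoint sets of labels since they differ in their exterior part.\<close>

type_synonym label = "expo \<times> nat set"

definition wedge :: "nat \<Rightarrow> nat \<Rightarrow> int \<Rightarrow> int \<Rightarrow> int \<Rightarrow> nat set set" where
  "wedge r s a b c = {I. I \<subseteq> {0..r + s} \<and> int (card (I \<inter> {1..r})) = a \<and>
     int (card (I \<inter> {r + 1..r + s})) = b \<and> int (card (I \<inter> {0})) = c}"

definition omega1 :: "nat \<Rightarrow> nat \<Rightarrow> nat \<Rightarrow> nat set set" where
  "omega1 nz r s = wedge r s (int r) (int s - int nz + 1) 0"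

definition omega2 :: "nat \<Rightarrow> nat \<Rightarrow> nat \<Rightarrow> nat set set" where
  "omega2 nz r s = wedge r s (int r) (int s - int nz) 1"

definition K1_basis :: "nat \<Rightarrow> nat \<Rightarrow> nat \<Rightarrow> nat \<Rightarrow> nat \<Rightarrow> label set" where
  "K1_basis nx ny nz r s =
     expos nx ny nz (1, int r - int ny, 0) \<times> omega1 nz r s \<union>
     expos nx ny nz (1, int r - int ny + 1, 0) \<times> omega2 nz r s"

definition K0_basis :: "nat \<Rightarrow> nat \<Rightarrow> nat \<Rightarrow> nat \<Rightarrow> nat \<Rightarrow> label set" where
  "K0_basis nx ny nz r s =
     expos nx ny nz (0, int r - int ny - 1, 0) \<times> wedge r s (int r - 1) (int s - int nz + 1) 0 \<union>
     expos nx ny nz (0, int r - int ny, 1) \<times> wedge r s (int r) (int s - int nz) 0 \<union>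
     expos nx ny nz (0, int r - int ny, 0) \<times> wedge r s (int r - 1) (int s - int nz) 1 \<union>
     expos nx ny nz (0, int r - int ny + 1, 1) \<times> wedge r s (int r) (int s - int nz - 1) 1"

text \<open>\<open>\<theta> \<le> \<sigma>\<close> componentwise; the order of the type of finitely supported maps is a
  lexicographic one.\<close>

definition mono_le :: "mono \<Rightarrow> mono \<Rightarrow> bool" where
  "mono_le \<theta> \<sigma> \<longleftrightarrow> (\<forall>i. lookup \<theta> i \<le> lookup \<sigma> i)"

text \<open>The elements of the first argument and of the result of \<open>\<psi>\<close> are the families of
  coefficients on the \<open>\<partial>x\<^bsup>\<sigma>\<^sub>x\<^esup> \<otimes> \<partial>y\<^bsup>\<sigma>\<^sub>y\<^esup> \<otimes> z\<^bsup>\<sigma>\<^sub>z\<^esup>\<close>.\<close>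

fun psi_basis :: "expo \<Rightarrow> expo \<Rightarrow> 'c::comm_ring_1 \<Rightarrow> (expo \<Rightarrow>\<^sub>0 'c)" where
  "psi_basis (\<sigma>x, \<sigma>y, \<sigma>z) (\<theta>x, \<theta>y, \<theta>z) c =
     (if mono_le \<theta>x \<sigma>x \<and> mono_le \<theta>y \<sigma>y
      then Poly_Mapping.single (\<sigma>x - \<theta>x, \<sigma>y - \<theta>y, \<theta>z + \<sigma>z) c else 0)"

definition psi :: "(expo \<Rightarrow>\<^sub>0 'c::comm_ring_1) \<Rightarrow> 'c xyz_poly \<Rightarrow> (expo \<Rightarrow>\<^sub>0 'c)" where
  "psi l f = (\<Sum>\<sigma>\<in>keys l. \<Sum>\<theta>\<in>keys f. psi_basis \<sigma> \<theta> (lookup l \<sigma> * lookup f \<theta>))"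

text \<open>\<open>c \<cdot> (p \<otimes> e\<^sub>J)\<close>\<close>

definition wedge_tensor :: "'c::comm_ring_1 \<Rightarrow> (expo \<Rightarrow>\<^sub>0 'c) \<Rightarrow> nat set \<Rightarrow> (label \<Rightarrow>\<^sub>0 'c)" where
  "wedge_tensor c p J = (\<Sum>\<sigma>\<in>keys p. Poly_Mapping.single (\<sigma>, J) (c * lookup p \<sigma>))"

text \<open>\<open>nth_elem I i\<close> is \<open>I\<^sub>i\<close> for \<open>I = {I\<^sub>1 < I\<^sub>2 < \<dots>}\<close>, so indices start at 1.\<close>

definition nth_elem :: "nat set \<Rightarrow> nat \<Rightarrow> nat" where
  "nth_elem I i = sorted_list_of_set I ! (i - 1)"

definition delta1 ::
    "nat \<Rightarrow> nat \<Rightarrow> (nat \<Rightarrow> 'c::comm_ring_1 xyz_poly) \<Rightarrow> (label \<Rightarrow>\<^sub>0 'c) \<Rightarrow> (label \<Rightarrow>\<^sub>0 'c)" where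
  "delta1 nx ny f v = (\<Sum>(\<sigma>, I)\<in>keys v. \<Sum>i\<in>{1..nx + ny + 1}.
     wedge_tensor ((-1) ^ (i - 1))
       (psi (Poly_Mapping.single \<sigma> (lookup v (\<sigma>, I))) (f (nth_elem I i)))
       (I - {nth_elem I i}))"

text \<open>The matrix of \<open>\<delta>\<^sub>1\<close> for the orderings \<open>rs\<close> of the basis of \<open>K\<^sub>0\<close> and \<open>cs\<close> of that of \<open>K\<^sub>1\<close>.\<close>

definition delta1_mat ::
    "nat \<Rightarrow> nat \<Rightarrow> (nat \<Rightarrow> 'c::comm_ring_1 xyz_poly) \<Rightarrow> label list \<Rightarrow> label list \<Rightarrow> 'c mat" where
  "delta1_mat nx ny f rs cs = mat (length rs) (length cs)
     (\<lambda>(i, j). lookup (delta1 nx ny f (Poly_Mapping.single (cs ! j) 1)) (rs ! i))"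

definition rearranged ::
    "nat \<Rightarrow> nat \<Rightarrow> nat \<Rightarrow> nat \<Rightarrow> nat \<Rightarrow> expo \<Rightarrow> label list \<Rightarrow> label list \<Rightarrow>
     (uvar, 'a::comm_ring_1) mvpoly mat \<Rightarrow> (uvar, 'a) mvpoly mat \<Rightarrow>
     (uvar, 'a) mvpoly mat \<Rightarrow> (uvar, 'a) mvpoly mat \<Rightarrow> bool" where
  "rearranged nx ny nz r s \<theta> rs cs M11 M12 M21 M22 \<longleftrightarrow>
     distinct rs \<and> set rs = K0_basis nx ny nz r s \<and>
     distinct cs \<and> set cs = K1_basis nx ny nz r s \<and>
     (\<exists>p q k. M11 \<in> carrier_mat p q \<and> M12 \<in> carrier_mat p k \<and>
        M21 \<in> carrier_mat k q \<and> M22 \<in> carrier_mat k k \<and>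
        delta1_mat nx ny (universal_system nx ny nz r) rs cs = four_block_mat M11 M12 M21 M22 \<and>
        (\<forall>i<k. M22 $$ (i, i) = Var (0, \<theta>)) \<and>
        (\<forall>i<k. \<forall>j<k. i \<noteq> j \<longrightarrow> (0, \<theta>) \<notin> vars_of (M22 $$ (i, j))) \<and>
        (\<forall>A\<in>{M11, M12, M21}. \<forall>a\<in>elements_mat A. (0, \<theta>) \<notin> vars_of a))"

section \<open>The map \<open>\<rho>\<^sub>\<alpha>\<close>\<close>

text \<open>Coefficient \<open>(t\<^sup>\<sigma> / t\<^sub>0\<^sup>d)(X)\<close> of \<open>\<partial>t\<^sup>\<sigma>\<close> in \<open>\<one>\<^sub>\<alpha>(d)\<close>, where \<open>X\<close> is the \<open>t\<close>-component of \<open>\<alpha>\<close>.\<close>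

definition one_coeff :: "'a::field vec set \<Rightarrow> nat \<Rightarrow> mono \<Rightarrow> 'a" where
  "one_coeff X d \<sigma> = mono_val \<sigma> (coords X) / (coords X $ 0) ^ d"

definition one_tensor ::
    "nat \<Rightarrow> nat \<Rightarrow> 'a::field point \<Rightarrow> nat \<Rightarrow> nat \<Rightarrow> (expo \<Rightarrow>\<^sub>0 'a)" where
  "one_tensor nx ny \<alpha> dx dy = (\<Sum>\<sigma>x\<in>monos_of nx (int dx). \<Sum>\<sigma>y\<in>monos_of ny (int dy).
     Poly_Mapping.single (\<sigma>x, \<sigma>y, 0)
       (one_coeff (fst \<alpha>) dx \<sigma>x * one_coeff (fst (snd \<alpha>)) dy \<sigma>y))"

text \<open>A vector of \<open>K\<^bsup>#\<omega>\<^sup>(\<^sup>1\<^sup>)\<^esup> \<times> K\<^bsup>#\<omega>\<^sup>(\<^sup>2\<^sup>)\<^esup>\<close> is given by two functions on index sets; only their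
  values on \<open>\<omega>\<^sup>(\<^sup>1\<^sup>)\<close> and \<open>\<omega>\<^sup>(\<^sup>2\<^sup>)\<close> matter.\<close>

definition rho ::
    "nat \<Rightarrow> nat \<Rightarrow> nat \<Rightarrow> nat \<Rightarrow> nat \<Rightarrow> 'a::field point \<Rightarrow>
     (nat set \<Rightarrow> 'a) \<times> (nat set \<Rightarrow> 'a) \<Rightarrow> (label \<Rightarrow>\<^sub>0 'a)" where
  "rho nx ny nz r s \<alpha> = (\<lambda>(l1, l2).
     (\<Sum>I\<in>omega1 nz r s. wedge_tensor (l1 I) (one_tensor nx ny \<alpha> 1 (r - ny)) I) +
     (\<Sum>J\<in>omega2 nz r s. wedge_tensor (l2 J) (one_tensor nx ny \<alpha> 1 (r - ny + 1)) J))"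

definition coord_vec :: "label list \<Rightarrow> (label \<Rightarrow>\<^sub>0 'a::zero) \<Rightarrow> 'a vec" where
  "coord_vec cs v = vec (length cs) (\<lambda>j. lookup v (cs ! j))"

definition diagonalizable :: "'a::field mat \<Rightarrow> bool" where
  "diagonalizable A \<longleftrightarrow> (\<exists>D. diagonal_mat D \<and> similar_mat A D)"

end

theory Submission
  imports Defs "HOL-Library.Function_Algebras"
begin

text \<open>Set \<open>q = r - n\<^sub>y\<close> and \<open>b = s - n\<^sub>z\<close>.  Since \<open>w\<^sup>\<theta>\<close> has no zero on \<open>V(f)\<close>, the system \<open>f\<close> has no zero left
  once one of the variables dividing \<open>w\<^sup>\<theta>\<close> is dropped.  A system without zeros admits no nonzero family
  killed by its Koszul differential: for every fixed \<open>x\<close> the Koszul complex of \<open>f\<close> in \<open>y\<close> and \<open>z\<close> is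
  exact by an explicit homotopy, and a complex of finite-dimensional spaces that depends linearly on \<open>x\<close> and
  is exact at each \<open>x \<noteq> 0\<close> is exact in the divided powers of \<open>x\<close>.  The latter is shown by induction on the
  number of variables: a cycle becomes a boundary after multiplication by a nonzero binary form, because the
  number of forms of large degree exceeds the dimension, and the linear factors of that form can be cancelled one at a
  time since the complex is exact on their hyperplanes.  Applied to the three subsystems that omit one of the three
  variables, this shows that \<open>M\<^sub>1\<^sub>,\<^sub>1\<close> has no kernel.

  Conversely, let \<open>\<alpha>\<close> be a solution and \<open>e\<close> the value of \<open>f\<^sub>0 / w\<^sup>\<theta>\<close> at it.  Then \<open>\<alpha>\<close> is a zero of \<open>f\<close> and
  \<open>f\<^sub>0 - e w\<^sup>\<theta>\<close>, and contracting the top exterior form with the coefficients in \<open>z\<close> of these polynomials at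
  \<open>(\<alpha>\<^sub>x, \<alpha>\<^sub>y)\<close>, which are linearly dependent, yields an element \<open>\<rho>\<^sub>\<alpha>(\<lambda>) \<noteq> 0\<close> of the kernel of \<open>\<delta>\<^sub>1\<close>.
  Replacing \<open>f\<^sub>0\<close> by \<open>f\<^sub>0 - e w\<^sup>\<theta>\<close> only subtracts \<open>e\<close> on the diagonal of \<open>M\<^sub>2\<^sub>,\<^sub>2\<close>, so this is an
  eigenvector of the Schur complement.  As many distinct eigenvalues arise as the size of \<open>M\<^sub>2\<^sub>,\<^sub>2\<close>.\<close>

section \<open>Linear complexes that are exact on fibers\<close>

text \<open>Exactness alone does not make a kernel trivial. It does here because every label of
  \<open>K1\<close> has z-degree 0 and an exterior part containing all of \<open>U\<close> = {1..r}.
  A term of the differential arriving at such a label either removes an index of \<open>U\<close>,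
  none of which is missing there, or multiplies by a variable of z. So boundaries vanish at these
  labels, and a cycle supported on them is zero once it is a boundary. Exactness is available from
  x-degree 1 on, the x-degree of \<open>K1\<close>. The order of the three subsystems is forced. No
  row missing from M11 contains the index 0, so the part of a kernel vector whose exterior part
  contains 0 satisfies all its equations. Its known zeros are divisible by x_i0 y_j0, hence x_i0 is
  dropped for the multiples of y_j0, and then y_j0. Only then do the terms of f_0 disappear from the
  other rows, where those with z_k0 are missing and z_k0 is dropped. The argument on fibers needs r
  < q + #y and s < b + #z; a lost variable y or z is made up for by the degree q + 1 or b + 1 of the
  part concerned.\<close>

lemma linear_dependence:
  fixes c :: "'s \<Rightarrow> 'p \<Rightarrow> 'a::field" and P :: "'p set" and S :: "'s set"
  assumes "finite P" "finite S" "card P < card S"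
  shows "\<exists>p. (\<exists>t\<in>S. p t \<noteq> 0) \<and> (\<forall>x\<in>P. (\<Sum>t\<in>S. p t * c t x) = 0)"
  using assms
proof (induction P arbitrary: S c rule: finite_induct)
  case empty
  then have "S \<noteq> {}" by auto
  then show ?case by (intro exI[of _ "\<lambda>_. 1"]) auto
next
  case (insert x0 P)
  show ?case
  proof (cases "\<forall>t\<in>S. c t x0 = 0")
    case True
    from insert.hyps insert.prems have "card P < card S" by simp
    from insert.IH[OF insert.prems(1) this, of c] True show ?thesis by auto
  next
    case False
    then obtain t0 where t0: "t0 \<in> S" "c t0 x0 \<noteq> 0" by auto
    define S' where "S' = S - {t0}"
    define c' where "c' = (\<lambda>t x. c t x - c t x0 / c t0 x0 * c t0 x)"
    have "finite S'" "card P < card S'"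
      using insert t0 by (auto simp: S'_def)
    from insert.IH[OF this, of c'] obtain p where
      p: "\<exists>t\<in>S'. p t \<noteq> 0" "\<forall>x\<in>P. (\<Sum>t\<in>S'. p t * c' t x) = 0" by auto
    \<comment> \<open>The coefficient of the pivot \<open>t0\<close> is forced by the equation
      \<open>x0\<close>; with it the other equations become the reduced ones with coefficients
      \<open>c'\<close>.\<close>
    define p' where "p' = p(t0 := - (\<Sum>t\<in>S'. p t * c t x0) / c t0 x0)"
    have split: "(\<Sum>t\<in>S. p' t * c t x) =
        (\<Sum>t\<in>S'. p t * c t x) - (\<Sum>t\<in>S'. p t * c t x0) / c t0 x0 * c t0 x" for x
    proof -
      have "(\<Sum>t\<in>S. p' t * c t x) = p' t0 * c t0 x + (\<Sum>t\<in>S'. p' t * c t x)"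
        unfolding S'_def using insert.prems t0 by (intro sum.remove) auto
      also have "(\<Sum>t\<in>S'. p' t * c t x) = (\<Sum>t\<in>S'. p t * c t x)"
        by (intro sum.cong) (auto simp: p'_def S'_def)
      finally show ?thesis by (simp add: p'_def)
    qed
    have "(\<Sum>t\<in>S. p' t * c t x) = 0" if x: "x \<in> insert x0 P" for x
    proof (cases "x = x0")
      case True then show ?thesis using t0 by (simp add: split)
    next
      case False
      with x p have "0 = (\<Sum>t\<in>S'. p t * c' t x)" by auto
      also have "\<dots> = (\<Sum>t\<in>S. p' t * c t x)"
        by (simp add: split c'_def right_diff_distrib sum_subtractf sum_divide_distrib
            sum_distrib_right sum_distrib_left mult_ac)
      finally show ?thesis ..
    qed
    moreover have "\<exists>t\<in>S. p' t \<noteq> 0" using p(1) by (auto simp: p'_def S'_def)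
    ultimately show ?thesis by blast
  qed
qed

text \<open>Induction on the columns \<open>l\<close>. A functional found for the smaller set of
  columns that does not kill the new column \<open>l0\<close> serves as a pivot for it.\<close>

lemma fredholm_alternative:
  fixes A :: "'i \<Rightarrow> 'l \<Rightarrow> 'a::field"
  assumes "finite L" "finite I"
  shows "(\<exists>y. \<forall>i\<in>I. t i = (\<Sum>l\<in>L. y l * A i l)) \<or>
    (\<exists>c. (\<forall>l\<in>L. (\<Sum>i\<in>I. c i * A i l) = 0) \<and> (\<Sum>i\<in>I. c i * t i) = 1)"
  using assms(1)
proof (induction L arbitrary: t rule: finite_induct)
  case empty
  show ?case
  proof (cases "\<forall>i\<in>I. t i = 0")
    case False
    then obtain i where i: "i \<in> I" "t i \<noteq> 0" by auto
    then have "(\<Sum>j\<in>I. (if j = i then 1 / t i else 0) * t j) = 1"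
      using assms(2) by (simp add: if_distrib[of "\<lambda>x. x * _"] sum.delta cong: if_cong)
    then show ?thesis by auto
  qed auto
next
  case (insert l0 L)
  consider (y) y where "\<forall>i\<in>I. t i = (\<Sum>l\<in>L. y l * A i l)"
    | (c) c where "\<forall>l\<in>L. (\<Sum>i\<in>I. c i * A i l) = 0" "(\<Sum>i\<in>I. c i * t i) = 1"
    using insert.IH[of t] by blast
  then show ?case
  proof cases
    case y
    have "(\<Sum>l\<in>insert l0 L. (y(l0 := 0)) l * A i l) = (\<Sum>l\<in>L. y l * A i l)" for i
      using insert.hyps by (auto intro!: sum.cong)
    with y show ?thesis by (intro disjI1 exI[of _ "y(l0 := 0)"]) simp
  next
    case c
    define \<gamma> where "\<gamma> = (\<Sum>i\<in>I. c i * A i l0)"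
    show ?thesis
    proof (cases "\<gamma> = 0")
      case True
      with c show ?thesis by (auto simp: \<gamma>_def)
    next
      case False
      \<comment> \<open>The multiple of column \<open>l0\<close> is chosen so that \<open>c\<close>
        pairs to 0 with \<open>t'\<close>. Either outcome of the induction hypothesis for
        \<open>t'\<close> transfers back to \<open>t\<close>.\<close>
      define t' where "t' = (\<lambda>i. t i - A i l0 / \<gamma>)"
      consider (y) y where "\<forall>i\<in>I. t' i = (\<Sum>l\<in>L. y l * A i l)"
        | (c) c' where "\<forall>l\<in>L. (\<Sum>i\<in>I. c' i * A i l) = 0" "(\<Sum>i\<in>I. c' i * t' i) = 1"
        using insert.IH[of t'] by blast
      then show ?thesis
      proof cases
        case y
        have "(\<Sum>l\<in>insert l0 L. (y(l0 := 1 / \<gamma>)) l * A i l) = A i l0 / \<gamma> + (\<Sum>l\<in>L. y l * A i l)" for i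
          using insert.hyps by (auto intro!: sum.cong)
        with y show ?thesis by (intro disjI1 exI[of _ "y(l0 := 1 / \<gamma>)"]) (auto simp: t'_def algebra_simps)
      next
        case c': c
        \<comment> \<open>Subtracting \<delta>/\<gamma> times \<open>c\<close> makes
          \<open>c'\<close> orthogonal to column \<open>l0\<close>, and the pairing with
          \<open>t\<close> becomes that of \<open>c'\<close> with \<open>t'\<close>.\<close>
        define \<delta> where "\<delta> = (\<Sum>i\<in>I. c' i * A i l0)"
        have "(\<Sum>i\<in>I. (c' i - \<delta> / \<gamma> * c i) * A i l) = (\<Sum>i\<in>I. c' i * A i l) - \<delta> / \<gamma> * (\<Sum>i\<in>I. c i * A i l)" for l
          by (simp add: algebra_simps sum_subtractf sum_distrib_left)
        moreover have "(\<Sum>i\<in>I. (c' i - \<delta> / \<gamma> * c i) * t i) = (\<Sum>i\<in>I. c' i * t i) - \<delta> / \<gamma> * (\<Sum>i\<in>I. c i * t i)"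
          by (simp add: algebra_simps sum_subtractf sum_distrib_left)
        moreover have "(\<Sum>i\<in>I. c' i * t i) - \<delta> / \<gamma> = 1"
          using c'(2) by (simp add: t'_def right_diff_distrib sum_subtractf \<delta>_def sum_divide_distrib)
        ultimately show ?thesis
          using c c' False by (intro disjI2 exI[of _ "\<lambda>i. c' i - \<delta> / \<gamma> * c i"])
            (auto simp: \<delta>_def[symmetric] \<gamma>_def[symmetric])
      qed
    qed
  qed
qed

section \<open>Chains with values in divided powers of the x-variables; \<open>shift j\<close> is
  contraction with x_j\<close>

definition shift :: "nat \<Rightarrow> ((nat \<Rightarrow> nat) \<Rightarrow> 'e) \<Rightarrow> (nat \<Rightarrow> nat) \<Rightarrow> 'e" where
  "shift j v = (\<lambda>\<sigma>. v (\<sigma>(j := Suc (\<sigma> j))))"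

lemma shift_add: "shift j (v + w) = shift j v + shift j w"
  and shift_diff: "shift j (v - w) = shift j v - shift j w"
  and shift_zero [simp]: "shift j 0 = 0"
  by (simp_all add: shift_def fun_eq_iff)

lemma shift_commute: "shift j (shift k v) = shift k (shift j v)"
  by (cases "j = k") (simp_all add: shift_def fun_eq_iff fun_upd_twist)

text \<open>The differential of a complex whose maps depend linearly on x: \<open>\<Delta> j\<close>
  is the coefficient of x_j, and x_j acts by contraction, so degrees drop by one.\<close>

definition bd :: "nat set \<Rightarrow> (nat \<Rightarrow> 'e \<Rightarrow> 'e) \<Rightarrow> ((nat \<Rightarrow> nat) \<Rightarrow> 'e) \<Rightarrow> (nat \<Rightarrow> nat) \<Rightarrow> 'e::comm_monoid_add"
  where "bd J \<Delta> v = (\<lambda>\<sigma>. \<Sum>j\<in>J. \<Delta> j (shift j v \<sigma>))"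

text \<open>\<open>E\<close> lies in a possibly larger type, and finitely many coordinates
  separating its elements take the place of a basis: they bound the dimension. Algebraic closedness
  supplies roots of binary forms, characteristic 0 the division by 2.\<close>

locale fin_dim_space = vector_space scale
  for scale :: "'a::{alg_closed_field, field_char_0} \<Rightarrow> 'e::ab_group_add \<Rightarrow> 'e" (infixr \<open>*s\<close> 75) +
  fixes E :: "'e set" and T :: "'i set" and coord :: "'i \<Rightarrow> 'e \<Rightarrow> 'a"
  assumes subspace_E: "subspace E"
    and finite_T: "finite T"
    and coord_add: "coord t (u + w) = coord t u + coord t w"
    and coord_scale: "coord t (c *s u) = c * coord t u"
    and coord_zeroD: "u \<in> E \<Longrightarrow> (\<And>t. t \<in> T \<Longrightarrow> coord t u = 0) \<Longrightarrow> u = 0"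
begin

definition endo :: "('e \<Rightarrow> 'e) \<Rightarrow> bool" where
  "endo D \<longleftrightarrow> (\<forall>u w. D (u + w) = D u + D w) \<and> (\<forall>c u. D (c *s u) = c *s D u) \<and> D ` E \<subseteq> E"

lemma endo_simps:
  assumes "endo D"
  shows "D (u + w) = D u + D w" "D (c *s u) = c *s D u" "D 0 = 0" "D (- u) = - D u"
    "D (u - w) = D u - D w" "D (sum g A) = (\<Sum>x\<in>A. D (g x))" "u \<in> E \<Longrightarrow> D u \<in> E"
proof -
  show add: "D (u + w) = D u + D w" for u w using assms by (simp add: endo_def)
  show "D (c *s u) = c *s D u" for c u using assms by (simp add: endo_def)
  show zero: "D 0 = 0" using add[of 0 0] by simp
  show minus: "D (- u) = - D u" for u using add[of u "- u"] zero by (simp add: eq_neg_iff_add_eq_0 add.commute)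
  show "D (u - w) = D u - D w" using add[of u "- w"] minus by simp
  show "D (sum g A) = (\<Sum>x\<in>A. D (g x))"
    by (induction A rule: infinite_finite_induct) (simp_all add: zero add)
  show "u \<in> E \<Longrightarrow> D u \<in> E" using assms by (auto simp: endo_def)
qed

text \<open>Anticommutation, the case j = k included, says that the square of \<Sum>\<xi>_j
  \<Delta>_j vanishes for all \<xi> at once.\<close>

definition complex :: "nat set \<Rightarrow> (nat \<Rightarrow> 'e \<Rightarrow> 'e) \<Rightarrow> bool" where
  "complex J \<Delta> \<longleftrightarrow> (\<forall>j\<in>J. endo (\<Delta> j)) \<and> (\<forall>j\<in>J. \<forall>k\<in>J. \<forall>u. \<Delta> j (\<Delta> k u) + \<Delta> k (\<Delta> j u) = 0)"

definition fiberwise_exact :: "nat set \<Rightarrow> (nat \<Rightarrow> 'e \<Rightarrow> 'e) \<Rightarrow> bool" where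
  "fiberwise_exact J \<Delta> \<longleftrightarrow> (\<forall>\<xi>. (\<exists>j\<in>J. \<xi> j \<noteq> 0) \<longrightarrow>
     (\<forall>u\<in>E. (\<Sum>j\<in>J. \<xi> j *s \<Delta> j u) = 0 \<longrightarrow> (\<exists>w\<in>E. u = (\<Sum>j\<in>J. \<xi> j *s \<Delta> j w))))"

text \<open>Exponents are plain functions; for finite \<open>J\<close> the support condition, with
  vanishing outside \<open>J\<close>, cuts out the divided power of degree \<open>d\<close> tensored
  with \<open>E\<close>.\<close>

definition chain :: "nat set \<Rightarrow> nat \<Rightarrow> ((nat \<Rightarrow> nat) \<Rightarrow> 'e) \<Rightarrow> bool" where
  "chain J d v \<longleftrightarrow> (\<forall>\<sigma>. v \<sigma> \<in> E) \<and> (\<forall>\<sigma>. v \<sigma> \<noteq> 0 \<longrightarrow> (\<forall>i. i \<notin> J \<longrightarrow> \<sigma> i = 0) \<and> sum \<sigma> J = d)"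

definition boundary :: "nat set \<Rightarrow> (nat \<Rightarrow> 'e \<Rightarrow> 'e) \<Rightarrow> nat \<Rightarrow> ((nat \<Rightarrow> nat) \<Rightarrow> 'e) \<Rightarrow> bool" where
  "boundary J \<Delta> d v \<longleftrightarrow> (\<exists>w. chain J (Suc d) w \<and> bd J \<Delta> w = v)"

definition cycle :: "nat set \<Rightarrow> (nat \<Rightarrow> 'e \<Rightarrow> 'e) \<Rightarrow> nat \<Rightarrow> ((nat \<Rightarrow> nat) \<Rightarrow> 'e) \<Rightarrow> bool" where
  "cycle J \<Delta> d v \<longleftrightarrow> chain J d v \<and> bd J \<Delta> v = 0"

lemma E_intros: "0 \<in> E" "u \<in> E \<Longrightarrow> w \<in> E \<Longrightarrow> u + w \<in> E" "u \<in> E \<Longrightarrow> w \<in> E \<Longrightarrow> u - w \<in> E"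
  "u \<in> E \<Longrightarrow> c *s u \<in> E" "(\<And>x. x \<in> A \<Longrightarrow> g x \<in> E) \<Longrightarrow> sum g A \<in> E"
  using subspace_E by (auto intro: subspace_0 subspace_add subspace_diff subspace_scale subspace_sum)

lemma chain_zero [simp]: "chain J d 0"
  by (simp add: chain_def E_intros)

lemma chain_add: "chain J d v \<Longrightarrow> chain J d w \<Longrightarrow> chain J d (v + w)"
  and chain_diff: "chain J d v \<Longrightarrow> chain J d w \<Longrightarrow> chain J d (v - w)"
proof -
  assume c: "chain J d v" "chain J d w"
  have "v \<sigma> + w \<sigma> \<noteq> 0 \<Longrightarrow> v \<sigma> \<noteq> 0 \<or> w \<sigma> \<noteq> 0" "v \<sigma> - w \<sigma> \<noteq> 0 \<Longrightarrow> v \<sigma> \<noteq> 0 \<or> w \<sigma> \<noteq> 0" for \<sigma>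
    by auto
  with c show "chain J d (v + w)" "chain J d (v - w)"
    unfolding chain_def by (simp_all add: E_intros) blast+
qed

lemma sum_upd_Suc:
  assumes "finite J" "j \<in> J"
  shows "sum (\<sigma>(j := Suc (\<sigma> j))) J = Suc (sum \<sigma> J)"
proof -
  have "sum (\<sigma>(j := Suc (\<sigma> j))) (J - {j}) = sum \<sigma> (J - {j})" by (intro sum.cong) auto
  then show ?thesis using assms by (subst (1 2) sum.remove[of J j]) auto
qed

lemma chain_shift:
  assumes "finite J" "j \<in> J" "chain J (Suc d) v"
  shows "chain J d (shift j v)"
  unfolding chain_def shift_def
proof (intro conjI allI impI)
  fix \<sigma> show "v (\<sigma>(j := Suc (\<sigma> j))) \<in> E" using assms by (auto simp: chain_def)
  assume "v (\<sigma>(j := Suc (\<sigma> j))) \<noteq> 0"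
  with assms have *: "\<forall>i. i \<notin> J \<longrightarrow> (\<sigma>(j := Suc (\<sigma> j))) i = 0"
    "sum (\<sigma>(j := Suc (\<sigma> j))) J = Suc d"
    unfolding chain_def by blast+
  show "sum \<sigma> J = d" using *(2) sum_upd_Suc[OF assms(1,2), of \<sigma>] by simp
  fix i assume "i \<notin> J" then show "\<sigma> i = 0" using *(1) assms(2) by (auto split: if_splits)
qed

lemma bd_add: "complex J \<Delta> \<Longrightarrow> bd J \<Delta> (v + w) = bd J \<Delta> v + bd J \<Delta> w"
  and bd_diff: "complex J \<Delta> \<Longrightarrow> bd J \<Delta> (v - w) = bd J \<Delta> v - bd J \<Delta> w"
  and bd_zero: "complex J \<Delta> \<Longrightarrow> bd J \<Delta> 0 = 0"
  by (auto simp: bd_def fun_eq_iff complex_def endo_simps shift_add shift_diff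
      sum.distrib sum_subtractf intro!: sum.neutral)

lemma bd_shift: "shift k (bd J \<Delta> v) = bd J \<Delta> (shift k v)"
proof -
  have "shift k (bd J \<Delta> v) = (\<lambda>\<sigma>. \<Sum>j\<in>J. \<Delta> j (shift k (shift j v) \<sigma>))"
    by (simp add: bd_def shift_def)
  also have "\<dots> = bd J \<Delta> (shift k v)" by (simp add: bd_def shift_commute[of k])
  finally show ?thesis .
qed

lemma chain_bd:
  assumes "finite J" "complex J \<Delta>" "chain J (Suc d) v"
  shows "chain J d (bd J \<Delta> v)"
proof -
  have s: "chain J d (shift j v)" if "j \<in> J" for j using chain_shift assms that by blast
  show ?thesis
    unfolding chain_def bd_def
  proof (intro conjI allI impI)
    fix \<sigma> show "(\<Sum>j\<in>J. \<Delta> j (shift j v \<sigma>)) \<in> E"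
      using s assms(2) by (intro E_intros) (auto simp: complex_def endo_simps chain_def)
    assume "(\<Sum>j\<in>J. \<Delta> j (shift j v \<sigma>)) \<noteq> 0"
    then obtain j where j: "j \<in> J" "\<Delta> j (shift j v \<sigma>) \<noteq> 0" by (meson sum.neutral)
    then have "shift j v \<sigma> \<noteq> 0" using assms(2) by (metis complex_def endo_simps(3))
    with s[OF j(1)] show "sum \<sigma> J = d" "\<And>i. i \<notin> J \<Longrightarrow> \<sigma> i = 0" unfolding chain_def by blast+
  qed
qed

text \<open>Swapping the two summation indices turns the double sum into its negative, so twice the
  sum is zero.\<close>

lemma bd_bd:
  assumes "complex J \<Delta>"
  shows "bd J \<Delta> (bd J \<Delta> v) = 0"
proof
  fix \<sigma>
  define S where "S = bd J \<Delta> (bd J \<Delta> v) \<sigma>"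
  have S: "S = (\<Sum>j\<in>J. \<Sum>k\<in>J. \<Delta> j (\<Delta> k (shift j (shift k v) \<sigma>)))"
    using assms by (simp add: S_def bd_def shift_def endo_simps complex_def)
  have "S = (\<Sum>j\<in>J. \<Sum>k\<in>J. \<Delta> k (\<Delta> j (shift k (shift j v) \<sigma>)))"
    unfolding S by (rule sum.swap)
  then have "S + S = (\<Sum>j\<in>J. \<Sum>k\<in>J. \<Delta> j (\<Delta> k (shift j (shift k v) \<sigma>)) + \<Delta> k (\<Delta> j (shift j (shift k v) \<sigma>)))"
    by (simp add: S sum.distrib shift_commute)
  also have "\<dots> = 0" using assms by (simp add: complex_def)
  finally have "(2::'a) *s S = 0" by (metis one_add_one scale_left_distrib scale_one)
  then show "bd J \<Delta> (bd J \<Delta> v) \<sigma> = 0 \<sigma>" by (simp add: S_def)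
qed

text \<open>Multiplication by a linear form, dually the operator \<open>h\<close>, such that the complex of \<open>\<Delta>\<close> is exact on
  the hyperplane where the form vanishes.\<close>

definition regular_form where
  "regular_form J \<Delta> h \<longleftrightarrow>
     (\<forall>v w. h (v - w) = h v - h w) \<and> (\<forall>v. bd J \<Delta> (h v) = h (bd J \<Delta> v)) \<and>
     (\<forall>d v. chain J (Suc d) v \<longrightarrow> chain J d (h v)) \<and>
     (\<forall>d v. chain J d v \<longrightarrow> (\<exists>u. chain J (Suc d) u \<and> h u = v)) \<and>
     (\<forall>d v. d \<ge> 1 \<longrightarrow> cycle J \<Delta> d v \<longrightarrow> h v = 0 \<longrightarrow>
       (\<exists>w. chain J (Suc d) w \<and> h w = 0 \<and> bd J \<Delta> w = v))"

text \<open>A diagram chase: a preimage of the cycle under \<open>h\<close> has its boundary in the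
  kernel of \<open>h\<close>, where the complex is exact, so it can be corrected by an element of
  that kernel. Hence \<open>h\<close> is surjective on cycles.\<close>

lemma regular_form_lift:
  assumes "regular_form J \<Delta> h" "finite J" "complex J \<Delta>" "d \<ge> 1" "cycle J \<Delta> d v"
  obtains z where "cycle J \<Delta> (Suc d) z" "h z = v"
proof -
  from assms obtain u where u: "chain J (Suc d) u" "h u = v"
    unfolding regular_form_def cycle_def by blast
  have "cycle J \<Delta> d (bd J \<Delta> u)"
    using chain_bd bd_bd assms u unfolding cycle_def by blast
  moreover have "h (bd J \<Delta> u) = 0"
    using assms u unfolding regular_form_def cycle_def by metis
  ultimately obtain w where w: "chain J (Suc d) w" "h w = 0" "bd J \<Delta> w = bd J \<Delta> u"
    using assms(1,4) unfolding regular_form_def by blast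
  have hd: "h (u - w) = h u - h w" using assms(1) unfolding regular_form_def by blast
  show ?thesis
  proof (rule that)
    show "cycle J \<Delta> (Suc d) (u - w)"
      unfolding cycle_def using u w assms(3) by (simp add: chain_diff bd_diff)
    show "h (u - w) = v" using hd u w by simp
  qed
qed

text \<open>The companion chase: \<open>h\<close> is injective on homology from degree d + 1 to
  degree d. The bounding chain is lifted along \<open>h\<close>, and the error lies in the kernel of
  \<open>h\<close>.\<close>

lemma regular_form_inj:
  assumes "regular_form J \<Delta> h" "complex J \<Delta>" "cycle J \<Delta> (Suc d) y" "boundary J \<Delta> d (h y)"
  shows "boundary J \<Delta> (Suc d) y"
proof -
  from assms(4) obtain w where w: "chain J (Suc d) w" "bd J \<Delta> w = h y" by (auto simp: boundary_def)
  from assms(1) w obtain u where u: "chain J (Suc (Suc d)) u" "h u = w"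
    unfolding regular_form_def by blast
  have "bd J \<Delta> (h u) = h (bd J \<Delta> u)" "h (y - bd J \<Delta> u) = h y - h (bd J \<Delta> u)"
    using assms(1) unfolding regular_form_def by blast+
  then have h0: "h (y - bd J \<Delta> u) = 0" using u w by simp
  have "chain J (Suc d) (bd J \<Delta> u)"
  proof (cases "finite J")
    case True then show ?thesis using chain_bd assms(2) u by blast
  next
    case False then show ?thesis by (simp add: bd_def flip: zero_fun_def)
  qed
  then have "cycle J \<Delta> (Suc d) (y - bd J \<Delta> u)"
    using assms(2,3) by (simp add: cycle_def chain_diff bd_diff bd_bd)
  with h0 assms(1) obtain w' where "chain J (Suc (Suc d)) w'" "bd J \<Delta> w' = y - bd J \<Delta> u"
    unfolding regular_form_def by (metis One_nat_def Suc_le_mono le0)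
  then have "bd J \<Delta> (w' + u) = y" "chain J (Suc (Suc d)) (w' + u)"
    using assms(2) u by (simp_all add: bd_add chain_add)
  then show ?thesis by (auto simp: boundary_def)
qed

lemma cycle_regular_form:
  assumes "regular_form J \<Delta> h" "cycle J \<Delta> (Suc d) y"
  shows "cycle J \<Delta> d (h y)"
proof -
  have "h (0 - 0) = h 0 - h 0" using assms(1) unfolding regular_form_def by blast
  then have "h 0 = 0" by simp
  with assms show ?thesis unfolding regular_form_def cycle_def by metis
qed

text \<open>\<open>(j\<^sub>1, j\<^sub>2)\<close>-binary forms of degree \<open>N\<close> act by contraction on divided powers; \<open>p\<close> is the dehomogenized form.\<close>

definition binary :: "nat \<Rightarrow> nat \<Rightarrow> nat \<Rightarrow> 'a poly \<Rightarrow> ((nat \<Rightarrow> nat) \<Rightarrow> 'e) \<Rightarrow> (nat \<Rightarrow> nat) \<Rightarrow> 'e" where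
  "binary j1 j2 N p z = (\<lambda>\<sigma>. \<Sum>t\<le>N. coeff p t *s z (\<sigma>(j1 := \<sigma> j1 + t, j2 := \<sigma> j2 + (N - t))))"

definition pencil :: "nat \<Rightarrow> nat \<Rightarrow> 'a \<Rightarrow> ((nat \<Rightarrow> nat) \<Rightarrow> 'e) \<Rightarrow> (nat \<Rightarrow> nat) \<Rightarrow> 'e" where
  "pencil j1 j2 \<xi> v = (\<lambda>\<sigma>. shift j1 v \<sigma> - \<xi> *s shift j2 v \<sigma>)"

text \<open>A drop in the degree of the dehomogenized form is a root at infinity, that is, a factor
  x_j2.\<close>

lemma binary_Suc_degree_less:
  assumes "degree p < Suc N" "j1 \<noteq> j2"
  shows "binary j1 j2 (Suc N) p z = binary j1 j2 N p (shift j2 z)"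
proof -
  have "coeff p (Suc N) = 0" using assms by (simp add: coeff_eq_0)
  then show ?thesis using assms(2)
    by (auto simp: binary_def shift_def Suc_diff_le intro!: sum.cong ext arg_cong[of _ _ z])
qed

text \<open>A root \<xi> of the dehomogenized form is a factor x_j1 - \<xi> x_j2, which acts as
  \<open>pencil\<close>.\<close>

lemma binary_Suc_mult:
  assumes "degree p \<le> N" "j1 \<noteq> j2"
  shows "binary j1 j2 (Suc N) ([:-\<xi>, 1:] * p) z = binary j1 j2 N p (pencil j1 j2 \<xi> z)"
proof
  fix \<sigma>
  define g where "g t = z (\<sigma>(j1 := \<sigma> j1 + t, j2 := \<sigma> j2 + (Suc N - t)))" for t
  have c0: "coeff p (Suc N) = 0" using assms by (simp add: coeff_eq_0)
  have "binary j1 j2 (Suc N) ([:-\<xi>, 1:] * p) z \<sigma> =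
      (\<Sum>t\<le>Suc N. coeff (pCons 0 p) t *s g t) - (\<Sum>t\<le>Suc N. (\<xi> * coeff p t) *s g t)"
    by (simp add: binary_def g_def scale_left_diff_distrib sum_subtractf del: sum.atMost_Suc)
  also have "(\<Sum>t\<le>Suc N. coeff (pCons 0 p) t *s g t) = (\<Sum>t\<le>N. coeff p t *s g (Suc t))"
    by (subst sum.atMost_Suc_shift) simp
  also have "(\<Sum>t\<le>Suc N. (\<xi> * coeff p t) *s g t) = (\<Sum>t\<le>N. (\<xi> * coeff p t) *s g t)"
    using c0 by simp
  also have "(\<Sum>t\<le>N. coeff p t *s g (Suc t)) - (\<Sum>t\<le>N. (\<xi> * coeff p t) *s g t) =
      (\<Sum>t\<le>N. coeff p t *s g (Suc t) - (\<xi> * coeff p t) *s g t)"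
    by (rule sum_subtractf[symmetric])
  also have "\<dots> = binary j1 j2 N p (pencil j1 j2 \<xi> z) \<sigma>"
    unfolding binary_def
  proof (intro sum.cong refl)
    fix t assume "t \<in> {..N}"
    then have t: "Suc N - t = Suc (N - t)" by auto
    define \<tau> where "\<tau> = \<sigma>(j1 := \<sigma> j1 + t, j2 := \<sigma> j2 + (N - t))"
    have "shift j1 z \<tau> = g (Suc t)" "shift j2 z \<tau> = g t"
      unfolding shift_def g_def \<tau>_def t using assms(2)
      by (auto intro!: arg_cong[of _ _ z])
    then show "coeff p t *s g (Suc t) - (\<xi> * coeff p t) *s g t = coeff p t *s pencil j1 j2 \<xi> z \<tau>"
      by (simp add: pencil_def scale_right_diff_distrib mult.commute)
  qed
  finally show "binary j1 j2 (Suc N) ([:-\<xi>, 1:] * p) z \<sigma> = binary j1 j2 N p (pencil j1 j2 \<xi> z) \<sigma>" .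
qed

text \<open>Each linear factor is injective on homology, so the factors are cancelled one by one;
  over an algebraically closed field there is always one, at infinity or at a root. A nonzero scalar
  remains at the end.\<close>

lemma boundary_if_binary_boundary:
  assumes "\<And>\<xi>. regular_form J \<Delta> (pencil j1 j2 \<xi>)" "regular_form J \<Delta> (shift j2)"
    and "complex J \<Delta>" "j1 \<noteq> j2" "p \<noteq> 0" "degree p \<le> N"
    and "cycle J \<Delta> (d + N) z" "boundary J \<Delta> d (binary j1 j2 N p z)"
  shows "boundary J \<Delta> (d + N) z"
  using assms(5-)
proof (induction N arbitrary: p z)
  case 0
  then obtain w where w: "chain J (Suc d) w" "bd J \<Delta> w = (\<lambda>\<sigma>. coeff p 0 *s z \<sigma>)"
    by (auto simp: boundary_def binary_def)
  from 0 have p0: "coeff p 0 \<noteq> 0" by (metis le_0_eq leading_coeff_0_iff)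
  define w' where "w' = (\<lambda>\<sigma>. inverse (coeff p 0) *s w \<sigma>)"
  have "chain J (Suc d) w'" using w by (auto simp: chain_def w'_def E_intros)
  moreover have "bd J \<Delta> w' = z"
  proof
    fix \<sigma>
    have "bd J \<Delta> w' \<sigma> = inverse (coeff p 0) *s bd J \<Delta> w \<sigma>"
      using assms(3) by (simp add: bd_def w'_def shift_def complex_def endo_simps scale_sum_right)
    then show "bd J \<Delta> w' \<sigma> = z \<sigma>" using p0 w by simp
  qed
  ultimately show ?case by (auto simp: boundary_def)
next
  case (Suc N)
  have "\<exists>h p'. regular_form J \<Delta> h \<and> p' \<noteq> 0 \<and> degree p' \<le> N \<and>
      binary j1 j2 (Suc N) p z = binary j1 j2 N p' (h z)"
  proof (cases "degree p < Suc N")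
    case True
    then show ?thesis using assms(2,4) Suc.prems binary_Suc_degree_less[OF True assms(4)]
      by (intro exI[of _ "shift j2"] exI[of _ p]) auto
  next
    case False
    with Suc.prems have deg: "degree p = Suc N" by simp
    then obtain \<xi> where "poly p \<xi> = 0" using alg_closed_imp_poly_has_root by (metis zero_less_Suc)
    then obtain p' where p': "p = [:-\<xi>, 1:] * p'" by (metis dvdE poly_eq_0_iff_dvd)
    with Suc.prems have nz: "p' \<noteq> 0" by auto
    have "degree p = degree [:-\<xi>, 1:] + degree p'" unfolding p' using nz by (intro degree_mult_eq) auto
    then have "degree p' = N" using deg by simp
    with p' nz show ?thesis
      using binary_Suc_mult[OF _ assms(4), of p' N \<xi> z] assms(1) by blast
  qed
  then obtain h p' where h: "regular_form J \<Delta> h" "p' \<noteq> 0" "degree p' \<le> N"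
    "binary j1 j2 (Suc N) p z = binary j1 j2 N p' (h z)" by blast
  have "cycle J \<Delta> (d + N) (h z)" using cycle_regular_form[OF h(1), of "d + N" z] Suc.prems by simp
  with Suc.IH[OF h(2,3)] Suc.prems h have "boundary J \<Delta> (d + N) (h z)" by auto
  then show ?case using regular_form_inj[OF h(1) assms(3), of "d + N" z] Suc.prems by simp
qed

text \<open>In one variable each divided power has dimension one, and exactness is that of the fiber
  at \<xi> = 1.\<close>

lemma exact_at_one_variable:
  assumes "complex {j} \<Delta>" "fiberwise_exact {j} \<Delta>" "cycle {j} \<Delta> d v" "d \<ge> 1"
  shows "boundary {j} \<Delta> d v"
proof -
  obtain d' where d: "d = Suc d'" using assms(4) by (cases d) auto
  define \<epsilon> where "\<epsilon> n = (\<lambda>i. if i = j then n else (0::nat))" for n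
  have supp: "\<sigma> = \<epsilon> d" if "v \<sigma> \<noteq> 0" for \<sigma>
    using assms(3) that by (auto simp: cycle_def chain_def \<epsilon>_def fun_eq_iff)
  have vE: "v \<sigma> \<in> E" for \<sigma> using assms(3) by (auto simp: cycle_def chain_def)
  have "bd {j} \<Delta> v (\<epsilon> d') = 0" using assms(3) by (simp add: cycle_def)
  moreover have "(\<epsilon> d')(j := Suc (\<epsilon> d' j)) = \<epsilon> d" by (auto simp: \<epsilon>_def d)
  ultimately have "\<Delta> j (v (\<epsilon> d)) = 0" by (simp add: bd_def shift_def)
  moreover have "\<forall>u\<in>E. (\<Sum>i\<in>{j}. 1 *s \<Delta> i u) = 0 \<longrightarrow> (\<exists>w\<in>E. u = (\<Sum>i\<in>{j}. 1 *s \<Delta> i w))"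
    using assms(2)[unfolded fiberwise_exact_def, rule_format, of "\<lambda>_. 1"] by auto
  ultimately obtain w where w: "w \<in> E" "v (\<epsilon> d) = \<Delta> j w" using vE by force
  define W where "W = (\<lambda>\<sigma>. if \<sigma> = \<epsilon> (Suc d) then w else 0)"
  have "chain {j} (Suc d) W"
    using w by (auto simp: chain_def W_def E_intros) (simp_all add: \<epsilon>_def)
  moreover have "bd {j} \<Delta> W = v"
  proof
    fix \<sigma>
    have "\<sigma>(j := Suc (\<sigma> j)) = \<epsilon> (Suc d) \<longleftrightarrow> \<sigma> = \<epsilon> d"
      by (auto simp: \<epsilon>_def fun_eq_iff split: if_splits)
    then show "bd {j} \<Delta> W \<sigma> = v \<sigma>"
      using w supp assms(1) by (auto simp: bd_def shift_def W_def complex_def endo_simps)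
  qed
  ultimately show ?thesis by (auto simp: boundary_def)
qed

section \<open>Restriction of the complex to hyperplanes in x\<close>

lemma chain_superset:
  assumes "chain J' d v" "J' \<subseteq> J" "finite J"
  shows "chain J d v"
  unfolding chain_def
proof (intro conjI allI impI)
  fix \<sigma> show "v \<sigma> \<in> E" using assms by (auto simp: chain_def)
  assume nz: "v \<sigma> \<noteq> 0"
  with assms have z: "\<forall>i. i \<notin> J' \<longrightarrow> \<sigma> i = 0" "sum \<sigma> J' = d" by (auto simp: chain_def)
  show "\<sigma> i = 0" if "i \<notin> J" for i using z that assms by auto
  have "sum \<sigma> J = sum \<sigma> J'" using z(1) assms by (intro sum.mono_neutral_right) auto
  then show "sum \<sigma> J = d" using z by simp
qed

lemma chain_remove:
  assumes "chain J d v" "\<And>\<sigma>. v \<sigma> \<noteq> 0 \<Longrightarrow> \<sigma> k = 0" "finite J"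
  shows "chain (J - {k}) d v"
  unfolding chain_def
proof (intro conjI allI impI)
  fix \<sigma> show "v \<sigma> \<in> E" using assms by (auto simp: chain_def)
  assume nz: "v \<sigma> \<noteq> 0"
  with assms have z: "\<forall>i. i \<notin> J \<longrightarrow> \<sigma> i = 0" "sum \<sigma> J = d" "\<sigma> k = 0" by (auto simp: chain_def)
  show "\<sigma> i = 0" if "i \<notin> J - {k}" for i using z that by (cases "i = k") auto
  have "sum \<sigma> J = sum \<sigma> (J - {k})" using z(3) assms by (intro sum.mono_neutral_right) auto
  then show "sum \<sigma> (J - {k}) = d" using z by simp
qed

text \<open>The kernel of contraction with x_k is the complex in the remaining variables, to which
  the induction hypothesis applies.\<close>

lemma regular_form_shift:
  assumes J: "finite J" "k \<in> J" and c: "complex J \<Delta>"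
    and IH: "\<And>d v. d \<ge> 1 \<Longrightarrow> cycle (J - {k}) \<Delta> d v \<Longrightarrow> boundary (J - {k}) \<Delta> d v"
  shows "regular_form J \<Delta> (shift k)"
  unfolding regular_form_def
proof (intro conjI allI impI)
  fix d and v w :: "(nat \<Rightarrow> nat) \<Rightarrow> 'e"
  show "shift k (v - w) = shift k v - shift k w" by (rule shift_diff)
  show "bd J \<Delta> (shift k v) = shift k (bd J \<Delta> v)" by (simp add: bd_shift)
  show "chain J (Suc d) v \<Longrightarrow> chain J d (shift k v)" using chain_shift J by blast
  show "\<exists>u. chain J (Suc d) u \<and> shift k u = v" if v: "chain J d v"
  proof (intro exI conjI)
    \<comment> \<open>A right inverse of \<open>shift k\<close>: the exponent of k is raised by one,
      and the value is zero where that exponent is zero.\<close>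
    let ?u = "\<lambda>\<sigma>. if \<sigma> k = 0 then 0 else v (\<sigma>(k := \<sigma> k - 1))"
    show "shift k ?u = v" by (auto simp: shift_def)
    show "chain J (Suc d) ?u"
      unfolding chain_def
    proof (intro conjI allI impI)
      fix \<sigma> show "?u \<sigma> \<in> E" using v by (auto simp: chain_def E_intros)
      assume nz: "?u \<sigma> \<noteq> 0"
      define \<tau> where "\<tau> = \<sigma>(k := \<sigma> k - 1)"
      from nz have *: "v \<tau> \<noteq> 0" "\<sigma> = \<tau>(k := Suc (\<tau> k))" by (auto simp: \<tau>_def split: if_splits)
      with v have z: "\<forall>i. i \<notin> J \<longrightarrow> \<tau> i = 0" "sum \<tau> J = d" by (auto simp: chain_def)
      show "sum \<sigma> J = Suc d" using sum_upd_Suc[OF J, of \<tau>] z *(2) by simp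
      fix i assume "i \<notin> J" then show "\<sigma> i = 0" using z J by (subst *(2)) auto
    qed
  qed
  assume d: "d \<ge> 1" and v: "cycle J \<Delta> d v" "shift k v = 0"
  have supp: "\<sigma> k = 0" if "v \<sigma> \<noteq> 0" for \<sigma>
  proof (rule ccontr)
    assume "\<sigma> k \<noteq> 0"
    then have "v \<sigma> = shift k v (\<sigma>(k := \<sigma> k - 1))" by (simp add: shift_def)
    with v that show False by simp
  qed
  have bd_eq: "bd (J - {k}) \<Delta> u = bd J \<Delta> u" if "shift k u = 0" for u
    using J c that by (auto simp: bd_def fun_eq_iff sum.remove[of J k] complex_def endo_simps)
  have "cycle (J - {k}) \<Delta> d v"
    using v supp bd_eq[of v] J by (auto simp: cycle_def intro: chain_remove)
  from IH[OF d this] obtain w where w: "chain (J - {k}) (Suc d) w" "bd (J - {k}) \<Delta> w = v"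
    by (auto simp: boundary_def)
  have "shift k w = 0"
    using w(1) by (auto simp: chain_def shift_def fun_eq_iff) (metis DiffD2 Zero_not_Suc fun_upd_same singletonI)
  moreover have "chain J (Suc d) w" using chain_superset[OF w(1)] J by auto
  ultimately show "\<exists>w. chain J (Suc d) w \<and> shift k w = 0 \<and> bd J \<Delta> w = v"
    using w bd_eq[of w] by auto
qed

text \<open>Dual to the substitution x_j1 = \<xi> x_j2: it embeds families in the variables other
  than j1 as the kernel of \<open>pencil\<close>.\<close>

definition extend :: "nat \<Rightarrow> nat \<Rightarrow> 'a \<Rightarrow> ((nat \<Rightarrow> nat) \<Rightarrow> 'e) \<Rightarrow> (nat \<Rightarrow> nat) \<Rightarrow> 'e" where
  "extend j1 j2 \<xi> w = (\<lambda>\<sigma>. \<xi> ^ \<sigma> j1 *s w (\<sigma>(j1 := 0, j2 := \<sigma> j2 + \<sigma> j1)))"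

lemma pencil_extend: "j1 \<noteq> j2 \<Longrightarrow> pencil j1 j2 \<xi> (extend j1 j2 \<xi> w) = 0"
  by (auto simp: pencil_def extend_def shift_def fun_eq_iff intro!: arg_cong[of _ _ "(*s) _"] arg_cong[of _ _ w])

text \<open>Vanishing of the pencil trades one unit of exponent at j1 for one at j2 and a factor
  \<xi>; repeating this empties j1.\<close>

lemma extend_if_pencil_zero:
  assumes "j1 \<noteq> j2" "pencil j1 j2 \<xi> v = 0"
  shows "v \<sigma> = \<xi> ^ \<sigma> j1 *s v (\<sigma>(j1 := 0, j2 := \<sigma> j2 + \<sigma> j1))"
proof (induction "\<sigma> j1" arbitrary: \<sigma>)
  case 0
  then have "\<sigma>(j1 := 0, j2 := \<sigma> j2 + \<sigma> j1) = \<sigma>" by (auto simp: fun_eq_iff)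
  moreover have "\<xi> ^ \<sigma> j1 = 1" using 0 by (metis power_0)
  ultimately show ?case by (simp only: scale_one)
next
  case (Suc m)
  define \<tau> where "\<tau> = \<sigma>(j1 := m)"
  have "pencil j1 j2 \<xi> v \<tau> = 0" using assms by simp
  moreover have "shift j1 v \<tau> = v \<sigma>"
    using Suc(2) by (auto simp: shift_def \<tau>_def intro!: arg_cong[of _ _ v])
  ultimately have 1: "v \<sigma> = \<xi> *s v (\<tau>(j2 := Suc (\<tau> j2)))" by (simp add: pencil_def shift_def)
  define \<rho> where "\<rho> = \<tau>(j2 := Suc (\<tau> j2))"
  have \<rho>: "\<rho> j1 = m" using assms by (simp add: \<rho>_def \<tau>_def)
  have "\<rho>(j1 := 0, j2 := \<rho> j2 + \<rho> j1) = \<sigma>(j1 := 0, j2 := \<sigma> j2 + \<sigma> j1)"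
    using assms Suc(2) by (auto simp: \<rho>_def \<tau>_def fun_eq_iff)
  with Suc(1)[of \<rho>] \<rho> 1 show ?case by (simp add: \<rho>_def[symmetric] flip: Suc(2))
qed

text \<open>On the hyperplane x_j1 = \<xi> x_j2 the variables \<open>J - {j1}\<close> remain and the
  coefficient of x_j2 becomes \<Delta>_j2 + \<xi> \<Delta>_j1. The map \<open>extend\<close>
  identifies this complex with the kernel of the pencil.\<close>

lemma regular_form_pencil:
  assumes J: "finite J" "j1 \<in> J" "j2 \<in> J" "j1 \<noteq> j2" and c: "complex J \<Delta>"
    and \<Delta>': "\<Delta>' = \<Delta>(j2 := \<lambda>u. \<Delta> j2 u + \<xi> *s \<Delta> j1 u)"
    and IH: "\<And>d v. d \<ge> 1 \<Longrightarrow> cycle (J - {j1}) \<Delta>' d v \<Longrightarrow> boundary (J - {j1}) \<Delta>' d v"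
  shows "regular_form J \<Delta> (pencil j1 j2 \<xi>)"
  unfolding regular_form_def
proof (intro conjI allI impI)
  fix d and v w :: "(nat \<Rightarrow> nat) \<Rightarrow> 'e"
  show "pencil j1 j2 \<xi> (v - w) = pencil j1 j2 \<xi> v - pencil j1 j2 \<xi> w"
    by (simp add: pencil_def shift_diff fun_eq_iff scale_right_diff_distrib)
  have e: "endo (\<Delta> j)" if "j \<in> J" for j using c that by (simp add: complex_def)
  have "bd J \<Delta> (pencil j1 j2 \<xi> v) \<sigma> = pencil j1 j2 \<xi> (bd J \<Delta> v) \<sigma>" for \<sigma>
  proof -
    have "bd J \<Delta> (pencil j1 j2 \<xi> v) \<sigma> = (\<Sum>j\<in>J. \<Delta> j (shift j (shift j1 v) \<sigma> - \<xi> *s shift j (shift j2 v) \<sigma>))"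
      by (simp add: bd_def pencil_def shift_def)
    also have "\<dots> = bd J \<Delta> (shift j1 v) \<sigma> - \<xi> *s bd J \<Delta> (shift j2 v) \<sigma>"
      by (simp add: bd_def e endo_simps sum_subtractf scale_sum_right)
    finally show ?thesis by (simp add: pencil_def bd_shift)
  qed
  then show "bd J \<Delta> (pencil j1 j2 \<xi> v) = pencil j1 j2 \<xi> (bd J \<Delta> v)" by (simp add: fun_eq_iff)
  have lin: "pencil j1 j2 \<xi> v = shift j1 v - (\<lambda>\<sigma>. \<xi> *s shift j2 v \<sigma>)" for v
    by (simp add: pencil_def fun_eq_iff)
  have cs: "chain K d (\<lambda>\<sigma>. \<xi> *s u \<sigma>)" if "chain K d u" for K d u \<xi>
    using that by (auto simp: chain_def E_intros)
  show "chain J (Suc d) v \<Longrightarrow> chain J d (pencil j1 j2 \<xi> v)"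
    unfolding lin using J by (intro chain_diff cs chain_shift) auto
  show "\<exists>u. chain J (Suc d) u \<and> pencil j1 j2 \<xi> u = v" if v: "chain J d v"
  proof (intro exI conjI)
    \<comment> \<open>The unrolled solution of u(\<sigma> + e_j1) = v(\<sigma>) + \<xi> u(\<sigma> +
      e_j2) with u = 0 where the exponent of j1 is 0.\<close>
    define g where "g \<sigma> t = \<xi> ^ t *s v (\<sigma>(j1 := \<sigma> j1 - Suc t, j2 := \<sigma> j2 + t))" for \<sigma> t
    let ?u = "\<lambda>\<sigma>. \<Sum>t<\<sigma> j1. g \<sigma> t"
    show "pencil j1 j2 \<xi> ?u = v"
    proof
      fix \<sigma>
      have 1: "shift j1 ?u \<sigma> = (\<Sum>t<Suc (\<sigma> j1). g (\<sigma>(j1 := Suc (\<sigma> j1))) t)"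
        by (simp add: shift_def)
      have 2: "g (\<sigma>(j1 := Suc (\<sigma> j1))) (Suc t) = \<xi> *s g (\<sigma>(j2 := Suc (\<sigma> j2))) t" for t
        using J(4) by (auto simp: g_def intro!: arg_cong[of _ _ "(*s) _"] arg_cong[of _ _ v])
      have 3: "g (\<sigma>(j1 := Suc (\<sigma> j1))) 0 = v \<sigma>"
        using J(4) by (auto simp: g_def intro!: arg_cong[of _ _ v])
      have "shift j1 ?u \<sigma> = v \<sigma> + (\<Sum>t<\<sigma> j1. \<xi> *s g (\<sigma>(j2 := Suc (\<sigma> j2))) t)"
        unfolding 1 by (subst sum.lessThan_Suc_shift) (simp only: 2 3)
      then show "pencil j1 j2 \<xi> ?u \<sigma> = v \<sigma>"
        using J(4) by (simp add: pencil_def shift_def scale_sum_right)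
    qed
    show "chain J (Suc d) ?u"
      unfolding chain_def
    proof (intro conjI allI impI)
      fix \<sigma> show "?u \<sigma> \<in> E" using v by (auto simp: chain_def g_def intro!: E_intros)
      assume "?u \<sigma> \<noteq> 0"
      then obtain t where t: "t < \<sigma> j1" "g \<sigma> t \<noteq> 0" by (meson lessThan_iff sum.neutral)
      define \<tau> where "\<tau> = \<sigma>(j1 := \<sigma> j1 - Suc t, j2 := \<sigma> j2 + t)"
      from t have "v \<tau> \<noteq> 0" by (auto simp: g_def \<tau>_def)
      with v have z: "\<forall>i. i \<notin> J \<longrightarrow> \<tau> i = 0" "sum \<tau> J = d" by (auto simp: chain_def)
      have "sum \<tau> (J - {j1} - {j2}) = sum \<sigma> (J - {j1} - {j2})"
        by (intro sum.cong) (auto simp: \<tau>_def)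
      moreover have "sum \<rho> J = \<rho> j1 + (\<rho> j2 + sum \<rho> (J - {j1} - {j2}))" for \<rho> :: "nat \<Rightarrow> nat"
        using J by (simp add: sum.remove[of J j1] sum.remove[of "J - {j1}" j2])
      ultimately show "sum \<sigma> J = Suc d" using z t J(4) by (simp add: \<tau>_def)
      fix i assume "i \<notin> J" then show "\<sigma> i = 0" using z J by (auto simp: \<tau>_def split: if_splits)
    qed
  qed
  assume d: "d \<ge> 1" and v: "cycle J \<Delta> d v" "pencil j1 j2 \<xi> v = 0"
  let ?J' = "J - {j1}"
  let ?ext = "extend j1 j2 \<xi>"
  \<comment> \<open>Restricting to exponents free of j1 loses nothing, since \<open>v\<close> lies
    in the kernel of the pencil.\<close>
  define r where "r = (\<lambda>\<sigma>. if \<sigma> j1 = 0 then v \<sigma> else 0)"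
  have ext_r: "?ext r = v"
  proof
    fix \<sigma> :: "nat \<Rightarrow> nat"
    have "(\<sigma>(j1 := 0, j2 := \<sigma> j2 + \<sigma> j1)) j1 = 0" using J(4) by simp
    then have "?ext r \<sigma> = \<xi> ^ \<sigma> j1 *s v (\<sigma>(j1 := 0, j2 := \<sigma> j2 + \<sigma> j1))"
      by (simp only: extend_def r_def simp_thms if_True)
    then show "?ext r \<sigma> = v \<sigma>" using extend_if_pencil_zero[OF J(4) v(2)] by metis
  qed
  \<comment> \<open>Extension intertwines the two differentials: a step in direction j1 equals \<xi>
    times a step in direction j2.\<close>
  have bd_ext: "bd J \<Delta> (?ext u) = ?ext (bd ?J' \<Delta>' u)" for u
  proof
    fix \<sigma> :: "nat \<Rightarrow> nat"
    define \<rho> where "\<rho> = \<sigma>(j1 := 0, j2 := \<sigma> j2 + \<sigma> j1)"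
    have sh: "shift j (?ext u) \<sigma> = \<xi> ^ \<sigma> j1 *s shift j u \<rho>" if "j \<noteq> j1" for j
      using that J(4) by (auto simp: shift_def extend_def \<rho>_def intro!: arg_cong[of _ _ "(*s) _"] arg_cong[of _ _ u])
    have sh1: "shift j1 (?ext u) \<sigma> = \<xi> ^ \<sigma> j1 *s \<xi> *s shift j2 u \<rho>"
      using J(4) by (auto simp: shift_def extend_def \<rho>_def mult.commute intro!: arg_cong[of _ _ "(*s) _"] arg_cong[of _ _ u])
    have "bd J \<Delta> (?ext u) \<sigma> = \<Delta> j1 (shift j1 (?ext u) \<sigma>) + (\<Delta> j2 (shift j2 (?ext u) \<sigma>) +
        (\<Sum>j\<in>?J' - {j2}. \<Delta> j (shift j (?ext u) \<sigma>)))"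
      unfolding bd_def using J by (subst sum.remove[of J j1], simp, simp, subst sum.remove[of ?J' j2]) auto
    also have "(\<Sum>j\<in>?J' - {j2}. \<Delta> j (shift j (?ext u) \<sigma>)) = (\<Sum>j\<in>?J' - {j2}. \<xi> ^ \<sigma> j1 *s \<Delta> j (shift j u \<rho>))"
      by (intro sum.cong) (auto simp: sh e endo_simps)
    also have "\<Delta> j1 (shift j1 (?ext u) \<sigma>) = \<xi> ^ \<sigma> j1 *s \<xi> *s \<Delta> j1 (shift j2 u \<rho>)"
      unfolding sh1 using e J by (simp add: endo_simps)
    also have "\<Delta> j2 (shift j2 (?ext u) \<sigma>) = \<xi> ^ \<sigma> j1 *s \<Delta> j2 (shift j2 u \<rho>)"
      using e J sh[of j2] by (simp add: endo_simps)
    also have "\<xi> ^ \<sigma> j1 *s \<xi> *s \<Delta> j1 (shift j2 u \<rho>) + (\<xi> ^ \<sigma> j1 *s \<Delta> j2 (shift j2 u \<rho>) +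
        (\<Sum>j\<in>?J' - {j2}. \<xi> ^ \<sigma> j1 *s \<Delta> j (shift j u \<rho>))) =
        \<xi> ^ \<sigma> j1 *s (\<Delta>' j2 (shift j2 u \<rho>) + (\<Sum>j\<in>?J' - {j2}. \<Delta> j (shift j u \<rho>)))"
      by (simp add: \<Delta>' scale_right_distrib scale_sum_right)
    also have "(\<Sum>j\<in>?J' - {j2}. \<Delta> j (shift j u \<rho>)) = (\<Sum>j\<in>?J' - {j2}. \<Delta>' j (shift j u \<rho>))"
      by (intro sum.cong) (auto simp: \<Delta>')
    also have "\<Delta>' j2 (shift j2 u \<rho>) + (\<Sum>j\<in>?J' - {j2}. \<Delta>' j (shift j u \<rho>)) = bd ?J' \<Delta>' u \<rho>"
      unfolding bd_def using J by (subst sum.remove[of ?J' j2]) auto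
    finally show "bd J \<Delta> (?ext u) \<sigma> = ?ext (bd ?J' \<Delta>' u) \<sigma>" by (simp add: extend_def \<rho>_def)
  qed
  have e': "\<Delta>' j 0 = 0" if "j \<in> J" for j using that e J by (auto simp: \<Delta>' endo_simps)
  have "bd ?J' \<Delta>' r \<sigma> = 0" for \<sigma>
  proof (cases "\<sigma> j1 = 0")
    case True
    then have "\<sigma>(j1 := 0, j2 := \<sigma> j2 + \<sigma> j1) = \<sigma>" by (auto simp: fun_eq_iff)
    then have "bd ?J' \<Delta>' r \<sigma> = ?ext (bd ?J' \<Delta>' r) \<sigma>" using True by (simp add: extend_def)
    also have "\<dots> = 0" using v(1) by (simp flip: bd_ext add: ext_r cycle_def)
    finally show ?thesis .
  next
    case False
    then have "shift j r \<sigma> = 0" if "j \<noteq> j1" for j using that by (simp add: shift_def r_def)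
    then show ?thesis by (auto simp: bd_def e' intro!: sum.neutral)
  qed
  moreover have "chain J d r" using v(1) by (auto simp: cycle_def chain_def r_def E_intros)
  then have "chain ?J' d r" using J by (intro chain_remove) (auto simp: r_def split: if_splits)
  ultimately have "cycle ?J' \<Delta>' d r" by (auto simp: cycle_def)
  from IH[OF d this] obtain w where w: "chain ?J' (Suc d) w" "bd ?J' \<Delta>' w = r"
    by (auto simp: boundary_def)
  have "chain J (Suc d) (?ext w)"
    unfolding chain_def
  proof (intro conjI allI impI)
    fix \<sigma> show "?ext w \<sigma> \<in> E" using w by (auto simp: chain_def extend_def intro!: E_intros)
    assume nz: "?ext w \<sigma> \<noteq> 0"
    define \<rho> where "\<rho> = \<sigma>(j1 := 0, j2 := \<sigma> j2 + \<sigma> j1)"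
    have "w \<rho> \<noteq> 0" using nz by (auto simp: extend_def \<rho>_def)
    with w have z: "\<forall>i. i \<notin> ?J' \<longrightarrow> \<rho> i = 0" "sum \<rho> ?J' = Suc d" by (auto simp: chain_def)
    have "sum \<rho> (?J' - {j2}) = sum \<sigma> (?J' - {j2})" by (intro sum.cong) (auto simp: \<rho>_def)
    then show "sum \<sigma> J = Suc d" using z(2) J
      by (simp add: sum.remove[of J j1] sum.remove[of ?J' j2] \<rho>_def)
    fix i assume "i \<notin> J" then show "\<sigma> i = 0" using z J by (auto simp: \<rho>_def split: if_splits)
  qed
  then show "\<exists>w. chain J (Suc d) w \<and> pencil j1 j2 \<xi> w = 0 \<and> bd J \<Delta> w = v"
    using bd_ext[of w] w ext_r pencil_extend[OF J(4)] by auto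
qed

section \<open>Induction on the number of x-variables\<close>

lemma complex_subset: "complex J \<Delta> \<Longrightarrow> K \<subseteq> J \<Longrightarrow> complex K \<Delta>"
  unfolding complex_def by blast

lemma fiberwise_exact_remove:
  assumes "finite J" "k \<in> J" "fiberwise_exact J \<Delta>"
  shows "fiberwise_exact (J - {k}) \<Delta>"
  unfolding fiberwise_exact_def
proof (intro allI impI)
  fix \<xi> :: "nat \<Rightarrow> 'a" assume nz: "\<exists>j\<in>J - {k}. \<xi> j \<noteq> 0"
  have "(\<Sum>j\<in>J. (\<xi>(k := 0)) j *s \<Delta> j u) = (\<Sum>j\<in>J - {k}. \<xi> j *s \<Delta> j u)" for u
    using assms by (subst sum.remove[of J k]) auto
  moreover have "\<exists>j\<in>J. (\<xi>(k := 0)) j \<noteq> 0" using nz by auto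
  ultimately show "\<forall>u\<in>E. (\<Sum>j\<in>J - {k}. \<xi> j *s \<Delta> j u) = 0 \<longrightarrow> (\<exists>w\<in>E. u = (\<Sum>j\<in>J - {k}. \<xi> j *s \<Delta> j w))"
    using assms(3)[unfolded fiberwise_exact_def, rule_format, of "\<xi>(k := 0)"] by metis
qed

text \<open>A point \<xi> of the smaller space is completed by the coordinate \<zeta> \<xi>_j2 at
  j1, which puts it on the hyperplane x_j1 = \<zeta> x_j2.\<close>

lemma fiberwise_exact_pencil:
  assumes J: "finite J" "j1 \<in> J" "j2 \<in> J" "j1 \<noteq> j2" and "fiberwise_exact J \<Delta>"
  shows "fiberwise_exact (J - {j1}) (\<Delta>(j2 := \<lambda>u. \<Delta> j2 u + \<zeta> *s \<Delta> j1 u))" (is "fiberwise_exact _ ?\<Delta>'")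
  unfolding fiberwise_exact_def
proof (intro allI impI)
  fix \<xi> :: "nat \<Rightarrow> 'a" assume nz: "\<exists>j\<in>J - {j1}. \<xi> j \<noteq> 0"
  let ?\<xi> = "\<xi>(j1 := \<zeta> * \<xi> j2)"
  have eq: "(\<Sum>j\<in>J. ?\<xi> j *s \<Delta> j u) = (\<Sum>j\<in>J - {j1}. \<xi> j *s ?\<Delta>' j u)" for u
  proof -
    have "(\<Sum>j\<in>J. ?\<xi> j *s \<Delta> j u) = (\<zeta> * \<xi> j2) *s \<Delta> j1 u + (\<xi> j2 *s \<Delta> j2 u + (\<Sum>j\<in>J - {j1} - {j2}. \<xi> j *s \<Delta> j u))"
      using J by (subst sum.remove[of J j1], simp, simp, subst sum.remove[of "J - {j1}" j2]) auto
    moreover have "(\<Sum>j\<in>J - {j1}. \<xi> j *s ?\<Delta>' j u) =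
        \<xi> j2 *s (\<Delta> j2 u + \<zeta> *s \<Delta> j1 u) + (\<Sum>j\<in>J - {j1} - {j2}. \<xi> j *s \<Delta> j u)"
      using J by (subst sum.remove[of "J - {j1}" j2]) auto
    ultimately show ?thesis by (simp add: scale_right_distrib mult.commute add_ac)
  qed
  have "\<exists>j\<in>J. ?\<xi> j \<noteq> 0" using nz by auto
  from assms(5)[unfolded fiberwise_exact_def, rule_format, OF this]
  show "\<forall>u\<in>E. (\<Sum>j\<in>J - {j1}. \<xi> j *s ?\<Delta>' j u) = 0 \<longrightarrow> (\<exists>w\<in>E. u = (\<Sum>j\<in>J - {j1}. \<xi> j *s ?\<Delta>' j w))"
    by (simp only: eq) blast
qed

lemma complex_pencil:
  assumes J: "j1 \<in> J" "j2 \<in> J" and c: "complex J \<Delta>"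
  shows "complex (J - {j1}) (\<Delta>(j2 := \<lambda>u. \<Delta> j2 u + \<zeta> *s \<Delta> j1 u))"
proof -
  define D where "D = (\<lambda>u. \<Delta> j2 u + \<zeta> *s \<Delta> j1 u)"
  have e: "endo (\<Delta> j)" if "j \<in> J" for j using c that by (simp add: complex_def)
  have ac: "\<Delta> j (\<Delta> k u) + \<Delta> k (\<Delta> j u) = 0" if "j \<in> J" "k \<in> J" for j k u
    using c that by (simp add: complex_def)
  have eD: "endo D"
    using e[OF J(1)] e[OF J(2)] unfolding endo_def D_def
    by (auto simp: scale_right_distrib algebra_simps image_subset_iff intro!: E_intros)
  have acD: "D (\<Delta> k u) + \<Delta> k (D u) = 0" if "k \<in> J" for k u
  proof -
    have "D (\<Delta> k u) + \<Delta> k (D u) =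
        (\<Delta> j2 (\<Delta> k u) + \<Delta> k (\<Delta> j2 u)) + \<zeta> *s (\<Delta> j1 (\<Delta> k u) + \<Delta> k (\<Delta> j1 u))"
      by (simp add: D_def e[OF that] endo_simps(1,2) scale_right_distrib add_ac)
    then show ?thesis by (simp add: ac J that)
  qed
  have Dval: "D w = \<Delta> j2 w + \<zeta> *s \<Delta> j1 w" for w by (simp add: D_def)
  have swap: "D (\<Delta> k u) = - \<Delta> k (D u)" if "k \<in> J" for k u
    using acD[OF that] by (simp add: eq_neg_iff_add_eq_0)
  \<comment> \<open>Expanding the inner \<open>D\<close> and moving each summand past the outer one
    reproduces the expression with opposite sign.\<close>
  have "D (D u) = - D (D u)" for u
  proof -
    have "D (D u) = D (\<Delta> j2 u) + \<zeta> *s D (\<Delta> j1 u)"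
      by (simp only: Dval[of u] endo_simps(1,2)[OF eD])
    also have "\<dots> = - (\<Delta> j2 (D u) + \<zeta> *s \<Delta> j1 (D u))" by (simp add: swap J)
    finally show ?thesis by (simp only: Dval[of "D u"])
  qed
  then have DD: "D (D u) + D (D u) = 0" for u by (simp add: eq_neg_iff_add_eq_0)
  show ?thesis
    using e ac eD acD DD unfolding complex_def D_def[symmetric]
    by (auto simp: add.commute)
qed

lemma unit_exponent:
  fixes \<sigma> :: "nat \<Rightarrow> nat"
  assumes "finite J" "\<forall>i. i \<notin> J \<longrightarrow> \<sigma> i = 0" "sum \<sigma> J = 1"
  obtains j where "j \<in> J" "\<sigma> = (\<lambda>i. if i = j then 1 else 0)"
proof -
  from assms(3) obtain j where j: "j \<in> J" "\<sigma> j \<noteq> 0" by (metis one_neq_zero sum.neutral)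
  then have *: "\<sigma> j + sum \<sigma> (J - {j}) = 1" using assms sum.remove[of J j \<sigma>] by simp
  with j have "\<sigma> j = 1" "sum \<sigma> (J - {j}) = 0" by auto
  then have "\<sigma> i = (if i = j then 1 else 0)" for i using assms(1,2) by (cases "i \<in> J") auto
  with j that show ?thesis by blast
qed

theorem exact_if_fiberwise_exact:
  assumes "finite J" "complex J \<Delta>" "fiberwise_exact J \<Delta>" "d \<ge> 1" "cycle J \<Delta> d v"
  shows "boundary J \<Delta> d v"
  using assms
proof (induction "card J" arbitrary: J \<Delta> d v rule: less_induct)
  case less
  note J = less.prems(1) and c = less.prems(2) and fe = less.prems(3)
  consider "J = {}" | j where "J = {j}" | j1 j2 where "j1 \<in> J" "j2 \<in> J" "j1 \<noteq> j2" by blast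
  then show ?case
  proof cases
    case 1
    then have "v = 0" using less.prems(4,5) by (auto simp: cycle_def chain_def fun_eq_iff)
    then show ?thesis using 1 by (auto simp: boundary_def bd_def fun_eq_iff intro!: exI[of _ 0])
  next
    case 2
    then show ?thesis using exact_at_one_variable less.prems by blast
  next
    case (3 j1 j2)
    have smaller: "card (J - {j}) < card J" if "j \<in> J" for j using J that by (rule card_Diff1_less)
    have r2: "regular_form J \<Delta> (shift j2)"
      using less.hyps[OF smaller[OF 3(2)], of \<Delta>] J c fe 3
      by (intro regular_form_shift) (auto intro: complex_subset fiberwise_exact_remove)
    have r1: "regular_form J \<Delta> (pencil j1 j2 \<xi>)" for \<xi>
    proof (rule regular_form_pencil[OF J 3 c refl])
      show "boundary (J - {j1}) (\<Delta>(j2 := \<lambda>u. \<Delta> j2 u + \<xi> *s \<Delta> j1 u)) d v"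
        if "d \<ge> 1" "cycle (J - {j1}) (\<Delta>(j2 := \<lambda>u. \<Delta> j2 u + \<xi> *s \<Delta> j1 u)) d v" for d v
        using J by (intro less.hyps[OF smaller[OF 3(1)]] complex_pencil[OF 3(1,2) c]
            fiberwise_exact_pencil[OF J 3 fe] that) auto
    qed
    \<comment> \<open>Degree 1 carries the whole argument; higher degrees are reduced to it because
      x_j2 is injective on homology.\<close>
    have deg1: "boundary J \<Delta> 1 v" if v: "cycle J \<Delta> 1 v" for v
    proof -
      \<comment> \<open>\<open>N\<close> bounds the dimension of the chains of degree 1, while there
        are N + 1 monomials of degree N in two variables.\<close>
      define N where "N = card (J \<times> T)"
      \<comment> \<open>Repeated lifting along x_j2 writes \<open>v\<close> as the contraction of a
        cycle of degree 1 + n with the n-th power of x_j2.\<close>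
      have lift: "\<exists>z. cycle J \<Delta> (1 + n) z \<and> (\<lambda>\<sigma>. z (\<sigma>(j2 := \<sigma> j2 + n))) = v" for n
      proof (induction n)
        case 0 then show ?case using v by auto
      next
        case (Suc n)
        then obtain z where z: "cycle J \<Delta> (1 + n) z" "(\<lambda>\<sigma>. z (\<sigma>(j2 := \<sigma> j2 + n))) = v" by blast
        obtain y where y: "cycle J \<Delta> (Suc (1 + n)) y" "shift j2 y = z"
          using regular_form_lift[OF r2 J c _ z(1)] by auto
        have "(\<lambda>\<sigma>. y (\<sigma>(j2 := \<sigma> j2 + Suc n))) = v"
          using z(2) unfolding y(2)[symmetric] by (simp add: shift_def)
        moreover have "cycle J \<Delta> (1 + Suc n) y" using y(1) by simp
        ultimately show ?case by blast
      qed
      then obtain z where z: "cycle J \<Delta> (1 + N) z" "(\<lambda>\<sigma>. z (\<sigma>(j2 := \<sigma> j2 + N))) = v" by blast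
      \<comment> \<open>\<open>m t\<close> is \<open>z\<close> contracted with x_j1^t x_j2^(N - t),
        again a chain of degree 1; a linear relation among the \<open>m t\<close> is a binary form
        killing \<open>z\<close>.\<close>
      define m where "m t = (\<lambda>\<sigma>. z (\<sigma>(j1 := \<sigma> j1 + t, j2 := \<sigma> j2 + (N - t))))" for t
      define \<epsilon> where "\<epsilon> j = (\<lambda>i. if i = j then 1 else (0::nat))" for j :: nat
      have m_chain: "chain J 1 (m t)" if "t \<le> N" for t
        unfolding chain_def
      proof (intro conjI allI impI)
        fix \<sigma> show "m t \<sigma> \<in> E" using z by (auto simp: m_def cycle_def chain_def)
        assume nz: "m t \<sigma> \<noteq> 0"
        define \<rho> where "\<rho> = \<sigma>(j1 := \<sigma> j1 + t, j2 := \<sigma> j2 + (N - t))"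
        have "z \<rho> \<noteq> 0" using nz by (simp only: m_def \<rho>_def not_False_eq_True)
        then have *: "\<forall>i. i \<notin> J \<longrightarrow> \<rho> i = 0" "sum \<rho> J = 1 + N"
          using z(1) unfolding cycle_def chain_def by blast+
        have "sum \<rho> (J - {j1} - {j2}) = sum \<sigma> (J - {j1} - {j2})"
          by (intro sum.cong) (auto simp: \<rho>_def)
        moreover have "sum \<rho> J = \<rho> j1 + (\<rho> j2 + sum \<rho> (J - {j1} - {j2}))" for \<rho> :: "nat \<Rightarrow> nat"
          using J 3 by (simp add: sum.remove[of J j1] sum.remove[of "J - {j1}" j2])
        ultimately show "sum \<sigma> J = 1" using * that 3 by (simp add: \<rho>_def)
        fix i assume "i \<notin> J" then show "\<sigma> i = 0" using * 3 by (auto simp: \<rho>_def split: if_splits)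
      qed
      have "\<exists>p. (\<exists>t\<in>{..N}. p t \<noteq> 0) \<and> (\<forall>x\<in>J \<times> T. (\<Sum>t\<in>{..N}. p t * coord (snd x) (m t (\<epsilon> (fst x)))) = 0)"
        using J finite_T by (intro linear_dependence) (auto simp: N_def)
      then obtain p where p: "\<exists>t\<le>N. p t \<noteq> 0"
        "\<And>j i. j \<in> J \<Longrightarrow> i \<in> T \<Longrightarrow> (\<Sum>t\<le>N. p t * coord i (m t (\<epsilon> j))) = 0" by fastforce
      define P where "P = (\<Sum>t\<le>N. monom (p t) t)"
      have cP: "coeff P t = (if t \<le> N then p t else 0)" for t
        by (simp add: P_def coeff_sum)
      have "P \<noteq> 0" using p(1) cP by (metis coeff_0)
      have degP: "degree P \<le> N" by (rule degree_le) (simp add: cP)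
      have bin: "binary j1 j2 N P z \<sigma> = (\<Sum>t\<le>N. p t *s m t \<sigma>)" for \<sigma>
        by (simp add: binary_def cP m_def)
      have coord0: "coord i 0 = 0" for i using coord_scale[of i 0 0] by simp
      have coord_sum: "coord i (sum g A) = (\<Sum>a\<in>A. coord i (g a))" for i g and A :: "nat set"
        by (induction A rule: infinite_finite_induct) (simp_all add: coord0 coord_add)
      have "binary j1 j2 N P z \<sigma> = 0" for \<sigma>
      proof (cases "\<exists>j\<in>J. \<sigma> = \<epsilon> j")
        case True
        then obtain j where j: "j \<in> J" "\<sigma> = \<epsilon> j" by blast
        have "(\<Sum>t\<le>N. p t *s m t \<sigma>) \<in> E"
          using m_chain by (auto simp: chain_def intro!: E_intros)
        then show ?thesis unfolding bin
          by (rule coord_zeroD) (simp add: coord_sum coord_scale p(2) j)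
      next
        case False
        then have "m t \<sigma> = 0" if "t \<le> N" for t
          using m_chain[OF that] unit_exponent[OF J, of \<sigma>] unfolding chain_def \<epsilon>_def by metis
        then show ?thesis unfolding bin by simp
      qed
      then have "binary j1 j2 N P z = 0" by (simp add: fun_eq_iff)
      \<comment> \<open>Zero is a boundary, and cancelling the factors of the form turns this into a
        statement about \<open>z\<close> itself.\<close>
      then have "boundary J \<Delta> 1 (binary j1 j2 N P z)"
        using c by (auto simp: boundary_def bd_zero intro!: exI[of _ 0])
      from boundary_if_binary_boundary[OF r1 r2 c 3(3) \<open>P \<noteq> 0\<close> degP z(1) this]
      have "boundary J \<Delta> (1 + N) z" .
      then obtain w where w: "chain J (Suc (1 + N)) w" "bd J \<Delta> w = z" by (auto simp: boundary_def)
      \<comment> \<open>The way back to \<open>v\<close>: contraction with a power of x_j2 keeps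
        boundaries.\<close>
      have "boundary J \<Delta> 1 (\<lambda>\<sigma>. z (\<sigma>(j2 := \<sigma> j2 + n)))" if "boundary J \<Delta> (1 + n) z" for n z
        using that
      proof (induction n arbitrary: z)
        case (Suc n)
        then obtain w where w: "chain J (Suc (Suc (1 + n))) w" "bd J \<Delta> w = z" by (auto simp: boundary_def)
        have "boundary J \<Delta> (1 + n) (shift j2 z)"
          using chain_shift[OF J 3(2) w(1)] bd_shift[of j2 J \<Delta> w] w(2) by (auto simp: boundary_def)
        moreover have "shift j2 z (\<sigma>(j2 := \<sigma> j2 + n)) = z (\<sigma>(j2 := \<sigma> j2 + Suc n))" for \<sigma>
          by (simp add: shift_def)
        ultimately show ?case using Suc.IH[of "shift j2 z"] by (simp only:)
      qed auto
      with \<open>boundary J \<Delta> (1 + N) z\<close> z(2) show ?thesis by metis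
    qed
    have "boundary J \<Delta> (Suc n) v" if "cycle J \<Delta> (Suc n) v" for n v
      using that
    proof (induction n arbitrary: v)
      case 0 then show ?case using deg1 by simp
    next
      case (Suc n)
      then have "boundary J \<Delta> (Suc n) (shift j2 v)"
        using cycle_regular_form[OF r2] by blast
      then show ?case using regular_form_inj[OF r2 c Suc.prems] by blast
    qed
    with less.prems(4,5) show ?thesis by (cases d) auto
  qed
qed

end

section \<open>Koszul complexes in two blocks of variables\<close>

definition fscale :: "'a::times \<Rightarrow> ('i \<Rightarrow> 'a) \<Rightarrow> 'i \<Rightarrow> 'a" where
  "fscale c e = (\<lambda>t. c * e t)"

lemma fscale_apply [simp]: "fscale c e t = c * e t"
  by (simp add: fscale_def)

lemma sum_fun_apply: "(\<Sum>x\<in>A. g x) t = (\<Sum>x\<in>A. g x t)"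
  for g :: "'x \<Rightarrow> 'i \<Rightarrow> 'a::comm_monoid_add"
  by (induction A rule: infinite_finite_induct) simp_all

interpretation fscale: vector_space "fscale :: 'a::field \<Rightarrow> ('i \<Rightarrow> 'a) \<Rightarrow> 'i \<Rightarrow> 'a"
  by unfold_locales (simp_all add: fun_eq_iff algebra_simps)

type_synonym fiber_index = "(nat \<Rightarrow>\<^sub>0 nat) \<times> (nat \<Rightarrow>\<^sub>0 nat) \<times> nat set"

definition linop :: "(('i \<Rightarrow> 'a::field) \<Rightarrow> 'i \<Rightarrow> 'a) \<Rightarrow> bool" where
  "linop F \<longleftrightarrow> (\<forall>u w. F (u + w) = F u + F w) \<and> (\<forall>c u. F (fscale c u) = fscale c (F u))"

lemma linop_simps:
  assumes "linop F"
  shows "F (u + w) = F u + F w" "F (fscale c u) = fscale c (F u)" "F 0 = 0"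
    "F (sum g A) = (\<Sum>x\<in>A. F (g x))" "F (u - w) = F u - F w"
proof -
  show add: "F (u + w) = F u + F w" for u w using assms by (simp add: linop_def)
  show "F (fscale c u) = fscale c (F u)" using assms by (simp add: linop_def)
  show zero: "F 0 = 0" using add[of 0 0] by simp
  show "F (sum g A) = (\<Sum>x\<in>A. F (g x))"
    by (induction A rule: infinite_finite_induct)
      (simp_all add: zero add del: plus_fun_apply zero_fun_apply)
  show "F (u - w) = F u - F w" using add[of "u - w" w] by (simp add: algebra_simps del: plus_fun_apply minus_apply)
qed

text \<open>The sign \<open>(-1)\<^bsup>i-1\<^esup>\<close> of \<open>\<delta>\<^sub>1\<close>, expressed by the removed index instead of its position.\<close>

definition wsgn :: "nat \<Rightarrow> nat set \<Rightarrow> 'a::comm_ring_1" where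
  "wsgn i I = (- 1) ^ card {j \<in> I. j < i}"

lemma wsgn_insert: "k \<notin> I \<Longrightarrow> wsgn i (insert k I) = (if k < i then - wsgn i I else wsgn i I)"
proof -
  assume k: "k \<notin> I"
  have "{j \<in> insert k I. j < i} = (if k < i then insert k {j \<in> I. j < i} else {j \<in> I. j < i})" by auto
  with k show ?thesis by (simp add: wsgn_def)
qed

lemma wsgn_remove:
  assumes "k \<in> I"
  shows "wsgn i (I - {k}) = (if k < i then - wsgn i I else wsgn i I :: 'a::comm_ring_1)"
proof -
  have "(wsgn i (insert k (I - {k})) :: 'a) = (if k < i then - wsgn i (I - {k}) else wsgn i (I - {k}))"
    by (rule wsgn_insert) simp
  with assms show ?thesis by (simp add: insert_absorb split: if_splits)
qed

lemma wsgn_square [simp]: "wsgn i I * wsgn i I = 1"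
  by (simp add: wsgn_def flip: power_add mult_2)

lemma wsgn_nonzero [simp]: "wsgn i I \<noteq> (0 :: 'a::{comm_ring_1, zero_neq_one, ring_1_no_zero_divisors})"
  by (simp add: wsgn_def)

text \<open>Interior product with the i-th dual basis vector, in terms of coefficients: the value at
  \<open>I\<close> comes from \<open>I\<close> with i inserted. Dually, \<open>eps\<close> is
  exterior multiplication by e_i.\<close>

definition iota :: "nat \<Rightarrow> (fiber_index \<Rightarrow> 'a::comm_ring_1) \<Rightarrow> fiber_index \<Rightarrow> 'a" where
  "iota i e = (\<lambda>(\<tau>, \<nu>, I). if i \<in> I then 0 else wsgn i I * e (\<tau>, \<nu>, insert i I))"

definition eps :: "nat \<Rightarrow> (fiber_index \<Rightarrow> 'a::comm_ring_1) \<Rightarrow> fiber_index \<Rightarrow> 'a" where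
  "eps i e = (\<lambda>(\<tau>, \<nu>, I). if i \<in> I then wsgn i I * e (\<tau>, \<nu>, I - {i}) else 0)"

definition contract_y :: "nat \<Rightarrow> (fiber_index \<Rightarrow> 'a::zero) \<Rightarrow> fiber_index \<Rightarrow> 'a" where
  "contract_y k e = (\<lambda>(\<tau>, \<nu>, I). e (\<tau> + Poly_Mapping.single k 1, \<nu>, I))"

definition times_z :: "nat \<Rightarrow> (fiber_index \<Rightarrow> 'a::zero) \<Rightarrow> fiber_index \<Rightarrow> 'a" where
  "times_z k e = (\<lambda>(\<tau>, \<nu>, I). if lookup \<nu> k = 0 then 0 else e (\<tau>, \<nu> - Poly_Mapping.single k 1, I))"

text \<open>One index type for both blocks: \<open>Inl k\<close> is y_k acting by contraction,
  \<open>Inr k\<close> is z_k acting by multiplication.\<close>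

definition var_op :: "nat + nat \<Rightarrow> (fiber_index \<Rightarrow> 'a::zero) \<Rightarrow> fiber_index \<Rightarrow> 'a" where
  "var_op \<kappa> = (case \<kappa> of Inl k \<Rightarrow> contract_y k | Inr k \<Rightarrow> times_z k)"

lemma linop_ops: "linop (iota i)" "linop (eps i)" "linop (contract_y k)" "linop (times_z k)" "linop (var_op \<kappa>)"
  by (auto simp: linop_def iota_def eps_def contract_y_def times_z_def var_op_def fun_eq_iff
      algebra_simps split: sum.splits)

lemma iota_iota: "iota i (iota k e) + iota k (iota i e) = 0"
proof -
  have "iota i (iota k e) (\<tau>, \<nu>, I) + iota k (iota i e) (\<tau>, \<nu>, I) = 0" for \<tau> \<nu> I
    by (cases "i < k"; cases "i = k") (auto simp: iota_def wsgn_insert insert_commute)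
  then show ?thesis by (simp add: fun_eq_iff)
qed

text \<open>The canonical anticommutation relation between exterior and interior multiplication,
  from which the homotopies below are built.\<close>

lemma eps_iota: "eps i (iota k e) + iota k (eps i e) = (if i = k then e else 0)"
proof -
  have "eps i (iota k e) (\<tau>, \<nu>, I) + iota k (eps i e) (\<tau>, \<nu>, I) = (if i = k then e else 0) (\<tau>, \<nu>, I)" for \<tau> \<nu> I
  proof (cases "i = k")
    case True
    have "wsgn k I * (wsgn k I * x) = x" for x :: 'a by (simp flip: mult.assoc)
    with True show ?thesis
      by (auto simp: iota_def eps_def wsgn_insert wsgn_remove insert_absorb)
  next
    case False
    then show ?thesis
      by (cases "i < k") (auto simp: iota_def eps_def wsgn_insert wsgn_remove insert_Diff_if)
  qed
  then show ?thesis by (simp add: fun_eq_iff)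
qed

lemma var_op_commute: "var_op \<kappa> (iota i e) = iota i (var_op \<kappa> e)" "var_op \<kappa> (eps i e) = eps i (var_op \<kappa> e)"
  "var_op \<kappa> (var_op \<mu> e) = var_op \<mu> (var_op \<kappa> e)"
proof -
  show "var_op \<kappa> (iota i e) = iota i (var_op \<kappa> e)" "var_op \<kappa> (eps i e) = eps i (var_op \<kappa> e)"
    by (auto simp: var_op_def iota_def eps_def contract_y_def times_z_def fun_eq_iff split: sum.splits)
  have "times_z k (times_z l e) (\<tau>, \<nu>, I) = times_z l (times_z k e) (\<tau>, \<nu>, I)" for k l \<tau> \<nu> I
  proof -
    have "\<nu> - Poly_Mapping.single k 1 - Poly_Mapping.single l 1 =
        \<nu> - Poly_Mapping.single l 1 - Poly_Mapping.single k (1::nat)"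
      by (rule poly_mapping_eqI) (simp add: lookup_minus)
    then show ?thesis
      by (cases "k = l") (auto simp: times_z_def lookup_minus lookup_single)
  qed
  then have "times_z k (times_z l e) = times_z l (times_z k e)" for k l by (simp add: fun_eq_iff)
  then show "var_op \<kappa> (var_op \<mu> e) = var_op \<mu> (var_op \<kappa> e)"
    by (auto simp: var_op_def contract_y_def fun_eq_iff add_ac split: sum.splits)
      (auto simp: times_z_def)
qed

text \<open>The Koszul differential \<Sum> f_i \<iota>_i of linear forms f_i, as a sum over pairs of
  a form and a variable; \<open>c (i, \<kappa>)\<close> is the coefficient of the variable \<kappa>
  in f_i.\<close>

definition kdiff :: "(nat \<times> (nat + nat)) set \<Rightarrow> (nat \<times> (nat + nat) \<Rightarrow> 'a::field) \<Rightarrow>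
    (fiber_index \<Rightarrow> 'a) \<Rightarrow> fiber_index \<Rightarrow> 'a" where
  "kdiff P c e = (\<Sum>p\<in>P. fscale (c p) (var_op (snd p) (iota (fst p) e)))"

lemma linop_kdiff: "linop (kdiff P c)"
  unfolding linop_def kdiff_def
  by (simp add: linop_simps[OF linop_ops(1)] linop_simps[OF linop_ops(5)] sum.distrib
      fscale.scale_right_distrib fscale.scale_sum_right mult.commute)

text \<open>Two coefficient families are allowed because the coefficients of the individual x_j must
  anticommute with one another, not just square to zero.\<close>

lemma kdiff_anticommute: "kdiff P c (kdiff P c' e) + kdiff P c' (kdiff P c e) = 0"
proof -
  have *: "kdiff P c (kdiff P c' e) =
      (\<Sum>p\<in>P. \<Sum>p'\<in>P. fscale (c p * c' p') (var_op (snd p) (var_op (snd p') (iota (fst p) (iota (fst p') e)))))"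
    for c c' by (simp add: kdiff_def linop_simps[OF linop_ops(1)] linop_simps[OF linop_ops(5)]
        fscale.scale_sum_right var_op_commute(1))
  have "kdiff P c' (kdiff P c e) =
      (\<Sum>p\<in>P. \<Sum>p'\<in>P. fscale (c' p' * c p) (var_op (snd p') (var_op (snd p) (iota (fst p') (iota (fst p) e)))))"
    unfolding * by (rule sum.swap)
  also have "\<dots> = (\<Sum>p\<in>P. \<Sum>p'\<in>P. fscale (c p * c' p') (var_op (snd p) (var_op (snd p') (iota (fst p') (iota (fst p) e)))))"
    by (intro sum.cong refl) (simp add: mult.commute var_op_commute(3))
  finally have "kdiff P c (kdiff P c' e) + kdiff P c' (kdiff P c e) =
      (\<Sum>p\<in>P. \<Sum>p'\<in>P. fscale (c p * c' p') (var_op (snd p) (var_op (snd p')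
        (iota (fst p) (iota (fst p') e) + iota (fst p') (iota (fst p) e)))))"
    by (simp add: * linop_simps[OF linop_ops(5)] fscale.scale_right_distrib sum.distrib)
  then show ?thesis by (simp only: iota_iota linop_simps(3)[OF linop_ops(5)] fscale.scale_zero_right) simp
qed

lemma kdiff_kdiff: "kdiff P c (kdiff P c e) = (0 :: fiber_index \<Rightarrow> 'a::field_char_0)"
proof -
  have "kdiff P c (kdiff P c e) t + kdiff P c (kdiff P c e) t = 0" for t
    using kdiff_anticommute[of P c c e] by (metis plus_fun_apply zero_fun_apply)
  then have "2 * kdiff P c (kdiff P c e) t = 0" for t by (simp only: mult_2)
  then show ?thesis by (simp add: fun_eq_iff)
qed

definition eps_sum :: "nat set \<Rightarrow> (nat \<Rightarrow> 'a::field) \<Rightarrow> (fiber_index \<Rightarrow> 'a) \<Rightarrow> fiber_index \<Rightarrow> 'a" where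
  "eps_sum V \<gamma> e = (\<Sum>i\<in>V. fscale (\<gamma> i) (eps i e))"

lemma linop_eps_sum: "linop (eps_sum V \<gamma>)"
  unfolding linop_def eps_sum_def
  by (simp add: linop_simps[OF linop_ops(2)] sum.distrib
      fscale.scale_right_distrib fscale.scale_sum_right mult.commute)

text \<open>Cartan's formula: the anticommutator of the differential with exterior multiplication by
  \<Sum>\<gamma>_i e_i is the action of the form \<Sum>\<gamma>_i f_i, restricted to indices in
  \<open>V\<close>.\<close>

lemma eps_sum_homotopy:
  assumes "finite V"
  shows "eps_sum V \<gamma> (kdiff P c e) + kdiff P c (eps_sum V \<gamma> e) =
    (\<Sum>p\<in>P. if fst p \<in> V then fscale (\<gamma> (fst p) * c p) (var_op (snd p) e) else 0)"
proof -
  have "eps_sum V \<gamma> (kdiff P c e) = (\<Sum>i\<in>V. \<Sum>p\<in>P. fscale (\<gamma> i * c p) (var_op (snd p) (eps i (iota (fst p) e))))"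
    by (simp add: eps_sum_def kdiff_def linop_simps[OF linop_ops(2)] fscale.scale_sum_right var_op_commute(2))
  also have "\<dots> = (\<Sum>p\<in>P. \<Sum>i\<in>V. fscale (\<gamma> i * c p) (var_op (snd p) (eps i (iota (fst p) e))))"
    by (rule sum.swap)
  finally have "eps_sum V \<gamma> (kdiff P c e) + kdiff P c (eps_sum V \<gamma> e) =
      (\<Sum>p\<in>P. \<Sum>i\<in>V. fscale (\<gamma> i * c p) (var_op (snd p) (eps i (iota (fst p) e) + iota (fst p) (eps i e))))"
    by (simp add: eps_sum_def kdiff_def linop_simps[OF linop_ops(1)] linop_simps[OF linop_ops(5)]
        fscale.scale_sum_right fscale.scale_right_distrib sum.distrib mult.commute)
  also have "\<dots> = (\<Sum>p\<in>P. \<Sum>i\<in>V. if i = fst p then fscale (\<gamma> (fst p) * c p) (var_op (snd p) e) else 0)"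
    by (intro sum.cong refl) (simp add: eps_iota linop_simps[OF linop_ops(5)])
  also have "\<dots> = (\<Sum>p\<in>P. if fst p \<in> V then fscale (\<gamma> (fst p) * c p) (var_op (snd p) e) else 0)"
    using assms by simp
  finally show ?thesis .
qed

section \<open>Degrees and the finite-dimensional strands of the Koszul complex\<close>

definition deg :: "(nat \<Rightarrow>\<^sub>0 nat) \<Rightarrow> nat" where
  "deg \<tau> = (\<Sum>i\<in>keys \<tau>. lookup \<tau> i)"

lemma deg_eq_sum: "finite A \<Longrightarrow> keys \<tau> \<subseteq> A \<Longrightarrow> deg \<tau> = (\<Sum>i\<in>A. lookup \<tau> i)"
  unfolding deg_def by (intro sum.mono_neutral_left) (auto simp: in_keys_iff)

lemma keys_add_nat: "keys (\<sigma> + \<tau>) = keys \<sigma> \<union> keys (\<tau> :: nat \<Rightarrow>\<^sub>0 nat)"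
  by (auto simp: in_keys_iff lookup_add)

lemma deg_add: "deg (\<sigma> + \<tau>) = deg \<sigma> + deg \<tau>"
proof -
  let ?A = "keys \<sigma> \<union> keys \<tau>"
  have "deg \<rho> = (\<Sum>i\<in>?A. lookup \<rho> i)" if "keys \<rho> \<subseteq> ?A" for \<rho>
    using that by (intro deg_eq_sum) auto
  then show ?thesis by (simp add: keys_add_nat lookup_add sum.distrib)
qed

lemma deg_single [simp]: "deg (Poly_Mapping.single k d) = d"
  by (cases "d = 0") (simp_all add: deg_def)

lemma deg_zero [simp]: "deg 0 = 0"
  by (simp add: deg_def)

lemma deg_eq_0_iff: "deg \<tau> = 0 \<longleftrightarrow> \<tau> = 0"
proof
  assume "deg \<tau> = 0"
  then have "\<forall>i\<in>keys \<tau>. lookup \<tau> i = 0" by (simp add: deg_def)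
  then show "\<tau> = 0" by (intro poly_mapping_eqI) (auto simp: in_keys_iff)
qed simp

lemma minus_single_add: "lookup \<nu> k \<noteq> 0 \<Longrightarrow> \<nu> - Poly_Mapping.single k 1 + Poly_Mapping.single k 1 = (\<nu> :: nat \<Rightarrow>\<^sub>0 nat)"
  by (rule poly_mapping_eqI) (auto simp: lookup_add lookup_minus lookup_single when_def)

lemma finite_deg_le:
  assumes "finite Y"
  shows "finite {\<tau>. keys \<tau> \<subseteq> Y \<and> deg \<tau> \<le> n}" (is "finite ?M")
proof (rule finite_imageD)
  have "(\<lambda>\<tau>. restrict (lookup \<tau>) Y) ` ?M \<subseteq> Y \<rightarrow>\<^sub>E {..n}"
  proof (clarsimp simp: PiE_iff extensional_def)
    fix \<tau> k assume "keys \<tau> \<subseteq> Y" "deg \<tau> \<le> n" "k \<in> Y"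
    moreover then have "lookup \<tau> k \<le> deg \<tau>"
      using assms by (simp add: deg_eq_sum member_le_sum)
    ultimately show "lookup \<tau> k \<le> n" by simp
  qed
  then show "finite ((\<lambda>\<tau>. restrict (lookup \<tau>) Y) ` ?M)"
    using assms by (meson finite_PiE finite_atMost finite_subset)
  show "inj_on (\<lambda>\<tau>. restrict (lookup \<tau>) Y) ?M"
  proof (rule inj_onI, rule poly_mapping_eqI)
    fix \<sigma> \<tau> k assume *: "\<sigma> \<in> ?M" "\<tau> \<in> ?M" "restrict (lookup \<sigma>) Y = restrict (lookup \<tau>) Y"
    show "lookup \<sigma> k = lookup \<tau> k"
    proof (cases "k \<in> Y")
      case True then show ?thesis using *(3) by (metis restrict_apply)
    next
      case False
      with * have "k \<notin> keys \<sigma>" "k \<notin> keys \<tau>" by auto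
      then show ?thesis by (simp add: in_keys_iff)
    qed
  qed
qed

text \<open>The label \<open>(\<tau>, \<nu>, I)\<close> stands for \<open>\<partial>y\<^sup>\<tau> \<otimes> z\<^sup>\<nu> \<otimes> e\<^sub>I\<close>; the strand is stable under \<open>kdiff\<close>, which lowers
  \<open>\<tau>\<close> along \<open>U\<close> and raises \<open>\<nu>\<close> along \<open>W\<close>.\<close>

definition strand :: "nat set \<Rightarrow> nat set \<Rightarrow> nat set \<Rightarrow> nat set \<Rightarrow> nat \<Rightarrow> nat \<Rightarrow> fiber_index set" where
  "strand U W Y Z q b = {(\<tau>, \<nu>, I). keys \<tau> \<subseteq> Y \<and> keys \<nu> \<subseteq> Z \<and> I \<subseteq> U \<union> W \<and>
     deg \<tau> + card U = q + card (I \<inter> U) \<and> deg \<nu> + card (I \<inter> W) = b}"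

lemma finite_strand:
  assumes "finite U" "finite W" "finite Y" "finite Z"
  shows "finite (strand U W Y Z q b)"
proof (rule finite_subset)
  show "strand U W Y Z q b \<subseteq> {\<tau>. keys \<tau> \<subseteq> Y \<and> deg \<tau> \<le> q} \<times>
      {\<nu>. keys \<nu> \<subseteq> Z \<and> deg \<nu> \<le> b} \<times> Pow (U \<union> W)"
  proof (clarsimp simp: strand_def)
    fix \<tau> I assume "deg \<tau> + card U = q + card (I \<inter> U)"
    moreover have "card (I \<inter> U) \<le> card U" using assms by (intro card_mono) auto
    ultimately show "deg \<tau> \<le> q" by simp
  qed
  show "finite ({\<tau>. keys \<tau> \<subseteq> Y \<and> deg \<tau> \<le> q} \<times>
      {\<nu>. keys \<nu> \<subseteq> Z \<and> deg \<nu> \<le> b} \<times> Pow (U \<union> W))"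
    using assms by (intro finite_cartesian_product finite_deg_le) auto
qed

definition supp_in :: "fiber_index set \<Rightarrow> (fiber_index \<Rightarrow> 'a::zero) \<Rightarrow> bool" where
  "supp_in T e \<longleftrightarrow> (\<forall>t. e t \<noteq> 0 \<longrightarrow> t \<in> T)"

lemma supp_in_intros:
  fixes e e' :: "fiber_index \<Rightarrow> 'a::field"
  shows "supp_in T (0 :: fiber_index \<Rightarrow> 'a)" "supp_in T e \<Longrightarrow> supp_in T e' \<Longrightarrow> supp_in T (e + e')"
    "supp_in T e \<Longrightarrow> supp_in T e' \<Longrightarrow> supp_in T (e - e')"
    "supp_in T e \<Longrightarrow> supp_in T (fscale c e)"
    "(\<And>x. x \<in> A \<Longrightarrow> supp_in T (g x)) \<Longrightarrow> supp_in T (\<Sum>x\<in>A. g x :: fiber_index \<Rightarrow> 'a)"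
proof -
  show add: "supp_in T e \<Longrightarrow> supp_in T e' \<Longrightarrow> supp_in T (e + e')" for e e' :: "fiber_index \<Rightarrow> 'a"
    unfolding supp_in_def by (metis add.right_neutral plus_fun_apply)
  show z: "supp_in T (0 :: fiber_index \<Rightarrow> 'a)" by (simp add: supp_in_def)
  show "supp_in T e \<Longrightarrow> supp_in T e' \<Longrightarrow> supp_in T (e - e')"
    unfolding supp_in_def by (metis diff_zero minus_apply)
  show "supp_in T e \<Longrightarrow> supp_in T (fscale c e)" by (auto simp: supp_in_def)
  show "(\<And>x. x \<in> A \<Longrightarrow> supp_in T (g x)) \<Longrightarrow> supp_in T (\<Sum>x\<in>A. g x :: fiber_index \<Rightarrow> 'a)"
    by (induction A rule: infinite_finite_induct) (auto intro: z add)
qed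

text \<open>Once x is fixed, the forms indexed by \<open>U\<close> involve only y and those indexed
  by \<open>W\<close> only z.\<close>

definition pairs :: "nat set \<Rightarrow> nat set \<Rightarrow> nat set \<Rightarrow> nat set \<Rightarrow> (nat \<times> (nat + nat)) set" where
  "pairs U W Y Z = U \<times> Inl ` Y \<union> W \<times> Inr ` Z"

lemma card_insert_Int: "finite U \<Longrightarrow> i \<notin> I \<Longrightarrow> card (insert i I \<inter> U) = (if i \<in> U then Suc (card (I \<inter> U)) else card (I \<inter> U))"
  by auto

lemma supp_kdiff:
  assumes "finite U" "finite W" "U \<inter> W = {}" "supp_in (strand U W Y Z q b) e"
  shows "supp_in (strand U W Y Z q b) (kdiff (pairs U W Y Z) c e)"
  unfolding kdiff_def
proof (intro supp_in_intros)
  fix p assume p: "p \<in> pairs U W Y Z"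
  show "supp_in (strand U W Y Z q b) (var_op (snd p) (iota (fst p) e))"
    unfolding supp_in_def
  proof (safe)
    fix \<tau> \<nu> I assume nz: "var_op (snd p) (iota (fst p) e) (\<tau>, \<nu>, I) \<noteq> 0"
    define i where "i = fst p"
    from p have "(\<exists>k. i \<in> U \<and> i \<notin> W \<and> k \<in> Y \<and> snd p = Inl k) \<or> (\<exists>k. i \<in> W \<and> i \<notin> U \<and> k \<in> Z \<and> snd p = Inr k)"
      using assms(3) by (auto simp: pairs_def i_def)
    then consider (y) k where "i \<in> U" "i \<notin> W" "k \<in> Y" "snd p = Inl k" | (z) k where "i \<in> W" "i \<notin> U" "k \<in> Z" "snd p = Inr k"
      by blast
    then show "(\<tau>, \<nu>, I) \<in> strand U W Y Z q b"
    proof cases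
      case y
      with nz have *: "i \<notin> I" "e (\<tau> + Poly_Mapping.single k 1, \<nu>, insert i I) \<noteq> 0"
        by (auto simp: var_op_def contract_y_def iota_def i_def split: if_splits)
      with assms(4) have "(\<tau> + Poly_Mapping.single k 1, \<nu>, insert i I) \<in> strand U W Y Z q b"
        unfolding supp_in_def by blast
      with y *(1) assms(1,2) show ?thesis
        by (auto simp: strand_def keys_add_nat deg_add card_insert_Int)
    next
      case z
      with nz have *: "i \<notin> I" "lookup \<nu> k \<noteq> 0" "e (\<tau>, \<nu> - Poly_Mapping.single k 1, insert i I) \<noteq> 0"
        by (auto simp: var_op_def times_z_def iota_def i_def split: if_splits)
      define \<mu> where "\<mu> = \<nu> - Poly_Mapping.single k 1"
      have \<nu>: "\<nu> = \<mu> + Poly_Mapping.single k 1" using minus_single_add[OF *(2)] by (simp add: \<mu>_def)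
      from * assms(4) have "(\<tau>, \<mu>, insert i I) \<in> strand U W Y Z q b"
        unfolding supp_in_def \<mu>_def by blast
      with z *(1) assms(1,2) show ?thesis
        by (auto simp: strand_def keys_add_nat deg_add card_insert_Int \<nu>)
    qed
  qed
qed

section \<open>Homotopies for a single variable of y or z\<close>

lemma sum_pairs_fst:
  fixes e :: "fiber_index \<Rightarrow> 'a::field"
  assumes "finite U" "finite W" "finite Y" "finite Z" "U \<inter> W = {}"
  shows "(\<Sum>p\<in>pairs U W Y Z. if fst p \<in> U then fscale (\<gamma> (fst p) * c p) (var_op (snd p) e) else 0) =
      (\<Sum>\<kappa>\<in>Inl ` Y. fscale (\<Sum>i\<in>U. \<gamma> i * c (i, \<kappa>)) (var_op \<kappa> e))" (is ?y)
    and "(\<Sum>p\<in>pairs U W Y Z. if fst p \<in> W then fscale (\<gamma> (fst p) * c p) (var_op (snd p) e) else 0) =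
      (\<Sum>\<kappa>\<in>Inr ` Z. fscale (\<Sum>i\<in>W. \<gamma> i * c (i, \<kappa>)) (var_op \<kappa> e))" (is ?z)
proof -
  have fin: "finite (pairs U W Y Z)" using assms by (auto simp: pairs_def)
  have *: "(\<Sum>p\<in>S \<times> K. fscale (\<gamma> (fst p) * c p) (var_op (snd p) e)) =
      (\<Sum>\<kappa>\<in>K. fscale (\<Sum>i\<in>S. \<gamma> i * c (i, \<kappa>)) (var_op \<kappa> e))" for S K
    by (simp add: sum.cartesian_product' sum.swap[of _ S] fscale.scale_sum_left del: sum.cartesian_product)
  have "{p \<in> pairs U W Y Z. fst p \<in> U} = U \<times> Inl ` Y" "{p \<in> pairs U W Y Z. fst p \<in> W} = W \<times> Inr ` Z"
    using assms(5) by (auto simp: pairs_def)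
  with fin show ?y ?z by (simp_all only: sum.inter_filter[symmetric] *)
qed

text \<open>When \<gamma> combines the forms of \<open>U\<close> to the variable y_k0, contraction
  with y_k0 is homotopic to zero.\<close>

lemma eps_sum_homotopy_y:
  assumes "finite U" "finite W" "finite Y" "finite Z" "U \<inter> W = {}" "k0 \<in> Y"
    and "\<And>k. k \<in> Y \<Longrightarrow> (\<Sum>i\<in>U. \<gamma> i * c (i, Inl k)) = (if k = k0 then 1 else 0)"
  shows "eps_sum U \<gamma> (kdiff (pairs U W Y Z) c e) + kdiff (pairs U W Y Z) c (eps_sum U \<gamma> e) = contract_y k0 e"
proof -
  have "(\<Sum>\<kappa>\<in>Inl ` Y. fscale (\<Sum>i\<in>U. \<gamma> i * c (i, \<kappa>)) (var_op \<kappa> e)) =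
      (\<Sum>\<kappa>\<in>Inl ` Y. if \<kappa> = Inl k0 then var_op \<kappa> e else 0)"
    using assms(7) by (intro sum.cong refl) auto
  also have "\<dots> = contract_y k0 e" using assms by (simp add: var_op_def)
  finally show ?thesis
    by (simp only: eps_sum_homotopy[OF assms(1)] sum_pairs_fst(1)[OF assms(1-5)])
qed

lemma eps_sum_homotopy_z:
  assumes "finite U" "finite W" "finite Y" "finite Z" "U \<inter> W = {}" "k0 \<in> Z"
    and "\<And>k. k \<in> Z \<Longrightarrow> (\<Sum>i\<in>W. \<gamma> i * c (i, Inr k)) = (if k = k0 then 1 else 0)"
  shows "eps_sum W \<gamma> (kdiff (pairs U W Y Z) c e) + kdiff (pairs U W Y Z) c (eps_sum W \<gamma> e) = times_z k0 e"
proof -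
  have "(\<Sum>\<kappa>\<in>Inr ` Z. fscale (\<Sum>i\<in>W. \<gamma> i * c (i, \<kappa>)) (var_op \<kappa> e)) =
      (\<Sum>\<kappa>\<in>Inr ` Z. if \<kappa> = Inr k0 then var_op \<kappa> e else 0)"
    using assms(7) by (intro sum.cong refl) auto
  also have "\<dots> = times_z k0 e" using assms by (simp add: var_op_def)
  finally show ?thesis
    by (simp only: eps_sum_homotopy[OF assms(2)] sum_pairs_fst(2)[OF assms(1-5)])
qed

lemma kdiff_var_op: "kdiff P c (var_op \<kappa> e) = var_op \<kappa> (kdiff P c e)"
  by (simp add: kdiff_def linop_simps[OF linop_ops(5)] flip: var_op_commute)

lemma kdiff_contract_y: "kdiff P c (contract_y k e) = contract_y k (kdiff P c e)"
  and kdiff_times_z: "kdiff P c (times_z k e) = times_z k (kdiff P c e)"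
  using kdiff_var_op[of P c "Inl k" e] kdiff_var_op[of P c "Inr k" e] by (simp_all add: var_op_def)

lemma kdiff_pairs_insert_y:
  assumes "finite U" "finite W" "finite Y" "finite Z" "k0 \<notin> Y" "contract_y k0 e = 0"
  shows "kdiff (pairs U W (insert k0 Y) Z) c e = kdiff (pairs U W Y Z) c e"
proof -
  have fin: "finite (pairs U W (insert k0 Y) Z)" using assms by (auto simp: pairs_def)
  show ?thesis unfolding kdiff_def
  proof (rule sum.mono_neutral_right[OF fin])
    show "\<forall>p\<in>pairs U W (insert k0 Y) Z - pairs U W Y Z. fscale (c p) (var_op (snd p) (iota (fst p) e)) = 0"
    proof
      fix p assume "p \<in> pairs U W (insert k0 Y) Z - pairs U W Y Z"
      then have "snd p = Inl k0" by (auto simp: pairs_def)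
      then have "var_op (snd p) (iota (fst p) e) = iota (fst p) (contract_y k0 e)"
        by (simp only: var_op_commute) (simp add: var_op_def)
      then show "fscale (c p) (var_op (snd p) (iota (fst p) e)) = 0"
        by (simp only: assms(6) linop_simps(3)[OF linop_ops(1)] fscale.scale_zero_right)
    qed
  qed (auto simp: pairs_def)
qed

text \<open>In contrast to y, the differential of an element free of z_k0 may contain z_k0; these
  terms have to be carried along.\<close>

lemma kdiff_pairs_insert_z:
  assumes "finite U" "finite W" "finite Y" "finite Z" "k0 \<notin> Z" "U \<inter> W = {}"
  shows "kdiff (pairs U W Y (insert k0 Z)) c e =
    kdiff (pairs U W Y Z) c e + times_z k0 (\<Sum>i\<in>W. fscale (c (i, Inr k0)) (iota i e))"
proof -
  have un: "pairs U W Y (insert k0 Z) = pairs U W Y Z \<union> W \<times> {Inr k0}" by (auto simp: pairs_def)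
  have fin: "finite (pairs U W Y Z)" using assms by (auto simp: pairs_def)
  have "kdiff (pairs U W Y (insert k0 Z)) c e = kdiff (pairs U W Y Z) c e +
      (\<Sum>p\<in>W \<times> {Inr k0}. fscale (c p) (var_op (snd p) (iota (fst p) e)))"
    unfolding kdiff_def un using fin assms by (intro sum.union_disjoint) (auto simp: pairs_def)
  also have "(\<Sum>p\<in>W \<times> {Inr k0}. fscale (c p) (var_op (snd p) (iota (fst p) e))) =
      times_z k0 (\<Sum>i\<in>W. fscale (c (i, Inr k0)) (iota i e))"
    by (simp add: sum.cartesian_product' linop_simps[OF linop_ops(4)] var_op_def del: sum.cartesian_product)
  finally show ?thesis .
qed

text \<open>Inserting an index of \<open>U\<close> at fixed \<tau> lowers the parameter of the
  strand by one, which undoes the increase made by lifting along y_k0.\<close>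

lemma supp_eps_sum_y:
  assumes "finite U" "finite W" "U \<inter> W = {}" "supp_in (strand U W Y Z (Suc q) b) e"
  shows "supp_in (strand U W Y Z q b) (eps_sum U \<gamma> e)"
  unfolding eps_sum_def
proof (intro supp_in_intros)
  fix i assume i: "i \<in> U"
  show "supp_in (strand U W Y Z q b) (eps i e)"
    unfolding supp_in_def
  proof safe
    fix \<tau> \<nu> I assume "eps i e (\<tau>, \<nu>, I) \<noteq> 0"
    then have iI: "i \<in> I" and "e (\<tau>, \<nu>, I - {i}) \<noteq> 0" by (auto simp: eps_def split: if_splits)
    then have *: "(\<tau>, \<nu>, I - {i}) \<in> strand U W Y Z (Suc q) b" using assms(4) unfolding supp_in_def by blast
    define K where "K = I - {i}"
    have I: "I = insert i K" "i \<notin> K" using iI by (auto simp: K_def)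
    have "i \<notin> W" using i assms by auto
    with * i show "(\<tau>, \<nu>, I) \<in> strand U W Y Z q b"
      unfolding K_def[symmetric] I(1) using I(2) assms(1,2) by (auto simp: strand_def card_insert_Int)
  qed
qed

lemma supp_eps_sum_z:
  assumes "finite U" "finite W" "U \<inter> W = {}" "supp_in (strand U W Y Z q b) e"
  shows "supp_in (strand U W Y Z q (Suc b)) (eps_sum W \<gamma> e)"
  unfolding eps_sum_def
proof (intro supp_in_intros)
  fix i assume i: "i \<in> W"
  show "supp_in (strand U W Y Z q (Suc b)) (eps i e)"
    unfolding supp_in_def
  proof safe
    fix \<tau> \<nu> I assume "eps i e (\<tau>, \<nu>, I) \<noteq> 0"
    then have iI: "i \<in> I" and "e (\<tau>, \<nu>, I - {i}) \<noteq> 0" by (auto simp: eps_def split: if_splits)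
    then have *: "(\<tau>, \<nu>, I - {i}) \<in> strand U W Y Z q b" using assms(4) unfolding supp_in_def by blast
    define K where "K = I - {i}"
    have I: "I = insert i K" "i \<notin> K" using iI by (auto simp: K_def)
    have "i \<notin> U" using i assms by auto
    with * i show "(\<tau>, \<nu>, I) \<in> strand U W Y Z q (Suc b)"
      unfolding K_def[symmetric] I(1) using I(2) assms(1,2) by (auto simp: strand_def card_insert_Int)
  qed
qed

text \<open>The Fredholm alternative for the column of \<open>k0\<close> against the other columns:
  a dependence between them would be a common zero of the forms.\<close>

lemma dual_vector:
  fixes c :: "'i \<Rightarrow> 'k \<Rightarrow> 'a::field"
  assumes "finite Y" "finite U" "k0 \<notin> Y"
    and inj: "\<And>y. (\<exists>k\<in>insert k0 Y. y k \<noteq> 0) \<Longrightarrow> \<exists>i\<in>U. (\<Sum>k\<in>insert k0 Y. y k * c i k) \<noteq> 0"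
  obtains \<gamma> where "\<And>k. k \<in> insert k0 Y \<Longrightarrow> (\<Sum>i\<in>U. \<gamma> i * c i k) = (if k = k0 then 1 else 0)"
proof -
  from fredholm_alternative[OF assms(1,2), of "\<lambda>i. c i k0" c]
  consider (y) y where "\<forall>i\<in>U. c i k0 = (\<Sum>k\<in>Y. y k * c i k)"
    | (\<gamma>) \<gamma> where "\<forall>k\<in>Y. (\<Sum>i\<in>U. \<gamma> i * c i k) = 0" "(\<Sum>i\<in>U. \<gamma> i * c i k0) = 1" by blast
  then show ?thesis
  proof cases
    case y
    have "(\<Sum>k\<in>insert k0 Y. (y(k0 := -1)) k * c i k) = - c i k0 + (\<Sum>k\<in>Y. y k * c i k)" for i
      using assms by (auto intro!: sum.cong)
    with y inj[of "y(k0 := -1)"] show ?thesis by auto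
  next
    case \<gamma>
    have "(\<Sum>i\<in>U. \<gamma> i * c i k) = (if k = k0 then 1 else 0)" if "k \<in> insert k0 Y" for k
      using \<gamma> assms(3) that by auto
    then show ?thesis using that by blast
  qed
qed

lemma inj_subset:
  fixes c :: "'i \<Rightarrow> 'k \<Rightarrow> 'a::field"
  assumes "finite Y" "k0 \<notin> Y"
    and inj: "\<And>y. (\<exists>k\<in>insert k0 Y. y k \<noteq> 0) \<Longrightarrow> \<exists>i\<in>U. (\<Sum>k\<in>insert k0 Y. y k * c i k) \<noteq> 0"
    and "\<exists>k\<in>Y. y k \<noteq> 0"
  shows "\<exists>i\<in>U. (\<Sum>k\<in>Y. y k * c i k) \<noteq> 0"
proof -
  have "(\<Sum>k\<in>insert k0 Y. (y(k0 := 0)) k * c i k) = (\<Sum>k\<in>Y. y k * c i k)" for i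
    using assms by (auto intro!: sum.cong)
  moreover obtain k where "k \<in> Y" "y k \<noteq> 0" using assms(4) by blast
  then have "k \<in> insert k0 Y" "(y(k0 := 0)) k \<noteq> 0" using assms(2) by auto
  then have "\<exists>k\<in>insert k0 Y. (y(k0 := 0)) k \<noteq> 0" by blast
  ultimately show ?thesis using inj[of "y(k0 := 0)"] by simp
qed

text \<open>Induction on the y-variables. Lift \<open>v\<close> along y_k0 to \<open>u\<close>; the
  differential of \<open>u\<close> is free of y_k0, hence by induction that of some \<open>w\<close>
  free of y_k0. Then \<open>u - w\<close> is a cycle lying over \<open>v\<close>, and the homotopy
  for y_k0 makes \<open>v\<close> a boundary. Each variable lost raises q by one, so
  \<open>q + card Y\<close> is kept, and without variables the strand is empty.\<close>

lemma fiber_exact_y: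
  fixes c :: "nat \<times> (nat + nat) \<Rightarrow> 'a::field_char_0"
  assumes "finite Y" and fin: "finite U" "finite W" "finite Z" and disj: "U \<inter> W = {}"
    and "\<And>y. (\<exists>k\<in>Y. y k \<noteq> 0) \<Longrightarrow> \<exists>i\<in>U. (\<Sum>k\<in>Y. y k * c (i, Inl k)) \<noteq> 0"
    and "card U < q + card Y" "supp_in (strand U W Y Z q b) v" "kdiff (pairs U W Y Z) c v = 0"
  shows "\<exists>w. supp_in (strand U W Y Z q b) w \<and> kdiff (pairs U W Y Z) c w = v"
  using assms(1,6-)
proof (induction Y arbitrary: q v rule: finite_induct)
  case empty
  have "v t = 0" for t
  proof (rule ccontr)
    assume "v t \<noteq> 0"
    then have "t \<in> strand U W {} Z q b" using empty.prems(3) unfolding supp_in_def by blast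
    then show False using empty.prems(2) by (cases t) (auto simp: strand_def)
  qed
  then have "v = 0" by (simp add: fun_eq_iff)
  then show ?case using supp_in_intros(1) linop_simps(3)[OF linop_kdiff] by metis
next
  case (insert k0 Y)
  let ?P = "pairs U W (insert k0 Y) Z" and ?P' = "pairs U W Y Z"
  let ?T = "strand U W (insert k0 Y) Z" and ?T' = "strand U W Y Z"
  obtain \<gamma> where \<gamma>: "\<And>k. k \<in> insert k0 Y \<Longrightarrow> (\<Sum>i\<in>U. \<gamma> i * c (i, Inl k)) = (if k = k0 then 1 else 0)"
    using dual_vector[OF insert.hyps(1) fin(1) insert.hyps(2), of "\<lambda>i k. c (i, Inl k)"] insert.prems(1) by blast
  have inj': "\<exists>i\<in>U. (\<Sum>k\<in>Y. y k * c (i, Inl k)) \<noteq> 0" if "\<exists>k\<in>Y. y k \<noteq> 0" for y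
    using inj_subset[OF insert.hyps(1,2), of U "\<lambda>i k. c (i, Inl k)" y] insert.prems(1) that by blast
  have hom: "eps_sum U \<gamma> (kdiff ?P c e) + kdiff ?P c (eps_sum U \<gamma> e) = contract_y k0 e" for e
    using insert.hyps fin disj \<gamma> by (intro eps_sum_homotopy_y) auto
  \<comment> \<open>The lift of \<open>v\<close> along y_k0 that raises the exponent of y_k0 by one;
    it is zero where y_k0 does not occur.\<close>
  define u where "u = (\<lambda>(\<tau>, \<nu>, I). if lookup \<tau> k0 = 0 then 0 else v (\<tau> - Poly_Mapping.single k0 1, \<nu>, I))"
  have cu: "contract_y k0 u = v"
    by (auto simp: contract_y_def u_def fun_eq_iff lookup_add)
  have su: "supp_in (?T (Suc q) b) u"
    unfolding supp_in_def
  proof safe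
    fix \<tau> \<nu> I assume "u (\<tau>, \<nu>, I) \<noteq> 0"
    then have *: "lookup \<tau> k0 \<noteq> 0" "v (\<tau> - Poly_Mapping.single k0 1, \<nu>, I) \<noteq> 0"
      by (auto simp: u_def split: if_splits)
    define \<rho> where "\<rho> = \<tau> - Poly_Mapping.single k0 1"
    have \<tau>: "\<tau> = \<rho> + Poly_Mapping.single k0 1" using minus_single_add[OF *(1)] by (simp add: \<rho>_def)
    have "(\<rho>, \<nu>, I) \<in> ?T q b" using *(2) insert.prems(3) unfolding supp_in_def \<rho>_def by blast
    then show "(\<tau>, \<nu>, I) \<in> ?T (Suc q) b" by (auto simp: strand_def \<tau> keys_add_nat deg_add)
  qed
  define x where "x = kdiff ?P c u"
  have cx: "contract_y k0 x = 0"
    using insert.prems(4) cu kdiff_contract_y x_def by metis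
  have sx: "supp_in (?T (Suc q) b) x" unfolding x_def using fin disj su by (intro supp_kdiff) auto
  have sx': "supp_in (?T' (Suc q) b) x"
    unfolding supp_in_def
  proof safe
    fix \<tau> \<nu> I assume nz: "x (\<tau>, \<nu>, I) \<noteq> 0"
    have "lookup \<tau> k0 = 0"
    proof (rule ccontr)
      assume "lookup \<tau> k0 \<noteq> 0"
      then have "contract_y k0 x (\<tau> - Poly_Mapping.single k0 1, \<nu>, I) = x (\<tau>, \<nu>, I)"
        by (simp only: contract_y_def split minus_single_add not_False_eq_True)
      with cx nz show False by simp
    qed
    moreover have "(\<tau>, \<nu>, I) \<in> ?T (Suc q) b" using nz sx unfolding supp_in_def by blast
    ultimately show "(\<tau>, \<nu>, I) \<in> ?T' (Suc q) b" by (auto simp: strand_def in_keys_iff)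
  qed
  have "kdiff ?P' c x = kdiff ?P c x"
    using kdiff_pairs_insert_y[OF fin(1,2) insert.hyps(1) fin(3) insert.hyps(2) cx, of c] by simp
  also have "\<dots> = 0" unfolding x_def by (rule kdiff_kdiff)
  finally have "kdiff ?P' c x = 0" .
  moreover have "card U < Suc q + card Y" using insert.prems(2) insert.hyps by simp
  ultimately obtain w where w: "supp_in (?T' (Suc q) b) w" "kdiff ?P' c w = x"
    using insert.IH[OF inj' _ sx'] by blast
  have "contract_y k0 w t = 0" for t
  proof (rule ccontr)
    assume "contract_y k0 w t \<noteq> 0"
    then obtain \<tau> \<nu> I where "w (\<tau> + Poly_Mapping.single k0 1, \<nu>, I) \<noteq> 0"
      by (cases t) (auto simp: contract_y_def)
    then have "(\<tau> + Poly_Mapping.single k0 1, \<nu>, I) \<in> ?T' (Suc q) b" using w unfolding supp_in_def by blast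
    then show False using insert.hyps by (auto simp: strand_def keys_add_nat)
  qed
  then have cw: "contract_y k0 w = 0" by (simp add: fun_eq_iff)
  have kw: "kdiff ?P c w = x"
    using kdiff_pairs_insert_y[OF fin(1,2) insert.hyps(1) fin(3) insert.hyps(2) cw, of c] w(2) by simp
  have sw: "supp_in (?T (Suc q) b) w" using w(1) by (fastforce simp: supp_in_def strand_def)
  define z where "z = u - w"
  have "kdiff ?P c z = 0" using kw by (simp add: z_def linop_simps(5)[OF linop_kdiff] x_def del: zero_fun_apply)
  moreover have "contract_y k0 z = v" unfolding z_def linop_simps(5)[OF linop_ops(3)] cu cw by (rule diff_zero)
  ultimately have "kdiff ?P c (eps_sum U \<gamma> z) = v"
    using hom[of z] linop_simps(3)[OF linop_eps_sum] by (metis add_0)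
  moreover have "supp_in (?T q b) (eps_sum U \<gamma> z)"
    using fin disj su sw by (intro supp_eps_sum_y) (auto simp: z_def supp_in_intros)
  ultimately show ?case by blast
qed

lemma times_z_inj:
  assumes "times_z k e = times_z k e'"
  shows "e = e'"
proof -
  have "e (\<tau>, \<nu>, I) = e' (\<tau>, \<nu>, I)" for \<tau> \<nu> I
    using fun_cong[OF assms, of "(\<tau>, \<nu> + Poly_Mapping.single k 1, I)"]
    by (simp add: times_z_def lookup_add)
  then show ?thesis by (simp add: fun_eq_iff)
qed

text \<open>The dual induction: z_k0 is injective where y_k0 was surjective. The homotopy writes
  z_k0 times \<open>v\<close> as the differential of some \<open>u\<close>. The part
  \<open>p\<close> of \<open>u\<close> free of z_k0 is a cycle in fewer variables, hence a boundary
  there; after correction by it \<open>u\<close> is divisible by z_k0, and z_k0 is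
  cancelled.\<close>

lemma fiber_exact_z:
  fixes c :: "nat \<times> (nat + nat) \<Rightarrow> 'a::field_char_0"
  assumes "finite Z" and fin: "finite U" "finite W" "finite Y" and disj: "U \<inter> W = {}"
    and "\<And>y. (\<exists>k\<in>Z. y k \<noteq> 0) \<Longrightarrow> \<exists>i\<in>W. (\<Sum>k\<in>Z. y k * c (i, Inr k)) \<noteq> 0"
    and "card W < b + card Z" "supp_in (strand U W Y Z q b) v" "kdiff (pairs U W Y Z) c v = 0"
  shows "\<exists>w. supp_in (strand U W Y Z q b) w \<and> kdiff (pairs U W Y Z) c w = v"
  using assms(1,6-)
proof (induction Z arbitrary: b v rule: finite_induct)
  case empty
  have "v t = 0" for t
  proof (rule ccontr)
    assume "v t \<noteq> 0"
    then have "t \<in> strand U W Y {} q b" using empty.prems(3) unfolding supp_in_def by blast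
    then obtain I where "card (I \<inter> W) = b" by (cases t) (auto simp: strand_def)
    moreover have "card (I \<inter> W) \<le> card W" using fin by (intro card_mono) auto
    ultimately show False using empty.prems(2) by simp
  qed
  then have "v = 0" by (simp add: fun_eq_iff)
  then show ?case using supp_in_intros(1) linop_simps(3)[OF linop_kdiff] by metis
next
  case (insert k0 Z)
  let ?P = "pairs U W Y (insert k0 Z)" and ?P' = "pairs U W Y Z"
  let ?T = "strand U W Y (insert k0 Z) q" and ?T' = "strand U W Y Z q"
  obtain \<gamma> where \<gamma>: "\<And>k. k \<in> insert k0 Z \<Longrightarrow> (\<Sum>i\<in>W. \<gamma> i * c (i, Inr k)) = (if k = k0 then 1 else 0)"
    using dual_vector[OF insert.hyps(1) fin(2) insert.hyps(2), of "\<lambda>i k. c (i, Inr k)"] insert.prems(1) by blast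
  have inj': "\<exists>i\<in>W. (\<Sum>k\<in>Z. y k * c (i, Inr k)) \<noteq> 0" if "\<exists>k\<in>Z. y k \<noteq> 0" for y
    using inj_subset[OF insert.hyps(1,2), of W "\<lambda>i k. c (i, Inr k)" y] insert.prems(1) that by blast
  have hom: "eps_sum W \<gamma> (kdiff ?P c e) + kdiff ?P c (eps_sum W \<gamma> e) = times_z k0 e" for e
    using insert.hyps fin disj \<gamma> by (intro eps_sum_homotopy_z) auto
  define u where "u = eps_sum W \<gamma> v"
  have ku: "kdiff ?P c u = times_z k0 v"
    using hom[of v] insert.prems(4) linop_simps(3)[OF linop_eps_sum] unfolding u_def by (metis add_0)
  have su: "supp_in (?T (Suc b)) u" unfolding u_def using fin disj insert.prems(3) by (intro supp_eps_sum_z) auto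
  define p where "p = (\<lambda>(\<tau>, \<nu>, I). if lookup \<nu> k0 = 0 then u (\<tau>, \<nu>, I) else 0)"
  define u' where "u' = (\<lambda>(\<tau>, \<nu>, I). u (\<tau>, \<nu> + Poly_Mapping.single k0 1, I))"
  have u_split: "u = p + times_z k0 u'"
  proof -
    have "u (\<tau>, \<nu>, I) = p (\<tau>, \<nu>, I) + times_z k0 u' (\<tau>, \<nu>, I)" for \<tau> \<nu> I
      using minus_single_add[of \<nu> k0] by (auto simp: p_def times_z_def u'_def)
    then show ?thesis by (simp add: fun_eq_iff)
  qed
  have sp: "supp_in (?T' (Suc b)) p"
    unfolding supp_in_def
  proof safe
    fix \<tau> \<nu> I assume "p (\<tau>, \<nu>, I) \<noteq> 0"
    then have "lookup \<nu> k0 = 0" "u (\<tau>, \<nu>, I) \<noteq> 0" by (auto simp: p_def split: if_splits)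
    moreover from this have "(\<tau>, \<nu>, I) \<in> ?T (Suc b)" using su unfolding supp_in_def by blast
    ultimately show "(\<tau>, \<nu>, I) \<in> ?T' (Suc b)" by (auto simp: strand_def in_keys_iff)
  qed
  have su': "supp_in (?T b) u'"
    unfolding supp_in_def
  proof safe
    fix \<tau> \<nu> I assume "u' (\<tau>, \<nu>, I) \<noteq> 0"
    then have "(\<tau>, \<nu> + Poly_Mapping.single k0 1, I) \<in> ?T (Suc b)"
      using su unfolding supp_in_def u'_def by auto
    then show "(\<tau>, \<nu>, I) \<in> ?T b" by (auto simp: strand_def keys_add_nat deg_add)
  qed
  \<comment> \<open>\<open>g\<close> collects the coefficients of z_k0 in the forms of
    \<open>W\<close>, so the full differential is the one without z_k0 plus z_k0 times
    \<open>g\<close>.\<close>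
  define g where "g e = (\<Sum>i\<in>W. fscale (c (i, Inr k0)) (iota i e))" for e
  have ins: "kdiff ?P c e = kdiff ?P' c e + times_z k0 (g e)" for e
    unfolding g_def using insert.hyps fin disj by (intro kdiff_pairs_insert_z) auto
  have kp: "kdiff ?P' c p = times_z k0 (v - kdiff ?P c u' - g p)"
  proof -
    have "times_z k0 v = kdiff ?P c p + times_z k0 (kdiff ?P c u')"
      by (simp add: ku[symmetric] u_split linop_simps[OF linop_kdiff] kdiff_times_z)
    then show ?thesis by (simp add: linop_simps[OF linop_ops(4)] ins[of p])
  qed
  \<comment> \<open>By \<open>kp\<close> it is divisible by z_k0, yet it is supported on exponents
    without z_k0.\<close>
  have "kdiff ?P' c p t = 0" for t
  proof (cases t)
    case (fields \<tau> \<nu> I)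
    show ?thesis
    proof (cases "lookup \<nu> k0 = 0")
      case True
      then show ?thesis unfolding kp fields by (simp add: times_z_def)
    next
      case False
      have "supp_in (?T' (Suc b)) (kdiff ?P' c p)" using sp fin disj by (intro supp_kdiff) auto
      moreover have "t \<notin> ?T' (Suc b)"
        using False insert.hyps in_keys_iff[of k0 \<nu>] by (auto simp: fields strand_def)
      ultimately show ?thesis unfolding supp_in_def by blast
    qed
  qed
  then have "kdiff ?P' c p = 0" by (simp add: fun_eq_iff)
  moreover have "card W < Suc b + card Z" using insert.prems(2) insert.hyps by simp
  ultimately obtain w where w: "supp_in (?T' (Suc b)) w" "kdiff ?P' c w = p"
    using insert.IH[OF inj' _ sp] by blast
  have "supp_in (?T b) (g w)"
    unfolding g_def
  proof (intro supp_in_intros)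
    fix i assume i: "i \<in> W"
    show "supp_in (?T b) (iota i w)"
      unfolding supp_in_def
    proof safe
      fix \<tau> \<nu> I assume "iota i w (\<tau>, \<nu>, I) \<noteq> 0"
      then have *: "i \<notin> I" "w (\<tau>, \<nu>, insert i I) \<noteq> 0" by (auto simp: iota_def split: if_splits)
      then have "(\<tau>, \<nu>, insert i I) \<in> ?T' (Suc b)" using w(1) unfolding supp_in_def by blast
      then show "(\<tau>, \<nu>, I) \<in> ?T b" using * i disj fin by (auto simp: strand_def card_insert_Int)
    qed
  qed
  then have "supp_in (?T b) (u' - g w)" using su' by (rule supp_in_intros(3)[rotated])
  moreover have "kdiff ?P c (u' - g w) = v"
  proof (rule times_z_inj)
    have "u = kdiff ?P c w + times_z k0 (u' - g w)"
      by (simp add: u_split ins w(2) linop_simps[OF linop_ops(4)])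
    then have "kdiff ?P c u = 0 + times_z k0 (kdiff ?P c (u' - g w))"
      by (simp only: linop_simps(1)[OF linop_kdiff] kdiff_kdiff kdiff_times_z)
    then show "times_z k0 (kdiff ?P c (u' - g w)) = times_z k0 v" by (simp only: ku add_0)
  qed
  ultimately show ?case by blast
qed

text \<open>The \<open>g j\<close> are the components of a cycle of x-degree 1, and
  \<open>supp\<close> places them at labels that no boundary can reach.\<close>

theorem no_kernel_if_no_zero:
  fixes c :: "nat \<Rightarrow> nat \<times> (nat + nat) \<Rightarrow> 'a::{alg_closed_field, field_char_0}"
  assumes fin: "finite J" "finite U" "finite W" "finite Y" "finite Z" and disj: "U \<inter> W = {}"
    and card: "card U < q + card Y" "card W < b + card Z"
    and nozero: "\<And>x y z. \<exists>j\<in>J. x j \<noteq> 0 \<Longrightarrow> \<exists>k\<in>Y. y k \<noteq> 0 \<Longrightarrow> \<exists>k\<in>Z. z k \<noteq> 0 \<Longrightarrow>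
      (\<exists>i\<in>U. (\<Sum>k\<in>Y. y k * (\<Sum>j\<in>J. x j * c j (i, Inl k))) \<noteq> 0) \<or>
      (\<exists>i\<in>W. (\<Sum>k\<in>Z. z k * (\<Sum>j\<in>J. x j * c j (i, Inr k))) \<noteq> 0)"
    and supp: "\<And>j \<tau> \<nu> I. j \<in> J \<Longrightarrow> g j (\<tau>, \<nu>, I) \<noteq> 0 \<Longrightarrow> \<nu> = 0 \<and> U \<subseteq> I \<and> (\<tau>, \<nu>, I) \<in> strand U W Y Z q b"
    and eq: "(\<Sum>j\<in>J. kdiff (pairs U W Y Z) (c j) (g j)) = 0"
    and j: "j \<in> J"
  shows "g j = 0"
proof -
  let ?T = "strand U W Y Z q b" and ?P = "pairs U W Y Z"
  interpret F: fin_dim_space fscale "{e :: fiber_index \<Rightarrow> 'a. supp_in ?T e}" ?T "\<lambda>t e. e t"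
  proof
    show "fscale.subspace {e :: fiber_index \<Rightarrow> 'a. supp_in ?T e}"
      unfolding fscale.subspace_def using supp_in_intros[of ?T] by blast
    show "finite ?T" using fin by (intro finite_strand) auto
    show "u = 0" if "u \<in> {e. supp_in ?T e}" "\<And>t. t \<in> ?T \<Longrightarrow> u t = 0" for u :: "fiber_index \<Rightarrow> 'a"
    proof -
      have "u t = 0" for t using that unfolding supp_in_def by blast
      then show ?thesis by (simp add: fun_eq_iff)
    qed
    show "(u + w) t = u t + w t" for t and u w :: "fiber_index \<Rightarrow> 'a" by simp
    show "fscale a u t = a * u t" for t a and u :: "fiber_index \<Rightarrow> 'a" by simp
  qed
  define \<Delta> where "\<Delta> j = kdiff ?P (c j)" for j
  have cplx: "F.complex J \<Delta>"
    unfolding F.complex_def F.endo_def \<Delta>_def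
  proof (intro conjI ballI allI)
    fix j k u
    show "kdiff ?P (c j) (kdiff ?P (c k) u) + kdiff ?P (c k) (kdiff ?P (c j) u) = 0"
      by (rule kdiff_anticommute)
    show "kdiff ?P (c j) ` {e. supp_in ?T e} \<subseteq> {e. supp_in ?T e}"
      using supp_kdiff[OF fin(2,3) disj] by blast
    show "kdiff ?P (c j) (u + w) = kdiff ?P (c j) u + kdiff ?P (c j) w"
      "kdiff ?P (c j) (fscale a u) = fscale a (kdiff ?P (c j) u)" for w a
      by (rule linop_simps[OF linop_kdiff])+
  qed
  have comb: "(\<Sum>j\<in>J. fscale (\<xi> j) (\<Delta> j u)) = kdiff ?P (\<lambda>p. \<Sum>j\<in>J. \<xi> j * c j p) u" for \<xi> u
  proof -
    have "(\<Sum>j\<in>J. fscale (\<xi> j) (\<Delta> j u)) = (\<Sum>j\<in>J. \<Sum>p\<in>?P. fscale (\<xi> j * c j p) (var_op (snd p) (iota (fst p) u)))"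
      by (simp add: \<Delta>_def kdiff_def fscale.scale_sum_right)
    also have "\<dots> = (\<Sum>p\<in>?P. \<Sum>j\<in>J. fscale (\<xi> j * c j p) (var_op (snd p) (iota (fst p) u)))"
      by (rule sum.swap)
    finally show ?thesis by (simp add: kdiff_def fscale.scale_sum_left)
  qed
  have "F.fiberwise_exact J \<Delta>"
    unfolding F.fiberwise_exact_def
  proof (intro allI impI ballI)
    fix \<xi> u assume nz: "\<exists>j\<in>J. \<xi> j \<noteq> 0" and u: "u \<in> {e. supp_in ?T e}" "(\<Sum>j\<in>J. fscale (\<xi> j) (\<Delta> j u)) = 0"
    let ?c = "\<lambda>p. \<Sum>j\<in>J. \<xi> j * c j p"
    have k0: "kdiff ?P ?c u = 0" using u(2) by (simp only: comb)
    have su: "supp_in ?T u" using u(1) by simp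
    \<comment> \<open>If the forms of \<open>U\<close> have a common zero over this \<xi>, then by
      \<open>nozero\<close> those of \<open>W\<close> have none; so one of the two blocks always
      supplies the homotopies.\<close>
    have "\<exists>w. supp_in ?T w \<and> kdiff ?P ?c w = u"
    proof (cases "\<forall>y. (\<exists>k\<in>Y. y k \<noteq> 0) \<longrightarrow> (\<exists>i\<in>U. (\<Sum>k\<in>Y. y k * ?c (i, Inl k)) \<noteq> 0)")
      case True
      then show ?thesis by (intro fiber_exact_y[OF fin(4,2,3,5) disj _ card(1) su k0]) blast
    next
      case False
      then obtain y where "\<exists>k\<in>Y. y k \<noteq> 0" "\<not> (\<exists>i\<in>U. (\<Sum>k\<in>Y. y k * ?c (i, Inl k)) \<noteq> 0)" by blast
      with nozero[OF nz] have "\<exists>i\<in>W. (\<Sum>k\<in>Z. z k * ?c (i, Inr k)) \<noteq> 0" if "\<exists>k\<in>Z. z k \<noteq> 0" for z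
        using that by blast
      then show ?thesis by (intro fiber_exact_z[OF fin(5,2,3,4) disj _ card(2) su k0])
    qed
    then obtain w where w: "supp_in ?T w" "kdiff ?P ?c w = u" by blast
    have "u = (\<Sum>j\<in>J. fscale (\<xi> j) (\<Delta> j w))" by (simp only: comb w(2))
    then show "\<exists>w\<in>{e. supp_in ?T e}. u = (\<Sum>j\<in>J. fscale (\<xi> j) (\<Delta> j w))" using w(1) by blast
  qed
  note exact = F.exact_if_fiberwise_exact[OF fin(1) cplx this, of 1]
  define \<epsilon> where "\<epsilon> j = (\<lambda>i. if i = j then 1 else (0::nat))" for j :: nat
  have \<epsilon>_inj: "\<epsilon> i = \<epsilon> k \<longleftrightarrow> i = k" for i k by (auto simp: \<epsilon>_def fun_eq_iff split: if_splits)
  \<comment> \<open>The differential of this chain at exponent zero is the left side of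
    \<open>eq\<close>; at all other exponents it vanishes for reasons of degree.\<close>
  define v where "v \<sigma> = (\<Sum>j\<in>J. if \<sigma> = \<epsilon> j then g j else 0)" for \<sigma>
  have v_\<epsilon>: "v (\<epsilon> j) = g j" if "j \<in> J" for j
    using fin(1) that by (simp add: v_def \<epsilon>_inj)
  have v_other: "v \<sigma> = 0" if "\<And>j. j \<in> J \<Longrightarrow> \<sigma> \<noteq> \<epsilon> j" for \<sigma>
    using that unfolding v_def by (intro sum.neutral) auto
  have gT: "supp_in ?T (g j)" if "j \<in> J" for j
    unfolding supp_in_def
  proof safe
    fix \<tau> \<nu> I assume "g j (\<tau>, \<nu>, I) \<noteq> 0" then show "(\<tau>, \<nu>, I) \<in> ?T" using supp[OF that] by blast
  qed
  have "F.chain J 1 v"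
    unfolding F.chain_def
  proof (intro conjI allI impI)
    fix \<sigma>
    show "v \<sigma> \<in> {e. supp_in ?T e}"
      unfolding v_def by (auto intro!: supp_in_intros gT)
    assume "v \<sigma> \<noteq> 0"
    then obtain j where j: "j \<in> J" "\<sigma> = \<epsilon> j" using v_other by blast
    then show "sum \<sigma> J = 1" using fin(1) by (simp add: \<epsilon>_def)
    fix i assume "i \<notin> J" then show "\<sigma> i = 0" using j by (auto simp: \<epsilon>_def)
  qed
  moreover have "bd J \<Delta> v = 0"
  proof
    fix \<sigma> :: "nat \<Rightarrow> nat"
    show "bd J \<Delta> v \<sigma> = 0 \<sigma>"
    proof (cases "\<sigma> = (\<lambda>_. 0)")
      case True
      then have "\<sigma>(j := Suc (\<sigma> j)) = \<epsilon> j" for j by (auto simp: \<epsilon>_def)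
      then have "bd J \<Delta> v \<sigma> = (\<Sum>j\<in>J. \<Delta> j (g j))"
        unfolding bd_def shift_def by (intro sum.cong) (auto simp: v_\<epsilon>)
      then show ?thesis using eq by (simp add: \<Delta>_def)
    next
      case False
      have "shift j v \<sigma> = 0" for j
        unfolding shift_def
      proof (rule v_other)
        fix i assume "i \<in> J"
        show "\<sigma>(j := Suc (\<sigma> j)) \<noteq> \<epsilon> i"
        proof
          assume *: "\<sigma>(j := Suc (\<sigma> j)) = \<epsilon> i"
          have "Suc (\<sigma> j) = \<epsilon> i j" using fun_cong[OF *, of j] by simp
          then have "i = j" "\<sigma> j = 0" by (auto simp: \<epsilon>_def split: if_splits)
          moreover have "\<sigma> k = 0" if "k \<noteq> j" for k
            using fun_cong[OF *, of k] that \<open>i = j\<close> by (simp add: \<epsilon>_def)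
          ultimately show False using False by (metis ext)
        qed
      qed
      then show ?thesis
        by (simp add: bd_def \<Delta>_def linop_simps(3)[OF linop_kdiff])
    qed
  qed
  ultimately have "F.boundary J \<Delta> 1 v" using exact[of v] by (simp add: F.cycle_def)
  then obtain w where w: "F.chain J (Suc 1) w" "bd J \<Delta> w = v" by (auto simp: F.boundary_def)
  have "g j (\<tau>, \<nu>, I) = 0" for \<tau> \<nu> I
  proof (rule ccontr)
    assume nz: "g j (\<tau>, \<nu>, I) \<noteq> 0"
    then have \<nu>: "\<nu> = 0" "U \<subseteq> I" using supp[OF j] by blast+
    \<comment> \<open>An index of \<open>U\<close> cannot be inserted again, and an index of
      \<open>W\<close> comes with a variable of z, which is absent here.\<close>
    have top: "kdiff ?P c' e (\<tau>, 0, I) = 0" for c' e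
      unfolding kdiff_def sum_fun_apply
    proof (intro sum.neutral ballI)
      fix p assume "p \<in> ?P"
      then show "fscale (c' p) (var_op (snd p) (iota (fst p) e)) (\<tau>, 0, I) = 0"
        using \<nu>(2) by (auto simp: pairs_def var_op_def contract_y_def times_z_def iota_def)
    qed
    have "g j (\<tau>, \<nu>, I) = bd J \<Delta> w (\<epsilon> j) (\<tau>, 0, I)" using w(2) v_\<epsilon>[OF j] \<nu>(1) by simp
    also have "\<dots> = 0" by (simp add: bd_def sum_fun_apply \<Delta>_def top)
    finally show False using nz by simp
  qed
  then show ?thesis by (simp add: fun_eq_iff)
qed

section \<open>The entries and the size of the matrix\<close>

text \<open>At most one monomial of \<open>p\<close> carries one basis element to another. The
  blocks x and y are dual, so their exponents drop from \<sigma> to \<tau>, while that of z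
  grows.\<close>

fun pcoef :: "'c::comm_ring_1 xyz_poly \<Rightarrow> expo \<Rightarrow> expo \<Rightarrow> 'c" where
  "pcoef p (\<sigma>x, \<sigma>y, \<sigma>z) (\<tau>x, \<tau>y, \<tau>z) =
     (if mono_le \<tau>x \<sigma>x \<and> mono_le \<tau>y \<sigma>y \<and> mono_le \<sigma>z \<tau>z
      then lookup p (\<sigma>x - \<tau>x, \<sigma>y - \<tau>y, \<tau>z - \<sigma>z) else 0)"

text \<open>A closed form of the matrix entries, defined for arbitrary labels. At most one index i
  contributes to the sum, the one removed from the exterior part.\<close>

definition entry :: "(nat \<Rightarrow> 'c::comm_ring_1 xyz_poly) \<Rightarrow> label \<Rightarrow> label \<Rightarrow> 'c" where
  "entry F rl cl = (\<Sum>i\<in>snd cl. if snd rl = snd cl - {i}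
     then wsgn i (snd cl) * pcoef (F i) (fst cl) (fst rl) else 0)"

lemma mono_le_minus: "mono_le \<theta> \<sigma> \<and> \<sigma> - \<theta> = \<tau> \<longleftrightarrow> mono_le \<tau> \<sigma> \<and> \<theta> = \<sigma> - \<tau>"
proof -
  have "a \<le> c \<and> c - a = b \<longleftrightarrow> b \<le> c \<and> a = c - b" for a b c :: nat by auto
  then show ?thesis
    unfolding mono_le_def poly_mapping_eq_iff fun_eq_iff lookup_minus by blast
qed

lemma mono_le_add: "\<theta> + \<sigma> = \<tau> \<longleftrightarrow> mono_le \<sigma> \<tau> \<and> \<theta> = \<tau> - \<sigma>"
proof -
  have "a + b = c \<longleftrightarrow> b \<le> c \<and> a = c - b" for a b c :: nat by auto
  then show ?thesis
    unfolding mono_le_def poly_mapping_eq_iff fun_eq_iff lookup_minus lookup_add by blast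
qed

lemma lookup_psi_basis:
  "lookup (psi_basis (\<sigma>x, \<sigma>y, \<sigma>z) (\<theta>x, \<theta>y, \<theta>z) c) (\<tau>x, \<tau>y, \<tau>z) =
    (if mono_le \<tau>x \<sigma>x \<and> mono_le \<tau>y \<sigma>y \<and> mono_le \<sigma>z \<tau>z \<and>
        (\<theta>x, \<theta>y, \<theta>z) = (\<sigma>x - \<tau>x, \<sigma>y - \<tau>y, \<tau>z - \<sigma>z) then c else 0)"
  using mono_le_minus[of \<theta>x \<sigma>x \<tau>x] mono_le_minus[of \<theta>y \<sigma>y \<tau>y] mono_le_add[of \<theta>z \<sigma>z \<tau>z]
  by (auto simp: lookup_single when_def)

lemma lookup_psi_single:
  fixes c :: "'a::comm_ring_1"
  shows "lookup (psi (Poly_Mapping.single \<sigma> c) p) \<tau> = c * pcoef p \<sigma> \<tau>"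
proof -
  obtain \<sigma>x \<sigma>y \<sigma>z \<tau>x \<tau>y \<tau>z where st: "\<sigma> = (\<sigma>x, \<sigma>y, \<sigma>z)" "\<tau> = (\<tau>x, \<tau>y, \<tau>z)"
    by (cases \<sigma>, cases \<tau>)
  let ?C = "mono_le \<tau>x \<sigma>x \<and> mono_le \<tau>y \<sigma>y \<and> mono_le \<sigma>z \<tau>z"
  let ?\<theta> = "(\<sigma>x - \<tau>x, \<sigma>y - \<tau>y, \<tau>z - \<sigma>z)"
  have "psi (Poly_Mapping.single \<sigma> c) p = (\<Sum>\<theta>\<in>keys p. psi_basis \<sigma> \<theta> (c * lookup p \<theta>))"
  proof (cases "c = 0")
    case True
    have "psi_basis \<sigma> \<theta> (0::'a) = 0" for \<theta> :: expo by (cases \<theta>) (simp add: st)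
    with True show ?thesis by (simp add: psi_def)
  qed (simp add: psi_def)
  then have "lookup (psi (Poly_Mapping.single \<sigma> c) p) \<tau> =
      (\<Sum>\<theta>\<in>keys p. lookup (psi_basis \<sigma> \<theta> (c * lookup p \<theta>)) \<tau>)"
    by (simp add: lookup_sum)
  also have "\<dots> = (\<Sum>\<theta>\<in>keys p. if \<theta> = ?\<theta> then (if ?C then c * lookup p \<theta> else 0) else 0)"
  proof (intro sum.cong refl)
    fix \<theta> :: expo
    obtain \<theta>x \<theta>y \<theta>z where \<theta>: "\<theta> = (\<theta>x, \<theta>y, \<theta>z)" by (cases \<theta>)
    show "lookup (psi_basis \<sigma> \<theta> (c * lookup p \<theta>)) \<tau> = (if \<theta> = ?\<theta> then (if ?C then c * lookup p \<theta> else 0) else 0)"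
      unfolding \<theta> st lookup_psi_basis by simp
  qed
  also have "\<dots> = c * pcoef p \<sigma> \<tau>" by (simp add: st in_keys_iff)
  finally show ?thesis .
qed

lemma lookup_wedge_tensor: "lookup (wedge_tensor c p J) (\<tau>, K) = (if K = J then c * lookup p \<tau> else 0)"
  by (auto simp: wedge_tensor_def lookup_sum lookup_single when_def in_keys_iff)

lemma card_less_nth:
  assumes "sorted_wrt (<) (xs :: nat list)" "m < length xs"
  shows "card {j \<in> set xs. j < xs ! m} = m"
proof -
  have "{j \<in> set xs. j < xs ! m} = (\<lambda>i. xs ! i) ` {..<m}"
  proof safe
    fix j assume "j \<in> set xs" "j < xs ! m"
    then obtain i where i: "i < length xs" "j = xs ! i" by (auto simp: in_set_conv_nth)
    have "i < m"
    proof (rule ccontr)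
      assume "\<not> i < m"
      then have "xs ! m \<le> xs ! i" using assms i by (cases "i = m") (auto simp: sorted_wrt_iff_nth_less less_imp_le)
      with i \<open>j < xs ! m\<close> show False by simp
    qed
    with i show "j \<in> (\<lambda>i. xs ! i) ` {..<m}" by auto
  next
    fix i assume "i < m"
    then show "xs ! i \<in> set xs" "xs ! i < xs ! m" using assms by (auto simp: sorted_wrt_iff_nth_less)
  qed
  moreover have "inj_on (\<lambda>i. xs ! i) {..<m}"
    using assms by (intro inj_onI) (metis lessThan_iff linorder_neqE_nat order.strict_trans sorted_wrt_iff_nth_less less_irrefl)
  ultimately show ?thesis by (simp add: card_image)
qed

text \<open>The position of an element in the sorted list is the number of smaller elements, so a
  sum over positions becomes one over elements.\<close>

lemma sum_nth_elem:
  assumes "finite I" "card I = n"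
  shows "(\<Sum>i\<in>{1..n}. g ((- 1) ^ (i - 1)) (nth_elem I i)) = (\<Sum>k\<in>I. g (wsgn k I :: 'c::comm_ring_1) k)"
proof -
  define xs where "xs = sorted_list_of_set I"
  have xs: "sorted_wrt (<) xs" "set xs = I" "length xs = n" "distinct xs"
    using assms by (auto simp: xs_def)
  have "(\<Sum>i\<in>{1..n}. g ((- 1) ^ (i - 1)) (nth_elem I i)) = (\<Sum>m\<in>{..<n}. g ((- 1) ^ m) (xs ! m))"
    by (rule sum.reindex_bij_witness[of _ Suc "\<lambda>i. i - 1"]) (auto simp: nth_elem_def xs_def)
  also have "\<dots> = (\<Sum>m\<in>{..<n}. g (wsgn (xs ! m) I) (xs ! m))"
    using card_less_nth[OF xs(1)] xs by (intro sum.cong refl) (simp add: wsgn_def)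
  also have "\<dots> = (\<Sum>k\<in>I. g (wsgn k I) k)"
    using bij_betw_nth[OF xs(4), of "{..<n}" I] xs by (intro sum.reindex_bij_betw) auto
  finally show ?thesis .
qed

text \<open>The sum in \<open>delta1\<close> has n_x + n_y + 1 terms, which is the size of every
  exterior part in \<open>K1\<close>; so it runs over the whole exterior part.\<close>

lemma lookup_delta1_single:
  assumes "finite (snd cl)" "card (snd cl) = nx + ny + 1"
  shows "lookup (delta1 nx ny F (Poly_Mapping.single cl 1)) rl = entry F rl cl"
proof -
  obtain \<sigma> I \<tau> K where l: "cl = (\<sigma>, I)" "rl = (\<tau>, K)" by (cases cl, cases rl)
  have "delta1 nx ny F (Poly_Mapping.single cl 1) =
      (\<Sum>i\<in>{1..nx + ny + 1}. wedge_tensor ((- 1) ^ (i - 1)) (psi (Poly_Mapping.single \<sigma> 1) (F (nth_elem I i))) (I - {nth_elem I i}))"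
    by (simp add: delta1_def l)
  also have "\<dots> = (\<Sum>k\<in>I. wedge_tensor (wsgn k I) (psi (Poly_Mapping.single \<sigma> 1) (F k)) (I - {k}))"
    using assms by (intro sum_nth_elem) (simp_all add: l)
  finally show ?thesis
    by (simp add: lookup_sum lookup_wedge_tensor lookup_psi_single entry_def l cong: if_cong)
qed

lemma entry_remove:
  assumes "finite I" "i \<in> I"
  shows "entry F (\<tau>, I - {i}) (\<sigma>, I) = wsgn i I * pcoef (F i) \<sigma> \<tau>"
proof -
  have "I - {i} = I - {k} \<longleftrightarrow> k = i" if "k \<in> I" for k using assms that by blast
  then have "entry F (\<tau>, I - {i}) (\<sigma>, I) = (\<Sum>k\<in>I. if k = i then wsgn k I * pcoef (F k) \<sigma> \<tau> else 0)"
    unfolding entry_def by (intro sum.cong) auto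
  then show ?thesis using assms by simp
qed

lemma entry_eq_0: "(\<And>i. i \<in> I \<Longrightarrow> K \<noteq> I - {i}) \<Longrightarrow> entry F (\<tau>, K) (\<sigma>, I) = 0"
  by (simp add: entry_def)

section \<open>Finite index sets and the entries of the universal matrix\<close>

lemma monos_of_int: "monos_of m (int d) = {\<sigma>. keys \<sigma> \<subseteq> {0..m} \<and> deg \<sigma> = d}"
  unfolding monos_of_def of_nat_eq_iff by (auto simp: deg_eq_sum[of "{0..m}"])

lemma monos_of_negative: "d < 0 \<Longrightarrow> monos_of m d = {}"
  unfolding monos_of_def by (auto simp del: of_nat_sum)

lemma finite_monos_of: "finite (monos_of m d)"
proof (cases "d \<ge> 0")
  case True
  then obtain d' where "d = int d'" by (metis nonneg_int_cases)
  then show ?thesis using finite_deg_le[of "{0..m}" d'] by (auto simp: monos_of_int elim: rev_finite_subset)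
next
  case False
  then have "monos_of m d = {}" by (simp add: monos_of_negative)
  then show ?thesis by simp
qed

lemma finite_expos: "finite (expos nx ny nz d)"
  by (cases d) (simp add: finite_monos_of)

lemma monos_of_0: "monos_of m 0 = {0}"
  using monos_of_int[of m 0] by (auto simp: deg_eq_0_iff)

lemma lookup_universal_system:
  "lookup (universal_system nx ny nz r i) \<theta> = (if \<theta> \<in> expos nx ny nz (mdeg r i) then Var (i, \<theta>) else 0)"
  by (auto simp: universal_system_def lookup_sum lookup_single when_def finite_expos)

lemma eval_at_zero: "eval_at G 0 = 0"
  by (simp add: eval_at_def eval_poly_via_def)

lemma uminus_single: "- Poly_Mapping.single k (a::'b::ab_group_add) = Poly_Mapping.single k (- a)"
  by (rule poly_mapping_eqI) (simp add: lookup_single when_def)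

text \<open>Every nonzero entry of the universal matrix is a variable up to sign, so this and the
  next lemma settle evaluation and occurring variables for all entries.\<close>

lemma eval_at_wsgn_Var: "eval_at G (wsgn i I * Var v) = wsgn i I * (coeff_of G v :: 'a::{comm_ring_1, ring_1_no_zero_divisors})"
proof -
  \<comment> \<open>The variables x and y fix the two rings in which the sign is read; both readings
    follow the same parity.\<close>
  have "wsgn i I = (1 :: 'c) \<and> wsgn i I = (1::'d) \<or> wsgn i I = (-1 :: 'c) \<and> wsgn i I = (-1::'d)"
    for x :: "'c::comm_ring_1" and y :: "'d::comm_ring_1"
    by (cases "even (card {j \<in> I. j < i})") (auto simp: wsgn_def)
  then consider "wsgn i I = (1 :: (uvar, 'a) mvpoly)" "wsgn i I = (1::'a)" | "wsgn i I = (-1 :: (uvar, 'a) mvpoly)" "wsgn i I = (-1::'a)"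
    by blast
  then show ?thesis
    by cases (simp_all add: eval_at_def eval_poly_via_def Var_def uminus_single)
qed

lemma vars_of_wsgn_Var: "vars_of (wsgn i I * Var v :: ('v, 'a::comm_ring_1) mvpoly) = {v}"
proof -
  have "wsgn i I = (1 :: ('v, 'a) mvpoly) \<or> wsgn i I = (-1 :: ('v, 'a) mvpoly)"
    by (cases "even (card {j \<in> I. j < i})") (auto simp: wsgn_def)
  then show ?thesis by (auto simp: vars_of_def Var_def uminus_single)
qed

lemma vars_of_zero: "vars_of 0 = {}"
  by (simp add: vars_of_def)

lemma pcoef_universal:
  "pcoef (universal_system nx ny nz r i) (\<sigma>x, \<sigma>y, \<sigma>z) (\<tau>x, \<tau>y, \<tau>z) =
    (if mono_le \<tau>x \<sigma>x \<and> mono_le \<tau>y \<sigma>y \<and> mono_le \<sigma>z \<tau>z \<and>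
        (\<sigma>x - \<tau>x, \<sigma>y - \<tau>y, \<tau>z - \<sigma>z) \<in> expos nx ny nz (mdeg r i)
     then Var (i, (\<sigma>x - \<tau>x, \<sigma>y - \<tau>y, \<tau>z - \<sigma>z)) else 0)"
  by (simp add: lookup_universal_system)

lemma eval_entry_universal:
  fixes G :: "nat \<Rightarrow> 'a::idom xyz_poly"
  assumes "finite (snd cl)" and G: "\<And>i. i \<in> snd cl \<Longrightarrow> G i \<in> S nx ny nz (mdeg r i)"
  shows "eval_at G (entry (universal_system nx ny nz r) rl cl) = entry G rl cl"
proof -
  obtain \<sigma>x \<sigma>y \<sigma>z I where l1: "cl = ((\<sigma>x, \<sigma>y, \<sigma>z), I)" by (cases cl, cases "fst cl") auto
  obtain \<tau>x \<tau>y \<tau>z K where l2: "rl = ((\<tau>x, \<tau>y, \<tau>z), K)" by (cases rl, cases "fst rl") auto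
  note l = l1 l2
  show ?thesis
  proof (cases "\<exists>i\<in>I. K = I - {i}")
    case False
    then show ?thesis by (simp add: l entry_eq_0 eval_at_zero)
  next
    case True
    then obtain i where i: "i \<in> I" "K = I - {i}" by blast
    have zero: "lookup (G i) \<theta> = 0" if "\<theta> \<notin> expos nx ny nz (mdeg r i)" for \<theta>
      using G[of i] i that by (auto simp: l S_def in_keys_iff)
    have fin: "finite I" using assms(1) by (simp add: l)
    show ?thesis
      unfolding l i(2) entry_remove[OF fin i(1)] pcoef_universal using zero
      by (auto simp: eval_at_wsgn_Var eval_at_zero coeff_of_def)
  qed
qed

lemma vars_of_entry_universal:
  assumes "finite I" "(\<theta>x, \<theta>y, \<theta>z) \<in> expos nx ny nz (1, 1, 1)"
  shows "(0, (\<theta>x, \<theta>y, \<theta>z)) \<in> vars_of (entry (universal_system nx ny nz r) ((\<tau>x, \<tau>y, \<tau>z), K) ((\<sigma>x, \<sigma>y, \<sigma>z), I)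
      :: (uvar, 'a::comm_ring_1) mvpoly) \<longleftrightarrow>
    0 \<in> I \<and> K = I - {0} \<and> \<sigma>x = \<theta>x + \<tau>x \<and> \<sigma>y = \<theta>y + \<tau>y \<and> \<tau>z = \<theta>z + \<sigma>z"
proof (cases "\<exists>i\<in>I. K = I - {i}")
  case False
  then show ?thesis by (auto simp: entry_eq_0 vars_of_def)
next
  case True
  then obtain i where i: "i \<in> I" "K = I - {i}" by blast
  have "0 \<in> I \<and> K = I - {0} \<longleftrightarrow> i = 0" using i by auto
  moreover have "(0, (\<theta>x, \<theta>y, \<theta>z)) \<in> vars_of (entry (universal_system nx ny nz r) ((\<tau>x, \<tau>y, \<tau>z), K) ((\<sigma>x, \<sigma>y, \<sigma>z), I)
      :: (uvar, 'a) mvpoly) \<longleftrightarrow>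
      i = 0 \<and> (mono_le \<tau>x \<sigma>x \<and> \<theta>x = \<sigma>x - \<tau>x) \<and> (mono_le \<tau>y \<sigma>y \<and> \<theta>y = \<sigma>y - \<tau>y) \<and> (mono_le \<sigma>z \<tau>z \<and> \<theta>z = \<tau>z - \<sigma>z)"
    unfolding i(2) entry_remove[OF assms(1) i(1)] pcoef_universal
    using assms(2) by (auto simp: vars_of_wsgn_Var vars_of_zero mdeg_def)
  ultimately show ?thesis
    using mono_le_add[of \<theta>x \<tau>x \<sigma>x] mono_le_add[of \<theta>y \<tau>y \<sigma>y] mono_le_add[of \<theta>z \<sigma>z \<tau>z] by auto
qed

section \<open>Counting labels: \<open>K1\<close> and \<open>K0\<close> have equal dimension\<close>

lemma card_monos_of: "card (monos_of m (int d)) = (m + d) choose d"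
proof -
  define g where "g \<sigma> = map (lookup \<sigma>) [0..<Suc m]" for \<sigma> :: mono
  have "bij_betw g (monos_of m (int d)) {l. length l = Suc m \<and> sum_list l = d}"
    unfolding bij_betw_def
  proof
    show "inj_on g (monos_of m (int d))"
    proof (rule inj_onI, rule poly_mapping_eqI)
      fix \<sigma> \<tau> k assume *: "\<sigma> \<in> monos_of m (int d)" "\<tau> \<in> monos_of m (int d)" "g \<sigma> = g \<tau>"
      show "lookup \<sigma> k = lookup \<tau> k"
      proof (cases "k \<le> m")
        case True
        then show ?thesis using *(3) unfolding g_def map_eq_conv by (auto simp del: upt_Suc)
      next
        case False
        with * have "k \<notin> keys \<sigma>" "k \<notin> keys \<tau>" by (auto simp: monos_of_def)
        then show ?thesis by (simp add: in_keys_iff)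
      qed
    qed
    have sum_g: "sum_list (g \<sigma>) = (\<Sum>i\<in>{0..m}. lookup \<sigma> i)" for \<sigma>
      by (simp add: g_def interv_sum_list_conv_sum_set_nat atLeast0LessThan lessThan_Suc_atMost atLeast0AtMost del: upt_Suc)
    show "g ` monos_of m (int d) = {l. length l = Suc m \<and> sum_list l = d}"
    proof (intro equalityI subsetI)
      fix l assume "l \<in> g ` monos_of m (int d)"
      then show "l \<in> {l. length l = Suc m \<and> sum_list l = d}"
        using sum_g by (auto simp: monos_of_int deg_eq_sum[of "{0..m}"]) (simp add: g_def)
    next
      fix l assume l: "l \<in> {l. length l = Suc m \<and> sum_list l = d}"
      define \<sigma> where "\<sigma> = Abs_poly_mapping (\<lambda>i. if i \<le> m then l ! i else 0)"
      have "finite {i. (if i \<le> m then l ! i else 0) \<noteq> 0}"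
        by (rule finite_subset[of _ "{..m}"]) auto
      then have \<sigma>: "lookup \<sigma> = (\<lambda>i. if i \<le> m then l ! i else 0)" by (simp add: \<sigma>_def)
      have gl: "g \<sigma> = l"
        using l by (auto simp: g_def \<sigma> list_eq_iff_nth_eq simp del: upt_Suc)
      moreover have "\<sigma> \<in> monos_of m (int d)"
      proof -
        have "keys \<sigma> \<subseteq> {0..m}" by (auto simp: in_keys_iff \<sigma> split: if_splits)
        moreover from this have "deg \<sigma> = d" using l gl sum_g[of \<sigma>] deg_eq_sum[of "{0..m}" \<sigma>] by simp
        ultimately show ?thesis unfolding monos_of_int by simp
      qed
      ultimately show "l \<in> g ` monos_of m (int d)" by blast
    qed
  qed
  then have "card (monos_of m (int d)) = card {l :: nat list. length l = Suc m \<and> sum_list l = d}"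
    by (rule bij_betw_same_card)
  then show ?thesis by (simp add: card_length_sum_list add.commute)
qed

lemma wedge_iff:
  "I \<in> wedge r s (int a) (int c) (int e) \<longleftrightarrow> I \<subseteq> {0..r + s} \<and> card (I \<inter> {1..r}) = a \<and>
    card (I \<inter> {r + 1..r + s}) = c \<and> card (I \<inter> {0}) = e"
  by (simp add: wedge_def)

lemma card_wedge: "card (wedge r s (int a) (int c) (int e)) = (r choose a) * (s choose c) * (1 choose e)"
proof -
  let ?U = "{1..r}" and ?W = "{r + 1..r + s}"
  let ?A = "{A. A \<subseteq> ?U \<and> card A = a} \<times> {B. B \<subseteq> ?W \<and> card B = c} \<times> {C. C \<subseteq> {0::nat} \<and> card C = e}"
  have "bij_betw (\<lambda>I. (I \<inter> ?U, I \<inter> ?W, I \<inter> {0})) (wedge r s (int a) (int c) (int e)) ?A"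
  proof (rule bij_betw_byWitness[where f' = "\<lambda>(A, B, C). A \<union> B \<union> C"])
    have split: "{0..r + s} = ?U \<union> ?W \<union> {0}" by auto
    show "\<forall>I\<in>wedge r s (int a) (int c) (int e). (case (I \<inter> ?U, I \<inter> ?W, I \<inter> {0}) of (A, B, C) \<Rightarrow> A \<union> B \<union> C) = I"
    proof
      fix I assume "I \<in> wedge r s (int a) (int c) (int e)"
      then have "I \<subseteq> ?U \<union> ?W \<union> {0}" unfolding wedge_iff split by blast
      then have "I \<inter> ?U \<union> I \<inter> ?W \<union> I \<inter> {0} = I" by blast
      then show "(case (I \<inter> ?U, I \<inter> ?W, I \<inter> {0}) of (A, B, C) \<Rightarrow> A \<union> B \<union> C) = I" by simp
    qed
    have un: "(A \<union> B \<union> C) \<inter> ?U = A" "(A \<union> B \<union> C) \<inter> ?W = B" "(A \<union> B \<union> C) \<inter> {0} = C"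
      if "A \<subseteq> ?U" "B \<subseteq> ?W" "C \<subseteq> {0}" for A B C using that by auto
    then show "\<forall>x\<in>?A. (\<lambda>I. (I \<inter> ?U, I \<inter> ?W, I \<inter> {0})) (case x of (A, B, C) \<Rightarrow> A \<union> B \<union> C) = x" by auto
    show "(\<lambda>I. (I \<inter> ?U, I \<inter> ?W, I \<inter> {0})) ` wedge r s (int a) (int c) (int e) \<subseteq> ?A"
      unfolding wedge_iff by (auto simp: wedge_def)
    show "(\<lambda>(A, B, C). A \<union> B \<union> C) ` ?A \<subseteq> wedge r s (int a) (int c) (int e)"
    proof clarify
      fix A B C :: "nat set" assume *: "A \<subseteq> ?U" "a = card A" "B \<subseteq> ?W" "c = card B" "C \<subseteq> {0}" "e = card C"
      then show "A \<union> B \<union> C \<in> wedge r s (int (card A)) (int (card B)) (int (card C))"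
        unfolding wedge_iff un[OF *(1,3,5)] by auto
    qed
  qed
  then have "card (wedge r s (int a) (int c) (int e)) = card ?A" by (rule bij_betw_same_card)
  also have "\<dots> = (r choose a) * (s choose c) * (1 choose e)"
    by (simp only: card_cartesian_product n_subsets finite_atLeastAtMost finite.intros card_atLeastAtMost) simp
  finally show ?thesis .
qed

lemma wedge_negative: "a < 0 \<or> b < 0 \<or> c < 0 \<Longrightarrow> wedge r s a b c = {}"
  by (auto simp: wedge_def)

lemma finite_wedge: "finite (wedge r s a b c)"
  by (rule finite_subset[of _ "Pow {0..r + s}"]) (auto simp: wedge_def)

lemma wedge_disjoint: "(a, b, c) \<noteq> (a', b', c') \<Longrightarrow> wedge r s a b c \<inter> wedge r s a' b' c' = {}"
  by (auto simp: wedge_def)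

text \<open>Makes the matrix of \<open>delta1\<close> square, so that M11 is square along with M22.
  One absorption identity each for \<open>A0\<close>, \<open>A1\<close>, \<open>B0\<close>,
  \<open>B1\<close> converts the two summands of \<open>K1\<close> into the four of
  \<open>K0\<close>.\<close>

lemma card_bases_eq:
  assumes "1 \<le> ny" "r = ny + q" "s = nz + b" "nx = q + b"
  shows "card (K1_basis nx ny nz r s) = card (K0_basis nx ny nz r s)"
proof -
  define A where "A = (r choose q)"
  define A1 where "A1 = (Suc r choose Suc q)"
  define B where "B = (s choose b)"
  define B1 where "B1 = (s choose Suc b)"
  \<comment> \<open>\<open>A0\<close> and \<open>B0\<close> are kept as cardinalities because the
    degrees q - 1 and b - 1 become negative, and the sets empty, for q = 0 and b = 0.\<close>
  define A0 where "A0 = card (monos_of ny (int q - 1))"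
  define B0 where "B0 = card (wedge r s (int r) (int b - 1) 1)"
  have A0: "r * A0 = q * A"
  proof (cases q)
    case 0
    then have "monos_of ny (int q - 1) = {}" using assms by (intro monos_of_negative) simp
    then show ?thesis using 0 by (simp add: A0_def)
  next
    case (Suc q')
    then have "int q - 1 = int q'" by simp
    then have "A0 = (ny + q') choose q'" by (simp add: A0_def card_monos_of)
    then show ?thesis using Suc_times_binomial[of q' "ny + q'"] Suc assms by (simp add: A_def)
  qed
  have B0: "(nz + 1) * B0 = b * B"
  proof (cases b)
    case 0
    then show ?thesis using assms by (simp add: B0_def wedge_negative)
  next
    case (Suc b')
    then have "int b - 1 = int b'" by simp
    then have "B0 = (s choose b')" using card_wedge[of r s r b' 1] by (simp add: B0_def)
    moreover have "(s - b') * (s choose b') = Suc b' * (s choose Suc b')"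
      using binomial_absorption[of b' s] binomial_absorb_comp[of s b'] by simp
    ultimately show ?thesis using Suc assms by (simp add: B_def)
  qed
  have A1: "(q + 1) * A1 = (r + 1) * A" using Suc_times_binomial[of q r] by (simp add: A1_def A_def)
  have B1: "(b + 1) * B1 = nz * B"
    using binomial_absorption[of b s] binomial_absorb_comp[of s b] assms by (simp add: B1_def B_def)
  have i: "int r - int ny = int q" "int r - int ny + 1 = int (Suc q)" "int s - int nz = int b"
    "int s - int nz + 1 = int (Suc b)" "int r - 1 = int (r - 1)"
    "int q + 1 = int (Suc q)" "int b + 1 = int (Suc b)"
    using assms by auto
  have m: "card (monos_of m 1) = m + 1" "card (monos_of m 0) = 1" for m
    using card_monos_of[of m 1] card_monos_of[of m 0] by simp_all
  have rr: "(r choose (r - 1)) = r" using assms binomial_symmetric[of 1 r] by simp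
  have mA: "card (monos_of ny (int q)) = A" "card (monos_of ny (int (Suc q))) = A1"
    using assms by (simp_all only: card_monos_of A_def A1_def) (simp_all add: add.commute)
  have w: "card (wedge r s (int r) (int c) 0) = (s choose c)" "card (wedge r s (int r) (int c) 1) = (s choose c)"
     "card (wedge r s (int (r - 1)) (int c) 0) = r * (s choose c)" "card (wedge r s (int (r - 1)) (int c) 1) = r * (s choose c)" for c
    using card_wedge[of r s r c 0] card_wedge[of r s r c 1] card_wedge[of r s "r - 1" c 0] card_wedge[of r s "r - 1" c 1] rr
    by simp_all
  have "card (K1_basis nx ny nz r s) = (nx + 1) * A * B1 + (nx + 1) * A1 * B"
  proof -
    have "omega1 nz r s \<inter> omega2 nz r s = {}" unfolding omega1_def omega2_def by (rule wedge_disjoint) simp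
    then have "card (K1_basis nx ny nz r s) =
        card (expos nx ny nz (1, int r - int ny, 0) \<times> omega1 nz r s) +
        card (expos nx ny nz (1, int r - int ny + 1, 0) \<times> omega2 nz r s)"
      unfolding K1_basis_def omega1_def omega2_def
      by (intro card_Un_disjoint) (auto simp: finite_monos_of finite_wedge)
    then show ?thesis
      by (simp only: omega1_def omega2_def card_cartesian_product expos.simps i m mA w)
        (simp add: B_def B1_def)
  qed
  moreover have "card (K0_basis nx ny nz r s) = A0 * (r * B1) + A * (nz + 1) * B + A * (r * B) + A1 * (nz + 1) * B0"
  proof -
    have "wedge r s (int r - 1) (int s - int nz + 1) 0 \<inter> wedge r s (int r) (int s - int nz) 0 = {}"
      "wedge r s (int r - 1) (int s - int nz + 1) 0 \<inter> wedge r s (int r - 1) (int s - int nz) 1 = {}"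
      "wedge r s (int r) (int s - int nz) 0 \<inter> wedge r s (int r - 1) (int s - int nz) 1 = {}"
      "wedge r s (int r - 1) (int s - int nz + 1) 0 \<inter> wedge r s (int r) (int s - int nz - 1) 1 = {}"
      "wedge r s (int r) (int s - int nz) 0 \<inter> wedge r s (int r) (int s - int nz - 1) 1 = {}"
      "wedge r s (int r - 1) (int s - int nz) 1 \<inter> wedge r s (int r) (int s - int nz - 1) 1 = {}"
      by (rule wedge_disjoint; simp)+
    note dis = this
    have "card (K0_basis nx ny nz r s) =
        card (expos nx ny nz (0, int r - int ny - 1, 0) \<times> wedge r s (int r - 1) (int s - int nz + 1) 0) +
        card (expos nx ny nz (0, int r - int ny, 1) \<times> wedge r s (int r) (int s - int nz) 0) +
        card (expos nx ny nz (0, int r - int ny, 0) \<times> wedge r s (int r - 1) (int s - int nz) 1) +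
        card (expos nx ny nz (0, int r - int ny + 1, 1) \<times> wedge r s (int r) (int s - int nz - 1) 1)"
      unfolding K0_basis_def using dis
      by (subst card_Un_disjoint, (auto simp: finite_monos_of finite_wedge)[3])+ simp
    then show ?thesis
      by (simp only: card_cartesian_product expos.simps A0_def[symmetric] B0_def[symmetric] i m mA w)
        (simp add: B_def B1_def)
  qed
  moreover have "(nx + 1) * A * B1 + (nx + 1) * A1 * B = A0 * (r * B1) + A * (nz + 1) * B + A * (r * B) + A1 * (nz + 1) * B0"
  proof -
    have "(nx + 1) * A * B1 + (nx + 1) * A1 * B = q * A * B1 + A * ((b + 1) * B1) + ((q + 1) * A1) * B + A1 * (b * B)"
      using assms by (simp add: algebra_simps)
    also have "\<dots> = r * A0 * B1 + A * (nz * B) + (r + 1) * A * B + A1 * ((nz + 1) * B0)"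
      by (simp only: A0[symmetric] B1 A1 B0)
    also have "\<dots> = A0 * (r * B1) + A * (nz + 1) * B + A * (r * B) + A1 * (nz + 1) * B0"
      by (simp add: algebra_simps)
    finally show ?thesis .
  qed
  ultimately show ?thesis by simp
qed

section \<open>The kernel of the upper left block\<close>

definition unit :: "nat \<Rightarrow> mono" where
  "unit j = Poly_Mapping.single j 1"

lemma lookup_unit: "lookup (unit j) k = (if j = k then 1 else 0)"
  by (simp add: unit_def lookup_single when_def)

lemma unit_inj [simp]: "unit j = unit k \<longleftrightarrow> j = k"
  by (metis lookup_unit zero_neq_one)

lemma keys_unit [simp]: "keys (unit j) = {j}"
  by (simp add: unit_def)

lemma deg_unit [simp]: "deg (unit j) = 1"
  by (simp add: unit_def)

lemma unit_nonzero [simp]: "unit j \<noteq> 0" "0 \<noteq> unit j"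
  by (metis deg_unit deg_zero zero_neq_one)+

lemma inj_on_unit: "inj_on unit A"
  by (simp add: inj_on_def)

lemma monos_of_unit: "monos_of m 1 = unit ` {0..m}"
proof -
  have "\<exists>j\<in>{0..m}. \<sigma> = Poly_Mapping.single j 1" if "keys \<sigma> \<subseteq> {0..m}" "deg \<sigma> = 1" for \<sigma>
  proof -
    from that have "keys \<sigma> \<noteq> {}" by (auto simp: deg_def)
    then obtain j where j: "j \<in> keys \<sigma>" by blast
    then have "\<sigma> - Poly_Mapping.single j 1 + Poly_Mapping.single j 1 = \<sigma>"
      using minus_single_add[of \<sigma> j] by (simp add: in_keys_iff)
    moreover from this have "deg (\<sigma> - Poly_Mapping.single j 1) + 1 = 1"
      using that by (metis deg_add deg_single)
    then have "\<sigma> - Poly_Mapping.single j 1 = 0" by (simp add: deg_eq_0_iff)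
    ultimately have "\<sigma> = Poly_Mapping.single j 1" by simp
    with j that show ?thesis by auto
  qed
  then show ?thesis using monos_of_int[of m 1] by (auto simp: unit_def)
qed

text \<open>The additive form of the parameters removes the integer subtractions in the degrees.
  \<open>F\<close> is the overdetermined system, with f_0 at index 0.\<close>

locale bilinear_system =
  fixes nx ny nz r s q b :: nat and F :: "nat \<Rightarrow> 'a::{alg_closed_field, field_char_0} xyz_poly"
  assumes pos: "1 \<le> ny" and r: "r = ny + q" and s: "s = nz + b" and nx: "nx = q + b"
    and F: "\<And>i. i \<le> r + s \<Longrightarrow> F i \<in> S nx ny nz (mdeg r i)"
begin

abbreviation U :: "nat set" where "U \<equiv> {1..r}"
abbreviation W :: "nat set" where "W \<equiv> {r + 1..r + s}"

lemma r_pos: "r \<ge> 1" using pos r by simp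

lemma int_eqs: "int r - int ny = int q" "int s - int nz = int b" by (simp_all add: r s)

lemma wedge_U: "I \<in> wedge r s (int r) c e \<Longrightarrow> U \<subseteq> I"
proof -
  assume "I \<in> wedge r s (int r) c e"
  then have "card (I \<inter> U) = r" by (simp add: wedge_def)
  then have "I \<inter> U = U" by (intro card_subset_eq) auto
  then show "U \<subseteq> I" by blast
qed

lemma mem_omega1: "I \<in> omega1 nz r s \<longleftrightarrow> (\<exists>I'\<subseteq>W. card I' = Suc b \<and> I = U \<union> I')"
proof
  assume I: "I \<in> omega1 nz r s"
  then have w: "I \<in> wedge r s (int r) (int (Suc b)) (int 0)"
    by (simp add: omega1_def int_eqs add.commute)
  then have "U \<subseteq> I" by (rule wedge_U)
  moreover have "I \<subseteq> {0..r + s}" "card (I \<inter> W) = Suc b" "card (I \<inter> {0}) = 0"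
    using w unfolding wedge_iff by blast+
  moreover from this have "I \<inter> {0} = {}" by (simp add: card_eq_0_iff)
  moreover have "{0..r + s} = U \<union> W \<union> {0}" by auto
  ultimately have "I = U \<union> (I \<inter> W)" by blast
  with \<open>card (I \<inter> W) = Suc b\<close> show "\<exists>I'\<subseteq>W. card I' = Suc b \<and> I = U \<union> I'" by blast
next
  assume "\<exists>I'\<subseteq>W. card I' = Suc b \<and> I = U \<union> I'"
  then obtain I' where I': "I' \<subseteq> W" "card I' = Suc b" "I = U \<union> I'" by blast
  have "I \<inter> U = U" "I \<inter> W = I'" "I \<inter> {0} = {}" using I' by auto
  then have "I \<in> wedge r s (int r) (int (Suc b)) (int 0)"
    using I' unfolding wedge_iff by auto
  then show "I \<in> omega1 nz r s" by (simp add: omega1_def int_eqs add.commute)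
qed

lemma wedge_zero: "I \<in> wedge r s a c e \<Longrightarrow> I - {0} \<subseteq> U \<union> W"
  by (auto simp: wedge_def)

lemma mem_omega2: "I \<in> omega2 nz r s \<longleftrightarrow> (\<exists>I'\<subseteq>W. card I' = b \<and> I = insert 0 (U \<union> I'))"
proof
  assume I: "I \<in> omega2 nz r s"
  then have w: "I \<in> wedge r s (int r) (int b) (int 1)"
    by (simp add: omega2_def int_eqs)
  then have "U \<subseteq> I" by (rule wedge_U)
  moreover have "card (I \<inter> W) = b" "card (I \<inter> {0}) = 1"
    using w unfolding wedge_iff by blast+
  moreover from this have "I \<inter> {0} \<noteq> {}" by (metis card.empty zero_neq_one)
  then have "0 \<in> I" by blast
  moreover have "I - {0} \<subseteq> U \<union> W" using w by (rule wedge_zero)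
  ultimately have "I = insert 0 (U \<union> (I \<inter> W))" by blast
  with \<open>card (I \<inter> W) = b\<close> show "\<exists>I'\<subseteq>W. card I' = b \<and> I = insert 0 (U \<union> I')" by blast
next
  assume "\<exists>I'\<subseteq>W. card I' = b \<and> I = insert 0 (U \<union> I')"
  then obtain I' where I': "I' \<subseteq> W" "card I' = b" "I = insert 0 (U \<union> I')" by blast
  have "I \<inter> U = U" "I \<inter> W = I'" "I \<inter> {0} = {0}" using I' by auto
  then have "I \<in> wedge r s (int r) (int b) (int 1)"
    using I' unfolding wedge_iff by auto
  then show "I \<in> omega2 nz r s" by (simp add: omega2_def int_eqs)
qed

lemma mem_K1_basis: "(\<sigma>, I) \<in> K1_basis nx ny nz r s \<longleftrightarrow>
    (\<exists>j\<le>nx. \<exists>\<tau> I'. keys \<tau> \<subseteq> {0..ny} \<and> I' \<subseteq> W \<and> \<sigma> = (unit j, \<tau>, 0) \<and>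
      (deg \<tau> = q \<and> card I' = Suc b \<and> I = U \<union> I' \<or> deg \<tau> = Suc q \<and> card I' = b \<and> I = insert 0 (U \<union> I')))"
proof -
  have 1: "int q + 1 = int (Suc q)" by simp
  have e: "\<sigma> \<in> expos nx ny nz (1, int d, 0) \<longleftrightarrow> (\<exists>j\<le>nx. \<exists>\<tau>. keys \<tau> \<subseteq> {0..ny} \<and> deg \<tau> = d \<and> \<sigma> = (unit j, \<tau>, 0))" for d
    by (cases \<sigma>) (auto simp: monos_of_0 monos_of_unit monos_of_int)
  show ?thesis
    unfolding K1_basis_def int_eqs 1 Un_iff mem_Times_iff mem_omega1 mem_omega2 fst_conv snd_conv e
    by blast
qed

lemma K1_exterior_part: "(\<sigma>, I) \<in> K1_basis nx ny nz r s \<Longrightarrow> finite I \<and> card I = nx + ny + 1 \<and> I \<subseteq> {0..r + s}"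
proof -
  assume "(\<sigma>, I) \<in> K1_basis nx ny nz r s"
  then obtain I' where I': "I' \<subseteq> W" "card I' = Suc b \<and> I = U \<union> I' \<or> card I' = b \<and> I = insert 0 (U \<union> I')"
    unfolding mem_K1_basis by blast
  have fin: "finite I'" using I'(1) finite_subset by blast
  have dis: "U \<inter> I' = {}" "0 \<notin> U \<union> I'" using I'(1) by auto
  have "card (U \<union> I') = r + card I'" using fin dis by (subst card_Un_disjoint) auto
  then show ?thesis using I' fin dis r nx by auto
qed

text \<open>A row of the matrix applied to a vector, without choosing an order of the bases.\<close>

definition rsum :: "(label \<Rightarrow> 'a) \<Rightarrow> label \<Rightarrow> 'a" where
  "rsum v rl = (\<Sum>cl\<in>K1_basis nx ny nz r s. entry F rl cl * v cl)"

text \<open>The coefficient of \<open>\<partial>y^\<tau> z^\<zeta>\<close> in \<psi> applied to F_i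
  and the component of \<open>v\<close> at \<open>I\<close>. In x-degree 0 and z-degree 0 the
  monomial \<theta> determines the label on which it acts.\<close>

definition act :: "(label \<Rightarrow> 'a) \<Rightarrow> nat \<Rightarrow> mono \<Rightarrow> mono \<Rightarrow> nat set \<Rightarrow> 'a" where
  "act v i \<tau> \<zeta> I = (\<Sum>\<theta>\<in>{\<theta>\<in>keys (F i). snd (snd \<theta>) = \<zeta>}.
     lookup (F i) \<theta> * v ((fst \<theta>, \<tau> + fst (snd \<theta>), 0), I))"

lemma finite_K1: "finite (K1_basis nx ny nz r s)"
  unfolding K1_basis_def omega1_def omega2_def by (simp add: finite_monos_of finite_wedge)

text \<open>Labels and monomials correspond by \<theta> = (\<sigma>_x, \<sigma>_y - \<tau>,
  \<zeta>). The two index sets match only on nonzero terms, which is why zero terms are discarded on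
  both sides first.\<close>

lemma sum_pcoef:
  assumes v: "\<And>cl. cl \<notin> K1_basis nx ny nz r s \<Longrightarrow> v cl = 0"
  shows "(\<Sum>\<sigma>\<in>{\<sigma>. (\<sigma>, I) \<in> K1_basis nx ny nz r s}. pcoef (F i) \<sigma> (0, \<tau>, \<zeta>) * v (\<sigma>, I)) = act v i \<tau> \<zeta> I"
    (is "sum ?g ?A = _")
proof -
  let ?M = "{\<theta>\<in>keys (F i). snd (snd \<theta>) = \<zeta>}"
  let ?h = "\<lambda>\<theta>. lookup (F i) \<theta> * v ((fst \<theta>, \<tau> + fst (snd \<theta>), 0), I)"
  have "?A \<subseteq> fst ` K1_basis nx ny nz r s" by force
  then have fin: "finite ?A" using finite_K1 finite_subset by blast
  have zl: "mono_le 0 \<sigma>" for \<sigma> by (simp add: mono_le_def)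
  have gval: "?g (unit j, \<rho>, 0) = (if mono_le \<tau> \<rho> then lookup (F i) (unit j, \<rho> - \<tau>, \<zeta>) * v ((unit j, \<rho>, 0), I) else 0)" for j \<rho>
    by (simp add: zl)
  have "sum ?g ?A = sum ?g {\<sigma> \<in> ?A. ?g \<sigma> \<noteq> 0}"
    using fin by (intro sum.mono_neutral_right) auto
  also have "\<dots> = sum ?h {\<theta> \<in> ?M. ?h \<theta> \<noteq> 0}"
  proof (rule sum.reindex_bij_witness
      [of _ "\<lambda>\<theta>. (fst \<theta>, \<tau> + fst (snd \<theta>), 0)" "\<lambda>\<sigma>. (fst \<sigma>, fst (snd \<sigma>) - \<tau>, \<zeta>)"])
    fix \<sigma> assume \<sigma>: "\<sigma> \<in> {\<sigma> \<in> ?A. ?g \<sigma> \<noteq> 0}"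
    then obtain j \<rho> where \<sigma>_eq: "\<sigma> = (unit j, \<rho>, 0)" unfolding mem_Collect_eq mem_K1_basis by blast
    from \<sigma> have nz: "?g \<sigma> \<noteq> 0" by blast
    then have le: "mono_le \<tau> \<rho>" and lk: "lookup (F i) (unit j, \<rho> - \<tau>, \<zeta>) \<noteq> 0"
      and vnz: "v ((unit j, \<rho>, 0), I) \<noteq> 0"
      unfolding \<sigma>_eq gval by (auto split: if_splits)
    have add: "\<tau> + (\<rho> - \<tau>) = \<rho>" using mono_le_add[of "\<rho> - \<tau>" \<tau> \<rho>] le by (simp add: add.commute)
    show "(fst (fst \<sigma>, fst (snd \<sigma>) - \<tau>, \<zeta>), \<tau> + fst (snd (fst \<sigma>, fst (snd \<sigma>) - \<tau>, \<zeta>)), 0) = \<sigma>"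
      unfolding \<sigma>_eq by (simp add: add)
    show "(fst \<sigma>, fst (snd \<sigma>) - \<tau>, \<zeta>) \<in> {\<theta> \<in> ?M. ?h \<theta> \<noteq> 0}"
      using lk vnz unfolding \<sigma>_eq by (simp add: add in_keys_iff)
    show "?h (fst \<sigma>, fst (snd \<sigma>) - \<tau>, \<zeta>) = ?g \<sigma>"
      using le unfolding \<sigma>_eq by (simp add: add zl)
  next
    fix \<theta> assume \<theta>: "\<theta> \<in> {\<theta> \<in> ?M. ?h \<theta> \<noteq> 0}"
    obtain \<theta>x \<theta>y where \<theta>_eq: "\<theta> = (\<theta>x, \<theta>y, \<zeta>)" using \<theta> by (cases \<theta>) auto
    have le: "mono_le \<tau> (\<tau> + \<theta>y)" by (simp add: mono_le_def lookup_add)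
    have nz: "lookup (F i) (\<theta>x, \<theta>y, \<zeta>) * v ((\<theta>x, \<tau> + \<theta>y, 0), I) \<noteq> 0" using \<theta> by (simp add: \<theta>_eq)
    then have mem: "((\<theta>x, \<tau> + \<theta>y, 0), I) \<in> K1_basis nx ny nz r s" using v by (metis mult_zero_right)
    then obtain j where "\<theta>x = unit j" unfolding mem_K1_basis by blast
    then show "(fst \<theta>, \<tau> + fst (snd \<theta>), 0) \<in> {\<sigma> \<in> ?A. ?g \<sigma> \<noteq> 0}"
      using nz le mem by (simp add: \<theta>_eq zl)
    show "(fst (fst \<theta>, \<tau> + fst (snd \<theta>), 0), fst (snd (fst \<theta>, \<tau> + fst (snd \<theta>), 0)) - \<tau>, \<zeta>) = \<theta>"
      by (simp add: \<theta>_eq)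
  qed
  also have "\<dots> = act v i \<tau> \<zeta> I"
    unfolding act_def by (intro sum.mono_neutral_left) auto
  finally show ?thesis .
qed

lemma wsgn_insert_self: "wsgn i (insert i K) = wsgn i K"
proof -
  have "{j \<in> insert i K. j < i} = {j \<in> K. j < i}" by auto
  then show ?thesis by (simp add: wsgn_def)
qed

text \<open>A column meets the row with exterior part \<open>K\<close> only if its own exterior part
  is \<open>K\<close> with one index inserted.\<close>

lemma rsum_eq:
  assumes v: "\<And>cl. cl \<notin> K1_basis nx ny nz r s \<Longrightarrow> v cl = 0"
  shows "rsum v ((0, \<tau>, \<zeta>), K) = (\<Sum>i\<in>{0..r + s} - K. wsgn i K * act v i \<tau> \<zeta> (insert i K))"
proof -
  let ?B = "K1_basis nx ny nz r s"
  let ?g = "\<lambda>i cl. if K = snd cl - {i} then wsgn i (snd cl) * pcoef (F i) (fst cl) (0, \<tau>, \<zeta>) * v cl else 0"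
  have "rsum v ((0, \<tau>, \<zeta>), K) = (\<Sum>cl\<in>?B. \<Sum>i\<in>{0..r + s}. if i \<in> snd cl then ?g i cl else 0)"
    unfolding rsum_def entry_def
  proof (intro sum.cong refl)
    fix cl assume "cl \<in> ?B"
    then have sub: "snd cl \<subseteq> {0..r + s}" using K1_exterior_part[of "fst cl" "snd cl"] by auto
    have "(\<Sum>i\<in>snd cl. if snd ((0, \<tau>, \<zeta>), K) = snd cl - {i} then wsgn i (snd cl) * pcoef (F i) (fst cl) (fst ((0, \<tau>, \<zeta>), K)) else 0) * v cl
        = (\<Sum>i\<in>snd cl. ?g i cl)"
      by (simp add: sum_distrib_right if_distrib[of "\<lambda>x. x * _"] cong: if_cong)
    also have "\<dots> = (\<Sum>i\<in>{0..r + s}. if i \<in> snd cl then ?g i cl else 0)"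
      using sub by (intro sum.mono_neutral_cong_left) auto
    finally show "(\<Sum>i\<in>snd cl. if snd ((0, \<tau>, \<zeta>), K) = snd cl - {i} then wsgn i (snd cl) * pcoef (F i) (fst cl) (fst ((0, \<tau>, \<zeta>), K)) else 0) * v cl
        = (\<Sum>i\<in>{0..r + s}. if i \<in> snd cl then ?g i cl else 0)" .
  qed
  also have "\<dots> = (\<Sum>i\<in>{0..r + s}. \<Sum>cl\<in>?B. if i \<in> snd cl then ?g i cl else 0)"
    by (rule sum.swap)
  also have "\<dots> = (\<Sum>i\<in>{0..r + s}. if i \<in> K then 0 else wsgn i K * act v i \<tau> \<zeta> (insert i K))"
  proof (intro sum.cong refl)
    fix i
    show "(\<Sum>cl\<in>?B. if i \<in> snd cl then ?g i cl else 0) = (if i \<in> K then 0 else wsgn i K * act v i \<tau> \<zeta> (insert i K))"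
    proof (cases "i \<in> K")
      case True
      then show ?thesis by (auto intro!: sum.neutral)
    next
      case False
      have "(\<Sum>cl\<in>?B. if i \<in> snd cl then ?g i cl else 0) =
          (\<Sum>cl\<in>{\<sigma>. (\<sigma>, insert i K) \<in> ?B} \<times> {insert i K}. wsgn i K * (pcoef (F i) (fst cl) (0, \<tau>, \<zeta>) * v cl))"
      proof -
        let ?h = "\<lambda>cl. wsgn i K * (pcoef (F i) (fst cl) (0, \<tau>, \<zeta>) * v cl)"
        have iff: "(i \<in> I \<and> K = I - {i}) \<longleftrightarrow> I = insert i K" for I using False by blast
        have "(\<Sum>cl\<in>?B. if i \<in> snd cl then ?g i cl else 0) = (\<Sum>cl\<in>?B. if snd cl = insert i K then ?h cl else 0)"
        proof (intro sum.cong refl)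
          fix cl :: label
          show "(if i \<in> snd cl then ?g i cl else 0) = (if snd cl = insert i K then ?h cl else 0)"
          proof (cases "snd cl = insert i K")
            case True
            then show ?thesis using False by (simp add: wsgn_insert_self mult.assoc)
          next
            case neq: False
            then show ?thesis using iff[of "snd cl"] by auto
          qed
        qed
        also have "\<dots> = sum ?h {cl \<in> ?B. snd cl = insert i K}"
          using finite_K1 by (simp add: sum.inter_filter)
        also have "{cl \<in> ?B. snd cl = insert i K} = {\<sigma>. (\<sigma>, insert i K) \<in> ?B} \<times> {insert i K}"
        proof (rule Set.set_eqI)
          fix cl :: label
          obtain \<sigma> I where cl: "cl = (\<sigma>, I)" by (cases cl)
          show "cl \<in> {cl \<in> ?B. snd cl = insert i K} \<longleftrightarrow> cl \<in> {\<sigma>. (\<sigma>, insert i K) \<in> ?B} \<times> {insert i K}"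
            unfolding cl mem_Collect_eq mem_Times_iff fst_conv snd_conv singleton_iff by metis
        qed
        finally show ?thesis .
      qed
      also have "\<dots> = wsgn i K * (\<Sum>\<sigma>\<in>{\<sigma>. (\<sigma>, insert i K) \<in> ?B}. pcoef (F i) \<sigma> (0, \<tau>, \<zeta>) * v (\<sigma>, insert i K))"
        by (simp add: sum.cartesian_product' sum_distrib_left del: sum.cartesian_product)
      also have "(\<Sum>\<sigma>\<in>{\<sigma>. (\<sigma>, insert i K) \<in> ?B}. pcoef (F i) \<sigma> (0, \<tau>, \<zeta>) * v (\<sigma>, insert i K)) = act v i \<tau> \<zeta> (insert i K)"
        by (rule sum_pcoef) (rule v)
      finally show ?thesis using False by simp
    qed
  qed
  also have "\<dots> = (\<Sum>i\<in>{0..r + s} - K. wsgn i K * act v i \<tau> \<zeta> (insert i K))"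
    by (intro sum.mono_neutral_cong_right) auto
  finally show ?thesis .
qed

abbreviation cA :: "nat \<Rightarrow> nat \<Rightarrow> nat \<Rightarrow> 'a" where "cA i j k \<equiv> lookup (F i) (unit j, unit k, 0)"
abbreviation cB :: "nat \<Rightarrow> nat \<Rightarrow> nat \<Rightarrow> 'a" where "cB i j k \<equiv> lookup (F i) (unit j, 0, unit k)"

lemma act_superset:
  assumes "finite M" "{\<theta>\<in>keys (F i). snd (snd \<theta>) = \<zeta>} \<subseteq> M" "\<And>\<theta>. \<theta> \<in> M \<Longrightarrow> snd (snd \<theta>) = \<zeta>"
  shows "act v i \<tau> \<zeta> I = (\<Sum>\<theta>\<in>M. lookup (F i) \<theta> * v ((fst \<theta>, \<tau> + fst (snd \<theta>), 0), I))"
  unfolding act_def using assms by (intro sum.mono_neutral_left) (auto simp: in_keys_iff)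

lemma keys_F: "i \<le> r + s \<Longrightarrow> keys (F i) \<subseteq> expos nx ny nz (mdeg r i)"
  using F by (simp add: S_def)

lemma act_U:
  assumes "i \<in> U"
  shows "act v i \<tau> \<zeta> I = (if \<zeta> = 0 then \<Sum>j\<le>nx. \<Sum>k\<le>ny. cA i j k * v ((unit j, \<tau> + unit k, 0), I) else 0)"
proof -
  have k: "keys (F i) \<subseteq> unit ` {0..nx} \<times> unit ` {0..ny} \<times> {0}"
    using keys_F[of i] assms by (auto simp: mdeg_def monos_of_0 monos_of_unit)
  show ?thesis
  proof (cases "\<zeta> = 0")
    case False
    then have "{\<theta>\<in>keys (F i). snd (snd \<theta>) = \<zeta>} = {}" using k by auto
    then show ?thesis using False unfolding act_def by (simp only: sum.empty) simp
  next
    case True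
    have "act v i \<tau> \<zeta> I = (\<Sum>\<theta>\<in>unit ` {0..nx} \<times> unit ` {0..ny} \<times> {0}. lookup (F i) \<theta> * v ((fst \<theta>, \<tau> + fst (snd \<theta>), 0), I))"
      using k True by (intro act_superset) auto
    also have "\<dots> = (\<Sum>j\<le>nx. \<Sum>k\<le>ny. cA i j k * v ((unit j, \<tau> + unit k, 0), I))"
      by (simp add: sum.cartesian_product' sum.reindex[OF inj_on_unit] atLeast0AtMost del: sum.cartesian_product)
    finally show ?thesis using True by simp
  qed
qed

lemma act_W:
  assumes "i \<in> W"
  shows "act v i \<tau> 0 I = 0"
    "k \<le> nz \<Longrightarrow> act v i \<tau> (unit k) I = (\<Sum>j\<le>nx. cB i j k * v ((unit j, \<tau>, 0), I))"
proof -
  have k: "keys (F i) \<subseteq> unit ` {0..nx} \<times> {0} \<times> unit ` {0..nz}"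
    using keys_F[of i] assms by (auto simp: mdeg_def monos_of_0 monos_of_unit)
  then have "{\<theta>\<in>keys (F i). snd (snd \<theta>) = 0} = {}" by auto
  then show "act v i \<tau> 0 I = 0" unfolding act_def by (simp only: sum.empty)
  have "act v i \<tau> (unit k) I = (\<Sum>\<theta>\<in>unit ` {0..nx} \<times> {0} \<times> {unit k}. lookup (F i) \<theta> * v ((fst \<theta>, \<tau> + fst (snd \<theta>), 0), I))"
    using k by (intro act_superset) auto
  also have "\<dots> = (\<Sum>j\<le>nx. cB i j k * v ((unit j, \<tau>, 0), I))"
    by (simp add: sum.cartesian_product' sum.reindex[OF inj_on_unit] atLeast0AtMost del: sum.cartesian_product)
  finally show "act v i \<tau> (unit k) I = (\<Sum>j\<le>nx. cB i j k * v ((unit j, \<tau>, 0), I))" .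
qed

lemma act_0:
  shows "act v 0 \<tau> 0 I = 0"
    "k \<le> nz \<Longrightarrow> act v 0 \<tau> (unit k) I = (\<Sum>j\<le>nx. \<Sum>l\<le>ny. lookup (F 0) (unit j, unit l, unit k) * v ((unit j, \<tau> + unit l, 0), I))"
proof -
  have k: "keys (F 0) \<subseteq> unit ` {0..nx} \<times> unit ` {0..ny} \<times> unit ` {0..nz}"
    using keys_F[of 0] by (auto simp: mdeg_def monos_of_unit)
  then have "{\<theta>\<in>keys (F 0). snd (snd \<theta>) = 0} = {}" by auto
  then show "act v 0 \<tau> 0 I = 0" unfolding act_def by (simp only: sum.empty)
  have "act v 0 \<tau> (unit k) I = (\<Sum>\<theta>\<in>unit ` {0..nx} \<times> unit ` {0..ny} \<times> {unit k}. lookup (F 0) \<theta> * v ((fst \<theta>, \<tau> + fst (snd \<theta>), 0), I))"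
    using k by (intro act_superset) auto
  also have "\<dots> = (\<Sum>j\<le>nx. \<Sum>l\<le>ny. lookup (F 0) (unit j, unit l, unit k) * v ((unit j, \<tau> + unit l, 0), I))"
    by (simp add: sum.cartesian_product' sum.reindex[OF inj_on_unit] atLeast0AtMost del: sum.cartesian_product)
  finally show "act v 0 \<tau> (unit k) I = (\<Sum>j\<le>nx. \<Sum>l\<le>ny. lookup (F 0) (unit j, unit l, unit k) * v ((unit j, \<tau> + unit l, 0), I))" .
qed

text \<open>Without z in the row only forms of \<open>U\<close> contribute, and all of
  \<open>U\<close> except i is already present in \<open>K\<close>.\<close>

lemma rsum_y:
  assumes v: "\<And>cl. cl \<notin> K1_basis nx ny nz r s \<Longrightarrow> v cl = 0"
    and K: "i \<in> U" "i \<notin> K" "U - {i} \<subseteq> K"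
  shows "rsum v ((0, \<tau>, 0), K) = wsgn i K * (\<Sum>j\<le>nx. \<Sum>k\<le>ny. cA i j k * v ((unit j, \<tau> + unit k, 0), insert i K))"
proof -
  have "rsum v ((0, \<tau>, 0), K) = (\<Sum>i'\<in>{0..r + s} - K. wsgn i' K * act v i' \<tau> 0 (insert i' K))"
    by (rule rsum_eq[OF v])
  also have "\<dots> = (\<Sum>i'\<in>{i}. wsgn i' K * act v i' \<tau> 0 (insert i' K))"
  proof (rule sum.mono_neutral_right)
    show "\<forall>i'\<in>{0..r + s} - K - {i}. wsgn i' K * act v i' \<tau> 0 (insert i' K) = 0"
    proof
      fix i' assume "i' \<in> {0..r + s} - K - {i}"
      moreover have "{0..r + s} \<subseteq> insert 0 (U \<union> W)" by auto
      ultimately have "i' = 0 \<or> i' \<in> W" using K by blast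
      then show "wsgn i' K * act v i' \<tau> 0 (insert i' K) = 0" using act_W(1) act_0(1) by auto
    qed
  qed (use K in auto)
  finally show ?thesis using K(1) by (simp add: act_U)
qed

text \<open>With all of \<open>U\<close> present only f_0 and the forms of \<open>W\<close>
  contribute; index 0 has sign +1, being the smallest.\<close>

lemma rsum_z:
  assumes v: "\<And>cl. cl \<notin> K1_basis nx ny nz r s \<Longrightarrow> v cl = 0"
    and K: "U \<subseteq> K" and k: "k \<le> nz"
  shows "rsum v ((0, \<tau>, unit k), K) = (if 0 \<in> K then 0 else
      (\<Sum>j\<le>nx. \<Sum>l\<le>ny. lookup (F 0) (unit j, unit l, unit k) * v ((unit j, \<tau> + unit l, 0), insert 0 K))) +
    (\<Sum>i\<in>W - K. wsgn i K * (\<Sum>j\<le>nx. cB i j k * v ((unit j, \<tau>, 0), insert i K)))"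
proof -
  have w0: "wsgn 0 K = (1 :: 'a)" by (simp add: wsgn_def)
  have "insert 0 (U' \<union> W') - K = (if 0 \<in> K then {} else {0}) \<union> (W' - K)" if "U' \<subseteq> K" for U' W'
    using that by auto
  moreover have "{0..r + s} = insert 0 (U \<union> W)" by auto
  ultimately have eq: "{0..r + s} - K = (if 0 \<in> K then {} else {0}) \<union> (W - K)" using K by metis
  have "rsum v ((0, \<tau>, unit k), K) = (\<Sum>i'\<in>{0..r + s} - K. wsgn i' K * act v i' \<tau> (unit k) (insert i' K))"
    by (rule rsum_eq[OF v])
  also have "\<dots> = (\<Sum>i'\<in>(if 0 \<in> K then {} else {0}). wsgn i' K * act v i' \<tau> (unit k) (insert i' K)) +
      (\<Sum>i'\<in>W - K. wsgn i' K * act v i' \<tau> (unit k) (insert i' K))"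
    unfolding eq by (intro sum.union_disjoint) auto
  also have "(\<Sum>i'\<in>W - K. wsgn i' K * act v i' \<tau> (unit k) (insert i' K)) =
      (\<Sum>i\<in>W - K. wsgn i K * (\<Sum>j\<le>nx. cB i j k * v ((unit j, \<tau>, 0), insert i K)))"
    using k by (intro sum.cong refl) (subst act_W(2), auto)
  finally show ?thesis using k by (simp add: act_0(2) w0)
qed

end

text \<open>Putting \<open>U\<close>, or 0 and \<open>U\<close>, in front of an exterior part
  multiplies the signs of all indices of \<open>W\<close> by one common factor, which then drops out
  of the equations.\<close>

lemma wsgn_Un_below:
  assumes "finite A" "finite B" "\<And>a. a \<in> A \<Longrightarrow> a < i" "A \<inter> B = {}"
  shows "wsgn i (A \<union> B) = (- 1) ^ card A * wsgn i B"
proof -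
  have "{j \<in> A \<union> B. j < i} = A \<union> {j \<in> B. j < i}" using assms(3) by auto
  moreover have "card (A \<union> {j \<in> B. j < i}) = card A + card {j \<in> B. j < i}"
    using assms by (intro card_Un_disjoint) auto
  ultimately show ?thesis by (simp add: wsgn_def power_add)
qed

section \<open>From the rows of the matrix to the Koszul complex\<close>

lemma contract_y_unit: "contract_y k e = (\<lambda>(\<tau>, \<nu>, I). e (\<tau> + unit k, \<nu>, I))"
  and times_z_unit: "times_z k e = (\<lambda>(\<tau>, \<nu>, I). if lookup \<nu> k = 0 then 0 else e (\<tau>, \<nu> - unit k, I))"
  unfolding contract_y_def times_z_def unit_def by (rule refl)+

context bilinear_system
begin

text \<open>Translates vanishing rows into a cycle of x-degree 1: adjoining \<open>U\<close> and the
  trivial z-exponent to \<open>h\<close> lands on labels that boundaries cannot reach.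
  \<open>H1\<close> is the equation at labels missing one index of \<open>U\<close>,
  \<open>H2\<close> the one at labels whose z-exponent is a single variable.\<close>

lemma killed_family_zero:
  fixes h :: "nat \<Rightarrow> mono \<Rightarrow> nat set \<Rightarrow> 'a"
  assumes fin: "finite J" "finite Y" "finite Z"
    and card: "r < d + card Y" "s < e + card Z"
    and nozero: "\<And>x y z. \<exists>j\<in>J. x j \<noteq> 0 \<Longrightarrow> \<exists>k\<in>Y. y k \<noteq> 0 \<Longrightarrow> \<exists>k\<in>Z. z k \<noteq> 0 \<Longrightarrow>
      (\<exists>i\<in>U. (\<Sum>k\<in>Y. y k * (\<Sum>j\<in>J. x j * cA i j k)) \<noteq> 0) \<or>
      (\<exists>i\<in>W. (\<Sum>k\<in>Z. z k * (\<Sum>j\<in>J. x j * cB i j k)) \<noteq> 0)"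
    and H1: "\<And>i \<tau> I. i \<in> U \<Longrightarrow> keys \<tau> \<subseteq> Y \<Longrightarrow> Suc (deg \<tau>) = d \<Longrightarrow> I \<subseteq> W \<Longrightarrow> card I = e \<Longrightarrow>
      (\<Sum>k\<in>Y. \<Sum>j\<in>J. cA i j k * h j (\<tau> + unit k) I) = 0"
    and H2: "\<And>k \<tau> I. k \<in> Z \<Longrightarrow> keys \<tau> \<subseteq> Y \<Longrightarrow> deg \<tau> = d \<Longrightarrow> I \<subseteq> W \<Longrightarrow> Suc (card I) = e \<Longrightarrow>
      (\<Sum>i\<in>W - I. wsgn i I * (\<Sum>j\<in>J. cB i j k * h j \<tau> (insert i I))) = 0"
    and concl: "j0 \<in> J" "keys \<tau>0 \<subseteq> Y" "deg \<tau>0 = d" "I0 \<subseteq> W" "card I0 = e"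
  shows "h j0 \<tau>0 I0 = 0"
proof -
  let ?T = "strand U W Y Z d e" and ?P = "pairs U W Y Z"
  define c where "c j p = (case snd p of Inl k \<Rightarrow> cA (fst p) j k | Inr k \<Rightarrow> cB (fst p) j k)" for j and p :: "nat \<times> (nat + nat)"
  define g where "g j = (\<lambda>(\<tau>, \<nu>, I). if \<nu> = 0 \<and> U \<subseteq> I \<and> (\<tau>, \<nu>, I) \<in> ?T then h j \<tau> (I \<inter> W) else 0)" for j
  have UW: "U \<inter> W = {}" by auto
  have eq: "(\<Sum>j\<in>J. kdiff ?P (c j) (g j)) t = 0" for t
  proof -
    obtain \<tau> \<nu> I where t: "t = (\<tau>, \<nu>, I)" by (cases t)
    let ?x = "\<lambda>i k. \<Sum>j\<in>J. cA i j k * contract_y k (iota i (g j)) t"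
    let ?w = "\<lambda>i k. \<Sum>j\<in>J. cB i j k * times_z k (iota i (g j)) t"
    have "(\<Sum>j\<in>J. kdiff ?P (c j) (g j)) t = (\<Sum>j\<in>J. \<Sum>p\<in>?P. c j p * var_op (snd p) (iota (fst p) (g j)) t)"
      by (simp add: sum_fun_apply kdiff_def)
    also have "\<dots> = (\<Sum>p\<in>?P. \<Sum>j\<in>J. c j p * var_op (snd p) (iota (fst p) (g j)) t)"
      by (rule sum.swap)
    also have "\<dots> = (\<Sum>p\<in>U \<times> Inl ` Y. \<Sum>j\<in>J. c j p * var_op (snd p) (iota (fst p) (g j)) t) +
        (\<Sum>p\<in>W \<times> Inr ` Z. \<Sum>j\<in>J. c j p * var_op (snd p) (iota (fst p) (g j)) t)"
      unfolding pairs_def using fin by (intro sum.union_disjoint) auto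
    also have "(\<Sum>p\<in>U \<times> Inl ` Y. \<Sum>j\<in>J. c j p * var_op (snd p) (iota (fst p) (g j)) t) = (\<Sum>i\<in>U. \<Sum>k\<in>Y. ?x i k)"
      by (simp add: sum.cartesian_product' sum.reindex c_def var_op_def del: sum.cartesian_product)
    also have "(\<Sum>p\<in>W \<times> Inr ` Z. \<Sum>j\<in>J. c j p * var_op (snd p) (iota (fst p) (g j)) t) = (\<Sum>i\<in>W. \<Sum>k\<in>Z. ?w i k)"
      by (simp add: sum.cartesian_product' sum.reindex c_def var_op_def del: sum.cartesian_product)
    also have "(\<Sum>i\<in>W. \<Sum>k\<in>Z. ?w i k) = (\<Sum>k\<in>Z. \<Sum>i\<in>W. ?w i k)" by (rule sum.swap)
    also have "(\<Sum>i\<in>U. \<Sum>k\<in>Y. ?x i k) = 0"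
    proof (rule sum.neutral, rule ballI)
      fix i assume i: "i \<in> U"
      \<comment> \<open>The case condition describes the labels at which \<open>H1\<close> applies;
        at all others each term vanishes by the support of \<open>g\<close>.\<close>
      show "(\<Sum>k\<in>Y. ?x i k) = 0"
      proof (cases "\<nu> = 0 \<and> i \<notin> I \<and> U \<subseteq> insert i I \<and> keys \<tau> \<subseteq> Y \<and> I \<subseteq> U \<union> W \<and> Suc (deg \<tau>) = d \<and> card (I \<inter> W) = e")
        case True
        then have mem: "(\<tau> + unit k, \<nu>, insert i I) \<in> ?T" if "k \<in> Y" for k
        proof -
          have "insert i I \<inter> U = U" "insert i I \<inter> W = I \<inter> W" using True i by auto
          then show ?thesis using True i that by (auto simp: strand_def keys_add_nat deg_add)
        qed
        have IW: "insert i I \<inter> W = I \<inter> W" using i by auto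
        have "?x i k = wsgn i I * (\<Sum>j\<in>J. cA i j k * h j (\<tau> + unit k) (I \<inter> W))" if "k \<in> Y" for k
          using True mem[OF that] IW unfolding t
          by (simp add: contract_y_unit iota_def g_def sum_distrib_left mult_ac)
        then have "(\<Sum>k\<in>Y. ?x i k) = wsgn i I * (\<Sum>k\<in>Y. \<Sum>j\<in>J. cA i j k * h j (\<tau> + unit k) (I \<inter> W))"
          by (simp add: sum_distrib_left)
        then show ?thesis using H1[OF i, of \<tau> "I \<inter> W"] True by simp
      next
        case False
        have "contract_y k (iota i (g j)) t = 0" if "k \<in> Y" for k j
        proof (rule ccontr)
          assume nz: "contract_y k (iota i (g j)) t \<noteq> 0"
          then have *: "i \<notin> I" "\<nu> = 0" "U \<subseteq> insert i I" "(\<tau> + unit k, \<nu>, insert i I) \<in> ?T"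
            unfolding t by (auto simp: contract_y_unit iota_def g_def split: if_splits)
          then have "insert i I \<inter> U = U" "insert i I \<inter> W = I \<inter> W" using i by auto
          with * that i False show False by (auto simp: strand_def keys_add_nat deg_add)
        qed
        then show ?thesis by (intro sum.neutral) simp
      qed
    qed
    also have "(\<Sum>k\<in>Z. \<Sum>i\<in>W. ?w i k) = 0"
    proof (rule sum.neutral, rule ballI)
      fix k assume k: "k \<in> Z"
      show "(\<Sum>i\<in>W. ?w i k) = 0"
      proof (cases "\<nu> = unit k \<and> U \<subseteq> I \<and> keys \<tau> \<subseteq> Y \<and> I \<subseteq> U \<union> W \<and> deg \<tau> = d \<and> Suc (card (I \<inter> W)) = e")
        case True
        define I' where "I' = I \<inter> W"
        have I: "I = U \<union> I'" "I' \<subseteq> W" using True by (auto simp: I'_def)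
        have finI: "finite I'" using I(2) finite_subset by blast
        have \<nu>: "\<nu> - unit k = 0" "lookup \<nu> k \<noteq> 0" using True by (simp_all add: lookup_unit)
        have val: "?w i k = (if i \<in> I' then 0 else (- 1) ^ r * (wsgn i I' * (\<Sum>j\<in>J. cB i j k * h j \<tau> (insert i I'))))"
          if i: "i \<in> W" for i
        proof (cases "i \<in> I'")
          case True
          then have "i \<in> I" by (simp add: I'_def)
          then have "times_z k (iota i (g j)) t = 0" for j
            unfolding t times_z_unit iota_def by (auto split: if_splits)
          then show ?thesis using True by simp
        next
          case False
          then have iI: "i \<notin> I" using i by (auto simp: I'_def)
          have int: "insert i I \<inter> U = U" "insert i I \<inter> W = insert i I'" using True i by (auto simp: I'_def)
          have mem: "(\<tau>, 0, insert i I) \<in> ?T"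
          proof -
            have "keys \<tau> \<subseteq> Y" "insert i I \<subseteq> U \<union> W" "deg \<tau> = d" using True i by auto
            moreover have "card (insert i I \<inter> U) = r" "card (insert i I \<inter> W) = e"
              unfolding int using False finI True by (simp_all add: I'_def)
            ultimately show ?thesis unfolding strand_def by simp
          qed
          have sgn: "wsgn i I = (- 1) ^ r * (wsgn i I' :: 'a)"
          proof -
            have "U \<inter> I' = {}" using I(2) UW by blast
            then show ?thesis using wsgn_Un_below[of U I' i] finI i I(1) by simp
          qed
          have "U \<subseteq> insert i I" using True by blast
          then have "g j (\<tau>, 0, insert i I) = h j \<tau> (insert i I')" for j
            using mem by (simp only: g_def split int simp_thms if_True)
          then have "times_z k (iota i (g j)) t = wsgn i I * h j \<tau> (insert i I')" for j
            unfolding t using \<nu> iI by (simp add: times_z_unit iota_def)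
          then show ?thesis using False by (simp add: sgn sum_distrib_left mult_ac)
        qed
        have "(\<Sum>i\<in>W. ?w i k) = (\<Sum>i\<in>W - I'. (- 1) ^ r * (wsgn i I' * (\<Sum>j\<in>J. cB i j k * h j \<tau> (insert i I'))))"
          using val by (intro sum.mono_neutral_cong_right) auto
        also have "\<dots> = 0"
          using H2[OF k, of \<tau> I'] True I(2) by (simp add: I'_def flip: sum_distrib_left)
        finally show ?thesis .
      next
        case False
        have "times_z k (iota i (g j)) t = 0" if i: "i \<in> W" for i j
        proof (rule ccontr)
          assume nz: "times_z k (iota i (g j)) t \<noteq> 0"
          then have *: "i \<notin> I" "lookup \<nu> k \<noteq> 0" "\<nu> - unit k = 0" "U \<subseteq> insert i I" "(\<tau>, 0, insert i I) \<in> ?T"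
            unfolding t by (auto simp: times_z_unit iota_def g_def split: if_splits)
          have "\<nu> = unit k" using minus_single_add[OF *(2)] *(3) by (simp add: unit_def)
          moreover have "U \<subseteq> I" using * i by auto
          moreover have "insert i I \<inter> U = U" "insert i I \<inter> W = insert i (I \<inter> W)" using * i by auto
          ultimately show False using * i False by (auto simp: strand_def)
        qed
        then show ?thesis by (intro sum.neutral) simp
      qed
    qed
    finally show ?thesis by simp
  qed
  have "g j0 = 0"
  proof (rule no_kernel_if_no_zero[OF fin(1) _ _ fin(2,3) UW, of d e c g j0])
    show "card U < d + card Y" "card W < e + card Z" using card by simp_all
    show "(\<exists>i\<in>U. (\<Sum>k\<in>Y. y k * (\<Sum>j\<in>J. x j * c j (i, Inl k))) \<noteq> 0) \<or>
      (\<exists>i\<in>W. (\<Sum>k\<in>Z. z k * (\<Sum>j\<in>J. x j * c j (i, Inr k))) \<noteq> 0)"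
      if "\<exists>j\<in>J. x j \<noteq> 0" "\<exists>k\<in>Y. y k \<noteq> 0" "\<exists>k\<in>Z. z k \<noteq> 0" for x y z
      using nozero[OF that] by (simp add: c_def)
    show "\<nu> = 0 \<and> U \<subseteq> I \<and> (\<tau>, \<nu>, I) \<in> ?T" if "g j (\<tau>, \<nu>, I) \<noteq> 0" for j \<tau> \<nu> I
      using that by (auto simp: g_def split: if_splits)
    show "(\<Sum>j\<in>J. kdiff ?P (c j) (g j)) = 0" by (rule ext) (simp only: eq zero_fun_apply)
    show "j0 \<in> J" by (rule concl)
  qed simp_all
  then have "g j0 (\<tau>0, 0, U \<union> I0) = 0" by simp
  moreover have "(U \<union> I0) \<inter> U = U" "(U \<union> I0) \<inter> W = I0" using concl by auto
  moreover from this have "(\<tau>0, 0, U \<union> I0) \<in> ?T" using concl by (auto simp: strand_def)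
  ultimately show ?thesis by (simp add: g_def)
qed

text \<open>The rows and columns that meet \<open>u\<^bsub>0,\<theta>\<^esub>\<close>, where \<open>\<theta>\<close> is the exponent of \<open>x\<^sub>i y\<^sub>j z\<^sub>k\<close>.\<close>

definition theta_rows :: "nat \<Rightarrow> label set" where
  "theta_rows k0 = {((0, \<tau>, unit k0), U \<union> I) |\<tau> I. keys \<tau> \<subseteq> {0..ny} \<and> deg \<tau> = q \<and> I \<subseteq> W \<and> card I = b}"

definition theta_cols :: "nat \<Rightarrow> nat \<Rightarrow> label set" where
  "theta_cols i0 j0 = {((unit i0, \<tau> + unit j0, 0), insert 0 (U \<union> I)) |\<tau> I.
     keys \<tau> \<subseteq> {0..ny} \<and> deg \<tau> = q \<and> I \<subseteq> W \<and> card I = b}"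

lemma K0_rows:
  assumes "keys \<tau> \<subseteq> {0..ny}" "I \<subseteq> W"
  shows "i \<in> U \<Longrightarrow> Suc (deg \<tau>) = q \<Longrightarrow> card I = Suc b \<Longrightarrow> ((0, \<tau>, 0), (U - {i}) \<union> I) \<in> K0_basis nx ny nz r s"
    and "k \<le> nz \<Longrightarrow> deg \<tau> = q \<Longrightarrow> card I = b \<Longrightarrow> ((0, \<tau>, unit k), U \<union> I) \<in> K0_basis nx ny nz r s"
    and "i \<in> U \<Longrightarrow> deg \<tau> = q \<Longrightarrow> card I = b \<Longrightarrow> ((0, \<tau>, 0), insert 0 ((U - {i}) \<union> I)) \<in> K0_basis nx ny nz r s"
    and "k \<le> nz \<Longrightarrow> deg \<tau> = Suc q \<Longrightarrow> Suc (card I) = b \<Longrightarrow> ((0, \<tau>, unit k), insert 0 (U \<union> I)) \<in> K0_basis nx ny nz r s"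
proof -
  have 1: "int q + 1 = int (Suc q)" "int r - 1 = int (r - 1)" "int b + 1 = int (Suc b)" using r_pos by simp_all
  have sub: "{0..r + s} = insert 0 (U \<union> W)" by auto
  have cap: "((U - {i}) \<union> I) \<inter> U = U - {i}" "((U - {i}) \<union> I) \<inter> W = I" "((U - {i}) \<union> I) \<inter> {0} = {}"
    "(U \<union> I) \<inter> U = U" "(U \<union> I) \<inter> W = I" "(U \<union> I) \<inter> {0} = {}"
    "insert 0 ((U - {i}) \<union> I) \<inter> U = U - {i}" "insert 0 ((U - {i}) \<union> I) \<inter> W = I" "insert 0 ((U - {i}) \<union> I) \<inter> {0} = {0}"
    "insert 0 (U \<union> I) \<inter> U = U" "insert 0 (U \<union> I) \<inter> W = I" "insert 0 (U \<union> I) \<inter> {0} = {0}" for i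
    using assms(2) by auto
  have w: "i \<in> U \<Longrightarrow> card I = a \<Longrightarrow> (U - {i}) \<union> I \<in> wedge r s (int (r - 1)) (int a) 0"
    "card I = a \<Longrightarrow> U \<union> I \<in> wedge r s (int r) (int a) 0"
    "i \<in> U \<Longrightarrow> card I = a \<Longrightarrow> insert 0 ((U - {i}) \<union> I) \<in> wedge r s (int (r - 1)) (int a) 1"
    "card I = a \<Longrightarrow> insert 0 (U \<union> I) \<in> wedge r s (int r) (int a) 1" for a i
    using wedge_iff[of "(U - {i}) \<union> I" r s "r - 1" a 0] wedge_iff[of "U \<union> I" r s r a 0]
      wedge_iff[of "insert 0 ((U - {i}) \<union> I)" r s "r - 1" a 1] wedge_iff[of "insert 0 (U \<union> I)" r s r a 1] assms(2)
    unfolding sub cap by auto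
  have m: "\<tau> \<in> monos_of ny (int (deg \<tau>))" "0 \<in> monos_of nx 0" "0 \<in> monos_of nz 0" "k \<le> nz \<Longrightarrow> unit k \<in> monos_of nz 1" for k
    using assms(1) by (simp_all add: monos_of_int monos_of_0 monos_of_unit)
  show "i \<in> U \<Longrightarrow> Suc (deg \<tau>) = q \<Longrightarrow> card I = Suc b \<Longrightarrow> ((0, \<tau>, 0), (U - {i}) \<union> I) \<in> K0_basis nx ny nz r s"
  proof -
    assume *: "i \<in> U" "Suc (deg \<tau>) = q" "card I = Suc b"
    have "int q - 1 = int (deg \<tau>)" using *(2) by simp
    then show ?thesis unfolding K0_basis_def int_eqs 1 using w(1)[OF *(1,3)] m by simp
  qed
  show "k \<le> nz \<Longrightarrow> deg \<tau> = q \<Longrightarrow> card I = b \<Longrightarrow> ((0, \<tau>, unit k), U \<union> I) \<in> K0_basis nx ny nz r s"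
    unfolding K0_basis_def int_eqs 1 using w(2)[of b] m by auto
  show "i \<in> U \<Longrightarrow> deg \<tau> = q \<Longrightarrow> card I = b \<Longrightarrow> ((0, \<tau>, 0), insert 0 ((U - {i}) \<union> I)) \<in> K0_basis nx ny nz r s"
    unfolding K0_basis_def int_eqs 1 using w(3)[of i b] m by auto
  show "k \<le> nz \<Longrightarrow> deg \<tau> = Suc q \<Longrightarrow> Suc (card I) = b \<Longrightarrow> ((0, \<tau>, unit k), insert 0 (U \<union> I)) \<in> K0_basis nx ny nz r s"
  proof -
    assume *: "k \<le> nz" "deg \<tau> = Suc q" "Suc (card I) = b"
    have "int b - 1 = int (card I)" using *(3) by simp
    then show ?thesis unfolding K0_basis_def int_eqs 1 using w(4)[OF refl] m *(1,2) by (simp del: of_nat_Suc)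
  qed
qed

lemma theta_rows_iff:
  shows "((0, \<tau>, \<zeta>), insert 0 K) \<notin> theta_rows k0" "((0, \<tau>, 0), K) \<notin> theta_rows k0"
    "k \<noteq> k0 \<Longrightarrow> ((0, \<tau>, unit k), K) \<notin> theta_rows k0"
proof -
  have "insert 0 K \<noteq> U \<union> I" if "I \<subseteq> W" for I
  proof
    assume "insert 0 K = U \<union> I"
    then have "0 \<in> U \<union> I" by blast
    then show False using that by auto
  qed
  then show "((0, \<tau>, \<zeta>), insert 0 K) \<notin> theta_rows k0" unfolding theta_rows_def by blast
qed (auto simp: theta_rows_def)

definition vanishes_off :: "nat \<Rightarrow> nat \<Rightarrow> nat \<Rightarrow> bool" where
  "vanishes_off i0 j0 k0 \<longleftrightarrow> (\<forall>x y z. (\<exists>j\<le>nx. x j \<noteq> 0) \<longrightarrow> (\<exists>k\<le>ny. y k \<noteq> 0) \<longrightarrow> (\<exists>k\<le>nz. z k \<noteq> 0) \<longrightarrow>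
     (\<forall>i\<in>U. (\<Sum>k\<le>ny. y k * (\<Sum>j\<le>nx. x j * cA i j k)) = 0) \<longrightarrow>
     (\<forall>i\<in>W. (\<Sum>k\<le>nz. z k * (\<Sum>j\<le>nx. x j * cB i j k)) = 0) \<longrightarrow>
     x i0 \<noteq> 0 \<and> y j0 \<noteq> 0 \<and> z k0 \<noteq> 0)"

text \<open>Extending by zero, a zero of a system in fewer variables is a zero of the given one.\<close>

lemma nozero_subsystem:
  assumes van: "vanishes_off i0 j0 k0"
    and sub: "J \<subseteq> {..nx}" "Y \<subseteq> {..ny}" "Z \<subseteq> {..nz}" and miss: "i0 \<notin> J \<or> j0 \<notin> Y \<or> k0 \<notin> Z"
    and nz: "\<exists>j\<in>J. x j \<noteq> 0" "\<exists>k\<in>Y. y k \<noteq> 0" "\<exists>k\<in>Z. z k \<noteq> (0 :: 'a)"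
  shows "(\<exists>i\<in>U. (\<Sum>k\<in>Y. y k * (\<Sum>j\<in>J. x j * cA i j k)) \<noteq> 0) \<or>
    (\<exists>i\<in>W. (\<Sum>k\<in>Z. z k * (\<Sum>j\<in>J. x j * cB i j k)) \<noteq> 0)"
proof (rule ccontr)
  assume contra: "\<not> ?thesis"
  let ?x = "\<lambda>j. if j \<in> J then x j else 0" and ?y = "\<lambda>k. if k \<in> Y then y k else 0" and ?z = "\<lambda>k. if k \<in> Z then z k else 0"
  have ext: "(\<Sum>j\<le>m. (if j \<in> K then u j else 0) * t j) = (\<Sum>j\<in>K. u j * t j)" if "K \<subseteq> {..m}"
    for u t :: "nat \<Rightarrow> 'a" and K m
    using that by (intro sum.mono_neutral_cong_right) auto
  have "\<exists>j\<le>nx. ?x j \<noteq> 0" "\<exists>k\<le>ny. ?y k \<noteq> 0" "\<exists>k\<le>nz. ?z k \<noteq> 0" using nz sub by auto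
  moreover have "\<forall>i\<in>U. (\<Sum>k\<le>ny. ?y k * (\<Sum>j\<le>nx. ?x j * cA i j k)) = 0"
    using contra by (simp only: ext sub) blast
  moreover have "\<forall>i\<in>W. (\<Sum>k\<le>nz. ?z k * (\<Sum>j\<le>nx. ?x j * cB i j k)) = 0"
    using contra by (simp only: ext sub) blast
  ultimately have "?x i0 \<noteq> 0 \<and> ?y j0 \<noteq> 0 \<and> ?z k0 \<noteq> 0"
    using van[unfolded vanishes_off_def, rule_format, of ?x ?y ?z] by blast
  then show False using miss by (auto split: if_splits)
qed

text \<open>A kernel vector of M11, extended by zero to the columns of M22, is a family
  \<open>v\<close> of this kind.\<close>

theorem kernel_zero:
  assumes idx: "i0 \<le> nx" "j0 \<le> ny" "k0 \<le> nz" and van: "vanishes_off i0 j0 k0"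
    and v: "\<And>cl. cl \<notin> K1_basis nx ny nz r s \<Longrightarrow> v cl = 0"
    and vc: "\<And>cl. cl \<in> theta_cols i0 j0 \<Longrightarrow> v cl = 0"
    and rows: "\<And>rl. rl \<in> K0_basis nx ny nz r s \<Longrightarrow> rl \<notin> theta_rows k0 \<Longrightarrow> rsum v rl = 0"
  shows "v cl = 0"
proof -
  have wnz: "wsgn i K \<noteq> (0 :: 'a)" for i K by simp
  have UW: "U \<inter> W = {}" "0 \<notin> U" "0 \<notin> W" by auto
  have fin_W: "finite I" if "I \<subseteq> W" for I using that finite_subset by blast
  have rowA: "(\<Sum>j\<le>nx. \<Sum>k\<le>ny. cA i j k * v ((unit j, \<tau> + unit k, 0), insert 0 (U \<union> I))) = 0"
    if "i \<in> U" "keys \<tau> \<subseteq> {0..ny}" "deg \<tau> = q" "I \<subseteq> W" "card I = b" for i \<tau> I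
  proof -
    let ?K = "insert 0 ((U - {i}) \<union> I)"
    have "i \<notin> ?K" "U - {i} \<subseteq> ?K" "insert i ?K = insert 0 (U \<union> I)" using that UW by auto
    moreover have "rsum v ((0, \<tau>, 0), ?K) = 0"
      using that by (intro rows K0_rows theta_rows_iff)
    ultimately show ?thesis using rsum_y[where v = v and i = i and K = ?K and \<tau> = \<tau>, OF v] that wnz[of i ?K] by simp
  qed
  have rowB: "(\<Sum>i\<in>W - I. wsgn i I * (\<Sum>j\<le>nx. cB i j k * v ((unit j, \<tau>, 0), insert 0 (U \<union> insert i I)))) = 0"
    if "k \<le> nz" "keys \<tau> \<subseteq> {0..ny}" "deg \<tau> = Suc q" "I \<subseteq> W" "Suc (card I) = b" for k \<tau> I
  proof -
    let ?K = "insert 0 (U \<union> I)"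
    have "rsum v ((0, \<tau>, unit k), ?K) = 0"
      using that by (intro rows K0_rows theta_rows_iff)
    moreover have "W - ?K = W - I" using UW by auto
    moreover have "wsgn i ?K = - ((- 1) ^ r) * (wsgn i I :: 'a)" if "i \<in> W" for i
    proof -
      have "insert 0 U \<inter> I = {}" using \<open>I \<subseteq> W\<close> UW by blast
      moreover have "a < i" if "a \<in> insert 0 U" for a using that \<open>i \<in> W\<close> by auto
      ultimately have "wsgn i (insert 0 U \<union> I) = (- 1) ^ card (insert 0 U) * (wsgn i I :: 'a)"
        using fin_W[OF \<open>I \<subseteq> W\<close>] by (intro wsgn_Un_below) auto
      then show ?thesis by simp
    qed
    moreover have "insert i ?K = insert 0 (U \<union> insert i I)" for i by auto
    moreover have "U \<subseteq> ?K" by blast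
    ultimately have "0 = (\<Sum>i\<in>W - I. (- ((- 1) ^ r)) * (wsgn i I * (\<Sum>j\<le>nx. cB i j k * v ((unit j, \<tau>, 0), insert 0 (U \<union> insert i I)))))"
      using rsum_z[where v = v and K = ?K and k = k and \<tau> = \<tau>, OF v] that(1) by (simp add: mult.assoc)
    also have "\<dots> = (- ((- 1) ^ r)) * (\<Sum>i\<in>W - I. wsgn i I * (\<Sum>j\<le>nx. cB i j k * v ((unit j, \<tau>, 0), insert 0 (U \<union> insert i I))))"
      by (rule sum_distrib_left[symmetric])
    finally show ?thesis by simp
  qed
  \<comment> \<open>Contraction with y_j0 lowers the y-degree to q, and its components at x_i0 are
    among the columns set to zero, so x_i0 can be left out.\<close>
  have step2: "v ((unit j, \<tau> + unit j0, 0), insert 0 (U \<union> I)) = 0"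
    if "j \<le> nx" "keys \<tau> \<subseteq> {0..ny}" "deg \<tau> = q" "I \<subseteq> W" "card I = b" for j \<tau> I
  proof (cases "j = i0")
    case True
    then show ?thesis using that by (intro vc) (auto simp: theta_cols_def)
  next
    case False
    let ?J = "{..nx} - {i0}"
    have drop: "(\<Sum>j\<le>nx. t j) = (\<Sum>j\<in>?J. t j)" if "t i0 = 0" for t :: "nat \<Rightarrow> 'a"
      using that by (intro sum.mono_neutral_right) auto
    have vc': "v ((unit i0, \<sigma> + unit j0, 0), insert 0 (U \<union> I)) = 0"
      if "keys \<sigma> \<subseteq> {0..ny}" "deg \<sigma> = q" "I \<subseteq> W" "card I = b" for \<sigma> I
      using that by (intro vc) (auto simp: theta_cols_def)
    show ?thesis
    proof (rule killed_family_zero[of ?J "{0..ny}" "{..nz}" q b "\<lambda>j \<tau> I. v ((unit j, \<tau> + unit j0, 0), insert 0 (U \<union> I))"])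
      show "(\<exists>i\<in>U. (\<Sum>k\<in>{0..ny}. y k * (\<Sum>j\<in>?J. x j * cA i j k)) \<noteq> 0) \<or>
        (\<exists>i\<in>W. (\<Sum>k\<in>{..nz}. z k * (\<Sum>j\<in>?J. x j * cB i j k)) \<noteq> 0)"
        if "\<exists>j\<in>?J. x j \<noteq> 0" "\<exists>k\<in>{0..ny}. y k \<noteq> 0" "\<exists>k\<in>{..nz}. z k \<noteq> 0" for x y z
        using that by (intro nozero_subsystem[OF van]) auto
      show "(\<Sum>k\<in>{0..ny}. \<Sum>j\<in>?J. cA i j k * v ((unit j, \<tau> + unit k + unit j0, 0), insert 0 (U \<union> I))) = 0"
        if *: "i \<in> U" "keys \<tau> \<subseteq> {0..ny}" "Suc (deg \<tau>) = q" "I \<subseteq> W" "card I = b" for i \<tau> I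
      proof -
        have "0 = (\<Sum>j\<le>nx. \<Sum>k\<le>ny. cA i j k * v ((unit j, \<tau> + unit j0 + unit k, 0), insert 0 (U \<union> I)))"
          using * idx by (intro rowA[symmetric]) (auto simp: keys_add_nat deg_add)
        also have "\<dots> = (\<Sum>k\<le>ny. \<Sum>j\<le>nx. cA i j k * v ((unit j, \<tau> + unit k + unit j0, 0), insert 0 (U \<union> I)))"
          by (subst sum.swap) (simp add: add_ac)
        also have "\<dots> = (\<Sum>k\<le>ny. \<Sum>j\<in>?J. cA i j k * v ((unit j, \<tau> + unit k + unit j0, 0), insert 0 (U \<union> I)))"
        proof (rule sum.cong[OF refl], rule drop)
          fix k assume "k \<in> {..ny}"
          then have "v ((unit i0, \<tau> + unit k + unit j0, 0), insert 0 (U \<union> I)) = 0"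
            using * by (intro vc') (auto simp: keys_add_nat deg_add)
          then show "cA i i0 k * v ((unit i0, \<tau> + unit k + unit j0, 0), insert 0 (U \<union> I)) = 0" by simp
        qed
        finally show ?thesis by (simp add: atLeast0AtMost)
      qed
      show "(\<Sum>i\<in>W - I. wsgn i I * (\<Sum>j\<in>?J. cB i j k * v ((unit j, \<tau> + unit j0, 0), insert 0 (U \<union> insert i I)))) = 0"
        if *: "k \<in> {..nz}" "keys \<tau> \<subseteq> {0..ny}" "deg \<tau> = q" "I \<subseteq> W" "Suc (card I) = b" for k \<tau> I
      proof -
        have "0 = (\<Sum>i\<in>W - I. wsgn i I * (\<Sum>j\<le>nx. cB i j k * v ((unit j, \<tau> + unit j0, 0), insert 0 (U \<union> insert i I))))"
          using * idx by (intro rowB[symmetric]) (auto simp: keys_add_nat deg_add)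
        also have "\<dots> = (\<Sum>i\<in>W - I. wsgn i I * (\<Sum>j\<in>?J. cB i j k * v ((unit j, \<tau> + unit j0, 0), insert 0 (U \<union> insert i I))))"
        proof (rule sum.cong[OF refl])
          fix i assume "i \<in> W - I"
          then have "v ((unit i0, \<tau> + unit j0, 0), insert 0 (U \<union> insert i I)) = 0"
            using * fin_W[OF *(4)] by (intro vc') auto
          then show "wsgn i I * (\<Sum>j\<le>nx. cB i j k * v ((unit j, \<tau> + unit j0, 0), insert 0 (U \<union> insert i I))) =
              wsgn i I * (\<Sum>j\<in>?J. cB i j k * v ((unit j, \<tau> + unit j0, 0), insert 0 (U \<union> insert i I)))"
            by (subst drop) simp_all
        qed
        finally show ?thesis by simp
      qed
    qed (use that False r s in auto)
  qed
  \<comment> \<open>Exponents containing y_j0 are settled by \<open>step2\<close>; the rest is a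
    family of degree q + 1 in the other y-variables.\<close>
  have step3: "v ((unit j, \<tau>, 0), insert 0 (U \<union> I)) = 0"
    if "j \<le> nx" "keys \<tau> \<subseteq> {0..ny}" "deg \<tau> = Suc q" "I \<subseteq> W" "card I = b" for j \<tau> I
  proof (cases "j0 \<in> keys \<tau>")
    case True
    define \<rho> where "\<rho> = \<tau> - unit j0"
    have \<tau>: "\<tau> = \<rho> + unit j0" using minus_single_add[of \<tau> j0] True by (simp add: \<rho>_def unit_def in_keys_iff)
    have "deg \<rho> = q" "keys \<rho> \<subseteq> {0..ny}" using that(2,3) by (simp_all add: \<tau> deg_add keys_add_nat)
    then show ?thesis unfolding \<tau> using that by (intro step2) auto
  next
    case False
    let ?Y = "{0..ny} - {j0}"
    have drop: "(\<Sum>k\<le>ny. t k) = (\<Sum>k\<in>?Y. t k)" if "t j0 = 0" for t :: "nat \<Rightarrow> 'a"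
      using that by (intro sum.mono_neutral_right) auto
    show ?thesis
    proof (rule killed_family_zero[of "{..nx}" ?Y "{..nz}" "Suc q" b "\<lambda>j \<tau> I. v ((unit j, \<tau>, 0), insert 0 (U \<union> I))"])
      show "(\<exists>i\<in>U. (\<Sum>k\<in>?Y. y k * (\<Sum>j\<in>{..nx}. x j * cA i j k)) \<noteq> 0) \<or>
        (\<exists>i\<in>W. (\<Sum>k\<in>{..nz}. z k * (\<Sum>j\<in>{..nx}. x j * cB i j k)) \<noteq> 0)"
        if "\<exists>j\<in>{..nx}. x j \<noteq> 0" "\<exists>k\<in>?Y. y k \<noteq> 0" "\<exists>k\<in>{..nz}. z k \<noteq> 0" for x y z
        using that by (intro nozero_subsystem[OF van]) auto
      show "(\<Sum>k\<in>?Y. \<Sum>j\<le>nx. cA i j k * v ((unit j, \<tau> + unit k, 0), insert 0 (U \<union> I))) = 0"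
        if *: "i \<in> U" "keys \<tau> \<subseteq> ?Y" "Suc (deg \<tau>) = Suc q" "I \<subseteq> W" "card I = b" for i \<tau> I
      proof -
        have "0 = (\<Sum>k\<le>ny. \<Sum>j\<le>nx. cA i j k * v ((unit j, \<tau> + unit k, 0), insert 0 (U \<union> I)))"
          using * by (subst sum.swap, intro rowA[symmetric]) auto
        also have "\<dots> = (\<Sum>k\<in>?Y. \<Sum>j\<le>nx. cA i j k * v ((unit j, \<tau> + unit k, 0), insert 0 (U \<union> I)))"
        proof (rule drop, rule sum.neutral, rule ballI)
          fix j assume "j \<in> {..nx}"
          then have "v ((unit j, \<tau> + unit j0, 0), insert 0 (U \<union> I)) = 0"
            using * by (intro step2) auto
          then show "cA i j j0 * v ((unit j, \<tau> + unit j0, 0), insert 0 (U \<union> I)) = 0" by simp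
        qed
        finally show ?thesis by simp
      qed
      show "(\<Sum>i\<in>W - I. wsgn i I * (\<Sum>j\<le>nx. cB i j k * v ((unit j, \<tau>, 0), insert 0 (U \<union> insert i I)))) = 0"
        if *: "k \<in> {..nz}" "keys \<tau> \<subseteq> ?Y" "deg \<tau> = Suc q" "I \<subseteq> W" "Suc (card I) = b" for k \<tau> I
        using * by (intro rowB) auto
    qed (use that False idx r s in auto)
  qed
  have step1: "v ((unit j, \<tau>, 0), U \<union> I) = 0"
    if "j \<le> nx" "keys \<tau> \<subseteq> {0..ny}" "deg \<tau> = q" "I \<subseteq> W" "card I = Suc b" for j \<tau> I
  proof -
    let ?Z = "{..nz} - {k0}"
    show ?thesis
    proof (rule killed_family_zero[of "{..nx}" "{0..ny}" ?Z q "Suc b" "\<lambda>j \<tau> I. v ((unit j, \<tau>, 0), U \<union> I)"])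
      show "(\<exists>i\<in>U. (\<Sum>k\<in>{0..ny}. y k * (\<Sum>j\<in>{..nx}. x j * cA i j k)) \<noteq> 0) \<or>
        (\<exists>i\<in>W. (\<Sum>k\<in>?Z. z k * (\<Sum>j\<in>{..nx}. x j * cB i j k)) \<noteq> 0)"
        if "\<exists>j\<in>{..nx}. x j \<noteq> 0" "\<exists>k\<in>{0..ny}. y k \<noteq> 0" "\<exists>k\<in>?Z. z k \<noteq> 0" for x y z
        using that by (intro nozero_subsystem[OF van]) auto
      show "(\<Sum>k\<in>{0..ny}. \<Sum>j\<le>nx. cA i j k * v ((unit j, \<tau> + unit k, 0), U \<union> I)) = 0"
        if *: "i \<in> U" "keys \<tau> \<subseteq> {0..ny}" "Suc (deg \<tau>) = q" "I \<subseteq> W" "card I = Suc b" for i \<tau> I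
      proof -
        let ?K = "(U - {i}) \<union> I"
        have "i \<notin> ?K" "U - {i} \<subseteq> ?K" "insert i ?K = U \<union> I" using * UW by auto
        moreover have "rsum v ((0, \<tau>, 0), ?K) = 0"
          using * by (intro rows K0_rows theta_rows_iff)
        ultimately have "(\<Sum>j\<le>nx. \<Sum>k\<le>ny. cA i j k * v ((unit j, \<tau> + unit k, 0), U \<union> I)) = 0"
          using rsum_y[where v = v and i = i and K = ?K and \<tau> = \<tau>, OF v] * wnz[of i ?K] by simp
        then show ?thesis by (subst sum.swap) (simp add: atLeast0AtMost)
      qed
      show "(\<Sum>i\<in>W - I. wsgn i I * (\<Sum>j\<le>nx. cB i j k * v ((unit j, \<tau>, 0), U \<union> insert i I))) = 0"
        if *: "k \<in> ?Z" "keys \<tau> \<subseteq> {0..ny}" "deg \<tau> = q" "I \<subseteq> W" "Suc (card I) = Suc b" for k \<tau> I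
      proof -
        let ?K = "U \<union> I"
        have "rsum v ((0, \<tau>, unit k), ?K) = 0"
          using * by (intro rows K0_rows theta_rows_iff) auto
        moreover have "W - ?K = W - I" using UW by auto
        moreover have "0 \<notin> ?K" using UW * by auto
        moreover have "wsgn i ?K = (- 1) ^ r * (wsgn i I :: 'a)" if "i \<in> W" for i
        proof -
          have "U \<inter> I = {}" using \<open>I \<subseteq> W\<close> UW by blast
          then show ?thesis using wsgn_Un_below[of U I i] that fin_W[OF \<open>I \<subseteq> W\<close>] by simp
        qed
        moreover have "insert i ?K = U \<union> insert i I" for i by auto
        moreover have "(\<Sum>j\<le>nx. \<Sum>l\<le>ny. lookup (F 0) (unit j, unit l, unit k) * v ((unit j, \<tau> + unit l, 0), insert 0 ?K)) = 0"
        proof (rule sum.neutral, rule ballI, rule sum.neutral, rule ballI)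
          fix j l assume "j \<in> {..nx}" "l \<in> {..ny}"
          then have "v ((unit j, \<tau> + unit l, 0), insert 0 ?K) = 0"
            using * by (intro step3) (auto simp: keys_add_nat deg_add)
          then show "lookup (F 0) (unit j, unit l, unit k) * v ((unit j, \<tau> + unit l, 0), insert 0 ?K) = 0" by simp
        qed
        ultimately have "0 = (\<Sum>i\<in>W - I. (- 1) ^ r * (wsgn i I * (\<Sum>j\<le>nx. cB i j k * v ((unit j, \<tau>, 0), U \<union> insert i I))))"
          using rsum_z[where v = v and K = ?K and k = k and \<tau> = \<tau>, OF v] * by (simp add: mult.assoc)
        also have "\<dots> = (- 1) ^ r * (\<Sum>i\<in>W - I. wsgn i I * (\<Sum>j\<le>nx. cB i j k * v ((unit j, \<tau>, 0), U \<union> insert i I)))"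
          by (rule sum_distrib_left[symmetric])
        finally show ?thesis by simp
      qed
    qed (use that idx r s in auto)
  qed
  show ?thesis
  proof (cases "cl \<in> K1_basis nx ny nz r s")
    case True
    obtain \<sigma> I where cl: "cl = (\<sigma>, I)" by (cases cl)
    show ?thesis using True step1 step3 unfolding cl mem_K1_basis by blast
  qed (rule v)
qed

end

section \<open>Kernel elements at the solutions\<close>

text \<open>Interior product with the covector \<beta> on the indices \<open>V\<close>. It is used
  at \<tau> = \<nu> = 0, where only the exterior part matters.\<close>

definition contraction :: "nat set \<Rightarrow> (nat \<Rightarrow> 'a::field) \<Rightarrow> (fiber_index \<Rightarrow> 'a) \<Rightarrow> fiber_index \<Rightarrow> 'a" where
  "contraction V \<beta> e = (\<Sum>i\<in>V. fscale (\<beta> i) (iota i e))"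

lemma contraction_apply:
  assumes "finite V"
  shows "contraction V \<beta> e (\<tau>, \<nu>, I) = (\<Sum>i\<in>V - I. wsgn i I * \<beta> i * e (\<tau>, \<nu>, insert i I))"
proof -
  have "contraction V \<beta> e (\<tau>, \<nu>, I) = (\<Sum>i\<in>V. if i \<in> I then 0 else wsgn i I * \<beta> i * e (\<tau>, \<nu>, insert i I))"
    unfolding contraction_def sum_fun_apply by (intro sum.cong) (auto simp: iota_def)
  also have "\<dots> = (\<Sum>i\<in>V - I. wsgn i I * \<beta> i * e (\<tau>, \<nu>, insert i I))"
    using assms by (intro sum.mono_neutral_cong_right) auto
  finally show ?thesis .
qed

lemma contraction_iota: "contraction V \<beta> (iota k e) + iota k (contraction V \<beta> e) = 0"
proof -
  have "contraction V \<beta> (iota k e) + iota k (contraction V \<beta> e) =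
      (\<Sum>i\<in>V. fscale (\<beta> i) (iota i (iota k e) + iota k (iota i e)))"
    by (simp add: contraction_def linop_simps[OF linop_ops(1)] fscale.scale_right_distrib sum.distrib)
  then show ?thesis by (simp only: iota_iota fscale.scale_zero_right sum.neutral_const)
qed

lemma contraction_anticommute:
  "contraction V \<beta> (contraction V \<gamma> e) + contraction V \<gamma> (contraction V \<beta> e) = 0"
proof -
  have "contraction V \<beta> (contraction V \<gamma> e) = (\<Sum>k\<in>V. fscale (\<gamma> k) (contraction V \<beta> (iota k e)))"
    unfolding contraction_def
    by (simp add: linop_simps[OF linop_ops(1)] fscale.scale_sum_right)
      (subst sum.swap, simp add: mult.commute)
  moreover have "contraction V \<gamma> (contraction V \<beta> e) = (\<Sum>k\<in>V. fscale (\<gamma> k) (iota k (contraction V \<beta> e)))"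
    by (simp add: contraction_def[of V \<gamma>])
  ultimately have "contraction V \<beta> (contraction V \<gamma> e) + contraction V \<gamma> (contraction V \<beta> e) =
      (\<Sum>k\<in>V. fscale (\<gamma> k) (contraction V \<beta> (iota k e) + iota k (contraction V \<beta> e)))"
    by (simp add: fscale.scale_right_distrib sum.distrib)
  then show ?thesis by (simp only: contraction_iota fscale.scale_zero_right sum.neutral_const)
qed

text \<open>Contract the top form successively with the vectors; whenever a contraction would vanish, contract
  with a basis vector instead.\<close>

lemma ex_annihilated_form:
  fixes \<beta> :: "'k \<Rightarrow> nat \<Rightarrow> 'a::field_char_0"
  assumes "finite M" "finite V" "finite U" "U \<inter> V = {}" "card M + t = card V"
  shows "\<exists>e. (\<exists>I. e (0, 0, I) \<noteq> 0) \<and> (\<forall>I. e (0, 0, I) \<noteq> 0 \<longrightarrow> U \<subseteq> I \<and> I \<subseteq> U \<union> V \<and> card (I \<inter> V) = t) \<and>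
    (\<forall>k\<in>M. \<forall>I. contraction V (\<beta> k) e (0, 0, I) = 0)"
  using assms(1,5)
proof (induction M arbitrary: t rule: finite_induct)
  case empty
  have "(U \<union> V) \<inter> V = V" by blast
  with empty show ?case
    by (intro exI[of _ "\<lambda>(\<tau>, \<nu>, I). if I = U \<union> V then 1 else 0"]) auto
next
  case (insert k M)
  then have "card M + Suc t = card V" by simp
  from insert.IH[OF this] obtain e where
    E: "(\<exists>I. e (0, 0, I) \<noteq> 0) \<and> (\<forall>I. e (0, 0, I) \<noteq> 0 \<longrightarrow> U \<subseteq> I \<and> I \<subseteq> U \<union> V \<and> card (I \<inter> V) = Suc t) \<and>
      (\<forall>k\<in>M. \<forall>I. contraction V (\<beta> k) e (0, 0, I) = 0)" by (rule exE)
  note e = conjunct1[OF E] conjunct1[OF conjunct2[OF E], rule_format] conjunct2[OF conjunct2[OF E], rule_format]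
  have shape: "U \<subseteq> I \<and> I \<subseteq> U \<union> V \<and> card (I \<inter> V) = t" if "i \<in> V" "i \<notin> I" "e (0, 0, insert i I) \<noteq> 0" for i I
  proof -
    have *: "U \<subseteq> insert i I" "insert i I \<subseteq> U \<union> V" "card (insert i I \<inter> V) = Suc t" using e(2)[OF that(3)] by auto
    have "card (insert i I \<inter> V) = Suc (card (I \<inter> V))"
      using that(1,2) assms(2) by (subst Int_insert_left_if1) auto
    moreover have "i \<notin> U" using that(1) assms(4) by blast
    ultimately show ?thesis using * by auto
  qed
  have zero: "contraction V \<gamma> e' (0, 0, I) = 0" if "\<And>I. e' (0, 0, I) = 0" for \<gamma> e' I
    using that assms(2) by (simp add: contraction_apply)
  show ?case
  proof (cases "\<exists>I. contraction V (\<beta> k) e (0, 0, I) \<noteq> 0")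
    case True
    let ?e = "contraction V (\<beta> k) e"
    have s1: "U \<subseteq> I \<and> I \<subseteq> U \<union> V \<and> card (I \<inter> V) = t" if "?e (0, 0, I) \<noteq> 0" for I
    proof -
      from that obtain i where "i \<in> V - I" "e (0, 0, insert i I) \<noteq> 0"
        unfolding contraction_apply[OF assms(2)] by (metis (no_types, lifting) mult_zero_right sum.neutral)
      then show ?thesis using shape by blast
    qed
    have s2: "contraction V (\<beta> k') ?e (0, 0, I) = 0" if "k' \<in> insert k M" for k' I
    proof (cases "k' = k")
      case True
      have "contraction V (\<beta> k) ?e (0, 0, I) + contraction V (\<beta> k) ?e (0, 0, I) = 0"
        using fun_cong[OF contraction_anticommute[of V "\<beta> k" "\<beta> k" e], of "(0, 0, I)"] by simp
      then have "2 * contraction V (\<beta> k) ?e (0, 0, I) = 0" by (simp only: mult_2)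
      then show ?thesis using True by simp
    next
      case False
      then have "contraction V (\<beta> k) (contraction V (\<beta> k') e) (0, 0, I) = 0"
        using that by (intro zero e(3)) auto
      then show ?thesis
        using fun_cong[OF contraction_anticommute[of V "\<beta> k'" "\<beta> k" e], of "(0, 0, I)"] by simp
    qed
    show ?thesis
      by (intro exI[of _ ?e] conjI ballI allI impI) (use True s1 s2 in blast)+
  next
    case False
    \<comment> \<open>Contraction with \<beta>_k already annihilates \<open>e\<close>. A basis
      contraction that is nonzero on \<open>e\<close> lowers the degree and preserves every
      annihilation, since contractions anticommute.\<close>
    from e(1) obtain I0 where I0: "e (0, 0, I0) \<noteq> 0" by blast
    then have "card (I0 \<inter> V) = Suc t" using e(2) by blast
    then obtain i where i: "i \<in> I0" "i \<in> V" by (metis Int_iff card.empty equals0I nat.distinct(1))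
    let ?e = "iota i e"
    have s0: "?e (0, 0, I0 - {i}) \<noteq> 0" using I0 i by (simp add: iota_def insert_absorb)
    have s1: "U \<subseteq> I \<and> I \<subseteq> U \<union> V \<and> card (I \<inter> V) = t" if "?e (0, 0, I) \<noteq> 0" for I
    proof -
      from that have "i \<notin> I" "e (0, 0, insert i I) \<noteq> 0" by (auto simp: iota_def split: if_splits)
      then show ?thesis using shape i by blast
    qed
    have s2: "contraction V (\<beta> k') ?e (0, 0, I) = 0" if "k' \<in> insert k M" for k' I
    proof -
      have "contraction V (\<beta> k') e (0, 0, I) = 0" for I using that False e(3) by blast
      then have "iota i (contraction V (\<beta> k') e) (0, 0, I) = 0" by (simp add: iota_def)
      then show ?thesis
        using fun_cong[OF contraction_iota[of V "\<beta> k'" i e], of "(0, 0, I)"] by simp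
    qed
    show ?thesis
      by (intro exI[of _ ?e] conjI ballI allI impI) (use s0 s1 s2 in blast)+
  qed
qed

text \<open>The dependence saves one contraction: leaving out k0 gives a form of degree one higher,
  and its annihilation by \<beta>_k0 follows from that by the others.\<close>

lemma ex_annihilated_form_dependent:
  fixes \<beta> :: "'k \<Rightarrow> nat \<Rightarrow> 'a::field_char_0"
  assumes "finite M" "finite V" "finite U" "U \<inter> V = {}" "card M + t = Suc (card V)"
    and dep: "k0 \<in> M" "z k0 \<noteq> 0" "\<And>i. i \<in> V \<Longrightarrow> (\<Sum>k\<in>M. z k * \<beta> k i) = 0"
  obtains e where "\<exists>I. e (0, 0, I) \<noteq> 0" "\<And>I. e (0, 0, I) \<noteq> 0 \<Longrightarrow> U \<subseteq> I \<and> I \<subseteq> U \<union> V \<and> card (I \<inter> V) = t"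
    "\<And>k I. k \<in> M \<Longrightarrow> contraction V (\<beta> k) e (0, 0, I) = 0"
proof -
  have "card (M - {k0}) + t = card V" using card.remove[OF assms(1) dep(1)] assms(5) by simp
  from ex_annihilated_form[OF finite_Diff[OF assms(1)] assms(2-4) this, of \<beta>] obtain e where
    E: "(\<exists>I. e (0, 0, I) \<noteq> 0) \<and> (\<forall>I. e (0, 0, I) \<noteq> 0 \<longrightarrow> U \<subseteq> I \<and> I \<subseteq> U \<union> V \<and> card (I \<inter> V) = t) \<and>
      (\<forall>k\<in>M - {k0}. \<forall>I. contraction V (\<beta> k) e (0, 0, I) = 0)" by (rule exE)
  note e = conjunct1[OF E] conjunct1[OF conjunct2[OF E], rule_format] conjunct2[OF conjunct2[OF E], rule_format]
  have "contraction V (\<beta> k0) e (0, 0, I) = 0" for I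
  proof -
    have "(\<Sum>k\<in>M. z k * contraction V (\<beta> k) e (0, 0, I)) =
        (\<Sum>k\<in>M. \<Sum>i\<in>V - I. wsgn i I * (z k * \<beta> k i) * e (0, 0, insert i I))"
      using assms(2) by (simp add: contraction_apply sum_distrib_left mult_ac)
    also have "\<dots> = (\<Sum>i\<in>V - I. \<Sum>k\<in>M. wsgn i I * (z k * \<beta> k i) * e (0, 0, insert i I))"
      by (rule sum.swap)
    also have "\<dots> = (\<Sum>i\<in>V - I. wsgn i I * (\<Sum>k\<in>M. z k * \<beta> k i) * e (0, 0, insert i I))"
      by (simp add: sum_distrib_left sum_distrib_right)
    also have "\<dots> = 0" using dep(3) by simp
    finally have "z k0 * contraction V (\<beta> k0) e (0, 0, I) + (\<Sum>k\<in>M - {k0}. z k * contraction V (\<beta> k) e (0, 0, I)) = 0"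
      using sum.remove[OF assms(1) dep(1), of "\<lambda>k. z k * contraction V (\<beta> k) e (0, 0, I)"] by simp
    then show ?thesis using e(3) dep(2) by simp
  qed
  then show ?thesis using that[OF e(1,2)] e(3) by (metis Diff_iff singletonD)
qed

section \<open>Pure tensors in the kernel of the map\<close>

definition mval :: "(nat \<Rightarrow> 'a::comm_semiring_1) \<Rightarrow> mono \<Rightarrow> 'a" where
  "mval y \<tau> = (\<Prod>i\<in>keys \<tau>. y i ^ lookup \<tau> i)"

lemma mval_superset: "finite A \<Longrightarrow> keys \<tau> \<subseteq> A \<Longrightarrow> mval y \<tau> = (\<Prod>i\<in>A. y i ^ lookup \<tau> i)"
  unfolding mval_def by (intro prod.mono_neutral_left) (auto simp: in_keys_iff)

lemma mval_add: "mval y (\<sigma> + \<tau>) = mval y \<sigma> * mval y \<tau>"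
proof -
  let ?A = "keys \<sigma> \<union> keys \<tau>"
  have "mval y \<rho> = (\<Prod>i\<in>?A. y i ^ lookup \<rho> i)" if "keys \<rho> \<subseteq> ?A" for \<rho>
    using that by (intro mval_superset) auto
  then show ?thesis by (simp add: keys_add_nat lookup_add power_add prod.distrib)
qed

lemma mval_unit [simp]: "mval y (unit k) = y k"
  by (simp add: mval_def lookup_unit)

lemma mval_single: "mval y (Poly_Mapping.single k d) = y k ^ d"
  by (cases "d = 0") (simp_all add: mval_def)

context bilinear_system
begin

lemma mem_K1_unit: "((unit j, \<tau>, 0), I) \<in> K1_basis nx ny nz r s \<longleftrightarrow> j \<le> nx \<and> keys \<tau> \<subseteq> {0..ny} \<and>
    (\<exists>I'\<subseteq>W. deg \<tau> = q \<and> card I' = Suc b \<and> I = U \<union> I' \<or> deg \<tau> = Suc q \<and> card I' = b \<and> I = insert 0 (U \<union> I'))"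
  unfolding mem_K1_basis prod.inject unit_inj by blast

lemma K0_cases:
  assumes "rl \<in> K0_basis nx ny nz r s"
  obtains i \<tau> K where "rl = ((0, \<tau>, 0), K)" "i \<in> U" "i \<notin> K" "U - {i} \<subseteq> K"
  | k \<tau> I where "rl = ((0, \<tau>, unit k), U \<union> I)" "k \<le> nz" "keys \<tau> \<subseteq> {0..ny}" "deg \<tau> = q" "I \<subseteq> W" "card I = b"
  | k \<tau> I where "rl = ((0, \<tau>, unit k), insert 0 (U \<union> I))" "k \<le> nz" "keys \<tau> \<subseteq> {0..ny}" "deg \<tau> = Suc q" "I \<subseteq> W" "Suc (card I) = b"
proof -
  obtain \<tau>x \<tau> \<zeta> K where rl: "rl = ((\<tau>x, \<tau>, \<zeta>), K)" by (cases rl, cases "fst rl") auto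
  have 1: "int q + 1 = int (Suc q)" by simp
  have miss: "\<exists>i\<in>U. i \<notin> K \<and> U - {i} \<subseteq> K" if "K \<in> wedge r s (int r - 1) c e" for c e
  proof -
    have "int (card (K \<inter> U)) = int r - 1" using that by (simp add: wedge_def)
    then have "card (K \<inter> U) = r - 1" by simp
    then have "card (U - K) = 1" using r_pos card_Diff_subset_Int[of U K] by (simp add: Int_commute)
    then obtain i where "U - K = {i}" by (auto simp: card_1_singleton_iff)
    then show ?thesis by blast
  qed
  have full: "K = (if 0 \<in> K then insert 0 (U \<union> (K \<inter> W)) else U \<union> (K \<inter> W))" if "K \<in> wedge r s (int r) c e" for c e
    using wedge_U[OF that] wedge_zero[OF that] by auto
  have z0: "0 \<notin> K" if "K \<in> wedge r s a c 0" for a c using that by (auto simp: wedge_def)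
  have z1: "0 \<in> K" if "K \<in> wedge r s a c 1" for a c
  proof (rule ccontr)
    assume "0 \<notin> K"
    then have "K \<inter> {0} = {}" by simp
    then show False using that by (simp add: wedge_def)
  qed
  have cW: "int (card (K \<inter> W)) = c" if "K \<in> wedge r s a c e" for a c e using that by (simp add: wedge_def)
  from assms consider
      (A) c e where "\<tau>x = 0" "\<zeta> = 0" "K \<in> wedge r s (int r - 1) c e"
    | (B) "\<tau>x = 0" "\<tau> \<in> monos_of ny (int q)" "\<zeta> \<in> monos_of nz 1" "K \<in> wedge r s (int r) (int b) 0"
    | (C) "\<tau>x = 0" "\<tau> \<in> monos_of ny (int (Suc q))" "\<zeta> \<in> monos_of nz 1" "K \<in> wedge r s (int r) (int b - 1) 1"
    unfolding K0_basis_def rl int_eqs 1 by (auto simp: monos_of_0 simp del: of_nat_Suc)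
  then show ?thesis
  proof cases
    case (A c e)
    then show ?thesis using miss[OF A(3)] that(1)[of \<tau> K] A by (auto simp: rl)
  next
    case B
    then obtain k where k: "k \<le> nz" "\<zeta> = unit k" by (auto simp: monos_of_unit)
    have "K = U \<union> (K \<inter> W)" using full[OF B(4)] z0[OF B(4)] by simp
    then show ?thesis using that(2)[of \<tau> k "K \<inter> W"] k B cW[OF B(4)] by (auto simp: rl monos_of_int)
  next
    case C
    then obtain k where k: "k \<le> nz" "\<zeta> = unit k" by (auto simp: monos_of_unit)
    have "K = insert 0 (U \<union> (K \<inter> W))" using full[OF C(4)] z1[OF C(4)] by simp
    moreover have "Suc (card (K \<inter> W)) = b" using cW[OF C(4)] by simp
    moreover have "keys \<tau> \<subseteq> {0..ny}" "deg \<tau> = Suc q" using C(2) unfolding monos_of_int by auto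
    ultimately show ?thesis using that(3)[of \<tau> k "K \<inter> W"] k C(1) by (simp add: rl)
  qed
qed

text \<open>The element \<rho>_\<alpha>(l) before division by the zeroth coordinates; in this form
  it makes sense for every point.\<close>

definition pure :: "(nat \<Rightarrow> 'a) \<Rightarrow> (nat \<Rightarrow> 'a) \<Rightarrow> (nat set \<Rightarrow> 'a) \<Rightarrow> label \<Rightarrow> 'a" where
  "pure x y l cl = (if cl \<in> K1_basis nx ny nz r s
     then mval x (fst (fst cl)) * mval y (fst (snd (fst cl))) * l (snd cl) else 0)"

lemma pure_val:
  assumes "((unit j, \<tau>, 0), I) \<in> K1_basis nx ny nz r s"
  shows "pure x y l ((unit j, \<tau>, 0), I) = x j * mval y \<tau> * l I"
  using assms by (simp add: pure_def)

text \<open>Contracting the divided powers of a point with a form evaluates the form there. Rows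
  without z vanish since f_i does, and a row with z_k is the contraction of \<open>l\<close> with
  the covector \<beta>_k of coefficients of z_k at (x, y). The vector z makes these n_z + 1
  covectors on s + 1 indices dependent, so a nonzero form \<open>l\<close> of degree b + 1 is
  annihilated by all of them.\<close>

lemma pure_kernel:
  assumes x: "\<exists>j\<le>nx. x j \<noteq> 0" and y: "\<exists>k\<le>ny. y k \<noteq> 0" and z: "\<exists>k\<le>nz. z k \<noteq> 0"
    and zU: "\<And>i. i \<in> U \<Longrightarrow> (\<Sum>k\<le>ny. y k * (\<Sum>j\<le>nx. x j * cA i j k)) = 0"
    and zW: "\<And>i. i \<in> W \<Longrightarrow> (\<Sum>k\<le>nz. z k * (\<Sum>j\<le>nx. x j * cB i j k)) = 0"
    and z0: "(\<Sum>k\<le>nz. z k * (\<Sum>j\<le>nx. \<Sum>l\<le>ny. x j * y l * lookup (F 0) (unit j, unit l, unit k))) = 0"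
  obtains l where "\<exists>cl\<in>K1_basis nx ny nz r s. pure x y l cl \<noteq> 0"
    "\<And>rl. rl \<in> K0_basis nx ny nz r s \<Longrightarrow> rsum (pure x y l) rl = 0"
proof -
  let ?V = "insert 0 W"
  define \<beta> where "\<beta> k i = (if i = 0 then \<Sum>j\<le>nx. \<Sum>l\<le>ny. x j * y l * lookup (F 0) (unit j, unit l, unit k)
    else \<Sum>j\<le>nx. x j * cB i j k)" for k i
  obtain k0 where k0: "k0 \<le> nz" "z k0 \<noteq> 0" using z by blast
  have dep: "(\<Sum>k\<in>{..nz}. z k * \<beta> k i) = 0" if "i \<in> ?V" for i
    using that zW z0 by (auto simp: \<beta>_def)
  have UV: "U \<inter> ?V = {}" by auto
  have cV: "card {..nz} + Suc b = Suc (card ?V)" using s by simp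
  obtain e where e: "\<exists>I. e (0, 0, I) \<noteq> 0" "\<And>I. e (0, 0, I) \<noteq> 0 \<Longrightarrow> U \<subseteq> I \<and> I \<subseteq> U \<union> ?V \<and> card (I \<inter> ?V) = Suc b"
    "\<And>k I. k \<in> {..nz} \<Longrightarrow> contraction ?V (\<beta> k) e (0, 0, I) = 0"
    by (rule ex_annihilated_form_dependent[of "{..nz}" ?V U "Suc b" k0 z \<beta>]) (use k0 dep UV cV in auto)
  define l where "l I = e (0, 0, I)" for I
  have v: "pure x y l cl = 0" if "cl \<notin> K1_basis nx ny nz r s" for cl using that by (simp add: pure_def)
  show ?thesis
  proof (rule that[of l])
    obtain I where I: "l I \<noteq> 0" using e(1) by (auto simp: l_def)
    then have *: "U \<subseteq> I" "I \<subseteq> U \<union> ?V" "card (I \<inter> ?V) = Suc b" using e(2) by (auto simp: l_def)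
    obtain j where j: "j \<le> nx" "x j \<noteq> 0" using x by blast
    obtain k where k: "k \<le> ny" "y k \<noteq> 0" using y by blast
    \<comment> \<open>The y-degree of a label is q + 1 or q according to whether 0 lies in
      \<open>I\<close>; a power of one y_k with nonzero coordinate gives a nonzero entry.\<close>
    define d where "d = (if 0 \<in> I then Suc q else q)"
    have mem: "((unit j, Poly_Mapping.single k d, 0), I) \<in> K1_basis nx ny nz r s"
    proof (cases "0 \<in> I")
      case True
      then have "I \<inter> ?V = insert 0 (I \<inter> W)" by auto
      moreover have "0 \<notin> I \<inter> W" by auto
      ultimately have "card (I \<inter> W) = b" using *(3) by (metis card_insert_disjoint finite_Int finite_atLeastAtMost nat.inject)
      moreover have "I = insert 0 (U \<union> (I \<inter> W))" using *(1,2) True by blast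
      ultimately show ?thesis unfolding mem_K1_basis using j(1) k(1) True
        by (intro exI[of _ j] conjI exI[of _ "Poly_Mapping.single k d"] exI[of _ "I \<inter> W"]) (simp_all add: d_def)
    next
      case False
      then have "I \<inter> ?V = I \<inter> W" by auto
      then have "card (I \<inter> W) = Suc b" using *(3) by simp
      moreover have "I = U \<union> (I \<inter> W)" using *(1,2) False by blast
      ultimately show ?thesis unfolding mem_K1_basis using j(1) k(1) False
        by (intro exI[of _ j] conjI exI[of _ "Poly_Mapping.single k d"] exI[of _ "I \<inter> W"]) (simp_all add: d_def)
    qed
    then have "pure x y l ((unit j, Poly_Mapping.single k d, 0), I) \<noteq> 0"
      using j k I by (simp add: pure_val mval_single)
    with mem show "\<exists>cl\<in>K1_basis nx ny nz r s. pure x y l cl \<noteq> 0" by blast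
  next
    fix rl assume "rl \<in> K0_basis nx ny nz r s"
    \<comment> \<open>Common to both kinds of rows with z_k: the factor y^\<tau> splits off and
      leaves the contraction with \<beta>_k.\<close>
    have rowz: "rsum (pure x y l) ((0, \<tau>, unit k), K) = 0"
      if k: "k \<le> nz" and K: "U \<subseteq> K"
        and mem0: "\<And>j m. 0 \<notin> K \<Longrightarrow> j \<le> nx \<Longrightarrow> m \<le> ny \<Longrightarrow> ((unit j, \<tau> + unit m, 0), insert 0 K) \<in> K1_basis nx ny nz r s"
        and mem1: "\<And>i j. i \<in> W - K \<Longrightarrow> j \<le> nx \<Longrightarrow> ((unit j, \<tau>, 0), insert i K) \<in> K1_basis nx ny nz r s" for \<tau> k K
    proof -
      have t0: "(\<Sum>j\<le>nx. \<Sum>m\<le>ny. lookup (F 0) (unit j, unit m, unit k) * pure x y l ((unit j, \<tau> + unit m, 0), insert 0 K)) =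
          mval y \<tau> * (\<beta> k 0 * l (insert 0 K))" if "0 \<notin> K"
        using mem0[OF that] by (simp add: pure_val mval_add \<beta>_def sum_distrib_left sum_distrib_right mult_ac)
      have t1: "(\<Sum>j\<le>nx. cB i j k * pure x y l ((unit j, \<tau>, 0), insert i K)) = mval y \<tau> * (\<beta> k i * l (insert i K))"
        if "i \<in> W - K" for i
        using mem1[OF that] that by (simp add: pure_val \<beta>_def sum_distrib_left sum_distrib_right mult_ac)
      have t1s: "(\<Sum>i\<in>W - K. wsgn i K * (\<Sum>j\<le>nx. cB i j k * pure x y l ((unit j, \<tau>, 0), insert i K))) =
          mval y \<tau> * (\<Sum>i\<in>W - K. wsgn i K * \<beta> k i * l (insert i K))"
      proof -
        have "(\<Sum>i\<in>W - K. wsgn i K * (\<Sum>j\<le>nx. cB i j k * pure x y l ((unit j, \<tau>, 0), insert i K))) =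
            (\<Sum>i\<in>W - K. mval y \<tau> * (wsgn i K * \<beta> k i * l (insert i K)))"
          by (rule sum.cong[OF refl]) (simp only: t1 mult_ac)
        then show ?thesis by (simp only: sum_distrib_left)
      qed
      have w0: "wsgn 0 K = (1 :: 'a)" by (simp add: wsgn_def)
      have c0: "contraction ?V (\<beta> k) e (0, 0, K) = 0" using k e(3) by simp
      have ceq: "contraction ?V (\<beta> k) e (0, 0, K) = (if 0 \<in> K then 0 else \<beta> k 0 * l (insert 0 K)) +
          (\<Sum>i\<in>W - K. wsgn i K * \<beta> k i * l (insert i K))"
      proof (cases "0 \<in> K")
        case True
        then have "?V - K = W - K" by blast
        then show ?thesis using True by (simp add: contraction_apply l_def)
      next
        case False
        then have "?V - K = insert 0 (W - K)" "0 \<notin> W - K" by auto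
        then show ?thesis using False w0 by (simp add: contraction_apply l_def)
      qed
      have "rsum (pure x y l) ((0, \<tau>, unit k), K) = (if 0 \<in> K then 0 else
          (\<Sum>j\<le>nx. \<Sum>m\<le>ny. lookup (F 0) (unit j, unit m, unit k) * pure x y l ((unit j, \<tau> + unit m, 0), insert 0 K))) +
          (\<Sum>i\<in>W - K. wsgn i K * (\<Sum>j\<le>nx. cB i j k * pure x y l ((unit j, \<tau>, 0), insert i K)))"
        by (rule rsum_z[OF _ K k]) (rule v)
      note rz = this[unfolded t1s]
      have "rsum (pure x y l) ((0, \<tau>, unit k), K) = mval y \<tau> * contraction ?V (\<beta> k) e (0, 0, K)"
      proof (cases "0 \<in> K")
        case True
        then show ?thesis unfolding rz ceq by (simp only: if_True add_0)
      next
        case False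
        then show ?thesis unfolding rz ceq by (simp only: if_False t0[OF False] distrib_left)
      qed
      then show ?thesis by (simp only: c0 mult_zero_right)
    qed
    from \<open>rl \<in> K0_basis nx ny nz r s\<close> show "rsum (pure x y l) rl = 0"
    proof (cases rule: K0_cases)
      case (1 i \<tau> K)
      \<comment> \<open>Either all labels in this sum belong to \<open>K1\<close> or none does,
        since membership depends only on \<tau> and \<open>insert i K\<close>.\<close>
      have "(\<Sum>j\<le>nx. \<Sum>k\<le>ny. cA i j k * pure x y l ((unit j, \<tau> + unit k, 0), insert i K)) = 0"
      proof (cases "keys \<tau> \<subseteq> {0..ny} \<and> ((unit 0, \<tau> + unit 0, 0), insert i K) \<in> K1_basis nx ny nz r s")
        case True
        then have mem: "((unit j, \<tau> + unit k, 0), insert i K) \<in> K1_basis nx ny nz r s" if "j \<le> nx" "k \<le> ny" for j k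
          using that True unfolding mem_K1_unit by (simp add: keys_add_nat deg_add)
        have "(\<Sum>j\<le>nx. \<Sum>k\<le>ny. cA i j k * pure x y l ((unit j, \<tau> + unit k, 0), insert i K)) =
            mval y \<tau> * l (insert i K) * (\<Sum>j\<le>nx. \<Sum>k\<le>ny. y k * (x j * cA i j k))"
          by (simp add: pure_val mem mval_add sum_distrib_left sum_distrib_right mult_ac)
        also have "(\<Sum>j\<le>nx. \<Sum>k\<le>ny. y k * (x j * cA i j k)) = 0"
          using zU[OF 1(2)] by (subst sum.swap) (simp add: sum_distrib_left)
        finally show ?thesis by simp
      next
        case False
        have "((unit j, \<tau> + unit k, 0), insert i K) \<notin> K1_basis nx ny nz r s" for j k
          using False unfolding mem_K1_unit by (simp add: keys_add_nat deg_add)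
        then show ?thesis by (simp add: pure_def)
      qed
      moreover have "rsum (pure x y l) rl = wsgn i K *
          (\<Sum>j\<le>nx. \<Sum>k\<le>ny. cA i j k * pure x y l ((unit j, \<tau> + unit k, 0), insert i K))"
        unfolding 1(1) by (rule rsum_y[OF _ 1(2-4)]) (rule v)
      ultimately show ?thesis by simp
    next
      case (2 k \<tau> I)
      have fI: "finite I" using 2(5) finite_subset by blast
      have "0 \<notin> I" "0 \<notin> U \<union> I" using 2(5) by auto
      show ?thesis unfolding 2(1)
      proof (rule rowz[OF 2(2)])
        fix j m assume "j \<le> nx" "m \<le> ny"
        then show "((unit j, \<tau> + unit m, 0), insert 0 (U \<union> I)) \<in> K1_basis nx ny nz r s"
          unfolding mem_K1_basis using 2
          by (intro exI[of _ j] conjI exI[of _ "\<tau> + unit m"] exI[of _ I]) (simp_all add: keys_add_nat deg_add)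
      next
        fix i j assume i: "i \<in> W - (U \<union> I)" "j \<le> nx"
        then show "((unit j, \<tau>, 0), insert i (U \<union> I)) \<in> K1_basis nx ny nz r s"
          unfolding mem_K1_basis using 2 fI
          by (intro exI[of _ j] conjI exI[of _ \<tau>] exI[of _ "insert i I"]) simp_all
      qed simp
    next
      case (3 k \<tau> I)
      have fI: "finite I" using 3(5) finite_subset by blast
      show ?thesis unfolding 3(1)
      proof (rule rowz[OF 3(2)])
        fix i j assume i: "i \<in> W - insert 0 (U \<union> I)" "j \<le> nx"
        have "insert i (insert 0 (U \<union> I)) = insert 0 (U \<union> insert i I)" by blast
        with i show "((unit j, \<tau>, 0), insert i (insert 0 (U \<union> I))) \<in> K1_basis nx ny nz r s"
          unfolding mem_K1_basis using 3 fI
          by (intro exI[of _ j] conjI exI[of _ \<tau>] exI[of _ "insert i I"]) simp_all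
      qed auto
    qed
  qed
qed

end

section \<open>Eigenvectors of the Schur complement\<close>

lemma inverse_if_kernel_zero:
  fixes A :: "'a::field mat"
  assumes A: "A \<in> carrier_mat n n"
    and ker: "\<And>v. v \<in> carrier_vec n \<Longrightarrow> A *\<^sub>v v = 0\<^sub>v n \<Longrightarrow> v = 0\<^sub>v n"
  obtains B where "mat_inverse A = Some B" "B \<in> carrier_mat n n" "A * B = 1\<^sub>m n" "B * A = 1\<^sub>m n"
proof -
  have "det A \<noteq> 0" using det_0_iff_vec_prod_zero_field[OF A] ker by blast
  then have "A \<in> Units (ring_mat TYPE('a) n ())" by (rule det_non_zero_imp_unit[OF A])
  then obtain B where "mat_inverse A = Some B" using mat_inverse(1)[OF A, where b = "()"] by (cases "mat_inverse A") auto
  then show ?thesis using that mat_inverse(2)[OF A] by blast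
qed

lemma mult_mat_vec_nth:
  assumes "A \<in> carrier_mat m n" "v \<in> carrier_vec n" "i < m"
  shows "(A *\<^sub>v v) $ i = (\<Sum>j<n. A $$ (i, j) * v $ j)"
  using assms by (simp add: scalar_prod_def atLeast0LessThan)

text \<open>Applying A minus the eigenvalue of i0 to a relation removes the term of i0 and
  multiplies the others by nonzero factors.\<close>

lemma eigenvectors_independent:
  fixes A :: "'a::field mat"
  assumes A: "A \<in> carrier_mat n n"
    and u: "\<And>i. i \<in> M \<Longrightarrow> u i \<in> carrier_vec n \<and> u i \<noteq> 0\<^sub>v n \<and> A *\<^sub>v u i = e i \<cdot>\<^sub>v u i"
    and e: "inj_on e M" and M: "finite M"
    and c: "\<And>a. a < n \<Longrightarrow> (\<Sum>i\<in>M. c i * u i $ a) = 0"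
  shows "\<forall>i\<in>M. c i = 0"
  using M u e c
proof (induction M arbitrary: c rule: finite_induct)
  case (insert i0 M)
  have comb: "(\<Sum>i\<in>insert i0 M. c i * e i * u i $ a) = 0" if "a < n" for a
  proof -
    have "e i * u i $ a = (\<Sum>a'<n. A $$ (a, a') * u i $ a')" if "i \<in> insert i0 M" for i
    proof -
      have ui: "u i \<in> carrier_vec n" "A *\<^sub>v u i = e i \<cdot>\<^sub>v u i" using insert.prems(1)[OF that] by simp_all
      have "(e i \<cdot>\<^sub>v u i) $ a = e i * u i $ a" using \<open>a < n\<close> carrier_vecD[OF ui(1)] by (intro index_smult_vec(1)) simp
      then show ?thesis using mult_mat_vec_nth[OF A ui(1) \<open>a < n\<close>] unfolding ui(2) by simp
    qed
    then have "(\<Sum>i\<in>insert i0 M. c i * e i * u i $ a) = (\<Sum>i\<in>insert i0 M. \<Sum>a'<n. A $$ (a, a') * (c i * u i $ a'))"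
      by (intro sum.cong refl) (simp add: sum_distrib_left mult_ac)
    also have "\<dots> = (\<Sum>a'<n. \<Sum>i\<in>insert i0 M. A $$ (a, a') * (c i * u i $ a'))"
      by (rule sum.swap)
    also have "\<dots> = (\<Sum>a'<n. A $$ (a, a') * (\<Sum>i\<in>insert i0 M. c i * u i $ a'))"
      by (simp only: sum_distrib_left)
    also have "\<dots> = 0" using insert.prems(3) by simp
    finally show ?thesis .
  qed
  have "\<forall>i\<in>M. c i * (e i - e i0) = 0"
  proof (rule insert.IH)
    show "(\<Sum>i\<in>M. c i * (e i - e i0) * u i $ a) = 0" if "a < n" for a
    proof -
      have "(\<Sum>i\<in>insert i0 M. c i * (e i - e i0) * u i $ a) =
          (\<Sum>i\<in>insert i0 M. c i * e i * u i $ a) - e i0 * (\<Sum>i\<in>insert i0 M. c i * u i $ a)"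
        by (simp only: sum_distrib_left sum_subtractf[symmetric]) (intro sum.cong refl, simp add: algebra_simps)
      then show ?thesis using comb[OF that] insert.prems(3)[OF that] insert.hyps by simp
    qed
  qed (use insert.prems in auto)
  moreover have "e i \<noteq> e i0" if "i \<in> M" for i using insert.prems(2) insert.hyps that by (auto simp: inj_on_def)
  ultimately have cS: "c i = 0" if "i \<in> M" for i using that by auto
  have "c i0 = 0"
  proof (rule ccontr)
    assume "c i0 \<noteq> 0"
    have "u i0 $ a = 0" if "a < n" for a
      using insert.prems(3)[OF that] insert.hyps cS \<open>c i0 \<noteq> 0\<close> by simp
    then have "u i0 = 0\<^sub>v n" using insert.prems(1)[of i0] by (intro eq_vecI) auto
    then show False using insert.prems(1)[of i0] by simp
  qed
  then show ?case using cS by simp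
qed simp

text \<open>Besides diagonalizability it shows that each eigenspace is a line, which transfers the
  shape of one eigenvector to all eigenvectors of the same eigenvalue.\<close>

lemma distinct_eigenvalues:
  fixes A :: "'a::field mat"
  assumes A: "A \<in> carrier_mat n n"
    and u: "\<And>i. i < n \<Longrightarrow> eigenvector A (u i) (e i)" and e: "inj_on e {..<n}"
  shows "diagonalizable A"
    and "eigenvector A v x \<Longrightarrow> \<exists>i<n. \<exists>c. x = e i \<and> v = c \<cdot>\<^sub>v u i"
proof -
  have u': "u i \<in> carrier_vec n" "u i \<noteq> 0\<^sub>v n" "A *\<^sub>v u i = e i \<cdot>\<^sub>v u i" if "i < n" for i
    using u[OF that] A by (auto simp: eigenvector_def)
  define P where "P = mat n n (\<lambda>(a, i). u i $ a)"
  define D where "D = mat n n (\<lambda>(i, j). if i = j then e i else 0)"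
  have P: "P \<in> carrier_mat n n" and D: "D \<in> carrier_mat n n" by (simp_all add: P_def D_def)
  have "w = 0\<^sub>v n" if w: "w \<in> carrier_vec n" "P *\<^sub>v w = 0\<^sub>v n" for w
  proof -
    have "\<forall>i\<in>{..<n}. w $ i = 0"
    proof (rule eigenvectors_independent[OF A _ e, of u])
      show "(\<Sum>i<n. w $ i * u i $ a) = 0" if "a < n" for a
      proof -
        have "(P *\<^sub>v w) $ a = 0" using w that by simp
        then show ?thesis using mult_mat_vec_nth[OF P w(1) that] that by (simp add: P_def mult.commute)
      qed
    qed (use u' in auto)
    then show ?thesis using w(1) by (intro eq_vecI) auto
  qed
  then obtain Q where Q: "Q \<in> carrier_mat n n" "P * Q = 1\<^sub>m n" "Q * P = 1\<^sub>m n"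
    using inverse_if_kernel_zero[OF P] by blast
  have AP: "A * P = P * D"
  proof (rule eq_matI)
    fix a i assume "a < dim_row (P * D)" "i < dim_col (P * D)"
    then have ai: "a < n" "i < n" by (simp_all add: P_def D_def)
    have "(A * P) $$ (a, i) = (A *\<^sub>v u i) $ a"
    proof -
      have "col P i = u i" using ai carrier_vecD[OF u'(1)[OF ai(2)]] by (intro eq_vecI) (auto simp: P_def)
      then show ?thesis using ai A P by simp
    qed
    also have "\<dots> = e i * u i $ a" unfolding u'(3)[OF ai(2)] using index_smult_vec(1)[of a "u i" "e i"] ai carrier_vecD[OF u'(1)[OF ai(2)]] by simp
    also have "\<dots> = (P * D) $$ (a, i)"
    proof -
      have "(P * D) $$ (a, i) = (\<Sum>j<n. P $$ (a, j) * D $$ (j, i))"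
        using ai P D by (simp add: scalar_prod_def atLeast0LessThan)
      also have "\<dots> = (\<Sum>j<n. if j = i then u i $ a * e i else 0)"
        using ai by (intro sum.cong) (auto simp: P_def D_def)
      finally show ?thesis using ai by (simp add: mult.commute)
    qed
    finally show "(A * P) $$ (a, i) = (P * D) $$ (a, i)" .
  qed (use A in \<open>simp_all add: P_def D_def\<close>)
  have A_eq: "A = P * D * Q"
  proof -
    have "A = A * (P * Q)" using A by (simp add: Q)
    also have "\<dots> = A * P * Q" using A P Q(1) by simp
    finally show ?thesis by (simp only: AP)
  qed
  have "similar_mat A D"
    unfolding similar_mat_def using A P D Q A_eq by (intro exI[of _ P] exI[of _ Q] similar_mat_witI[of _ _ n]) auto
  moreover have "diagonal_mat D" by (auto simp: diagonal_mat_def D_def)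
  ultimately show "diagonalizable A" by (auto simp: diagonalizable_def)
  assume "eigenvector A v x"
  then have v: "v \<in> carrier_vec n" "v \<noteq> 0\<^sub>v n" "A *\<^sub>v v = x \<cdot>\<^sub>v v" using A by (auto simp: eigenvector_def)
  define y where "y = Q *\<^sub>v v"
  have y: "y \<in> carrier_vec n" using Q v by (simp add: y_def)
  have Py: "P *\<^sub>v y = v"
  proof -
    have "P *\<^sub>v (Q *\<^sub>v v) = (P * Q) *\<^sub>v v" using P Q(1) v(1) by simp
    then show ?thesis using v(1) by (simp add: y_def Q)
  qed
  have Dy: "D *\<^sub>v y = x \<cdot>\<^sub>v y"
  proof -
    have "P *\<^sub>v (D *\<^sub>v y) = A *\<^sub>v v"
    proof -
      have "P *\<^sub>v (D *\<^sub>v y) = (P * D) *\<^sub>v y" using P D y by simp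
      also have "\<dots> = A *\<^sub>v (P *\<^sub>v y)" using A P y by (simp flip: AP)
      finally show ?thesis by (simp only: Py)
    qed
    also have "\<dots> = P *\<^sub>v (x \<cdot>\<^sub>v y)" by (simp only: v(3) mult_mat_vec[OF P y] Py)
    finally have "Q *\<^sub>v (P *\<^sub>v (D *\<^sub>v y)) = Q *\<^sub>v (P *\<^sub>v (x \<cdot>\<^sub>v y))" by simp
    moreover have "Q *\<^sub>v (P *\<^sub>v t) = t" if "t \<in> carrier_vec n" for t
    proof -
      have "Q *\<^sub>v (P *\<^sub>v t) = (Q * P) *\<^sub>v t" using P Q(1) that by simp
      then show ?thesis using that by (simp add: Q)
    qed
    ultimately show ?thesis using D y by simp
  qed
  have comp: "e i * y $ i = x * y $ i" if "i < n" for i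
  proof -
    have "(D *\<^sub>v y) $ i = (\<Sum>j<n. D $$ (i, j) * y $ j)" by (rule mult_mat_vec_nth[OF D y that])
    also have "\<dots> = (\<Sum>j<n. if j = i then e i * y $ i else 0)"
      using that by (intro sum.cong) (auto simp: D_def)
    finally show ?thesis using Dy that y carrier_vecD[OF y] by (simp add: eq_commute[of "e i"])
  qed
  have "\<exists>i<n. y $ i \<noteq> 0"
  proof (rule ccontr)
    assume "\<not> (\<exists>i<n. y $ i \<noteq> 0)"
    then have "y = 0\<^sub>v n" using y by (intro eq_vecI) auto
    then have "v = P *\<^sub>v 0\<^sub>v n" using Py by simp
    also have "\<dots> = 0\<^sub>v n" using P by (intro eq_vecI) (auto simp: scalar_prod_def)
    finally show False using v(2) by simp
  qed
  then obtain i where i: "i < n" "y $ i \<noteq> 0" by blast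
  then have x: "x = e i" using comp[of i] by simp
  have y0: "y $ j = 0" if "j < n" "j \<noteq> i" for j
    using comp[OF that(1)] x e that i by (auto simp: inj_on_def)
  have "v = y $ i \<cdot>\<^sub>v u i"
  proof (rule eq_vecI)
    fix a assume "a < dim_vec (y $ i \<cdot>\<^sub>v u i)"
    then have a: "a < n" using u'(1)[OF i(1)] by simp
    have "v $ a = (\<Sum>j<n. P $$ (a, j) * y $ j)" using mult_mat_vec_nth[OF P y a] Py by simp
    also have "\<dots> = (\<Sum>j<n. if j = i then u i $ a * y $ i else 0)"
      using a y0 by (intro sum.cong) (auto simp: P_def)
    finally show "v $ a = (y $ i \<cdot>\<^sub>v u i) $ a" using i a u'(1)[OF i(1)] by (simp add: mult.commute)
  qed (use v u'(1)[OF i(1)] in simp)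
  with x i show "\<exists>i<n. \<exists>c. x = e i \<and> v = c \<cdot>\<^sub>v u i" by blast
qed

section \<open>Evaluation at points of the product of projective spaces\<close>

lemma mono_val_eq: "mono_val \<sigma> v = mval (\<lambda>i. v $ i) \<sigma>"
  by (simp add: mono_val_def mval_def)

lemma poly_val_superset:
  assumes "finite A" "keys p \<subseteq> A"
  shows "poly_val p a b c = (\<Sum>\<theta>\<in>A. lookup p \<theta> * mono_val (fst \<theta>) a * mono_val (fst (snd \<theta>)) b * mono_val (snd (snd \<theta>)) c)"
  unfolding poly_val_def case_prod_unfold
  using assms by (intro sum.mono_neutral_cong_left) (auto simp: in_keys_iff)

lemma poly_val_xy:
  fixes a b c :: "'a::comm_ring_1 vec"
  assumes "p \<in> S nx ny nz (1, 1, 0)"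
  shows "poly_val p a b c = (\<Sum>k\<le>ny. b $ k * (\<Sum>j\<le>nx. a $ j * lookup p (unit j, unit k, 0)))"
proof -
  have "poly_val p a b c = (\<Sum>\<theta>\<in>unit ` {..nx} \<times> unit ` {..ny} \<times> {0}. lookup p \<theta> * mono_val (fst \<theta>) a * mono_val (fst (snd \<theta>)) b * mono_val (snd (snd \<theta>)) c)"
    using assms by (intro poly_val_superset) (auto simp: S_def monos_of_0 monos_of_unit atLeast0AtMost)
  also have "\<dots> = (\<Sum>j\<le>nx. \<Sum>k\<le>ny. b $ k * (a $ j * lookup p (unit j, unit k, 0)))"
    by (simp add: sum.cartesian_product' sum.reindex[OF inj_on_unit] mono_val_eq mval_def[of _ 0] mult_ac del: sum.cartesian_product)
  also have "\<dots> = (\<Sum>k\<le>ny. b $ k * (\<Sum>j\<le>nx. a $ j * lookup p (unit j, unit k, 0)))"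
    by (subst sum.swap) (simp add: sum_distrib_left)
  finally show ?thesis .
qed

lemma poly_val_xz:
  fixes a b c :: "'a::comm_ring_1 vec"
  assumes "p \<in> S nx ny nz (1, 0, 1)"
  shows "poly_val p a b c = (\<Sum>k\<le>nz. c $ k * (\<Sum>j\<le>nx. a $ j * lookup p (unit j, 0, unit k)))"
proof -
  have "poly_val p a b c = (\<Sum>\<theta>\<in>unit ` {..nx} \<times> {0} \<times> unit ` {..nz}. lookup p \<theta> * mono_val (fst \<theta>) a * mono_val (fst (snd \<theta>)) b * mono_val (snd (snd \<theta>)) c)"
    using assms by (intro poly_val_superset) (auto simp: S_def monos_of_0 monos_of_unit atLeast0AtMost)
  also have "\<dots> = (\<Sum>j\<le>nx. \<Sum>k\<le>nz. c $ k * (a $ j * lookup p (unit j, 0, unit k)))"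
    by (simp add: sum.cartesian_product' sum.reindex[OF inj_on_unit] mono_val_eq mval_def[of _ 0] mult_ac del: sum.cartesian_product)
  also have "\<dots> = (\<Sum>k\<le>nz. c $ k * (\<Sum>j\<le>nx. a $ j * lookup p (unit j, 0, unit k)))"
    by (subst sum.swap) (simp add: sum_distrib_left)
  finally show ?thesis .
qed

lemma poly_val_xyz:
  fixes a b c :: "'a::comm_ring_1 vec"
  assumes "p \<in> S nx ny nz (1, 1, 1)"
  shows "poly_val p a b c = (\<Sum>k\<le>nz. c $ k * (\<Sum>j\<le>nx. \<Sum>l\<le>ny. a $ j * b $ l * lookup p (unit j, unit l, unit k)))"
proof -
  have "poly_val p a b c = (\<Sum>\<theta>\<in>unit ` {..nx} \<times> unit ` {..ny} \<times> unit ` {..nz}. lookup p \<theta> * mono_val (fst \<theta>) a * mono_val (fst (snd \<theta>)) b * mono_val (snd (snd \<theta>)) c)"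
    using assms by (intro poly_val_superset) (auto simp: S_def monos_of_unit atLeast0AtMost)
  also have "\<dots> = (\<Sum>j\<le>nx. \<Sum>l\<le>ny. \<Sum>k\<le>nz. c $ k * (a $ j * b $ l * lookup p (unit j, unit l, unit k)))"
    by (simp add: sum.cartesian_product' sum.reindex[OF inj_on_unit] mono_val_eq mult_ac del: sum.cartesian_product)
  also have "\<dots> = (\<Sum>j\<le>nx. \<Sum>k\<le>nz. \<Sum>l\<le>ny. c $ k * (a $ j * b $ l * lookup p (unit j, unit l, unit k)))"
    by (intro sum.cong refl sum.swap)
  also have "\<dots> = (\<Sum>k\<le>nz. \<Sum>j\<le>nx. \<Sum>l\<le>ny. c $ k * (a $ j * b $ l * lookup p (unit j, unit l, unit k)))"
    by (rule sum.swap)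
  finally show ?thesis by (simp only: sum_distrib_left)
qed

lemma poly_val_monomial:
  "poly_val (monomial (unit i, unit j, unit k)) a b c = a $ i * b $ j * (c $ k :: 'a::field)"
  by (simp add: poly_val_def monomial_def mono_val_eq)

lemma coords_in:
  assumes "X \<in> proj_space m"
  shows "coords X \<in> X" "coords X \<in> carrier_vec (m + 1)" "coords X \<noteq> 0\<^sub>v (m + 1)"
    "\<exists>j\<le>m. coords X $ j \<noteq> 0"
proof -
  have "X \<noteq> {}" using assms in_quotient_imp_non_empty[OF equiv_proj_rel] by (auto simp: proj_space_def)
  then show 1: "coords X \<in> X" unfolding coords_def by (metis some_in_eq)
  have "X \<subseteq> carrier_vec (m + 1) - {0\<^sub>v (m + 1)}"
    using assms in_quotient_imp_subset[OF equiv_proj_rel] by (auto simp: proj_space_def)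
  with 1 show 2: "coords X \<in> carrier_vec (m + 1)" "coords X \<noteq> 0\<^sub>v (m + 1)" by auto
  show "\<exists>j\<le>m. coords X $ j \<noteq> 0"
  proof (rule ccontr)
    assume "\<not> (\<exists>j\<le>m. coords X $ j \<noteq> 0)"
    then have "coords X = 0\<^sub>v (m + 1)" using 2(1) by (intro eq_vecI) auto
    with 2(2) show False by simp
  qed
qed

lemma proj_class:
  fixes x :: "nat \<Rightarrow> 'a::field"
  assumes "\<exists>j\<le>m. x j \<noteq> 0"
  defines "X \<equiv> proj_rel m `` {vec (m + 1) x}"
  shows "X \<in> proj_space m" "v \<in> X \<Longrightarrow> \<exists>c. c \<noteq> 0 \<and> (\<forall>j\<le>m. v $ j = c * x j)"
proof -
  have "vec (m + 1) x \<noteq> 0\<^sub>v (m + 1)"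
  proof
    assume *: "vec (m + 1) x = 0\<^sub>v (m + 1)"
    obtain j where j: "j \<le> m" "x j \<noteq> 0" using assms by blast
    have "vec (m + 1) x $ j = 0" unfolding * using j by simp
    then show False using j by simp
  qed
  then show "X \<in> proj_space m" unfolding X_def proj_space_def by (intro quotientI) auto
  show "v \<in> X \<Longrightarrow> \<exists>c. c \<noteq> 0 \<and> (\<forall>j\<le>m. v $ j = c * x j)"
    by (auto simp: X_def proj_rel_def)
qed

lemma lookup_one_tensor:
  "lookup (one_tensor nx ny \<alpha> dx dy) (\<sigma>x, \<sigma>y, \<sigma>z) =
    (if \<sigma>x \<in> monos_of nx (int dx) \<and> \<sigma>y \<in> monos_of ny (int dy) \<and> \<sigma>z = 0
     then one_coeff (fst \<alpha>) dx \<sigma>x * one_coeff (fst (snd \<alpha>)) dy \<sigma>y else 0)"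
proof -
  have "lookup (one_tensor nx ny \<alpha> dx dy) (\<sigma>x, \<sigma>y, \<sigma>z) =
      (\<Sum>\<rho>x\<in>monos_of nx (int dx). \<Sum>\<rho>y\<in>monos_of ny (int dy).
        if \<rho>y = \<sigma>y then (if \<rho>x = \<sigma>x then (if \<sigma>z = 0 then one_coeff (fst \<alpha>) dx \<rho>x * one_coeff (fst (snd \<alpha>)) dy \<rho>y else 0) else 0) else 0)"
    unfolding one_tensor_def lookup_sum lookup_single when_def by (intro sum.cong refl) auto
  also have "\<dots> = (\<Sum>\<rho>x\<in>monos_of nx (int dx). if \<rho>x = \<sigma>x then (if \<sigma>y \<in> monos_of ny (int dy) \<and> \<sigma>z = 0 then one_coeff (fst \<alpha>) dx \<rho>x * one_coeff (fst (snd \<alpha>)) dy \<sigma>y else 0) else 0)"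
    by (intro sum.cong refl) (simp add: finite_monos_of)
  finally show ?thesis by (simp add: finite_monos_of)
qed

text \<open>Subtracting e w^\<theta> from f_0 lowers the entries at the positions of u_{0,\<theta>}
  by exactly e: no sign appears because 0 is the smallest possible index.\<close>

lemma entry_update_monomial:
  fixes f :: "nat \<Rightarrow> 'a::comm_ring_1 xyz_poly"
  assumes "finite I"
  shows "entry (f(0 := f0 - Poly_Mapping.single (\<theta>x, \<theta>y, \<theta>z) e)) ((\<tau>x, \<tau>y, \<tau>z), K) ((\<sigma>x, \<sigma>y, \<sigma>z), I) =
    entry (f(0 := f0)) ((\<tau>x, \<tau>y, \<tau>z), K) ((\<sigma>x, \<sigma>y, \<sigma>z), I) -
    (if 0 \<in> I \<and> K = I - {0} \<and> \<sigma>x = \<theta>x + \<tau>x \<and> \<sigma>y = \<theta>y + \<tau>y \<and> \<tau>z = \<theta>z + \<sigma>z then e else 0)"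
proof (cases "\<exists>i\<in>I. K = I - {i}")
  case False
  then show ?thesis by (auto simp: entry_eq_0)
next
  case True
  then obtain i where i: "i \<in> I" "K = I - {i}" by blast
  have z: "0 \<in> I \<and> K = I - {0} \<longleftrightarrow> i = 0" using i by auto
  show ?thesis
  proof (cases "i = 0")
    case False
    then show ?thesis using z unfolding i(2) entry_remove[OF assms i(1)] by (auto simp: i(2))
  next
    case True
    have eqv: "mono_le \<tau>x \<sigma>x \<and> mono_le \<tau>y \<sigma>y \<and> mono_le \<sigma>z \<tau>z \<and> (\<theta>x, \<theta>y, \<theta>z) = (\<sigma>x - \<tau>x, \<sigma>y - \<tau>y, \<tau>z - \<sigma>z) \<longleftrightarrow>
        \<sigma>x = \<theta>x + \<tau>x \<and> \<sigma>y = \<theta>y + \<tau>y \<and> \<tau>z = \<theta>z + \<sigma>z"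
      unfolding prod.inject eq_commute[of _ "_ + _"] mono_le_add by blast
    have single: "pcoef (Poly_Mapping.single (\<theta>x, \<theta>y, \<theta>z) e) (\<sigma>x, \<sigma>y, \<sigma>z) (\<tau>x, \<tau>y, \<tau>z) =
        (if \<sigma>x = \<theta>x + \<tau>x \<and> \<sigma>y = \<theta>y + \<tau>y \<and> \<tau>z = \<theta>z + \<sigma>z then e else 0)"
      unfolding pcoef.simps lookup_single when_def if_if_eq_conj conj_assoc
      by (rule arg_cong[OF eqv, of "\<lambda>P. if P then e else 0"])
    moreover have "pcoef (f0 - p) (\<sigma>x, \<sigma>y, \<sigma>z) (\<tau>x, \<tau>y, \<tau>z) = pcoef f0 (\<sigma>x, \<sigma>y, \<sigma>z) (\<tau>x, \<tau>y, \<tau>z) - pcoef p (\<sigma>x, \<sigma>y, \<sigma>z) (\<tau>x, \<tau>y, \<tau>z)" for p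
      by (simp add: lookup_minus)
    moreover have "wsgn 0 I = (1 :: 'a)" by (simp add: wsgn_def)
    moreover have "0 \<in> I" "K = I - {0}" using i True by simp_all
    ultimately show ?thesis
      unfolding \<open>K = I - {0}\<close> entry_remove[OF assms \<open>0 \<in> I\<close>] fun_upd_same by simp
  qed
qed

lemma sum_set_nth: "distinct xs \<Longrightarrow> (\<Sum>x\<in>set xs. g x) = (\<Sum>j<length xs. g (xs ! j))"
  using sum.reindex_bij_betw[OF bij_betw_nth[of xs "{..<length xs}" "set xs"], of g] by simp

lemma sum_lessThan_add:
  fixes m k :: nat
  shows "(\<Sum>j<m + k. g j) = (\<Sum>j<m. g j) + (\<Sum>j<k. g (m + j) :: 'a::comm_monoid_add)"
  by (induction k) (simp_all add: ac_simps)

text \<open>Block elimination. The last conclusion carries a scalar \<open>c\<close> because the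
  extension is wanted for every multiple of \<open>w2\<close>.\<close>

lemma schur_eigen:
  fixes A11 :: "'a::field mat"
  assumes A: "A11 \<in> carrier_mat p p" "A12 \<in> carrier_mat p k" "A21 \<in> carrier_mat k p" "A22 \<in> carrier_mat k k"
    and N: "N \<in> carrier_mat p p" "N * A11 = 1\<^sub>m p"
    and w: "w1 \<in> carrier_vec p" "w2 \<in> carrier_vec k"
    and eq1: "A11 *\<^sub>v w1 + A12 *\<^sub>v w2 = 0\<^sub>v p"
    and eq2: "A21 *\<^sub>v w1 + A22 *\<^sub>v w2 = e \<cdot>\<^sub>v w2"
  shows "w1 = - (N * A12) *\<^sub>v w2"
    and "(A22 - A21 * N * A12) *\<^sub>v w2 = e \<cdot>\<^sub>v w2"
    and "((- (N * A12)) @\<^sub>r 1\<^sub>m k) *\<^sub>v (c \<cdot>\<^sub>v w2) = c \<cdot>\<^sub>v (w1 @\<^sub>v w2)"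
proof -
  have c: "A11 *\<^sub>v w1 \<in> carrier_vec p" "A12 *\<^sub>v w2 \<in> carrier_vec p" "A21 *\<^sub>v w1 \<in> carrier_vec k" "A22 *\<^sub>v w2 \<in> carrier_vec k"
    "N * A12 \<in> carrier_mat p k" using A w N by auto
  have "w1 + N *\<^sub>v (A12 *\<^sub>v w2) = N *\<^sub>v (A11 *\<^sub>v w1) + N *\<^sub>v (A12 *\<^sub>v w2)"
    using assoc_mult_mat_vec[OF N(1) A(1) w(1)] N(2) w(1) by simp
  also have "\<dots> = N *\<^sub>v (A11 *\<^sub>v w1 + A12 *\<^sub>v w2)"
    using mult_add_distrib_mat_vec[OF N(1) c(1) c(2)] by simp
  also have "\<dots> = 0\<^sub>v p" unfolding eq1 using N(1) by (intro eq_vecI) (auto simp: scalar_prod_def)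
  finally have 0: "w1 + (N * A12) *\<^sub>v w2 = 0\<^sub>v p" using assoc_mult_mat_vec[OF N(1) A(2) w(2)] by simp
  have neg: "- (N * A12) *\<^sub>v w2 = - ((N * A12) *\<^sub>v w2)"
    using w(2) A(2) by (intro uminus_mult_mat_vec) simp
  have Nw: "(N * A12) *\<^sub>v w2 \<in> carrier_vec p" using c(5) w(2) by simp
  show w1: "w1 = - (N * A12) *\<^sub>v w2"
  proof (rule eq_vecI)
    fix i assume "i < dim_vec (- (N * A12) *\<^sub>v w2)"
    then have i: "i < p" using c(5) N(1) by simp
    have "(w1 + (N * A12) *\<^sub>v w2) $ i = 0" unfolding 0 using i by simp
    then show "w1 $ i = (- (N * A12) *\<^sub>v w2) $ i"
      unfolding neg using i carrier_vecD[OF Nw] by (simp add: eq_neg_iff_add_eq_0)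
  qed (use w(1) c(5) N(1) in simp)
  have "A21 *\<^sub>v w1 = - ((A21 * N * A12) *\<^sub>v w2)"
  proof -
    have "A21 *\<^sub>v w1 = A21 *\<^sub>v ((- (N * A12)) *\<^sub>v w2)" by (simp only: w1[symmetric])
    also have "\<dots> = (A21 * (- (N * A12))) *\<^sub>v w2"
      using A(3) c(5) w(2) by (intro assoc_mult_mat_vec[symmetric]) auto
    also have "A21 * (- (N * A12)) = - (A21 * N * A12)"
      using A N(1) c(5) by simp
    also have "- (A21 * N * A12) *\<^sub>v w2 = - ((A21 * N * A12) *\<^sub>v w2)"
      using w(2) A(2) by (intro uminus_mult_mat_vec) simp
    finally show ?thesis .
  qed
  then have eq2': "- ((A21 * N * A12) *\<^sub>v w2) + A22 *\<^sub>v w2 = e \<cdot>\<^sub>v w2" using eq2 by simp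
  have T: "A21 * N * A12 \<in> carrier_mat k k" using A N(1) by simp
  have "(A22 - A21 * N * A12) *\<^sub>v w2 = A22 *\<^sub>v w2 - (A21 * N * A12) *\<^sub>v w2"
    by (rule minus_mult_distrib_mat_vec[OF A(4) T w(2)])
  also have "\<dots> = - ((A21 * N * A12) *\<^sub>v w2) + A22 *\<^sub>v w2"
  proof -
    have "x - y = - y + x" if "x \<in> carrier_vec k" "y \<in> carrier_vec k" for x y :: "'a vec"
      using that by (intro eq_vecI) auto
    then show ?thesis using c(4) T w(2) mult_mat_vec_carrier by blast
  qed
  finally show "(A22 - A21 * N * A12) *\<^sub>v w2 = e \<cdot>\<^sub>v w2" by (simp only: eq2')
  have "((- (N * A12)) @\<^sub>r 1\<^sub>m k) *\<^sub>v (c \<cdot>\<^sub>v w2) = c \<cdot>\<^sub>v (((- (N * A12)) @\<^sub>r 1\<^sub>m k) *\<^sub>v w2)"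
    using c(5) w(2) by (intro mult_mat_vec[of _ "p + k" k]) auto
  also have "((- (N * A12)) @\<^sub>r 1\<^sub>m k) *\<^sub>v w2 = ((- (N * A12)) *\<^sub>v w2) @\<^sub>v (1\<^sub>m k *\<^sub>v w2)"
    using c(5) w(2) by (intro mat_mult_append[of _ p k _ k]) auto
  also have "\<dots> = w1 @\<^sub>v w2" using w(2) by (simp only: w1[symmetric] one_mult_mat_vec)
  finally show "((- (N * A12)) @\<^sub>r 1\<^sub>m k) *\<^sub>v (c \<cdot>\<^sub>v w2) = c \<cdot>\<^sub>v (w1 @\<^sub>v w2)" .
qed

text \<open>The positions of u_{0,\<theta>} in the matrix, described by labels instead of
  indices.\<close>

definition theta_pair :: "nat \<Rightarrow> nat \<Rightarrow> nat \<Rightarrow> label \<Rightarrow> label \<Rightarrow> bool" where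
  "theta_pair i0 j0 k0 rl cl \<longleftrightarrow> 0 \<in> snd cl \<and> snd rl = snd cl - {0} \<and> fst (fst cl) = unit i0 + fst (fst rl) \<and>
     fst (snd (fst cl)) = unit j0 + fst (snd (fst rl)) \<and> snd (snd (fst rl)) = unit k0 + snd (snd (fst cl))"

lemma poly_val_minus_single:
  fixes p :: "'a::field xyz_poly"
  shows "poly_val (p - Poly_Mapping.single \<theta> e) a b c = poly_val p a b c - e * poly_val (monomial \<theta>) a b c"
proof -
  let ?A = "insert \<theta> (keys p)"
  let ?m = "\<lambda>\<theta>. mono_val (fst \<theta>) a * mono_val (fst (snd \<theta>)) b * mono_val (snd (snd \<theta>)) c"
  have "poly_val g a b c = (\<Sum>\<theta>\<in>?A. lookup g \<theta> * ?m \<theta>)" if "keys g \<subseteq> ?A" for g :: "'a xyz_poly"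
    using poly_val_superset[OF _ that, of a b c] by (simp add: mult.assoc)
  moreover have "keys (p - Poly_Mapping.single \<theta> e) \<subseteq> ?A"
    by (auto simp: in_keys_iff lookup_minus lookup_single when_def split: if_splits)
  moreover have "keys (monomial \<theta> :: 'a xyz_poly) \<subseteq> ?A" by (simp add: monomial_def)
  moreover have "keys p \<subseteq> ?A" by blast
  ultimately have "poly_val (p - Poly_Mapping.single \<theta> e) a b c = (\<Sum>\<theta>'\<in>?A. lookup (p - Poly_Mapping.single \<theta> e) \<theta>' * ?m \<theta>')"
    "poly_val p a b c = (\<Sum>\<theta>'\<in>?A. lookup p \<theta>' * ?m \<theta>')"
    "poly_val (monomial \<theta>) a b c = (\<Sum>\<theta>'\<in>?A. lookup (monomial \<theta> :: 'a xyz_poly) \<theta>' * ?m \<theta>')"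
    by blast+
  moreover have "lookup (p - Poly_Mapping.single \<theta> e) \<theta>' * ?m \<theta>' = lookup p \<theta>' * ?m \<theta>' - e * (lookup (monomial \<theta> :: 'a xyz_poly) \<theta>' * ?m \<theta>')" for \<theta>'
    by (simp add: lookup_minus monomial_def lookup_single when_def algebra_simps)
  ultimately show ?thesis by (simp only: sum_subtractf sum_distrib_left)
qed

context bilinear_system
begin

section \<open>Rows and columns of the lower right block\<close>

lemma theta_rows_subset: "k0 \<le> nz \<Longrightarrow> theta_rows k0 \<subseteq> K0_basis nx ny nz r s"
  unfolding theta_rows_def using K0_rows(2) by blast

lemma theta_cols_subset: "i0 \<le> nx \<Longrightarrow> j0 \<le> ny \<Longrightarrow> theta_cols i0 j0 \<subseteq> K1_basis nx ny nz r s"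
proof
  fix cl assume *: "i0 \<le> nx" "j0 \<le> ny" "cl \<in> theta_cols i0 j0"
  then obtain \<tau> I where cl: "cl = ((unit i0, \<tau> + unit j0, 0), insert 0 (U \<union> I))"
    "keys \<tau> \<subseteq> {0..ny}" "deg \<tau> = q" "I \<subseteq> W" "card I = b" unfolding theta_cols_def by blast
  have "keys (\<tau> + unit j0) \<subseteq> {0..ny}" using cl(2) *(2) by (simp add: keys_add_nat)
  moreover have "deg (\<tau> + unit j0) = Suc q" using cl(3) by (simp add: deg_add)
  ultimately show "cl \<in> K1_basis nx ny nz r s" unfolding cl(1) mem_K1_unit using *(1) cl by blast
qed

text \<open>With \<open>theta_pair_col\<close> and \<open>theta_pair_row\<close> this identifies the
  rows and columns of M22, whatever order the rearrangement uses.\<close>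

lemma theta_pairD:
  assumes cl: "cl \<in> K1_basis nx ny nz r s" and rl: "rl \<in> K0_basis nx ny nz r s" and pair: "theta_pair i0 j0 k0 rl cl"
  shows "cl \<in> theta_cols i0 j0" "rl \<in> theta_rows k0"
proof -
  obtain \<sigma> I where clI: "cl = (\<sigma>, I)" by (cases cl)
  have I0: "0 \<in> I" using pair by (simp add: theta_pair_def clI)
  obtain j \<tau> I' where c: "keys \<tau> \<subseteq> {0..ny}" "I' \<subseteq> W" "\<sigma> = (unit j, \<tau>, 0)"
    "deg \<tau> = q \<and> card I' = Suc b \<and> I = U \<union> I' \<or> deg \<tau> = Suc q \<and> card I' = b \<and> I = insert 0 (U \<union> I')"
    using cl unfolding clI mem_K1_basis by blast
  have notin: "0 \<notin> U \<union> I'" using c(2) by auto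
  with I0 c(4) have d: "deg \<tau> = Suc q" "card I' = b" "I = insert 0 (U \<union> I')" by blast+
  obtain a t \<zeta> K where rlK: "rl = ((a, t, \<zeta>), K)" by (cases rl, cases "fst rl") auto
  have a: "a = 0" using rl unfolding rlK by (rule K0_cases) auto
  have p: "K = I - {0}" "unit j = unit i0 + a" "\<tau> = unit j0 + t" "\<zeta> = unit k0 + 0"
    using pair by (simp_all add: theta_pair_def clI rlK c(3))
  have j: "j = i0" using p(2) unfolding a by simp
  have K: "K = U \<union> I'" using notin unfolding p(1) d(3) by blast
  have t: "deg t = q" "keys t \<subseteq> {0..ny}" using d(1) c(1) unfolding p(3) by (simp_all add: deg_add keys_add_nat)
  show "cl \<in> theta_cols i0 j0" unfolding clI c(3) p(3) j d(3) add.commute[of "unit j0"] theta_cols_def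
    using t c(2) d(2) by blast
  show "rl \<in> theta_rows k0" unfolding rlK a K p(4) add_0_right theta_rows_def
    using t c(2) d(2) by blast
qed

lemma theta_pair_col:
  assumes "k0 \<le> nz" "cl \<in> theta_cols i0 j0"
  shows "\<exists>rl\<in>K0_basis nx ny nz r s. theta_pair i0 j0 k0 rl cl"
proof -
  obtain \<tau> I where cl: "cl = ((unit i0, \<tau> + unit j0, 0), insert 0 (U \<union> I))"
    "keys \<tau> \<subseteq> {0..ny}" "deg \<tau> = q" "I \<subseteq> W" "card I = b" using assms(2) unfolding theta_cols_def by blast
  have "0 \<notin> U \<union> I" using cl(4) by auto
  then have "theta_pair i0 j0 k0 ((0, \<tau>, unit k0), U \<union> I) cl" unfolding cl(1) by (simp add: theta_pair_def add.commute)
  then show ?thesis using K0_rows(2)[OF cl(2) cl(4) assms(1) cl(3) cl(5)] by blast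
qed

lemma theta_pair_row:
  assumes "i0 \<le> nx" "j0 \<le> ny" "rl \<in> theta_rows k0"
  shows "\<exists>cl\<in>K1_basis nx ny nz r s. theta_pair i0 j0 k0 rl cl"
proof -
  obtain \<tau> I where rl: "rl = ((0, \<tau>, unit k0), U \<union> I)"
    "keys \<tau> \<subseteq> {0..ny}" "deg \<tau> = q" "I \<subseteq> W" "card I = b" using assms(3) unfolding theta_rows_def by blast
  have "0 \<notin> U \<union> I" using rl(4) by auto
  then have "theta_pair i0 j0 k0 rl ((unit i0, \<tau> + unit j0, 0), insert 0 (U \<union> I))"
    unfolding rl(1) by (simp add: theta_pair_def add.commute)
  moreover have "((unit i0, \<tau> + unit j0, 0), insert 0 (U \<union> I)) \<in> theta_cols i0 j0"
    unfolding theta_cols_def using rl by blast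
  ultimately show ?thesis using theta_cols_subset[OF assms(1,2)] by blast
qed

text \<open>The size of M22 equals the number of solutions, which is what makes the eigenvectors
  found at them a basis.\<close>

lemma card_theta_rows: "card (theta_rows k0) = (r choose ny) * (s choose nz)"
proof -
  let ?A = "monos_of ny (int q) \<times> {I. I \<subseteq> W \<and> card I = b}"
  have "theta_rows k0 = (\<lambda>(\<tau>, I). ((0, \<tau>, unit k0), U \<union> I)) ` ?A"
    unfolding theta_rows_def monos_of_int by auto
  moreover have "inj_on (\<lambda>(\<tau>, I). ((0 :: mono, \<tau>, unit k0), U \<union> I)) ?A"
  proof (rule inj_onI)
    fix a a' assume *: "a \<in> ?A" "a' \<in> ?A" "(\<lambda>(\<tau>, I). ((0 :: mono, \<tau>, unit k0), U \<union> I)) a = (\<lambda>(\<tau>, I). ((0, \<tau>, unit k0), U \<union> I)) a'"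
    obtain \<tau> I \<tau>' I' where a: "a = (\<tau>, I)" "a' = (\<tau>', I')" by (cases a, cases a')
    have I: "I \<subseteq> W" "I' \<subseteq> W" "U \<union> I = U \<union> I'" "\<tau> = \<tau>'" using * by (auto simp only: a mem_Times_iff prod.case prod.inject fst_conv snd_conv mem_Collect_eq)
    have "U \<inter> W = {}" by auto
    with I have "I = I'" by blast
    with I(4) show "a = a'" by (simp add: a)
  qed
  ultimately have "card (theta_rows k0) = card ?A" by (simp only: card_image)
  also have "\<dots> = (r choose q) * (s choose b)"
    using n_subsets[of W b] by (simp add: card_cartesian_product card_monos_of r)
  finally show ?thesis using binomial_symmetric[of q r] binomial_symmetric[of b s] by (simp add: r s)
qed

text \<open>\<rho>_\<alpha> divides by the zeroth coordinate of x and by that of y to the y-degree,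
  which is q on the first index set and q + 1 on the second; the coefficients given to
  \<open>rho\<close> undo this.\<close>

lemma lookup_rho:
  fixes X Y :: "'a vec set"
  assumes X: "coords X $ 0 \<noteq> 0" and Y: "coords Y $ 0 \<noteq> 0" and cl: "cl \<in> K1_basis nx ny nz r s"
  defines "x0 \<equiv> coords X $ 0" and "y0 \<equiv> coords Y $ 0"
  shows "lookup (rho nx ny nz r s (X, Y, Z) (\<lambda>I. d * l I * (x0 * y0 ^ q), \<lambda>J. d * l J * (x0 * y0 ^ Suc q))) cl =
    d * pure (\<lambda>i. coords X $ i) (\<lambda>i. coords Y $ i) l cl"
proof -
  obtain \<sigma> I where clI: "cl = (\<sigma>, I)" by (cases cl)
  obtain j \<tau> I' where c: "j \<le> nx" "keys \<tau> \<subseteq> {0..ny}" "I' \<subseteq> W" "\<sigma> = (unit j, \<tau>, 0)"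
    "deg \<tau> = q \<and> card I' = Suc b \<and> I = U \<union> I' \<or> deg \<tau> = Suc q \<and> card I' = b \<and> I = insert 0 (U \<union> I')"
    using cl unfolding clI mem_K1_basis by blast
  have x0: "x0 \<noteq> 0" "y0 \<noteq> 0" using X Y by (simp_all add: x0_def y0_def)
  have rq: "r - ny = q" "r - ny + 1 = Suc q" by (simp_all add: r)
  have tensor: "lookup (one_tensor nx ny (X, Y, Z) 1 d') (unit j, \<tau>, 0) =
      (if deg \<tau> = d' then coords X $ j * mval (\<lambda>i. coords Y $ i) \<tau> / (x0 * y0 ^ d') else 0)" for d'
    using c(1,2) x0 by (simp add: lookup_one_tensor monos_of_int monos_of_unit one_coeff_def mono_val_eq x0_def y0_def)
  have sum1: "(\<Sum>J\<in>A. lookup (wedge_tensor (g J) p J) (\<sigma>, I)) = (if I \<in> A then g I * lookup p \<sigma> else 0)"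
    if "finite A" for A g and p :: "expo \<Rightarrow>\<^sub>0 'a"
    using that by (simp add: lookup_wedge_tensor cong: if_cong)
  have fin: "finite (omega1 nz r s)" "finite (omega2 nz r s)" by (simp_all add: omega1_def omega2_def finite_wedge)
  have zero1: "0 \<notin> I" if "I \<in> omega1 nz r s" using that unfolding mem_omega1 by auto
  have zero2: "0 \<in> I" if "I \<in> omega2 nz r s" using that unfolding mem_omega2 by auto
  have rho: "lookup (rho nx ny nz r s (X, Y, Z) (l1, l2)) cl =
      (if I \<in> omega1 nz r s then l1 I * lookup (one_tensor nx ny (X, Y, Z) 1 q) \<sigma> else 0) +
      (if I \<in> omega2 nz r s then l2 I * lookup (one_tensor nx ny (X, Y, Z) 1 (Suc q)) \<sigma> else 0)" for l1 l2
    unfolding rho_def prod.case lookup_add lookup_sum clI sum1[OF fin(1)] sum1[OF fin(2)] rq by simp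
  have pv: "pure (\<lambda>i. coords X $ i) (\<lambda>i. coords Y $ i) l cl = coords X $ j * mval (\<lambda>i. coords Y $ i) \<tau> * l I"
    using cl unfolding clI c(4) by (rule pure_val)
  show ?thesis
    using c(5)
  proof
    assume *: "deg \<tau> = q \<and> card I' = Suc b \<and> I = U \<union> I'"
    then have "I \<in> omega1 nz r s" unfolding mem_omega1 using c(3) by blast
    moreover from this have "I \<notin> omega2 nz r s" using zero1 zero2 by blast
    ultimately show ?thesis unfolding rho pv c(4) tensor using * x0 by simp
  next
    assume *: "deg \<tau> = Suc q \<and> card I' = b \<and> I = insert 0 (U \<union> I')"
    then have "I \<in> omega2 nz r s" unfolding mem_omega2 using c(3) by blast
    moreover from this have "I \<notin> omega1 nz r s" using zero1 zero2 by blast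
    ultimately show ?thesis unfolding rho pv c(4) tensor using * x0 by simp
  qed
qed

section \<open>Solutions in terms of coordinate functions\<close>

lemma point_equations:
  assumes \<alpha>: "(X, Y, Z) \<in> zeros nx ny nz (F ` {1..r + s})"
  shows "i \<in> U \<Longrightarrow> (\<Sum>k\<le>ny. coords Y $ k * (\<Sum>j\<le>nx. coords X $ j * cA i j k)) = 0"
    and "i \<in> W \<Longrightarrow> (\<Sum>k\<le>nz. coords Z $ k * (\<Sum>j\<le>nx. coords X $ j * cB i j k)) = 0"
proof -
  have sp: "X \<in> proj_space nx" "Y \<in> proj_space ny" "Z \<in> proj_space nz" using \<alpha> by (auto simp: zeros_def PP_def)
  have val: "poly_val (F i) (coords X) (coords Y) (coords Z) = 0" if "i \<in> {1..r + s}" for i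
    using \<alpha> that coords_in(1)[OF sp(1)] coords_in(1)[OF sp(2)] coords_in(1)[OF sp(3)] by (auto simp: zeros_def)
  show "(\<Sum>k\<le>ny. coords Y $ k * (\<Sum>j\<le>nx. coords X $ j * cA i j k)) = 0" if "i \<in> U"
  proof -
    have i: "i \<in> {1..r + s}" "F i \<in> S nx ny nz (1, 1, 0)" using that F[of i] by (auto simp: mdeg_def)
    show ?thesis using val[OF i(1)] unfolding poly_val_xy[OF i(2)] .
  qed
  show "(\<Sum>k\<le>nz. coords Z $ k * (\<Sum>j\<le>nx. coords X $ j * cB i j k)) = 0" if "i \<in> W"
  proof -
    have i: "i \<in> {1..r + s}" "F i \<in> S nx ny nz (1, 0, 1)" using that F[of i] by (auto simp: mdeg_def)
    show ?thesis using val[OF i(1)] unfolding poly_val_xz[OF i(2)] .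
  qed
qed

text \<open>The representative picked by \<open>coords\<close> may differ from the given coordinates
  by a scalar in each block, hence c, c', c''; multihomogeneity makes vanishing independent of
  them.\<close>

lemma ex_point:
  fixes x y z :: "nat \<Rightarrow> 'a"
  assumes nz: "\<exists>j\<le>nx. x j \<noteq> 0" "\<exists>k\<le>ny. y k \<noteq> 0" "\<exists>k\<le>nz. z k \<noteq> 0"
    and zU: "\<forall>i\<in>U. (\<Sum>k\<le>ny. y k * (\<Sum>j\<le>nx. x j * cA i j k)) = 0"
    and zW: "\<forall>i\<in>W. (\<Sum>k\<le>nz. z k * (\<Sum>j\<le>nx. x j * cB i j k)) = 0"
  obtains X Y Z c c' c'' where "(X, Y, Z) \<in> zeros nx ny nz (F ` {1..r + s})"
    "\<forall>j\<le>nx. coords X $ j = c * x j" "\<forall>j\<le>ny. coords Y $ j = c' * y j" "\<forall>j\<le>nz. coords Z $ j = c'' * z j"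
proof -
  let ?X = "proj_rel nx `` {vec (nx + 1) x}" and ?Y = "proj_rel ny `` {vec (ny + 1) y}" and ?Z = "proj_rel nz `` {vec (nz + 1) z}"
  note X = proj_class[OF nz(1)] and Y = proj_class[OF nz(2)] and Z = proj_class[OF nz(3)]
  have zero: "poly_val (F i) a a' a'' = 0" if "i \<in> {1..r + s}" and mem: "a \<in> ?X" "a' \<in> ?Y" "a'' \<in> ?Z" for i a a' a''
  proof -
    obtain c c' c'' where c: "\<forall>j\<le>nx. a $ j = c * x j" "\<forall>j\<le>ny. a' $ j = c' * y j" "\<forall>j\<le>nz. a'' $ j = c'' * z j"
      using X(2)[OF mem(1)] Y(2)[OF mem(2)] Z(2)[OF mem(3)] by blast
    show ?thesis
    proof (cases "i \<le> r")
      case True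
      then have i: "i \<in> U" "F i \<in> S nx ny nz (1, 1, 0)" using that F[of i] by (auto simp: mdeg_def)
      have "poly_val (F i) a a' a'' = (\<Sum>k\<le>ny. c' * y k * (\<Sum>j\<le>nx. c * x j * cA i j k))"
        unfolding poly_val_xy[OF i(2)] using c by simp
      also have "\<dots> = c * c' * (\<Sum>k\<le>ny. y k * (\<Sum>j\<le>nx. x j * cA i j k))"
        by (simp add: sum_distrib_left mult_ac)
      finally show ?thesis using zU i(1) by simp
    next
      case False
      then have i: "i \<in> W" "F i \<in> S nx ny nz (1, 0, 1)" using that F[of i] by (auto simp: mdeg_def)
      have "poly_val (F i) a a' a'' = (\<Sum>k\<le>nz. c'' * z k * (\<Sum>j\<le>nx. c * x j * cB i j k))"
        unfolding poly_val_xz[OF i(2)] using c by simp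
      also have "\<dots> = c * c'' * (\<Sum>k\<le>nz. z k * (\<Sum>j\<le>nx. x j * cB i j k))"
        by (simp add: sum_distrib_left mult_ac)
      finally show ?thesis using zW i(1) by simp
    qed
  qed
  have "(?X, ?Y, ?Z) \<in> zeros nx ny nz (F ` {1..r + s})"
    unfolding zeros_def PP_def using X(1) Y(1) Z(1) zero by blast
  moreover have "\<exists>c. \<forall>j\<le>nx. coords ?X $ j = c * x j" "\<exists>c. \<forall>j\<le>ny. coords ?Y $ j = c * y j" "\<exists>c. \<forall>j\<le>nz. coords ?Z $ j = c * z j"
    using X(2)[OF coords_in(1)[OF X(1)]] Y(2)[OF coords_in(1)[OF Y(1)]] Z(2)[OF coords_in(1)[OF Z(1)]] by blast+
  ultimately show ?thesis using that by blast
qed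

text \<open>A zero in coordinate functions yields a point at which the monomial is nonzero, and
  rescaling cannot turn a zero coordinate into a nonzero one.\<close>

lemma vanishes_off_if_separates:
  assumes idx: "i0 \<le> nx" "j0 \<le> ny" "k0 \<le> nz"
    and sep: "\<And>\<alpha>. \<alpha> \<in> zeros nx ny nz (F ` {1..r + s}) \<Longrightarrow> at_point (monomial (unit i0, unit j0, unit k0)) \<alpha> \<noteq> 0"
  shows "vanishes_off i0 j0 k0"
  unfolding vanishes_off_def
proof (intro allI impI)
  fix x y z :: "nat \<Rightarrow> 'a"
  assume *: "\<exists>j\<le>nx. x j \<noteq> 0" "\<exists>k\<le>ny. y k \<noteq> 0" "\<exists>k\<le>nz. z k \<noteq> 0"
    "\<forall>i\<in>U. (\<Sum>k\<le>ny. y k * (\<Sum>j\<le>nx. x j * cA i j k)) = 0"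
    "\<forall>i\<in>W. (\<Sum>k\<le>nz. z k * (\<Sum>j\<le>nx. x j * cB i j k)) = 0"
  obtain X Y Z c c' c'' where P: "(X, Y, Z) \<in> zeros nx ny nz (F ` {1..r + s})"
    "\<forall>j\<le>nx. coords X $ j = c * x j" "\<forall>j\<le>ny. coords Y $ j = c' * y j" "\<forall>j\<le>nz. coords Z $ j = c'' * z j"
    using ex_point[OF *] by blast
  show "x i0 \<noteq> 0 \<and> y j0 \<noteq> 0 \<and> z k0 \<noteq> 0"
    using sep[OF P(1)] P(2-4) idx by (auto simp: poly_val_monomial)
qed

text \<open>With f_0 - e w^\<theta> in place of f_0 the system vanishes at \<alpha> and has a pure
  kernel element; moving the terms with e to the other side gives an eigenvector equation in label
  form.\<close>

lemma eigen_label_vector: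
  assumes idx: "i0 \<le> nx" "j0 \<le> ny" "k0 \<le> nz" and \<alpha>: "(X, Y, Z) \<in> zeros nx ny nz (F ` {1..r + s})"
    and at: "at_point (monomial (unit i0, unit j0, unit k0)) (X, Y, Z) \<noteq> 0"
  defines "e \<equiv> ratio (F 0) (unit i0, unit j0, unit k0) (X, Y, Z)"
  obtains l where "\<exists>cl\<in>K1_basis nx ny nz r s. pure (\<lambda>i. coords X $ i) (\<lambda>i. coords Y $ i) l cl \<noteq> 0"
    "\<And>rl. rl \<in> K0_basis nx ny nz r s \<Longrightarrow> rsum (pure (\<lambda>i. coords X $ i) (\<lambda>i. coords Y $ i) l) rl =
      (\<Sum>cl\<in>K1_basis nx ny nz r s. (if theta_pair i0 j0 k0 rl cl then e else 0) * pure (\<lambda>i. coords X $ i) (\<lambda>i. coords Y $ i) l cl)"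
proof -
  let ?\<theta> = "(unit i0, unit j0, unit k0)"
  let ?G = "F(0 := F 0 - Poly_Mapping.single ?\<theta> e)"
  have F0: "F 0 \<in> S nx ny nz (1, 1, 1)" using F[of 0] by (simp add: mdeg_def)
  have "?\<theta> \<in> expos nx ny nz (1, 1, 1)" using idx by (simp add: monos_of_unit)
  moreover have "keys (F 0 - Poly_Mapping.single ?\<theta> e) \<subseteq> insert ?\<theta> (keys (F 0))"
    by (auto simp: in_keys_iff lookup_minus lookup_single when_def split: if_splits)
  ultimately have G0: "?G 0 \<in> S nx ny nz (1, 1, 1)" using F0 unfolding S_def fun_upd_same by blast
  interpret G: bilinear_system nx ny nz r s q b ?G
  proof
    show "?G i \<in> S nx ny nz (mdeg r i)" if "i \<le> r + s" for i
      using F[OF that] G0 by (cases "i = 0") (auto simp: mdeg_def)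
  qed (rule pos r s nx)+
  have sp: "X \<in> proj_space nx" "Y \<in> proj_space ny" "Z \<in> proj_space nz" using \<alpha> by (auto simp: zeros_def PP_def)
  have "poly_val (?G 0) (coords X) (coords Y) (coords Z) = 0"
    using at by (simp add: poly_val_minus_single e_def ratio_def)
  note z0 = this[unfolded poly_val_xyz[OF G0]]
  have G_same: "?G i = F i" if "i \<in> U \<union> W" for i
  proof -
    have "i \<noteq> 0" using that by auto
    then show ?thesis by simp
  qed
  have zU: "(\<Sum>k\<le>ny. coords Y $ k * (\<Sum>j\<le>nx. coords X $ j * G.cA i j k)) = 0" if "i \<in> U" for i
    using point_equations(1)[OF \<alpha> that] G_same[of i] that by (simp del: fun_upd_apply)
  have zW: "(\<Sum>k\<le>nz. coords Z $ k * (\<Sum>j\<le>nx. coords X $ j * G.cB i j k)) = 0" if "i \<in> W" for i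
    using point_equations(2)[OF \<alpha> that] G_same[of i] that by (simp del: fun_upd_apply)
  obtain l where l: "\<exists>cl\<in>K1_basis nx ny nz r s. pure (\<lambda>i. coords X $ i) (\<lambda>i. coords Y $ i) l cl \<noteq> 0"
    "\<And>rl. rl \<in> K0_basis nx ny nz r s \<Longrightarrow> G.rsum (pure (\<lambda>i. coords X $ i) (\<lambda>i. coords Y $ i) l) rl = 0"
  proof (rule G.pure_kernel[OF coords_in(4)[OF sp(1)] coords_in(4)[OF sp(2)] coords_in(4)[OF sp(3)] _ _ z0])
  qed (use zU zW in blast)+
  have "entry ?G rl cl = entry F rl cl - (if theta_pair i0 j0 k0 rl cl then e else 0)" if "cl \<in> K1_basis nx ny nz r s" for rl cl
  proof -
    obtain \<sigma>x \<sigma>y \<sigma>z I \<tau>x \<tau>y \<tau>z K where lab: "cl = ((\<sigma>x, \<sigma>y, \<sigma>z), I)" "rl = ((\<tau>x, \<tau>y, \<tau>z), K)" by (metis surj_pair)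
    have "finite I" using K1_exterior_part that unfolding lab by blast
    then show ?thesis using entry_update_monomial[of I F "F 0"] by (simp add: lab theta_pair_def)
  qed
  then have diff: "rsum v rl - (\<Sum>cl\<in>K1_basis nx ny nz r s. (if theta_pair i0 j0 k0 rl cl then e else 0) * v cl) = G.rsum v rl" for v rl
    unfolding rsum_def G.rsum_def sum_subtractf[symmetric] by (intro sum.cong refl) (simp add: left_diff_distrib)
  show ?thesis
  proof (rule that[OF l(1)])
    fix rl assume "rl \<in> K0_basis nx ny nz r s"
    from l(2)[OF this] show "rsum (pure (\<lambda>i. coords X $ i) (\<lambda>i. coords Y $ i) l) rl =
      (\<Sum>cl\<in>K1_basis nx ny nz r s. (if theta_pair i0 j0 k0 rl cl then e else 0) * pure (\<lambda>i. coords X $ i) (\<lambda>i. coords Y $ i) l cl)"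
      unfolding diff[symmetric] right_minus_eq .
  qed
qed

end

lemma block_positions:
  assumes "four_block_mat M11 M12 M21 M22 = D"
    and M: "M11 \<in> carrier_mat p p'" "M12 \<in> carrier_mat p k" "M21 \<in> carrier_mat k p'" "M22 \<in> carrier_mat k k"
    and diag: "\<And>i. i < k \<Longrightarrow> M22 $$ (i, i) = Var (0, \<theta>)"
    and off: "\<And>i j. i < k \<Longrightarrow> j < k \<Longrightarrow> i \<noteq> j \<Longrightarrow> (0, \<theta>) \<notin> vars_of (M22 $$ (i, j))"
    and els: "\<And>A a. A \<in> {M11, M12, M21} \<Longrightarrow> a \<in> elements_mat A \<Longrightarrow> (0, \<theta>) \<notin> vars_of a"
    and ij: "i < p + k" "j < p' + k"
  shows "(0, \<theta>) \<in> vars_of (D $$ (i, j) :: (uvar, 'a::comm_ring_1) mvpoly) \<longleftrightarrow> p \<le> i \<and> p' \<le> j \<and> i - p = j - p'"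
proof -
  have D: "D $$ (i, j) = (if i < p then if j < p' then M11 $$ (i, j) else M12 $$ (i, j - p')
      else if j < p' then M21 $$ (i - p, j) else M22 $$ (i - p, j - p'))"
    using ij M unfolding assms(1)[symmetric] by (subst index_mat_four_block(1)) auto
  have no: "(0, \<theta>) \<notin> vars_of (A $$ (a, a'))" if "A \<in> {M11, M12, M21}" "A \<in> carrier_mat n m" "a < n" "a' < m" for A n m a a'
    by (rule els[OF that(1)], rule elements_matI[OF that(2-4)]) simp
  have var: "(0, \<theta>) \<in> vars_of (Var (0, \<theta>) :: (uvar, 'a) mvpoly)" by (simp add: vars_of_def Var_def)
  show ?thesis
  proof (cases "p \<le> i \<and> p' \<le> j")
    case True
    then have "i - p < k" "j - p' < k" using ij by auto
    with True show ?thesis using diag[of "i - p"] off[of "i - p" "j - p'"] var by (cases "i - p = j - p'") (simp_all add: D)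
  next
    case False
    then consider "i < p" "j < p'" | "i < p" "p' \<le> j" | "p \<le> i" "j < p'" by linarith
    then show ?thesis
    proof cases
      case 1 then show ?thesis using no[OF _ M(1), of i j] by (simp add: D)
    next
      case 2 then show ?thesis using no[OF _ M(2), of i "j - p'"] ij by (simp add: D)
    next
      case 3 then show ?thesis using no[OF _ M(3), of "i - p" j] ij by (simp add: D)
    qed
  qed
qed

theorem theorem4p13:
  fixes nx ny nz r s :: nat
    and f :: "nat \<Rightarrow> 'a::{alg_closed_field, field_char_0} xyz_poly"
    and f0 :: "'a xyz_poly"
    and \<theta> :: expo
    and R :: "(uvar, int) mvpoly"
    and rs cs :: "label list"
    and M11 M12 M21 M22 :: "(uvar, 'a) mvpoly mat"
  assumes "square_2bilinear nx ny nz r s f"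
    and "finite (zeros nx ny nz (f ` {1..r + s}))"
    and "card (zeros nx ny nz (f ` {1..r + s})) = (r choose ny) * (s choose nz)"
    and "\<theta> \<in> expos nx ny nz (1, 1, 1)"
    and "is_resultant TYPE('a) nx ny nz r s R"
    and "eval_int (f(0 := monomial \<theta>)) R \<noteq> 0"
    and "f0 \<in> S nx ny nz (1, 1, 1)"
    and "separates f0 \<theta> (zeros nx ny nz (f ` {1..r + s}))"
    and "rearranged nx ny nz r s \<theta> rs cs M11 M12 M21 M22"
  shows "let V = zeros nx ny nz (f ` {1..r + s});
             ev = map_mat (eval_at (f(0 := f0)));
             N = the (mat_inverse (ev M11));
             C = ev M22 - ev M21 * N * ev M12
         in invertible_mat (ev M11) \<and>
            diagonalizable C \<and>
            (\<forall>e. eigenvalue C e \<longrightarrow> (\<exists>\<alpha>\<in>V. e = ratio f0 \<theta> \<alpha>)) \<and>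
            (\<forall>\<alpha>\<in>V. zeroth_coords_nonzero \<alpha> \<longrightarrow>
               eigenvalue C (ratio f0 \<theta> \<alpha>) \<and>
               (\<forall>v. eigenvector C v (ratio f0 \<theta> \<alpha>) \<longrightarrow>
                  (\<exists>l. ((- (N * ev M12)) @\<^sub>r 1\<^sub>m (dim_row C)) *\<^sub>v v =
                        coord_vec cs (rho nx ny nz r s \<alpha> l))))"
proof -
  define F where "F = f(0 := f0)"
  define V where "V = zeros nx ny nz (f ` {1..r + s})"
  define q where "q = r - ny"
  define b where "b = s - nz"
  note sq = assms(1)[unfolded square_2bilinear_def]
  have dims: "nx + ny + nz = r + s" "ny \<le> r" "nz \<le> s" "1 \<le> ny" using sq by simp_all
  have dims': "r = ny + q" "s = nz + b" "nx = q + b" using dims unfolding q_def b_def by linarith+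
  obtain i0 j0 k0 where \<theta>: "\<theta> = (unit i0, unit j0, unit k0)" and idx: "i0 \<le> nx" "j0 \<le> ny" "k0 \<le> nz"
    using assms(4) by (cases \<theta>) (auto simp: monos_of_unit)
  interpret bilinear_system nx ny nz r s q b F
  proof
    show "F i \<in> S nx ny nz (mdeg r i)" if "i \<le> r + s" for i
    proof (cases "i = 0")
      case True
      then show ?thesis using assms(7) by (simp add: F_def mdeg_def)
    next
      case False
      then show ?thesis using sq that by (simp add: F_def)
    qed
  qed (rule dims dims')+
  have "F ` {1..r + s} = f ` {1..r + s}"
  proof (rule image_cong[OF refl])
    fix i assume "i \<in> {1..r + s}"
    then have "i \<noteq> 0" by simp
    then show "F i = f i" unfolding F_def by (rule fun_upd_other)
  qed
  then have V: "V = zeros nx ny nz (F ` {1..r + s})" unfolding V_def by (simp only:)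
  have sep: "at_point (monomial (unit i0, unit j0, unit k0)) \<alpha> \<noteq> 0" if "\<alpha> \<in> V" for \<alpha>
    using assms(8) that unfolding separates_def \<theta> V_def by blast
  have van: "vanishes_off i0 j0 k0" by (rule vanishes_off_if_separates[OF idx sep]) (unfold V)
  note re = assms(9)[unfolded rearranged_def]
  note rs = re[THEN conjunct1] re[THEN conjunct2, THEN conjunct1]
    and cs = re[THEN conjunct2, THEN conjunct2, THEN conjunct1] re[THEN conjunct2, THEN conjunct2, THEN conjunct2, THEN conjunct1]
  obtain p p' k where M: "M11 \<in> carrier_mat p p'" "M12 \<in> carrier_mat p k" "M21 \<in> carrier_mat k p'" "M22 \<in> carrier_mat k k"
    and D: "delta1_mat nx ny (universal_system nx ny nz r) rs cs = four_block_mat M11 M12 M21 M22"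
    and diag': "\<forall>i<k. M22 $$ (i, i) = Var (0, \<theta>)"
    and off': "\<forall>i<k. \<forall>j<k. i \<noteq> j \<longrightarrow> (0, \<theta>) \<notin> vars_of (M22 $$ (i, j))"
    and els': "\<forall>A\<in>{M11, M12, M21}. \<forall>a\<in>elements_mat A. (0, \<theta>) \<notin> vars_of a"
    using re by (elim conjE exE) (rule that, assumption+)
  have diag: "M22 $$ (i, i) = Var (0, \<theta>)" if "i < k" for i using diag' that by blast
  have off: "(0, \<theta>) \<notin> vars_of (M22 $$ (i, j))" if "i < k" "j < k" "i \<noteq> j" for i j using off' that by blast
  have els: "(0, \<theta>) \<notin> vars_of a" if "A \<in> {M11, M12, M21}" "a \<in> elements_mat A" for A a using els' that by blast
  let ?D = "delta1_mat nx ny (universal_system nx ny nz r) rs cs :: (uvar, 'a) mvpoly mat"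
  have len: "length rs = p + k" "length cs = p' + k"
    using arg_cong[OF D, of dim_row] arg_cong[OF D, of dim_col] M by (simp_all add: delta1_mat_def)
  have "length cs = length rs"
    using card_bases_eq[OF pos r s nx] distinct_card[OF rs(1)] distinct_card[OF cs(1)] by (simp add: rs(2) cs(2))
  \<comment> \<open>Equal numbers of rows and columns, together with the square block M22, make M11
    square.\<close>
  then have [simp]: "p' = p" using len by simp
  note M = M[unfolded \<open>p' = p\<close>] and len = len[unfolded \<open>p' = p\<close>]
  have csK: "cs ! j \<in> K1_basis nx ny nz r s" if "j < p + k" for j using nth_mem[of j cs] that len(2) cs(2) by simp
  have rsK: "rs ! i \<in> K0_basis nx ny nz r s" if "i < p + k" for i using nth_mem[of i rs] that len(1) rs(2) by simp
  have K1_ex: "\<exists>j<p + k. cl = cs ! j" if "cl \<in> K1_basis nx ny nz r s" for cl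
    using that unfolding cs(2)[symmetric] in_set_conv_nth len(2) by blast
  have K0_ex: "\<exists>i<p + k. rl = rs ! i" if "rl \<in> K0_basis nx ny nz r s" for rl
    using that unfolding rs(2)[symmetric] in_set_conv_nth len(1) by blast
  have K1_I: "finite (snd cl) \<and> card (snd cl) = nx + ny + 1 \<and> snd cl \<subseteq> {0..r + s}" if "cl \<in> K1_basis nx ny nz r s" for cl
    using K1_exterior_part[of "fst cl" "snd cl"] that by simp
  have D_entry: "?D $$ (i, j) = entry (universal_system nx ny nz r) (rs ! i) (cs ! j)" if "i < p + k" "j < p + k" for i j
  proof -
    have "?D $$ (i, j) = lookup (delta1 nx ny (universal_system nx ny nz r) (Poly_Mapping.single (cs ! j) 1)) (rs ! i)"
      using that len by (simp add: delta1_mat_def)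
    then show ?thesis using lookup_delta1_single K1_I[OF csK[OF that(2)]] by metis
  qed
  have ev_entry: "eval_at F (?D $$ (i, j)) = entry F (rs ! i) (cs ! j)" if "i < p + k" "j < p + k" for i j
    unfolding D_entry[OF that]
  proof (rule eval_entry_universal)
    show "finite (snd (cs ! j))" using K1_I[OF csK[OF that(2)]] by blast
    show "F i' \<in> S nx ny nz (mdeg r i')" if "i' \<in> snd (cs ! j)" for i'
    proof (rule F)
      have "i' \<in> {0..r + s}" using K1_I[OF csK[OF \<open>j < p + k\<close>]] that by blast
      then show "i' \<le> r + s" by simp
    qed
  qed
  \<comment> \<open>The occurrences of u_{0,\<theta>} are computed twice, from the labels and from
    the blocks; comparing the two locates M22.\<close>
  have pair_iff: "theta_pair i0 j0 k0 (rs ! i) (cs ! j) \<longleftrightarrow> p \<le> i \<and> i = j" if ij: "i < p + k" "j < p + k" for i j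
  proof -
    obtain \<sigma>x \<sigma>y \<sigma>z I \<tau>x \<tau>y \<tau>z K where lab: "cs ! j = ((\<sigma>x, \<sigma>y, \<sigma>z), I)" "rs ! i = ((\<tau>x, \<tau>y, \<tau>z), K)" by (metis surj_pair)
    have "finite I" using K1_I[OF csK[OF ij(2)]] by (simp add: lab)
    from vars_of_entry_universal[OF this assms(4)[unfolded \<theta>], where r = r and ?'a = 'a]
    have "theta_pair i0 j0 k0 (rs ! i) (cs ! j) \<longleftrightarrow> (0, \<theta>) \<in> vars_of (?D $$ (i, j))"
      unfolding D_entry[OF ij] unfolding lab \<theta> theta_pair_def fst_conv snd_conv by blast
    also have "\<dots> \<longleftrightarrow> p \<le> i \<and> p \<le> j \<and> i - p = j - p"
      by (rule block_positions[OF D[symmetric] M diag off els ij])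
    finally show ?thesis by auto
  qed
  have cols: "cs ! j \<in> theta_cols i0 j0 \<longleftrightarrow> p \<le> j" if "j < p + k" for j
  proof
    assume "cs ! j \<in> theta_cols i0 j0"
    then obtain rl where rl: "rl \<in> K0_basis nx ny nz r s" "theta_pair i0 j0 k0 rl (cs ! j)"
      using theta_pair_col[OF idx(3)] by blast
    then obtain i where "i < p + k" "rl = rs ! i" using K0_ex by blast
    then show "p \<le> j" using rl(2) pair_iff[of i j] that by simp
  next
    assume "p \<le> j"
    then have "theta_pair i0 j0 k0 (rs ! j) (cs ! j)" using pair_iff[of j j] that by simp
    then show "cs ! j \<in> theta_cols i0 j0" by (rule theta_pairD(1)[OF csK[OF that] rsK[OF that]])
  qed
  have rows: "rs ! i \<in> theta_rows k0 \<longleftrightarrow> p \<le> i" if "i < p + k" for i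
  proof
    assume "rs ! i \<in> theta_rows k0"
    then obtain cl where cl: "cl \<in> K1_basis nx ny nz r s" "theta_pair i0 j0 k0 (rs ! i) cl"
      using theta_pair_row[OF idx(1,2)] by blast
    then obtain j where "j < p + k" "cl = cs ! j" using K1_ex by blast
    then show "p \<le> i" using cl(2) pair_iff[of i j] that by simp
  next
    assume "p \<le> i"
    then have "theta_pair i0 j0 k0 (rs ! i) (cs ! i)" using pair_iff[of i i] that by simp
    then show "rs ! i \<in> theta_rows k0" by (rule theta_pairD(2)[OF csK[OF that] rsK[OF that]])
  qed
  have card_V: "card V = k"
  proof -
    have "theta_rows k0 = (\<lambda>i. rs ! i) ` {p..<p + k}"
    proof (intro equalityI subsetI)
      fix rl assume rl: "rl \<in> theta_rows k0"
      then obtain i where i: "i < p + k" "rl = rs ! i" using K0_ex theta_rows_subset[OF idx(3)] by blast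
      then show "rl \<in> (\<lambda>i. rs ! i) ` {p..<p + k}" using rows[OF i(1)] rl by auto
    qed (use rows in auto)
    moreover have "inj_on (\<lambda>i. rs ! i) {p..<p + k}"
      using rs(1) len(1) by (auto simp: inj_on_def nth_eq_iff_index_eq)
    ultimately have "card (theta_rows k0) = k" by (simp add: card_image)
    then show ?thesis using card_theta_rows[of k0] assms(3) by (simp add: V_def)
  qed

  define ev where "ev = map_mat (eval_at F)"
  define B11 where "B11 = ev M11"
  define B12 where "B12 = ev M12"
  define B21 where "B21 = ev M21"
  define B22 where "B22 = ev M22"
  note B_defs = B11_def B12_def B21_def B22_def ev_def
  have B: "B11 \<in> carrier_mat p p" "B12 \<in> carrier_mat p k" "B21 \<in> carrier_mat k p" "B22 \<in> carrier_mat k k"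
    using M by (simp_all add: B_defs)
  have block: "?D $$ (i, j) = (if i < p then if j < p then M11 $$ (i, j) else M12 $$ (i, j - p)
      else if j < p then M21 $$ (i - p, j) else M22 $$ (i - p, j - p))" if "i < p + k" "j < p + k" for i j
    unfolding D using that M by (subst index_mat_four_block(1)) auto
  have B_entry: "i < p \<Longrightarrow> j < p \<Longrightarrow> B11 $$ (i, j) = entry F (rs ! i) (cs ! j)"
    "i < p \<Longrightarrow> j' < k \<Longrightarrow> B12 $$ (i, j') = entry F (rs ! i) (cs ! (p + j'))"
    "i' < k \<Longrightarrow> j < p \<Longrightarrow> B21 $$ (i', j) = entry F (rs ! (p + i')) (cs ! j)"
    "i' < k \<Longrightarrow> j' < k \<Longrightarrow> B22 $$ (i', j') = entry F (rs ! (p + i')) (cs ! (p + j'))" for i j i' j'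
    using ev_entry[of i j] ev_entry[of i "p + j'"] ev_entry[of "p + i'" j] ev_entry[of "p + i'" "p + j'"]
      block[of i j] block[of i "p + j'"] block[of "p + i'" j] block[of "p + i'" "p + j'"] M
    by (simp_all add: B_defs)
  have rsum_nth: "rsum v rl = (\<Sum>j<p + k. entry F rl (cs ! j) * v (cs ! j))" for v rl
    unfolding rsum_def cs(2)[symmetric] sum_set_nth[OF cs(1)] len(2) by (rule refl)

  have ker: "v = 0\<^sub>v p" if v: "v \<in> carrier_vec p" "B11 *\<^sub>v v = 0\<^sub>v p" for v
  proof -
    \<comment> \<open>The kernel vector as a family on labels, zero on the columns of M22; the
      labels in \<open>cs\<close> are distinct, so each sum has at most one nonzero term.\<close>
    define u where "u cl = (\<Sum>j<p. if cs ! j = cl then v $ j else 0)" for cl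
    have u_nth: "u (cs ! j) = (if j < p then v $ j else 0)" if "j < p + k" for j
    proof -
      have "u (cs ! j) = (\<Sum>i<p. if i = j then v $ i else 0)"
        unfolding u_def using that len(2) cs(1) by (intro sum.cong refl) (simp add: nth_eq_iff_index_eq)
      then show ?thesis by simp
    qed
    have "u cl = 0" for cl
    proof (rule kernel_zero[OF idx van])
      show "u cl = 0" if "cl \<notin> K1_basis nx ny nz r s" for cl
        unfolding u_def
      proof (rule sum.neutral, rule ballI)
        fix j assume "j \<in> {..<p}"
        then have "cs ! j \<in> K1_basis nx ny nz r s" using csK[of j] by simp
        with that have "cs ! j \<noteq> cl" by blast
        then show "(if cs ! j = cl then v $ j else 0) = 0" by simp
      qed
      show "u cl = 0" if cl: "cl \<in> theta_cols i0 j0" for cl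
      proof -
        have "cl \<in> K1_basis nx ny nz r s" using cl theta_cols_subset[OF idx(1,2)] by blast
        then obtain j where j: "j < p + k" "cl = cs ! j" using K1_ex by blast
        then have "p \<le> j" using cols[OF j(1)] cl by simp
        then show ?thesis using u_nth[OF j(1)] j(2) by simp
      qed
      show "rsum u rl = 0" if rl: "rl \<in> K0_basis nx ny nz r s" "rl \<notin> theta_rows k0" for rl
      proof -
        obtain i where i: "i < p + k" "rl = rs ! i" using K0_ex[OF rl(1)] by blast
        then have ip: "i < p" using rows[OF i(1)] rl(2) by simp
        have "rsum u rl = (\<Sum>j<p. entry F rl (cs ! j) * u (cs ! j)) + (\<Sum>j<k. entry F rl (cs ! (p + j)) * u (cs ! (p + j)))"
          unfolding rsum_nth by (rule sum_lessThan_add)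
        also have "\<dots> = (\<Sum>j<p. B11 $$ (i, j) * v $ j)"
          using ip by (simp add: u_nth B_entry(1) i(2))
        also have "\<dots> = (B11 *\<^sub>v v) $ i" using mult_mat_vec_nth[OF B(1) v(1) ip] by simp
        finally show ?thesis using v(2) ip by simp
      qed
    qed
    then show ?thesis using u_nth v(1) by (intro eq_vecI) (metis carrier_vecD index_zero_vec trans_less_add1, simp)
  qed
  obtain N where N: "mat_inverse B11 = Some N" "N \<in> carrier_mat p p" "B11 * N = 1\<^sub>m p" "N * B11 = 1\<^sub>m p"
    using inverse_if_kernel_zero[OF B(1) ker] by blast
  have inv: "invertible_mat B11"
    unfolding invertible_mat_def inverts_mat_def using B(1) N by auto
  define C where "C = B22 - B21 * N * B12"
  have C: "C \<in> carrier_mat k k" unfolding C_def using B N(2) by (intro minus_carrier_mat) auto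
  define E where "E = (- (N * B12)) @\<^sub>r 1\<^sub>m k"
  define pv where "pv \<alpha> l = vec (p + k) (\<lambda>j. pure (\<lambda>i. coords (fst \<alpha>) $ i) (\<lambda>i. coords (fst (snd \<alpha>)) $ i) l (cs ! j))" for \<alpha> :: "'a point" and l
  \<comment> \<open>The pure kernel element at the solution, split along the blocks, gives both the
    eigenvector and its extension.\<close>
  have "\<exists>w2 l. eigenvector C w2 (ratio f0 \<theta> \<alpha>) \<and> (\<forall>c. E *\<^sub>v (c \<cdot>\<^sub>v w2) = c \<cdot>\<^sub>v pv \<alpha> l)" if \<alpha>V: "\<alpha> \<in> V" for \<alpha>
  proof -
    obtain X Y Z where \<alpha>: "\<alpha> = (X, Y, Z)" by (cases \<alpha>)
    define e where "e = ratio f0 \<theta> \<alpha>"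
    have F0: "F 0 = f0" by (simp add: F_def)
    note \<alpha>V' = \<alpha>V[unfolded \<alpha>]
    obtain l where l: "\<exists>cl\<in>K1_basis nx ny nz r s. pure (\<lambda>i. coords X $ i) (\<lambda>i. coords Y $ i) l cl \<noteq> 0"
      "\<And>rl. rl \<in> K0_basis nx ny nz r s \<Longrightarrow> rsum (pure (\<lambda>i. coords X $ i) (\<lambda>i. coords Y $ i) l) rl =
        (\<Sum>cl\<in>K1_basis nx ny nz r s. (if theta_pair i0 j0 k0 rl cl then e else 0) * pure (\<lambda>i. coords X $ i) (\<lambda>i. coords Y $ i) l cl)"
      using eigen_label_vector[OF idx \<alpha>V'[unfolded V] sep[OF \<alpha>V']] unfolding F0 \<theta>[symmetric] \<alpha>[symmetric] e_def[symmetric] by blast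
    define w where "w j = pure (\<lambda>i. coords X $ i) (\<lambda>i. coords Y $ i) l (cs ! j)" for j
    have eqs: "(\<Sum>j<p. entry F (rs ! i) (cs ! j) * w j) + (\<Sum>j<k. entry F (rs ! i) (cs ! (p + j)) * w (p + j)) =
        (if p \<le> i then e * w i else 0)" if i: "i < p + k" for i
    proof -
      have "(\<Sum>j<p. entry F (rs ! i) (cs ! j) * w j) + (\<Sum>j<k. entry F (rs ! i) (cs ! (p + j)) * w (p + j)) =
          (\<Sum>j<p + k. entry F (rs ! i) (cs ! j) * w j)" by (rule sum_lessThan_add[symmetric])
      also have "\<dots> = (\<Sum>j<p + k. (if theta_pair i0 j0 k0 (rs ! i) (cs ! j) then e else 0) * w j)"
        using l(2)[OF rsK[OF i]] unfolding rsum_nth cs(2)[symmetric] sum_set_nth[OF cs(1)] len(2) w_def .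
      also have "\<dots> = (\<Sum>j<p + k. if j = i then (if p \<le> i then e * w i else 0) else 0)"
      proof (rule sum.cong[OF refl])
        fix j assume "j \<in> {..<p + k}"
        then show "(if theta_pair i0 j0 k0 (rs ! i) (cs ! j) then e else 0) * w j = (if j = i then (if p \<le> i then e * w i else 0) else 0)"
          using pair_iff[OF i, of j] by auto
      qed
      finally show ?thesis using i by simp
    qed
    define w1 where "w1 = vec p w"
    define w2 where "w2 = vec k (\<lambda>j. w (p + j))"
    have w: "w1 \<in> carrier_vec p" "w2 \<in> carrier_vec k" by (simp_all add: w1_def w2_def)
    have eq1: "B11 *\<^sub>v w1 + B12 *\<^sub>v w2 = 0\<^sub>v p"
    proof (rule eq_vecI)
      fix i assume "i < dim_vec (0\<^sub>v p :: 'a vec)"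
      then have i: "i < p" by simp
      have "(B11 *\<^sub>v w1 + B12 *\<^sub>v w2) $ i = (B11 *\<^sub>v w1) $ i + (B12 *\<^sub>v w2) $ i" using i B by simp
      also have "\<dots> = (\<Sum>j<p. entry F (rs ! i) (cs ! j) * w j) + (\<Sum>j<k. entry F (rs ! i) (cs ! (p + j)) * w (p + j))"
        unfolding mult_mat_vec_nth[OF B(1) w(1) i] mult_mat_vec_nth[OF B(2) w(2) i]
        using i by (simp add: B_entry w1_def w2_def)
      finally show "(B11 *\<^sub>v w1 + B12 *\<^sub>v w2) $ i = 0\<^sub>v p $ i" using eqs[of i] i by simp
    qed (use B in simp)
    have eq2: "B21 *\<^sub>v w1 + B22 *\<^sub>v w2 = e \<cdot>\<^sub>v w2"
    proof (rule eq_vecI)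
      fix i assume "i < dim_vec (e \<cdot>\<^sub>v w2)"
      then have i: "i < k" by (simp add: w2_def)
      have "(B21 *\<^sub>v w1 + B22 *\<^sub>v w2) $ i = (B21 *\<^sub>v w1) $ i + (B22 *\<^sub>v w2) $ i" using i B by simp
      also have "\<dots> = (\<Sum>j<p. entry F (rs ! (p + i)) (cs ! j) * w j) + (\<Sum>j<k. entry F (rs ! (p + i)) (cs ! (p + j)) * w (p + j))"
        unfolding mult_mat_vec_nth[OF B(3) w(1) i] mult_mat_vec_nth[OF B(4) w(2) i]
        using i by (simp add: B_entry w1_def w2_def)
      finally show "(B21 *\<^sub>v w1 + B22 *\<^sub>v w2) $ i = (e \<cdot>\<^sub>v w2) $ i" using eqs[of "p + i"] i by (simp add: w2_def)
    qed (use B in \<open>simp add: w2_def\<close>)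
    note schur = schur_eigen[OF B N(2,4) w eq1 eq2]
    \<comment> \<open>The upper part \<open>w1\<close> is determined by \<open>w2\<close>, so
      \<open>w2\<close> = 0 would make the nonzero element of \<open>K1\<close> vanish.\<close>
    have "w2 \<noteq> 0\<^sub>v k"
    proof
      assume w2: "w2 = 0\<^sub>v k"
      have "w1 = - (N * B12) *\<^sub>v 0\<^sub>v k" using schur(1) w2 by simp
      then have w1: "w1 = 0\<^sub>v p" using N(2) B(2) by (intro eq_vecI) (auto simp: scalar_prod_def)
      have "w j = 0" if "j < p + k" for j
      proof (cases "j < p")
        case True
        then have "w j = w1 $ j" by (simp add: w1_def)
        then show ?thesis using True by (simp add: w1)
      next
        case False
        then have "p + (j - p) = j" by simp
        then have "w j = w2 $ (j - p)" using False that by (simp add: w2_def)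
        then show ?thesis using False that by (simp add: w2)
      qed
      then show False using l(1) K1_ex unfolding w_def by blast
    qed
    then have "eigenvector C w2 e"
      using schur(2) w(2) C unfolding eigenvector_def C_def[symmetric] by auto
    moreover have "w1 @\<^sub>v w2 = pv \<alpha> l"
      unfolding pv_def \<alpha> fst_conv snd_conv w_def[symmetric]
      by (rule eq_vecI) (auto simp: w1_def w2_def)
    ultimately show ?thesis using schur(3) unfolding e_def E_def by auto
  qed
  then have "\<forall>\<alpha>\<in>V. \<exists>w2. eigenvector C w2 (ratio f0 \<theta> \<alpha>) \<and> (\<exists>l. \<forall>c. E *\<^sub>v (c \<cdot>\<^sub>v w2) = c \<cdot>\<^sub>v pv \<alpha> l)" by blast
  then obtain w where w: "\<And>\<alpha>. \<alpha> \<in> V \<Longrightarrow> eigenvector C (w \<alpha>) (ratio f0 \<theta> \<alpha>)"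
    "\<And>\<alpha>. \<alpha> \<in> V \<Longrightarrow> \<exists>l. \<forall>c. E *\<^sub>v (c \<cdot>\<^sub>v w \<alpha>) = c \<cdot>\<^sub>v pv \<alpha> l"
    unfolding bchoice_iff by blast
  have "finite V" using assms(2) by (simp add: V_def)
  \<comment> \<open>Numbering the solutions provides exactly as many distinct eigenvalues as
    \<open>C\<close> has rows.\<close>
  then obtain h where h: "bij_betw h {0..<k} V" using ex_bij_betw_nat_finite card_V by blast
  have hV: "h i \<in> V" if "i < k" for i using h that by (auto simp: bij_betw_def)
  have ratio_inj: "\<alpha> = \<alpha>'" if "\<alpha> \<in> V" "\<alpha>' \<in> V" "ratio f0 \<theta> \<alpha> = ratio f0 \<theta> \<alpha>'" for \<alpha> \<alpha>'
    using assms(8) that unfolding separates_def V_def by blast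
  have eig: "eigenvector C (w (h i)) (ratio f0 \<theta> (h i))" if "i < k" for i using w(1) hV[OF that] by blast
  have inj: "inj_on (\<lambda>i. ratio f0 \<theta> (h i)) {..<k}"
  proof (rule inj_onI)
    fix i j assume ij: "i \<in> {..<k}" "j \<in> {..<k}" "ratio f0 \<theta> (h i) = ratio f0 \<theta> (h j)"
    then have "h i = h j" using ratio_inj hV by simp
    then show "i = j" using h ij unfolding bij_betw_def inj_on_def by simp
  qed
  have dia: "diagonalizable C"
    by (rule distinct_eigenvalues(1)[OF C eig inj])
  have vectors: "\<exists>\<beta>\<in>V. \<exists>c. x = ratio f0 \<theta> \<beta> \<and> v = c \<cdot>\<^sub>v w \<beta>" if "eigenvector C v x" for v x
    using distinct_eigenvalues(2)[OF C eig inj that] hV by blast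
  have rho_ex: "\<exists>l. E *\<^sub>v v = coord_vec cs (rho nx ny nz r s \<alpha> l)"
    if \<alpha>V: "\<alpha> \<in> V" and nonzero: "zeroth_coords_nonzero \<alpha>" and v: "eigenvector C v (ratio f0 \<theta> \<alpha>)" for \<alpha> v
  proof -
    obtain X Y Z where \<alpha>: "\<alpha> = (X, Y, Z)" by (cases \<alpha>)
    have XY: "coords X $ 0 \<noteq> 0" "coords Y $ 0 \<noteq> 0" using nonzero by (simp_all add: \<alpha>)
    \<comment> \<open>Eigenspaces are lines and \<open>ratio\<close> separates the solutions, so an
      arbitrary eigenvector is a multiple of the one constructed at \<alpha>.\<close>
    obtain c where c: "v = c \<cdot>\<^sub>v w \<alpha>" using vectors[OF v] ratio_inj \<alpha>V by metis
    obtain l where l: "\<forall>c. E *\<^sub>v (c \<cdot>\<^sub>v w \<alpha>) = c \<cdot>\<^sub>v pv \<alpha> l" using w(2)[OF \<alpha>V] by blast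
    let ?l = "(\<lambda>I. c * l I * (coords X $ 0 * coords Y $ 0 ^ q), \<lambda>J. c * l J * (coords X $ 0 * coords Y $ 0 ^ Suc q))"
    have "c \<cdot>\<^sub>v pv \<alpha> l = coord_vec cs (rho nx ny nz r s \<alpha> ?l)"
    proof (rule eq_vecI)
      fix j assume "j < dim_vec (coord_vec cs (rho nx ny nz r s \<alpha> ?l))"
      then have j: "j < p + k" by (simp add: coord_vec_def len(2))
      then show "(c \<cdot>\<^sub>v pv \<alpha> l) $ j = coord_vec cs (rho nx ny nz r s \<alpha> ?l) $ j"
        using lookup_rho[OF XY csK[OF j], where Z = Z and d = c and l = l] by (simp only: coord_vec_def index_vec len(2) \<alpha> pv_def index_smult_vec dim_vec fst_conv snd_conv)
    qed (simp add: coord_vec_def pv_def len(2))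
    then show ?thesis using l c by metis
  qed
  have eigval: "eigenvalue C (ratio f0 \<theta> \<alpha>)" if "\<alpha> \<in> V" for \<alpha> using w(1)[OF that] unfolding eigenvalue_def by blast
  have spectrum: "\<exists>\<alpha>\<in>V. x = ratio f0 \<theta> \<alpha>" if "eigenvalue C x" for x
    using that vectors unfolding eigenvalue_def by blast
  have N_eq: "the (mat_inverse B11) = N" by (simp add: N(1))
  have dimC: "dim_row C = k" using C by simp
  show ?thesis
    unfolding Let_def F_def[symmetric] V_def[symmetric] ev_def[symmetric] B11_def[symmetric] B12_def[symmetric]
      B21_def[symmetric] B22_def[symmetric] N_eq C_def[symmetric] dimC E_def[symmetric]
    using inv dia spectrum eigval rho_ex by blast
qed

end
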